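(* Let $R$ be a commutative artinian ring and let $\mathcal{T}$ be an $R$-linear triangulated category which is Hom-finite and Krull-Schmidt. Denote by $S\colon \mathcal{T}_r\to\mathcal{T}_l$ its generalized Serre functor. Then both $\mathcal{T}_r$ and $\mathcal{T}_l$ are thick triangulated subcategories of $\mathcal{T}$. Moreover: (1) there is a natural isomorphism $\eta_X\colon S(X[1])\to S(X)[1]$, $X\in\mathcal{T}_r$, such that the pair $(S,\eta)$ is a triangle equivalence between $\mathcal{T}_r$ and $\mathcal{T}_l$; (2) an indecomposable object $X$ of $\mathcal{T}$ belongs to $\mathcal{T}_l$ (resp. $\mathcal{T}_r$) if and only if there is an Auslander-Reiten triangle in $\mathcal{T}$ containing $X$ as the first term (resp. the third term).
   Context: An $R$-linear category is Hom-finite if all its Hom spaces are finitely generated $R$-modules. An additive category is Krull-Schmidt if each object is a finite direct sum of indecomposable objects with local endomorphism rings. $[1]$ denotes the translation functor of $\mathcal{T}$. Let $D=\mathrm{Hom}_R(-,E)$ be the Matlis duality on the category $R\text{-mod}$ of finitely generated $R$-modules, where $E$ is the minimal injective cogenerator of $R$. For a Hom-finite $R$-linear category $\mathcal{C}$, write $(X,Y)=\mathrm{Hom}_{\mathcal{C}}(X,Y)$, and let $D(X,-)$ and $D(-,X)$ denote the composites of $D$ with $\mathrm{Hom}_{\mathcal{C}}(X,-)$ and $\mathrm{Hom}_{\mathcal{C}}(-,X)$. Define full subcategories $\mathcal{C}_r=\{X\in\mathcal{C}\mid D(X,-)\text{ is representable}\}$, that is, $D(X,-)\simeq(-,Z)$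 as $R$-linear functors for some object $Z\in\mathcal{C}$, and $\mathcal{C}_l=\{X\in\mathcal{C}\mid D(-,X)\text{ is representable}\}$, that is, $D(-,X)\simeq (Z,-)$ as $R$-linear functors for some $Z\in\mathcal{C}$. There is a functor $S\colon\mathcal{C}_r\to\mathcal{C}_l$, unique up to isomorphism, admitting $R$-linear isomorphisms $\phi_{X,Y}\colon D(X,Y)\simeq(Y,S(X))$ natural in $X\in\mathcal{C}_r$ and $Y\in\mathcal{C}$; it is an $R$-linear equivalence and is called the generalized Serre functor of $\mathcal{C}$. Here this is applied to $\mathcal{C}=\mathcal{T}$. A triangulated subcategory is thick if it is closed under direct summands. A pair $(S,\eta)$ with $\eta\colon S\circ[1]\to[1]\circ S$ a natural isomorphism is a triangle functor if for each distinguished triangle $X\xrightarrow{u}Y\xrightarrow{v}Z\xrightarrow{w}X[1]$ in the source, $S(X)\xrightarrow{S(u)}S(Y)\xrightarrow{S(v)}S(Z)\xrightarrow{\eta_X\circ S(w)}S(X)[1]$ is distinguished; it is a triangle equivalence if in addition $S$ is an equivalence. An Auslander-Reiten triangle in $\mathcal{T}$ is a distinguished triangle $X\xrightarrow{u}Y\xrightarrow{v}Z\xrightarrow{w}X[1]$ with $X$ and $Z$ indecomposable, $w\neq0$, and such that $w\circ\gamma=0$ for each morphism $\gamma\colon Y'\to Z$ in $\mathcal{T}$ that is not a retraction (split epimorphism). Its first term is $X$ and its third term is $Z$. *)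

theory Defs
  imports "HOL-Algebra.Module" "HOL-Algebra.Ideal"
begin

section \<open>Rings and modules\<close>

locale artinian_cring = cring R for R (structure) +
  assumes descending_chain_condition:
    "\<lbrakk>\<And>n :: nat. ideal (I n) R; \<And>n. I (Suc n) \<subseteq> I n\<rbrakk> \<Longrightarrow> \<exists>N. \<forall>n\<ge>N. I n = I N"

text \<open>No commutativity is assumed; the zero ring is excluded because an ideal is nonempty.\<close>
definition local_ring :: "('a, 'k) ring_scheme \<Rightarrow> bool" where
  "local_ring A \<longleftrightarrow> ring A \<and> ideal (carrier A - Units A) A"

definition fin_gen_module :: "('r, 'k) ring_scheme \<Rightarrow> ('r, 'a, 'l) module_scheme \<Rightarrow> bool" where
  "fin_gen_module R M \<longleftrightarrow> module R M \<and>
     (\<exists>B. finite B \<and> B \<subseteq> carrier M \<and> \<Inter>{N. submodule N R M \<and> B \<subseteq> N} = carrier M)"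

definition linear_maps ::
    "('r, 'k) ring_scheme \<Rightarrow> ('r, 'a, 'l) module_scheme \<Rightarrow> ('r, 'b, 'n) module_scheme \<Rightarrow> ('a \<Rightarrow> 'b) set" where
  "linear_maps R M N =
     {h \<in> hom (add_monoid M) (add_monoid N).
        \<forall>r\<in>carrier R. \<forall>x\<in>carrier M. h (r \<odot>\<^bsub>M\<^esub> x) = r \<odot>\<^bsub>N\<^esub> h x}"

definition module_isos ::
    "('r, 'k) ring_scheme \<Rightarrow> ('r, 'a, 'l) module_scheme \<Rightarrow> ('r, 'b, 'n) module_scheme \<Rightarrow> ('a \<Rightarrow> 'b) set" where
  "module_isos R M N = {h \<in> linear_maps R M N. bij_betw h (carrier M) (carrier N)}"

text \<open>The \<open>R\<close>-module of linear maps. Its elements are made extensional, so that equality of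
  functions is equality on \<open>carrier M\<close>; the ring fields \<open>mult\<close> and \<open>one\<close> play no role.\<close>
definition Hom_R ::
    "('r, 'k) ring_scheme \<Rightarrow> ('r, 'a, 'l) module_scheme \<Rightarrow> ('r, 'b, 'n) module_scheme \<Rightarrow> ('r, 'a \<Rightarrow> 'b) module" where
  "Hom_R R M N =
     \<lparr>carrier = linear_maps R M N \<inter> extensional (carrier M),
      mult = undefined, one = undefined,
      zero = (\<lambda>x\<in>carrier M. \<zero>\<^bsub>N\<^esub>),
      add = (\<lambda>f g. \<lambda>x\<in>carrier M. f x \<oplus>\<^bsub>N\<^esub> g x),
      smult = (\<lambda>r f. \<lambda>x\<in>carrier M. r \<odot>\<^bsub>N\<^esub> f x)\<rparr>"

text \<open>A formula of HOL cannot quantify over carrier types. In the next two definitions the test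
  modules have their elements in the type of the ring. This loses nothing, by Baer's criterion: the
  ring, its ideals, and copies of all cyclic modules live there. The extension property and the
  separation property for test modules over arbitrary types are proved below as
  \<open>injective_module_extend\<close> and \<open>injective_cogenerator_separates\<close>.\<close>
definition injective_module :: "('r, 'k) ring_scheme \<Rightarrow> ('r, 'e, 'l) module_scheme \<Rightarrow> bool" where
  "injective_module R E \<longleftrightarrow> module R E \<and>
     (\<forall>(M :: ('r, 'r) module) (N :: ('r, 'r) module) i f.
        module R M \<and> module R N \<and> i \<in> linear_maps R M N \<and> inj_on i (carrier M) \<and>
        f \<in> linear_maps R M E \<longrightarrow>
        (\<exists>g\<in>linear_maps R N E. \<forall>x\<in>carrier M. g (i x) = f x))"

definition cogenerator :: "('r, 'k) ring_scheme \<Rightarrow> ('r, 'e, 'l) module_scheme \<Rightarrow> bool" where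
  "cogenerator R E \<longleftrightarrow> module R E \<and>
     (\<forall>M :: ('r, 'r) module. module R M \<longrightarrow>
        (\<forall>x\<in>carrier M. x \<noteq> \<zero>\<^bsub>M\<^esub> \<longrightarrow> (\<exists>f\<in>linear_maps R M E. f x \<noteq> \<zero>\<^bsub>E\<^esub>)))"

lemma injective_module_extend_from_graph:
  fixes R :: "('r, 'k) ring_scheme" and E :: "('r, 'e, 'l) module_scheme"
    and N :: "('r, 'b, 'n) module_scheme"
  assumes inj: "injective_module R E" and N: "module R N"
    and G0_sub: "G0 \<subseteq> carrier N \<times> carrier E"
    and G0_zero: "(\<zero>\<^bsub>N\<^esub>, \<zero>\<^bsub>E\<^esub>) \<in> G0"
    and G0_add: "\<And>x y x' y'. \<lbrakk>(x, y) \<in> G0; (x', y') \<in> G0\<rbrakk> \<Longrightarrow> (x \<oplus>\<^bsub>N\<^esub> x', y \<oplus>\<^bsub>E\<^esub> y') \<in> G0"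
    and G0_smult: "\<And>r x y. \<lbrakk>r \<in> carrier R; (x, y) \<in> G0\<rbrakk> \<Longrightarrow> (r \<odot>\<^bsub>N\<^esub> x, r \<odot>\<^bsub>E\<^esub> y) \<in> G0"
    and G0_sv: "\<And>y. (\<zero>\<^bsub>N\<^esub>, y) \<in> G0 \<Longrightarrow> y = \<zero>\<^bsub>E\<^esub>"
  shows "\<exists>g\<in>linear_maps R N E. \<forall>(x, y)\<in>G0. g x = y"
proof -
  interpret N: module R N by (rule N)
  interpret E: module R E using inj by (simp add: injective_module_def)
  define good where "good G \<longleftrightarrow> G \<subseteq> carrier N \<times> carrier E \<and>
      (\<forall>x y x' y'. (x, y) \<in> G \<longrightarrow> (x', y') \<in> G \<longrightarrow> (x \<oplus>\<^bsub>N\<^esub> x', y \<oplus>\<^bsub>E\<^esub> y') \<in> G) \<and>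
      (\<forall>r\<in>carrier R. \<forall>x y. (x, y) \<in> G \<longrightarrow> (r \<odot>\<^bsub>N\<^esub> x, r \<odot>\<^bsub>E\<^esub> y) \<in> G) \<and>
      (\<forall>y. (\<zero>\<^bsub>N\<^esub>, y) \<in> G \<longrightarrow> y = \<zero>\<^bsub>E\<^esub>) \<and> G0 \<subseteq> G" for G
  have good0: "good G0"
    unfolding good_def using G0_sub G0_add G0_smult G0_sv by auto
  have "\<exists>G\<in>Collect good. \<forall>X\<in>Collect good. G \<subseteq> X \<longrightarrow> X = G"
  proof (rule subset_Zorn_nonempty)
    show "Collect good \<noteq> {}" using good0 by blast
  next
    fix \<C> assume ne: "\<C> \<noteq> {}" and ch: "subset.chain (Collect good) \<C>"
    have sub: "\<And>G. G \<in> \<C> \<Longrightarrow> good G" using ch by (auto simp: subset_chain_def)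
    have lin: "\<And>G H. \<lbrakk>G \<in> \<C>; H \<in> \<C>\<rbrakk> \<Longrightarrow> G \<subseteq> H \<or> H \<subseteq> G"
      using ch by (auto simp: subset_chain_def)
    have "good (\<Union>\<C>)"
      unfolding good_def
    proof (intro conjI allI ballI impI)
      show "\<Union>\<C> \<subseteq> carrier N \<times> carrier E" using sub unfolding good_def by blast
      show "G0 \<subseteq> \<Union>\<C>" using sub ne unfolding good_def by blast
    next
      fix x y x' y' assume "(x, y) \<in> \<Union>\<C>" "(x', y') \<in> \<Union>\<C>"
      then obtain G H where "G \<in> \<C>" "H \<in> \<C>" "(x, y) \<in> G" "(x', y') \<in> H" by blast
      then obtain K where "K \<in> \<C>" "(x, y) \<in> K" "(x', y') \<in> K" using lin by blast
      then show "(x \<oplus>\<^bsub>N\<^esub> x', y \<oplus>\<^bsub>E\<^esub> y') \<in> \<Union>\<C>" using sub unfolding good_def by blast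
    next
      fix r x y assume "r \<in> carrier R" "(x, y) \<in> \<Union>\<C>"
      then show "(r \<odot>\<^bsub>N\<^esub> x, r \<odot>\<^bsub>E\<^esub> y) \<in> \<Union>\<C>" using sub unfolding good_def by blast
    next
      fix y assume "(\<zero>\<^bsub>N\<^esub>, y) \<in> \<Union>\<C>"
      then show "y = \<zero>\<^bsub>E\<^esub>" using sub unfolding good_def by blast
    qed
    then show "\<Union>\<C> \<in> Collect good" by simp
  qed
  then obtain G where G: "good G" and max: "\<And>X. good X \<Longrightarrow> G \<subseteq> X \<Longrightarrow> X = G" by blast
  have Gsub: "\<And>x y. (x, y) \<in> G \<Longrightarrow> x \<in> carrier N \<and> y \<in> carrier E"
    and Gadd: "\<And>x y x' y'. \<lbrakk>(x, y) \<in> G; (x', y') \<in> G\<rbrakk> \<Longrightarrow> (x \<oplus>\<^bsub>N\<^esub> x', y \<oplus>\<^bsub>E\<^esub> y') \<in> G"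
    and Gsm: "\<And>r x y. \<lbrakk>r \<in> carrier R; (x, y) \<in> G\<rbrakk> \<Longrightarrow> (r \<odot>\<^bsub>N\<^esub> x, r \<odot>\<^bsub>E\<^esub> y) \<in> G"
    and Gz: "\<And>y. (\<zero>\<^bsub>N\<^esub>, y) \<in> G \<Longrightarrow> y = \<zero>\<^bsub>E\<^esub>"
    and G0: "G0 \<subseteq> G"
    using G unfolding good_def by blast+
  have Gneg: "(\<ominus>\<^bsub>N\<^esub> x, \<ominus>\<^bsub>E\<^esub> y) \<in> G" if "(x, y) \<in> G" for x y
    using Gsm[of "\<ominus>\<^bsub>R\<^esub> \<one>\<^bsub>R\<^esub>", OF _ that] Gsub[OF that]
    by (simp add: N.smult_l_minus E.smult_l_minus)
  have Gsv: "y = y'" if "(x, y) \<in> G" "(x, y') \<in> G" for x y y'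
  proof -
    have "(x \<oplus>\<^bsub>N\<^esub> \<ominus>\<^bsub>N\<^esub> x, y \<oplus>\<^bsub>E\<^esub> \<ominus>\<^bsub>E\<^esub> y') \<in> G" using Gadd[OF that(1) Gneg[OF that(2)]] .
    then have "y \<oplus>\<^bsub>E\<^esub> \<ominus>\<^bsub>E\<^esub> y' = \<zero>\<^bsub>E\<^esub>" using Gz Gsub[OF that(1)] by (simp add: N.M.r_neg)
    then have "\<ominus>\<^bsub>E\<^esub> (\<ominus>\<^bsub>E\<^esub> y') = y" using Gsub[OF that(1)] Gsub[OF that(2)] by (simp add: E.M.minus_equality)
    then show ?thesis using Gsub[OF that(2)] by simp
  qed
  have dom: "\<exists>y. (x, y) \<in> G" if x: "x \<in> carrier N" for x
  proof -
    define I where "I = {r \<in> carrier R. \<exists>y. (r \<odot>\<^bsub>N\<^esub> x, y) \<in> G}"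
    define h where "h r = (THE y. (r \<odot>\<^bsub>N\<^esub> x, y) \<in> G)" for r
    have h: "h r = y" if "(r \<odot>\<^bsub>N\<^esub> x, y) \<in> G" for r y
      unfolding h_def using that Gsv by blast
    have hI: "(r \<odot>\<^bsub>N\<^esub> x, h r) \<in> G" if "r \<in> I" for r
      using that h unfolding I_def by auto
    have IR: "r \<in> carrier R" if "r \<in> I" for r using that unfolding I_def by simp
    have Iadd: "(r \<oplus>\<^bsub>R\<^esub> s) \<in> I \<and> h (r \<oplus>\<^bsub>R\<^esub> s) = h r \<oplus>\<^bsub>E\<^esub> h s" if "r \<in> I" "s \<in> I" for r s
    proof -
      have "((r \<oplus>\<^bsub>R\<^esub> s) \<odot>\<^bsub>N\<^esub> x, h r \<oplus>\<^bsub>E\<^esub> h s) \<in> G"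
        using Gadd[OF hI[OF that(1)] hI[OF that(2)]] IR that x by (simp add: N.smult_l_distr)
      then show ?thesis using h IR that unfolding I_def by auto
    qed
    have Ism: "(r \<otimes>\<^bsub>R\<^esub> s) \<in> I \<and> h (r \<otimes>\<^bsub>R\<^esub> s) = r \<odot>\<^bsub>E\<^esub> h s" if "r \<in> carrier R" "s \<in> I" for r s
    proof -
      have "((r \<otimes>\<^bsub>R\<^esub> s) \<odot>\<^bsub>N\<^esub> x, r \<odot>\<^bsub>E\<^esub> h s) \<in> G"
        using Gsm[OF that(1) hI[OF that(2)]] IR that x by (simp add: N.smult_assoc1)
      then show ?thesis using h IR that unfolding I_def by auto
    qed
    have I0: "\<zero>\<^bsub>R\<^esub> \<in> I"
      using G0 G0_zero x unfolding I_def by auto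
    define reg :: "'r set \<Rightarrow> ('r, 'r) module" where "reg J = \<lparr>carrier = J, mult = mult R, one = one R, zero = zero R,
        add = add R, smult = mult R\<rparr>" for J
    have reg: "module R (reg J)" if J: "J \<subseteq> carrier R" "\<zero>\<^bsub>R\<^esub> \<in> J"
        "\<And>r s. r \<in> J \<Longrightarrow> s \<in> J \<Longrightarrow> r \<oplus>\<^bsub>R\<^esub> s \<in> J" "\<And>r s. r \<in> carrier R \<Longrightarrow> s \<in> J \<Longrightarrow> r \<otimes>\<^bsub>R\<^esub> s \<in> J" for J
    proof (rule moduleI)
      show "cring R" by (rule N.R.is_cring)
      have neg: "\<ominus>\<^bsub>R\<^esub> s \<in> J" if "s \<in> J" for s
        using J(4)[of "\<ominus>\<^bsub>R\<^esub> \<one>\<^bsub>R\<^esub>" s] that J(1) by (simp add: N.R.l_minus subset_iff)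
      have JR: "s \<in> carrier R" if "s \<in> J" for s using that J(1) by blast
      show "abelian_group (reg J)"
      proof (rule abelian_groupI)
        fix r s t assume "r \<in> carrier (reg J)" "s \<in> carrier (reg J)" "t \<in> carrier (reg J)"
        then show "r \<oplus>\<^bsub>reg J\<^esub> s \<oplus>\<^bsub>reg J\<^esub> t = r \<oplus>\<^bsub>reg J\<^esub> (s \<oplus>\<^bsub>reg J\<^esub> t)"
          by (simp add: reg_def JR N.R.a_assoc)
      next
        fix s assume "s \<in> carrier (reg J)"
        then show "\<exists>t\<in>carrier (reg J). t \<oplus>\<^bsub>reg J\<^esub> s = \<zero>\<^bsub>reg J\<^esub>"
          using neg[of s] J(1) by (intro bexI[of _ "\<ominus>\<^bsub>R\<^esub> s"]) (auto simp: reg_def N.R.l_neg)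
      qed (use J in \<open>auto simp: reg_def subset_iff N.R.a_assoc N.R.a_comm\<close>)
    qed (use J in \<open>auto simp: reg_def subset_iff N.R.m_assoc N.R.l_distr N.R.r_distr\<close>)
    have mI: "module R (reg I)" by (rule reg) (use I0 IR Iadd Ism in auto)
    have mR: "module R (reg (carrier R))" by (rule reg) auto
    have "id \<in> linear_maps R (reg I) (reg (carrier R))"
      using IR by (auto simp: linear_maps_def hom_def reg_def)
    moreover have "inj_on id (carrier (reg I))" by simp
    moreover have "h \<in> linear_maps R (reg I) E"
      using Iadd Ism Gsub[OF hI] by (simp add: linear_maps_def hom_def reg_def Pi_def)
    ultimately obtain g where g: "g \<in> linear_maps R (reg (carrier R)) E"
      and gh: "\<forall>r\<in>carrier (reg I). g (id r) = h r"
      using inj mI mR unfolding injective_module_def by blast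
    define e where "e = g \<one>\<^bsub>R\<^esub>"
    have e: "e \<in> carrier E" using g by (auto simp: e_def linear_maps_def hom_def reg_def)
    have gr: "g r = r \<odot>\<^bsub>E\<^esub> e" if "r \<in> carrier R" for r
    proof -
      have "\<forall>r\<in>carrier R. \<forall>s\<in>carrier R. g (r \<otimes>\<^bsub>R\<^esub> s) = r \<odot>\<^bsub>E\<^esub> g s"
        using g by (simp add: linear_maps_def reg_def)
      then have "g (r \<otimes>\<^bsub>R\<^esub> \<one>\<^bsub>R\<^esub>) = r \<odot>\<^bsub>E\<^esub> g \<one>\<^bsub>R\<^esub>" using that N.R.one_closed by blast
      then show ?thesis using that by (simp add: e_def)
    qed
    define G' where "G' = {(n \<oplus>\<^bsub>N\<^esub> r \<odot>\<^bsub>N\<^esub> x, y \<oplus>\<^bsub>E\<^esub> r \<odot>\<^bsub>E\<^esub> e) | n y r. (n, y) \<in> G \<and> r \<in> carrier R}"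
    have G'I: "(n \<oplus>\<^bsub>N\<^esub> r \<odot>\<^bsub>N\<^esub> x, y \<oplus>\<^bsub>E\<^esub> r \<odot>\<^bsub>E\<^esub> e) \<in> G'" if "(n, y) \<in> G" "r \<in> carrier R" for n y r
      using that unfolding G'_def by blast
    have GG': "G \<subseteq> G'"
    proof (rule subrelI)
      fix n y assume "(n, y) \<in> G"
      then show "(n, y) \<in> G'" using G'I[of n y "\<zero>\<^bsub>R\<^esub>"] Gsub x e by simp
    qed
    have "good G'"
      unfolding good_def
    proof (intro conjI allI ballI impI)
      show "G' \<subseteq> carrier N \<times> carrier E" using Gsub x e unfolding G'_def by auto
      show "G0 \<subseteq> G'" using G0 GG' by blast
    next
      fix a b a' b' assume "(a, b) \<in> G'" "(a', b') \<in> G'"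
      then obtain n y r n' y' r' where *: "(n, y) \<in> G" "r \<in> carrier R" "(n', y') \<in> G" "r' \<in> carrier R"
        and eq: "a = n \<oplus>\<^bsub>N\<^esub> r \<odot>\<^bsub>N\<^esub> x" "b = y \<oplus>\<^bsub>E\<^esub> r \<odot>\<^bsub>E\<^esub> e" "a' = n' \<oplus>\<^bsub>N\<^esub> r' \<odot>\<^bsub>N\<^esub> x" "b' = y' \<oplus>\<^bsub>E\<^esub> r' \<odot>\<^bsub>E\<^esub> e"
        unfolding G'_def by blast
      have "a \<oplus>\<^bsub>N\<^esub> a' = (n \<oplus>\<^bsub>N\<^esub> n') \<oplus>\<^bsub>N\<^esub> (r \<oplus>\<^bsub>R\<^esub> r') \<odot>\<^bsub>N\<^esub> x"
        using * x Gsub[OF *(1)] Gsub[OF *(3)] by (simp add: eq N.smult_l_distr N.M.a_ac)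
      moreover have "b \<oplus>\<^bsub>E\<^esub> b' = (y \<oplus>\<^bsub>E\<^esub> y') \<oplus>\<^bsub>E\<^esub> (r \<oplus>\<^bsub>R\<^esub> r') \<odot>\<^bsub>E\<^esub> e"
        using * e Gsub[OF *(1)] Gsub[OF *(3)] by (simp add: eq E.smult_l_distr E.M.a_ac)
      ultimately show "(a \<oplus>\<^bsub>N\<^esub> a', b \<oplus>\<^bsub>E\<^esub> b') \<in> G'"
        using G'I[OF Gadd[OF *(1,3)]] * by simp
    next
      fix s a b assume s: "s \<in> carrier R" and "(a, b) \<in> G'"
      then obtain n y r where *: "(n, y) \<in> G" "r \<in> carrier R"
        and eq: "a = n \<oplus>\<^bsub>N\<^esub> r \<odot>\<^bsub>N\<^esub> x" "b = y \<oplus>\<^bsub>E\<^esub> r \<odot>\<^bsub>E\<^esub> e"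
        unfolding G'_def by blast
      have "s \<odot>\<^bsub>N\<^esub> a = s \<odot>\<^bsub>N\<^esub> n \<oplus>\<^bsub>N\<^esub> (s \<otimes>\<^bsub>R\<^esub> r) \<odot>\<^bsub>N\<^esub> x"
        using * x s Gsub[OF *(1)] by (simp add: eq N.smult_r_distr N.smult_assoc1)
      moreover have "s \<odot>\<^bsub>E\<^esub> b = s \<odot>\<^bsub>E\<^esub> y \<oplus>\<^bsub>E\<^esub> (s \<otimes>\<^bsub>R\<^esub> r) \<odot>\<^bsub>E\<^esub> e"
        using * e s Gsub[OF *(1)] by (simp add: eq E.smult_r_distr E.smult_assoc1)
      ultimately show "(s \<odot>\<^bsub>N\<^esub> a, s \<odot>\<^bsub>E\<^esub> b) \<in> G'"
        using G'I[OF Gsm[OF s *(1)]] * s by simp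
    next
      fix b assume "(\<zero>\<^bsub>N\<^esub>, b) \<in> G'"
      then obtain n y r where *: "(n, y) \<in> G" "r \<in> carrier R"
        and eq: "\<zero>\<^bsub>N\<^esub> = n \<oplus>\<^bsub>N\<^esub> r \<odot>\<^bsub>N\<^esub> x" "b = y \<oplus>\<^bsub>E\<^esub> r \<odot>\<^bsub>E\<^esub> e"
        unfolding G'_def by blast
      have "r \<odot>\<^bsub>N\<^esub> x = \<ominus>\<^bsub>N\<^esub> n"
        using * x Gsub[OF *(1)] eq(1) by (intro N.M.minus_equality[symmetric]) (simp_all add: N.M.a_comm)
      then have rG: "(r \<odot>\<^bsub>N\<^esub> x, \<ominus>\<^bsub>E\<^esub> y) \<in> G" using Gneg[OF *(1)] by simp
      then have "r \<in> I" using * unfolding I_def by blast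
      then have "r \<odot>\<^bsub>E\<^esub> e = \<ominus>\<^bsub>E\<^esub> y" using gh gr[OF *(2)] h[OF rG] by (simp add: reg_def)
      then show "b = \<zero>\<^bsub>E\<^esub>" using eq(2) Gsub[OF *(1)] by (simp add: E.M.r_neg)
    qed
    then have "G' = G" using max GG' by blast
    moreover have "(\<zero>\<^bsub>N\<^esub> \<oplus>\<^bsub>N\<^esub> \<one>\<^bsub>R\<^esub> \<odot>\<^bsub>N\<^esub> x, \<zero>\<^bsub>E\<^esub> \<oplus>\<^bsub>E\<^esub> \<one>\<^bsub>R\<^esub> \<odot>\<^bsub>E\<^esub> e) \<in> G'"
      by (rule G'I) (use G0 G0_zero in auto)
    ultimately show ?thesis using x by auto
  qed
  define g where "g x = (THE y. (x, y) \<in> G)" for x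
  have g: "g x = y" if "(x, y) \<in> G" for x y
    unfolding g_def using that Gsv by blast
  have gG: "(x, g x) \<in> G" if "x \<in> carrier N" for x using dom[OF that] g by auto
  have "g \<in> linear_maps R N E"
    unfolding linear_maps_def hom_def
    using Gsub[OF gG] g[OF Gadd[OF gG gG]] g[OF Gsm[OF _ gG]] by auto
  then show ?thesis using G0 g by blast
qed

lemma linear_maps_zero:
  assumes "module R M" "module R N" "h \<in> linear_maps R M N"
  shows "h \<zero>\<^bsub>M\<^esub> = \<zero>\<^bsub>N\<^esub>"
proof -
  interpret M: module R M by fact
  interpret N: module R N by fact
  have "h (\<zero>\<^bsub>R\<^esub> \<odot>\<^bsub>M\<^esub> \<zero>\<^bsub>M\<^esub>) = \<zero>\<^bsub>R\<^esub> \<odot>\<^bsub>N\<^esub> h \<zero>\<^bsub>M\<^esub>"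
    using assms(3) M.M.zero_closed M.R.zero_closed unfolding linear_maps_def by blast
  moreover have "h \<zero>\<^bsub>M\<^esub> \<in> carrier N"
    using assms(3) by (auto simp: linear_maps_def hom_def)
  ultimately show ?thesis by simp
qed

lemma injective_module_extend:
  fixes M :: "('r, 'a, 'l) module_scheme" and N :: "('r, 'b, 'n) module_scheme"
  assumes inj: "injective_module R E" and M: "module R M" and N: "module R N"
    and i: "i \<in> linear_maps R M N" "inj_on i (carrier M)"
    and f: "f \<in> linear_maps R M E"
  shows "\<exists>g\<in>linear_maps R N E. \<forall>x\<in>carrier M. g (i x) = f x"
proof -
  interpret M: module R M by (rule M)
  have E: "module R E" using inj by (simp add: injective_module_def)
  have i': "\<And>x. x \<in> carrier M \<Longrightarrow> i x \<in> carrier N"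
      "\<And>x y. \<lbrakk>x \<in> carrier M; y \<in> carrier M\<rbrakk> \<Longrightarrow> i (x \<oplus>\<^bsub>M\<^esub> y) = i x \<oplus>\<^bsub>N\<^esub> i y"
      "\<And>r x. \<lbrakk>r \<in> carrier R; x \<in> carrier M\<rbrakk> \<Longrightarrow> i (r \<odot>\<^bsub>M\<^esub> x) = r \<odot>\<^bsub>N\<^esub> i x"
    using i(1) by (auto simp: linear_maps_def hom_def)
  have f': "\<And>x. x \<in> carrier M \<Longrightarrow> f x \<in> carrier E"
      "\<And>x y. \<lbrakk>x \<in> carrier M; y \<in> carrier M\<rbrakk> \<Longrightarrow> f (x \<oplus>\<^bsub>M\<^esub> y) = f x \<oplus>\<^bsub>E\<^esub> f y"
      "\<And>r x. \<lbrakk>r \<in> carrier R; x \<in> carrier M\<rbrakk> \<Longrightarrow> f (r \<odot>\<^bsub>M\<^esub> x) = r \<odot>\<^bsub>E\<^esub> f x"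
    using f by (auto simp: linear_maps_def hom_def)
  note z = linear_maps_zero[OF M N i(1)] linear_maps_zero[OF M E f]
  define G0 where "G0 = (\<lambda>x. (i x, f x)) ` carrier M"
  have G0I: "(i x, f x) \<in> G0" if "x \<in> carrier M" for x using that unfolding G0_def by blast
  have "\<exists>g\<in>linear_maps R N E. \<forall>(x, y)\<in>G0. g x = y"
  proof (rule injective_module_extend_from_graph[OF inj N])
    show "G0 \<subseteq> carrier N \<times> carrier E" using i' f' by (auto simp: G0_def)
    show "(\<zero>\<^bsub>N\<^esub>, \<zero>\<^bsub>E\<^esub>) \<in> G0" using G0I[OF M.M.zero_closed] z by simp
  next
    fix x y x' y' assume "(x, y) \<in> G0" "(x', y') \<in> G0"
    then obtain a b where "a \<in> carrier M" "b \<in> carrier M" "x = i a" "y = f a" "x' = i b" "y' = f b"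
      unfolding G0_def by blast
    then show "(x \<oplus>\<^bsub>N\<^esub> x', y \<oplus>\<^bsub>E\<^esub> y') \<in> G0" using G0I[of "a \<oplus>\<^bsub>M\<^esub> b"] i' f' by simp
  next
    fix r x y assume "r \<in> carrier R" "(x, y) \<in> G0"
    then obtain a where "a \<in> carrier M" "x = i a" "y = f a" unfolding G0_def by blast
    then show "(r \<odot>\<^bsub>N\<^esub> x, r \<odot>\<^bsub>E\<^esub> y) \<in> G0"
      using G0I[of "r \<odot>\<^bsub>M\<^esub> a"] i' f' \<open>r \<in> carrier R\<close> by simp
  next
    fix y assume "(\<zero>\<^bsub>N\<^esub>, y) \<in> G0"
    then obtain a where a: "a \<in> carrier M" "\<zero>\<^bsub>N\<^esub> = i a" "y = f a" unfolding G0_def by (elim imageE) simp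
    have "i a = i \<zero>\<^bsub>M\<^esub>" by (rule trans[OF a(2)[symmetric] z(1)[symmetric]])
    then have "a = \<zero>\<^bsub>M\<^esub>" by (rule inj_onD[OF i(2) _ a(1) M.M.zero_closed])
    then show "y = \<zero>\<^bsub>E\<^esub>" unfolding a(3) using z(2) by simp
  qed
  then obtain g where g: "g \<in> linear_maps R N E" "\<forall>(x, y)\<in>G0. g x = y" ..
  have "g (i x) = f x" if "x \<in> carrier M" for x using bspec[OF g(2) G0I[OF that]] by simp
  then show ?thesis using g(1) by blast
qed

lemma injective_cogenerator_separates:
  fixes M :: "('r, 'a, 'l) module_scheme"
  assumes inj: "injective_module R E" and cog: "cogenerator R E" and M: "module R M"
    and x: "x \<in> carrier M" "x \<noteq> \<zero>\<^bsub>M\<^esub>"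
  shows "\<exists>f\<in>linear_maps R M E. f x \<noteq> \<zero>\<^bsub>E\<^esub>"
proof -
  interpret M: module R M by (rule M)
  interpret E: module R E using inj by (simp add: injective_module_def)
  define Rx where "Rx = (\<lambda>r. r \<odot>\<^bsub>M\<^esub> x) ` carrier R"
  define rep where "rep z = (SOME r. r \<in> carrier R \<and> r \<odot>\<^bsub>M\<^esub> x = z)" for z
  have rep: "rep z \<in> carrier R" "rep z \<odot>\<^bsub>M\<^esub> x = z" if "z \<in> Rx" for z
    using someI_ex[of "\<lambda>r. r \<in> carrier R \<and> r \<odot>\<^bsub>M\<^esub> x = z"] that unfolding rep_def Rx_def by auto
  have RxM: "z \<in> carrier M" if "z \<in> Rx" for z using that x unfolding Rx_def by auto
  have Rx_add: "z \<oplus>\<^bsub>M\<^esub> z' \<in> Rx" if z: "z \<in> Rx" "z' \<in> Rx" for z z'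
  proof -
    have "z \<oplus>\<^bsub>M\<^esub> z' = (rep z \<oplus>\<^bsub>R\<^esub> rep z') \<odot>\<^bsub>M\<^esub> x"
      using rep[OF z(1)] rep[OF z(2)] x by (simp add: M.smult_l_distr)
    then show ?thesis using rep[OF z(1)] rep[OF z(2)] unfolding Rx_def by simp
  qed
  have Rx_sm: "r \<odot>\<^bsub>M\<^esub> z \<in> Rx" if "r \<in> carrier R" "z \<in> Rx" for r z
  proof -
    have "r \<odot>\<^bsub>M\<^esub> z = (r \<otimes>\<^bsub>R\<^esub> rep z) \<odot>\<^bsub>M\<^esub> x"
      using rep[OF that(2)] x that(1) by (simp add: M.smult_assoc1)
    then show ?thesis using rep[OF that(2)] that(1) unfolding Rx_def by simp
  qed
  have Rx_0: "\<zero>\<^bsub>M\<^esub> \<in> Rx" unfolding Rx_def using x by (intro image_eqI[of _ _ "\<zero>\<^bsub>R\<^esub>"]) auto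
  have Rx_x: "x \<in> Rx" unfolding Rx_def using x by (intro image_eqI[of _ _ "\<one>\<^bsub>R\<^esub>"]) auto
  have Rx_neg: "\<ominus>\<^bsub>M\<^esub> z \<in> Rx" if "z \<in> Rx" for z
    using Rx_sm[of "\<ominus>\<^bsub>R\<^esub> \<one>\<^bsub>R\<^esub>" z] that RxM[OF that] by (simp add: M.smult_l_minus)
  define C :: "('r, 'r) module" where "C = \<lparr>carrier = rep ` Rx, mult = undefined, one = undefined,
      zero = rep \<zero>\<^bsub>M\<^esub>, add = (\<lambda>a b. rep (a \<odot>\<^bsub>M\<^esub> x \<oplus>\<^bsub>M\<^esub> b \<odot>\<^bsub>M\<^esub> x)),
      smult = (\<lambda>r a. rep (r \<odot>\<^bsub>M\<^esub> (a \<odot>\<^bsub>M\<^esub> x)))\<rparr>"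
  have C: "module R C"
  proof (rule moduleI)
    show "cring R" by (rule M.R.is_cring)
    show "abelian_group C"
    proof (rule abelian_groupI)
      fix a assume "a \<in> carrier C"
      then obtain z where z: "z \<in> Rx" "a = rep z" unfolding C_def by auto
      then show "\<exists>b\<in>carrier C. b \<oplus>\<^bsub>C\<^esub> a = \<zero>\<^bsub>C\<^esub>"
        using Rx_neg[OF z(1)] rep RxM
        by (intro bexI[of _ "rep (\<ominus>\<^bsub>M\<^esub> z)"]) (auto simp: C_def M.M.l_neg)
    qed (auto simp: C_def rep Rx_add Rx_0 RxM M.M.a_ac)
  qed (auto simp: C_def rep Rx_add Rx_sm RxM M.smult_l_distr M.smult_r_distr M.smult_assoc1)
  have "rep x \<noteq> rep \<zero>\<^bsub>M\<^esub>" using rep Rx_x Rx_0 x by metis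
  then have "rep x \<in> carrier C" "rep x \<noteq> \<zero>\<^bsub>C\<^esub>" using Rx_x by (auto simp: C_def)
  then obtain f where f: "f \<in> linear_maps R C E" and fx: "f (rep x) \<noteq> \<zero>\<^bsub>E\<^esub>"
    using cog C unfolding cogenerator_def by blast
  have f': "\<And>z. z \<in> Rx \<Longrightarrow> f (rep z) \<in> carrier E"
    "\<And>z z'. \<lbrakk>z \<in> Rx; z' \<in> Rx\<rbrakk> \<Longrightarrow> f (rep (z \<oplus>\<^bsub>M\<^esub> z')) = f (rep z) \<oplus>\<^bsub>E\<^esub> f (rep z')"
    "\<And>r z. \<lbrakk>r \<in> carrier R; z \<in> Rx\<rbrakk> \<Longrightarrow> f (rep (r \<odot>\<^bsub>M\<^esub> z)) = r \<odot>\<^bsub>E\<^esub> f (rep z)"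
    using f by (auto simp: linear_maps_def hom_def C_def rep)
  have f0: "f (rep \<zero>\<^bsub>M\<^esub>) = \<zero>\<^bsub>E\<^esub>"
    using linear_maps_zero[OF C E.module_axioms f] by (simp add: C_def)
  define G0 where "G0 = (\<lambda>z. (z, f (rep z))) ` Rx"
  have G0I: "(z, f (rep z)) \<in> G0" if "z \<in> Rx" for z using that unfolding G0_def by blast
  have "\<exists>g\<in>linear_maps R M E. \<forall>(z, y)\<in>G0. g z = y"
  proof (rule injective_module_extend_from_graph[OF inj M])
    show "G0 \<subseteq> carrier M \<times> carrier E" using RxM f' by (auto simp: G0_def)
    show "(\<zero>\<^bsub>M\<^esub>, \<zero>\<^bsub>E\<^esub>) \<in> G0" using G0I[OF Rx_0] f0 by simp
  next
    fix z y z' y' assume "(z, y) \<in> G0" "(z', y') \<in> G0"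
    then have "z \<in> Rx" "z' \<in> Rx" "y = f (rep z)" "y' = f (rep z')" unfolding G0_def by auto
    then show "(z \<oplus>\<^bsub>M\<^esub> z', y \<oplus>\<^bsub>E\<^esub> y') \<in> G0" using G0I[OF Rx_add, of z z'] f' by simp
  next
    fix r z y assume "r \<in> carrier R" "(z, y) \<in> G0"
    then have "r \<in> carrier R" "z \<in> Rx" "y = f (rep z)" unfolding G0_def by auto
    then show "(r \<odot>\<^bsub>M\<^esub> z, r \<odot>\<^bsub>E\<^esub> y) \<in> G0" using G0I[OF Rx_sm, of r z] f' by simp
  next
    fix y assume "(\<zero>\<^bsub>M\<^esub>, y) \<in> G0"
    then show "y = \<zero>\<^bsub>E\<^esub>" using f0 unfolding G0_def by auto
  qed
  then obtain g where "g \<in> linear_maps R M E" "\<And>z. z \<in> Rx \<Longrightarrow> g z = f (rep z)"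
    unfolding G0_def by auto
  then show ?thesis using Rx_x fx by metis
qed

definition minimal_injective_cogenerator ::
    "('r, 'k) ring_scheme \<Rightarrow> ('r, 'e, 'l) module_scheme \<Rightarrow> bool" where
  "minimal_injective_cogenerator R E \<longleftrightarrow>
     injective_module R E \<and> cogenerator R E \<and>
     (\<forall>F. submodule F R E \<and> injective_module R (E\<lparr>carrier := F\<rparr>) \<and> cogenerator R (E\<lparr>carrier := F\<rparr>)
        \<longrightarrow> F = carrier E)"


section \<open>Categories and functors\<close>

record ('o, 'm) cat =
  Obj :: "'o set"
  Arr :: "'m set"
  Dom :: "'m \<Rightarrow> 'o"
  Cod :: "'m \<Rightarrow> 'o"
  Ident :: "'o \<Rightarrow> 'm"
  Comp :: "'m \<Rightarrow> 'm \<Rightarrow> 'm"  (infixl \<open>\<bullet>\<index>\<close> 70)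

definition Hom :: "('o, 'm, 'z) cat_scheme \<Rightarrow> 'o \<Rightarrow> 'o \<Rightarrow> 'm set" where
  "Hom C X Y = {f \<in> Arr C. Dom C f = X \<and> Cod C f = Y}"

locale category =
  fixes C :: "('o, 'm, 'z) cat_scheme" (structure)
  assumes Dom_closed: "f \<in> Arr C \<Longrightarrow> Dom C f \<in> Obj C"
    and Cod_closed: "f \<in> Arr C \<Longrightarrow> Cod C f \<in> Obj C"
    and Ident_closed: "X \<in> Obj C \<Longrightarrow> Ident C X \<in> Hom C X X"
    and Comp_closed: "\<lbrakk>f \<in> Hom C X Y; g \<in> Hom C Y Z\<rbrakk> \<Longrightarrow> g \<bullet> f \<in> Hom C X Z"
    and Comp_Ident: "f \<in> Hom C X Y \<Longrightarrow> f \<bullet> Ident C X = f"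
    and Ident_Comp: "f \<in> Hom C X Y \<Longrightarrow> Ident C Y \<bullet> f = f"
    and Comp_assoc:
      "\<lbrakk>f \<in> Hom C W X; g \<in> Hom C X Y; h \<in> Hom C Y Z\<rbrakk> \<Longrightarrow> (h \<bullet> g) \<bullet> f = h \<bullet> (g \<bullet> f)"

definition iso_arr :: "('o, 'm, 'z) cat_scheme \<Rightarrow> 'o \<Rightarrow> 'o \<Rightarrow> 'm \<Rightarrow> bool" where
  "iso_arr C X Y f \<longleftrightarrow> f \<in> Hom C X Y \<and>
     (\<exists>g\<in>Hom C Y X. g \<bullet>\<^bsub>C\<^esub> f = Ident C X \<and> f \<bullet>\<^bsub>C\<^esub> g = Ident C Y)"

definition retraction :: "('o, 'm, 'z) cat_scheme \<Rightarrow> 'o \<Rightarrow> 'o \<Rightarrow> 'm \<Rightarrow> bool" where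
  "retraction C X Y f \<longleftrightarrow> f \<in> Hom C X Y \<and> (\<exists>s\<in>Hom C Y X. f \<bullet>\<^bsub>C\<^esub> s = Ident C Y)"

definition zero_object :: "('o, 'm, 'z) cat_scheme \<Rightarrow> 'o \<Rightarrow> bool" where
  "zero_object C X \<longleftrightarrow> X \<in> Obj C \<and>
     (\<forall>Y\<in>Obj C. (\<exists>!f. f \<in> Hom C X Y) \<and> (\<exists>!f. f \<in> Hom C Y X))"

definition full_subcat :: "('o, 'm, 'z) cat_scheme \<Rightarrow> 'o set \<Rightarrow> ('o, 'm, 'z) cat_scheme" where
  "full_subcat C A = C\<lparr>Obj := A, Arr := {f \<in> Arr C. Dom C f \<in> A \<and> Cod C f \<in> A}\<rparr>"

record ('o, 'm, 'p, 'n) func =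
  fob :: "'o \<Rightarrow> 'p"
  far :: "'m \<Rightarrow> 'n"

definition is_functor ::
    "('o, 'm, 'z) cat_scheme \<Rightarrow> ('p, 'n, 'y) cat_scheme \<Rightarrow> ('o, 'm, 'p, 'n) func \<Rightarrow> bool" where
  "is_functor C D F \<longleftrightarrow>
     (\<forall>X\<in>Obj C. fob F X \<in> Obj D) \<and>
     (\<forall>X\<in>Obj C. \<forall>Y\<in>Obj C. \<forall>f\<in>Hom C X Y. far F f \<in> Hom D (fob F X) (fob F Y)) \<and>
     (\<forall>X\<in>Obj C. far F (Ident C X) = Ident D (fob F X)) \<and>
     (\<forall>X\<in>Obj C. \<forall>Y\<in>Obj C. \<forall>Z\<in>Obj C. \<forall>f\<in>Hom C X Y. \<forall>g\<in>Hom C Y Z.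
        far F (g \<bullet>\<^bsub>C\<^esub> f) = far F g \<bullet>\<^bsub>D\<^esub> far F f)"

definition id_func :: "('o, 'm, 'o, 'm) func" where
  "id_func = \<lparr>fob = id, far = id\<rparr>"

definition comp_func ::
    "('p, 'n, 'q, 'l) func \<Rightarrow> ('o, 'm, 'p, 'n) func \<Rightarrow> ('o, 'm, 'q, 'l) func" where
  "comp_func G F = \<lparr>fob = fob G \<circ> fob F, far = far G \<circ> far F\<rparr>"

definition nat_iso ::
    "('o, 'm, 'z) cat_scheme \<Rightarrow> ('p, 'n, 'y) cat_scheme \<Rightarrow>
     ('o, 'm, 'p, 'n) func \<Rightarrow> ('o, 'm, 'p, 'n) func \<Rightarrow> ('o \<Rightarrow> 'n) \<Rightarrow> bool" where
  "nat_iso C D F G \<eta> \<longleftrightarrow> is_functor C D F \<and> is_functor C D G \<and>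
     (\<forall>X\<in>Obj C. iso_arr D (fob F X) (fob G X) (\<eta> X)) \<and>
     (\<forall>X\<in>Obj C. \<forall>Y\<in>Obj C. \<forall>f\<in>Hom C X Y. \<eta> Y \<bullet>\<^bsub>D\<^esub> far F f = far G f \<bullet>\<^bsub>D\<^esub> \<eta> X)"

definition is_equivalence ::
    "('o, 'm, 'z) cat_scheme \<Rightarrow> ('p, 'n, 'y) cat_scheme \<Rightarrow> ('o, 'm, 'p, 'n) func \<Rightarrow> bool" where
  "is_equivalence C D F \<longleftrightarrow> is_functor C D F \<and>
     (\<exists>G \<alpha> \<beta>. is_functor D C G \<and>
        nat_iso C C id_func (comp_func G F) \<alpha> \<and> nat_iso D D (comp_func F G) id_func \<beta>)"


section \<open>Linear and additive categories\<close>

record ('o, 'm, 'r) lcat = "('o, 'm) cat" +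
  ZeroArr :: "'o \<Rightarrow> 'o \<Rightarrow> 'm"
  AddArr :: "'m \<Rightarrow> 'm \<Rightarrow> 'm"
  SmultArr :: "'r \<Rightarrow> 'm \<Rightarrow> 'm"

text \<open>As an \<open>R\<close>-module only \<open>zero\<close>, \<open>add\<close> and \<open>smult\<close> matter. For \<open>X = Y\<close> the fields \<open>mult\<close> and
  \<open>one\<close> make the same record the endomorphism ring of \<open>X\<close>.\<close>
definition hom_module :: "('o, 'm, 'r, 'z) lcat_scheme \<Rightarrow> 'o \<Rightarrow> 'o \<Rightarrow> ('r, 'm) module" where
  "hom_module C X Y =
     \<lparr>carrier = Hom C X Y, mult = Comp C, one = Ident C X,
      zero = ZeroArr C X Y, add = AddArr C, smult = SmultArr C\<rparr>"

locale linear_category = cring R + category C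
  for R :: "('r, 'k) ring_scheme" and C :: "('o, 'm, 'r, 'z) lcat_scheme" +
  assumes hom_is_module: "\<lbrakk>X \<in> Obj C; Y \<in> Obj C\<rbrakk> \<Longrightarrow> module R (hom_module C X Y)"
    and Comp_add_left: "\<lbrakk>f \<in> Hom C X Y; g \<in> Hom C Y Z; g' \<in> Hom C Y Z\<rbrakk> \<Longrightarrow>
          AddArr C g g' \<bullet>\<^bsub>C\<^esub> f = AddArr C (g \<bullet>\<^bsub>C\<^esub> f) (g' \<bullet>\<^bsub>C\<^esub> f)"
    and Comp_add_right: "\<lbrakk>f \<in> Hom C X Y; f' \<in> Hom C X Y; g \<in> Hom C Y Z\<rbrakk> \<Longrightarrow>
          g \<bullet>\<^bsub>C\<^esub> AddArr C f f' = AddArr C (g \<bullet>\<^bsub>C\<^esub> f) (g \<bullet>\<^bsub>C\<^esub> f')"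
    and Comp_smult_left: "\<lbrakk>r \<in> carrier R; f \<in> Hom C X Y; g \<in> Hom C Y Z\<rbrakk> \<Longrightarrow>
          SmultArr C r g \<bullet>\<^bsub>C\<^esub> f = SmultArr C r (g \<bullet>\<^bsub>C\<^esub> f)"
    and Comp_smult_right: "\<lbrakk>r \<in> carrier R; f \<in> Hom C X Y; g \<in> Hom C Y Z\<rbrakk> \<Longrightarrow>
          g \<bullet>\<^bsub>C\<^esub> SmultArr C r f = SmultArr C r (g \<bullet>\<^bsub>C\<^esub> f)"

definition direct_sum :: "('o, 'm, 'r, 'z) lcat_scheme \<Rightarrow> 'o list \<Rightarrow> 'o \<Rightarrow> bool" where
  "direct_sum C As X \<longleftrightarrow> set As \<subseteq> Obj C \<and> X \<in> Obj C \<and>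
     (\<exists>\<iota> \<pi>.
        (\<forall>i<length As. \<iota> i \<in> Hom C (As ! i) X \<and> \<pi> i \<in> Hom C X (As ! i)) \<and>
        (\<forall>i<length As. \<forall>j<length As.
           \<pi> j \<bullet>\<^bsub>C\<^esub> \<iota> i = (if i = j then Ident C (As ! i) else ZeroArr C (As ! i) (As ! j))) \<and>
        finsum (hom_module C X X) (\<lambda>i. \<iota> i \<bullet>\<^bsub>C\<^esub> \<pi> i) {..<length As} = Ident C X)"

text \<open>The empty list yields a zero object.\<close>
locale additive_linear_category = linear_category +
  assumes direct_sums_exist: "set As \<subseteq> Obj C \<Longrightarrow> \<exists>X. direct_sum C As X"

definition indecomposable :: "('o, 'm, 'r, 'z) lcat_scheme \<Rightarrow> 'o \<Rightarrow> bool" where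
  "indecomposable C X \<longleftrightarrow> X \<in> Obj C \<and> \<not> zero_object C X \<and>
     (\<forall>A B. direct_sum C [A, B] X \<longrightarrow> zero_object C A \<or> zero_object C B)"

definition Hom_finite :: "('r, 'k) ring_scheme \<Rightarrow> ('o, 'm, 'r, 'z) lcat_scheme \<Rightarrow> bool" where
  "Hom_finite R C \<longleftrightarrow> (\<forall>X\<in>Obj C. \<forall>Y\<in>Obj C. fin_gen_module R (hom_module C X Y))"

definition Krull_Schmidt :: "('o, 'm, 'r, 'z) lcat_scheme \<Rightarrow> bool" where
  "Krull_Schmidt C \<longleftrightarrow>
     (\<forall>X\<in>Obj C. \<exists>As. direct_sum C As X \<and>
        (\<forall>A\<in>set As. indecomposable C A \<and> local_ring (hom_module C A A)))"

definition linear_functor ::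
    "('r, 'k) ring_scheme \<Rightarrow> ('o, 'm, 'r, 'z) lcat_scheme \<Rightarrow> ('p, 'n, 'r, 'y) lcat_scheme \<Rightarrow>
     ('o, 'm, 'p, 'n) func \<Rightarrow> bool" where
  "linear_functor R C D F \<longleftrightarrow> is_functor C D F \<and>
     (\<forall>X\<in>Obj C. \<forall>Y\<in>Obj C.
        far F \<in> linear_maps R (hom_module C X Y) (hom_module D (fob F X) (fob F Y)))"


section \<open>Representability and the generalized Serre functor\<close>

text \<open>The data of a functor, covariant or contravariant, from a category to \<open>R\<close>-modules.\<close>
record ('o, 'm, 'r, 'a) modfunc =
  mob :: "'o \<Rightarrow> ('r, 'a) module"
  mar :: "'m \<Rightarrow> 'a \<Rightarrow> 'a"

definition Hom_from :: "('o, 'm, 'r, 'z) lcat_scheme \<Rightarrow> 'o \<Rightarrow> ('o, 'm, 'r, 'm) modfunc" where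
  "Hom_from C X = \<lparr>mob = (\<lambda>Y. hom_module C X Y), mar = (\<lambda>f g. f \<bullet>\<^bsub>C\<^esub> g)\<rparr>"

definition Hom_to :: "('o, 'm, 'r, 'z) lcat_scheme \<Rightarrow> 'o \<Rightarrow> ('o, 'm, 'r, 'm) modfunc" where
  "Hom_to C X = \<lparr>mob = (\<lambda>Y. hom_module C Y X), mar = (\<lambda>f g. g \<bullet>\<^bsub>C\<^esub> f)\<rparr>"

text \<open>The composite of \<open>D = Hom_R(-, E)\<close> with a covariant functor (the result is contravariant) and
  with a contravariant functor (the result is covariant): a morphism \<open>f\<close> acts by precomposition with
  the linear map \<open>mar F f\<close>, whose source is \<open>mob F (Dom C f)\<close> and \<open>mob F (Cod C f)\<close>, respectively.\<close>
definition dual_of_cov ::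
    "('r, 'k) ring_scheme \<Rightarrow> ('r, 'e, 'l) module_scheme \<Rightarrow> ('o, 'm, 'z) cat_scheme \<Rightarrow>
     ('o, 'm, 'r, 'a) modfunc \<Rightarrow> ('o, 'm, 'r, 'a \<Rightarrow> 'e) modfunc" where
  "dual_of_cov R E C F =
     \<lparr>mob = (\<lambda>Y. Hom_R R (mob F Y) E),
      mar = (\<lambda>f \<xi>. compose (carrier (mob F (Dom C f))) \<xi> (mar F f))\<rparr>"

definition dual_of_contra ::
    "('r, 'k) ring_scheme \<Rightarrow> ('r, 'e, 'l) module_scheme \<Rightarrow> ('o, 'm, 'z) cat_scheme \<Rightarrow>
     ('o, 'm, 'r, 'a) modfunc \<Rightarrow> ('o, 'm, 'r, 'a \<Rightarrow> 'e) modfunc" where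
  "dual_of_contra R E C F =
     \<lparr>mob = (\<lambda>Y. Hom_R R (mob F Y) E),
      mar = (\<lambda>f \<xi>. compose (carrier (mob F (Cod C f))) \<xi> (mar F f))\<rparr>"

definition precomp_func ::
    "('p, 'n, 'r, 'a) modfunc \<Rightarrow> ('o, 'm, 'p, 'n) func \<Rightarrow> ('o, 'm, 'r, 'a) modfunc" where
  "precomp_func F S = \<lparr>mob = mob F \<circ> fob S, mar = mar F \<circ> far S\<rparr>"

definition nat_iso_cov ::
    "('r, 'k) ring_scheme \<Rightarrow> ('o, 'm, 'z) cat_scheme \<Rightarrow>
     ('o, 'm, 'r, 'a) modfunc \<Rightarrow> ('o, 'm, 'r, 'b) modfunc \<Rightarrow> ('o \<Rightarrow> 'a \<Rightarrow> 'b) \<Rightarrow> bool" where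
  "nat_iso_cov R C F G \<psi> \<longleftrightarrow>
     (\<forall>X\<in>Obj C. \<psi> X \<in> module_isos R (mob F X) (mob G X)) \<and>
     (\<forall>X\<in>Obj C. \<forall>Y\<in>Obj C. \<forall>f\<in>Hom C X Y. \<forall>x\<in>carrier (mob F X).
        \<psi> Y (mar F f x) = mar G f (\<psi> X x))"

definition nat_iso_contra ::
    "('r, 'k) ring_scheme \<Rightarrow> ('o, 'm, 'z) cat_scheme \<Rightarrow>
     ('o, 'm, 'r, 'a) modfunc \<Rightarrow> ('o, 'm, 'r, 'b) modfunc \<Rightarrow> ('o \<Rightarrow> 'a \<Rightarrow> 'b) \<Rightarrow> bool" where
  "nat_iso_contra R C F G \<psi> \<longleftrightarrow>
     (\<forall>X\<in>Obj C. \<psi> X \<in> module_isos R (mob F X) (mob G X)) \<and>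
     (\<forall>X\<in>Obj C. \<forall>Y\<in>Obj C. \<forall>f\<in>Hom C X Y. \<forall>x\<in>carrier (mob F Y).
        \<psi> X (mar F f x) = mar G f (\<psi> Y x))"

definition right_objs ::
    "('r, 'k) ring_scheme \<Rightarrow> ('r, 'e, 'l) module_scheme \<Rightarrow> ('o, 'm, 'r, 'z) lcat_scheme \<Rightarrow> 'o set" where
  "right_objs R E C =
     {X \<in> Obj C. \<exists>Z\<in>Obj C. \<exists>\<psi>. nat_iso_contra R C (dual_of_cov R E C (Hom_from C X)) (Hom_to C Z) \<psi>}"

definition left_objs ::
    "('r, 'k) ring_scheme \<Rightarrow> ('r, 'e, 'l) module_scheme \<Rightarrow> ('o, 'm, 'r, 'z) lcat_scheme \<Rightarrow> 'o set" where
  "left_objs R E C =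
     {X \<in> Obj C. \<exists>Z\<in>Obj C. \<exists>\<psi>. nat_iso_cov R C (dual_of_contra R E C (Hom_to C X)) (Hom_from C Z) \<psi>}"

definition generalized_serre_functor ::
    "('r, 'k) ring_scheme \<Rightarrow> ('r, 'e, 'l) module_scheme \<Rightarrow> ('o, 'm, 'r, 'z) lcat_scheme \<Rightarrow>
     ('o, 'm, 'o, 'm) func \<Rightarrow> bool" where
  "generalized_serre_functor R E C S \<longleftrightarrow>
     is_functor (full_subcat C (right_objs R E C)) (full_subcat C (left_objs R E C)) S \<and>
     (\<exists>\<phi>.
        (\<forall>X\<in>right_objs R E C.
           nat_iso_contra R C (dual_of_cov R E C (Hom_from C X)) (Hom_to C (fob S X)) (\<lambda>Y. \<phi> X Y)) \<and>
        (\<forall>Y\<in>Obj C.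
           nat_iso_cov R (full_subcat C (right_objs R E C))
             (dual_of_contra R E C (Hom_to C Y)) (precomp_func (Hom_from C Y) S) (\<lambda>X. \<phi> X Y)))"


section \<open>Triangulated categories\<close>

record ('o, 'm, 'r) tcat = "('o, 'm, 'r) lcat" +
  Shift :: "('o, 'm, 'o, 'm) func"
  Tri :: "('m \<times> 'm \<times> 'm) set"

definition triangle ::
    "('o, 'm, 'r, 'z) tcat_scheme \<Rightarrow> 'o \<Rightarrow> 'o \<Rightarrow> 'o \<Rightarrow> 'm \<Rightarrow> 'm \<Rightarrow> 'm \<Rightarrow> bool" where
  "triangle T X Y Z u v w \<longleftrightarrow> X \<in> Obj T \<and> Y \<in> Obj T \<and> Z \<in> Obj T \<and>
     u \<in> Hom T X Y \<and> v \<in> Hom T Y Z \<and> w \<in> Hom T Z (fob (Shift T) X)"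

definition dist_triangle ::
    "('o, 'm, 'r, 'z) tcat_scheme \<Rightarrow> 'o \<Rightarrow> 'o \<Rightarrow> 'o \<Rightarrow> 'm \<Rightarrow> 'm \<Rightarrow> 'm \<Rightarrow> bool" where
  "dist_triangle T X Y Z u v w \<longleftrightarrow> triangle T X Y Z u v w \<and> (u, v, w) \<in> Tri T"

text \<open>The translation functor is an autoequivalence; it need not be a strict automorphism.\<close>
locale linear_triangulated_category = additive_linear_category R T
  for R :: "('r, 'k) ring_scheme" and T :: "('o, 'm, 'r, 'z) tcat_scheme" +
  assumes Shift_linear: "linear_functor R T T (Shift T)"
    and Shift_equivalence: "is_equivalence T T (Shift T)"
    and Tri_triangle: "(u, v, w) \<in> Tri T \<Longrightarrow> \<exists>X Y Z. triangle T X Y Z u v w"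
    and TR1_iso: "\<lbrakk>dist_triangle T X Y Z u v w; triangle T X' Y' Z' u' v' w';
          iso_arr T X X' f; iso_arr T Y Y' g; iso_arr T Z Z' h;
          g \<bullet>\<^bsub>T\<^esub> u = u' \<bullet>\<^bsub>T\<^esub> f; h \<bullet>\<^bsub>T\<^esub> v = v' \<bullet>\<^bsub>T\<^esub> g; far (Shift T) f \<bullet>\<^bsub>T\<^esub> w = w' \<bullet>\<^bsub>T\<^esub> h\<rbrakk>
          \<Longrightarrow> dist_triangle T X' Y' Z' u' v' w'"
    and TR1_ident: "\<lbrakk>X \<in> Obj T; zero_object T N\<rbrakk> \<Longrightarrow>
          dist_triangle T X X N (Ident T X) (ZeroArr T X N) (ZeroArr T N (fob (Shift T) X))"
    and TR1_cone: "\<lbrakk>X \<in> Obj T; Y \<in> Obj T; u \<in> Hom T X Y\<rbrakk> \<Longrightarrow> \<exists>Z v w. dist_triangle T X Y Z u v w"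
    and TR2: "triangle T X Y Z u v w \<Longrightarrow>
          dist_triangle T X Y Z u v w \<longleftrightarrow>
          dist_triangle T Y Z (fob (Shift T) X) v w
            (\<ominus>\<^bsub>hom_module T (fob (Shift T) X) (fob (Shift T) Y)\<^esub> far (Shift T) u)"
    and TR3: "\<lbrakk>dist_triangle T X Y Z u v w; dist_triangle T X' Y' Z' u' v' w';
          f \<in> Hom T X X'; g \<in> Hom T Y Y'; g \<bullet>\<^bsub>T\<^esub> u = u' \<bullet>\<^bsub>T\<^esub> f\<rbrakk>
          \<Longrightarrow> \<exists>h\<in>Hom T Z Z'. h \<bullet>\<^bsub>T\<^esub> v = v' \<bullet>\<^bsub>T\<^esub> g \<and> far (Shift T) f \<bullet>\<^bsub>T\<^esub> w = w' \<bullet>\<^bsub>T\<^esub> h"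
    and TR4: "\<lbrakk>dist_triangle T X Y Z' u j k; dist_triangle T Y Z X' v l i;
          dist_triangle T X Z Y' (v \<bullet>\<^bsub>T\<^esub> u) m n\<rbrakk>
          \<Longrightarrow> \<exists>f\<in>Hom T Z' Y'. \<exists>g\<in>Hom T Y' X'.
                dist_triangle T Z' Y' X' f g (far (Shift T) j \<bullet>\<^bsub>T\<^esub> i) \<and>
                f \<bullet>\<^bsub>T\<^esub> j = m \<bullet>\<^bsub>T\<^esub> v \<and> n \<bullet>\<^bsub>T\<^esub> f = k \<and>
                g \<bullet>\<^bsub>T\<^esub> m = l \<and> i \<bullet>\<^bsub>T\<^esub> g = far (Shift T) u \<bullet>\<^bsub>T\<^esub> n"

text \<open>Subcategories are full and given by their sets of objects. Since \<open>A\<close> is closed under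
  isomorphism, \<open>X[1] \<in> A \<Longrightarrow> X \<in> A\<close> expresses closure under the inverse translation.\<close>
definition triangulated_subcat :: "('o, 'm, 'r, 'z) tcat_scheme \<Rightarrow> 'o set \<Rightarrow> bool" where
  "triangulated_subcat T A \<longleftrightarrow> A \<subseteq> Obj T \<and>
     (\<exists>N\<in>A. zero_object T N) \<and>
     (\<forall>X\<in>A. \<forall>Y\<in>Obj T. (\<exists>f. iso_arr T X Y f) \<longrightarrow> Y \<in> A) \<and>
     (\<forall>X\<in>Obj T. X \<in> A \<longleftrightarrow> fob (Shift T) X \<in> A) \<and>
     (\<forall>X Y Z u v w. dist_triangle T X Y Z u v w \<longrightarrow>
        (X \<in> A \<and> Y \<in> A \<longrightarrow> Z \<in> A) \<and> (Y \<in> A \<and> Z \<in> A \<longrightarrow> X \<in> A) \<and> (X \<in> A \<and> Z \<in> A \<longrightarrow> Y \<in> A))"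

definition thick_subcat :: "('o, 'm, 'r, 'z) tcat_scheme \<Rightarrow> 'o set \<Rightarrow> bool" where
  "thick_subcat T A \<longleftrightarrow> triangulated_subcat T A \<and>
     (\<forall>X B B'. X \<in> A \<and> direct_sum T [B, B'] X \<longrightarrow> B \<in> A \<and> B' \<in> A)"

definition restrict_tcat :: "('o, 'm, 'r, 'z) tcat_scheme \<Rightarrow> 'o set \<Rightarrow> ('o, 'm, 'r, 'z) tcat_scheme" where
  "restrict_tcat T A =
     (full_subcat T A)\<lparr>Tri := {(u, v, w) \<in> Tri T. {u, v, w} \<subseteq> Arr (full_subcat T A)}\<rparr>"

definition triangle_functor ::
    "('o, 'm, 'r, 'z) tcat_scheme \<Rightarrow> ('p, 'n, 'r, 'y) tcat_scheme \<Rightarrow>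
     ('o, 'm, 'p, 'n) func \<Rightarrow> ('o \<Rightarrow> 'n) \<Rightarrow> bool" where
  "triangle_functor T T' S \<eta> \<longleftrightarrow> is_functor T T' S \<and>
     nat_iso T T' (comp_func S (Shift T)) (comp_func (Shift T') S) \<eta> \<and>
     (\<forall>X Y Z u v w. dist_triangle T X Y Z u v w \<longrightarrow>
        dist_triangle T' (fob S X) (fob S Y) (fob S Z) (far S u) (far S v) (\<eta> X \<bullet>\<^bsub>T'\<^esub> far S w))"

definition triangle_equivalence ::
    "('o, 'm, 'r, 'z) tcat_scheme \<Rightarrow> ('p, 'n, 'r, 'y) tcat_scheme \<Rightarrow>
     ('o, 'm, 'p, 'n) func \<Rightarrow> ('o \<Rightarrow> 'n) \<Rightarrow> bool" where
  "triangle_equivalence T T' S \<eta> \<longleftrightarrow> triangle_functor T T' S \<eta> \<and> is_equivalence T T' S"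

definition AR_triangle ::
    "('o, 'm, 'r, 'z) tcat_scheme \<Rightarrow> 'o \<Rightarrow> 'o \<Rightarrow> 'o \<Rightarrow> 'm \<Rightarrow> 'm \<Rightarrow> 'm \<Rightarrow> bool" where
  "AR_triangle T X Y Z u v w \<longleftrightarrow> dist_triangle T X Y Z u v w \<and>
     indecomposable T X \<and> indecomposable T Z \<and>
     w \<noteq> ZeroArr T Z (fob (Shift T) X) \<and>
     (\<forall>Y'\<in>Obj T. \<forall>\<gamma>\<in>Hom T Y' Z. \<not> retraction T Y' Z \<gamma> \<longrightarrow>
        w \<bullet>\<^bsub>T\<^esub> \<gamma> = ZeroArr T Y' (fob (Shift T) X))"

end

theory Submission
  imports Defs
begin

text \<open>
  By Matlis duality, \<open>X \<in> \<T>\<^sub>r\<close> with \<open>S(X) \<cong> Z\<close> and \<open>Z \<in> \<T>\<^sub>l\<close> with partner \<open>X\<close> both amount to one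
  symmetric datum: a linear form \<open>t : (X, Z) \<rightarrow> E\<close> for which all the pairings \<open>(g, f) \<mapsto> t (g f)\<close> of
  \<open>(Y, Z)\<close> with \<open>(X, Y)\<close> are nondegenerate on both sides (a Serre pairing). Over an artinian ring such a
  pairing of finitely generated modules is automatically perfect.

  Such forms can be shifted, with a sign, and restricted along split idempotents. Given a triangle on
  \<open>u : X \<rightarrow> Y\<close> and a triangle on \<open>S(u)\<close>, the forms of \<open>X\<close> and \<open>Y\<close> glue to a Serre pairing of the two
  cones. This single construction gives the closure of both subcategories under cones and the
  exactness of \<open>S\<close>. Idempotents split because \<open>\<T>\<close> is Krull-Schmidt.

  For an Auslander-Reiten triangle \<open>W \<rightarrow> Y \<rightarrow> X \<rightarrow> W[1]\<close> with last morphism \<open>w\<close>, any form that does not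
  vanish on \<open>w\<close> is a Serre pairing of \<open>X\<close> and \<open>W[1]\<close>; conversely, for a Serre pairing with \<open>X\<close>
  indecomposable, \<open>w\<close> is a morphism generating a minimal \<open>End(X)\<close>-submodule of \<open>(X, W[1])\<close>.
\<close>

section \<open>Modules over an artinian ring\<close>

text \<open>Nondegenerate pairings are perfect only because \<open>E\<close> is minimal: over a
  field, with a plane in place of \<open>E\<close>, multiplication of a line with itself into one
  axis of the plane is nondegenerate, yet the forms on the line fill a plane. Lengths are not
  counted; the chain condition on ideals of \<open>R\<close> is passed on to Hom modules and used
  through minimal counterexamples. The form of a Serre pairing is the preimage of an identity under
  the representing isomorphism, as in Yoneda's lemma. The gain is that \<open>a = S(u)\<close> is
  governed by one equation, \<open>t' (a h) = t (h u)\<close>, uniquely solvable for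
  \<open>a\<close> given \<open>u\<close> and for \<open>u\<close> given \<open>a\<close>. Functor
  laws, full faithfulness, naturality of \<eta> and exactness then come down to two arrows solving
  the same equation. The translation is only an autoequivalence, so objects are replaced by
  isomorphic \<open>V[1]\<close> before they are shifted back. The Krull-Schmidt hypothesis provides
  mere decompositions; that the endomorphism ring of each indecomposable object behaves as a local
  ring has to be derived.\<close>

lemma linear_mapsI:
  assumes "\<And>x. x \<in> carrier M \<Longrightarrow> h x \<in> carrier N"
    and "\<And>x y. \<lbrakk>x \<in> carrier M; y \<in> carrier M\<rbrakk> \<Longrightarrow> h (x \<oplus>\<^bsub>M\<^esub> y) = h x \<oplus>\<^bsub>N\<^esub> h y"
    and "\<And>r x. \<lbrakk>r \<in> carrier R; x \<in> carrier M\<rbrakk> \<Longrightarrow> h (r \<odot>\<^bsub>M\<^esub> x) = r \<odot>\<^bsub>N\<^esub> h x"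
  shows "h \<in> linear_maps R M N"
  using assms by (auto simp: linear_maps_def hom_def)

lemma linear_mapsD:
  assumes "h \<in> linear_maps R M N"
  shows "x \<in> carrier M \<Longrightarrow> h x \<in> carrier N"
    and "\<lbrakk>x \<in> carrier M; y \<in> carrier M\<rbrakk> \<Longrightarrow> h (x \<oplus>\<^bsub>M\<^esub> y) = h x \<oplus>\<^bsub>N\<^esub> h y"
    and "\<lbrakk>r \<in> carrier R; x \<in> carrier M\<rbrakk> \<Longrightarrow> h (r \<odot>\<^bsub>M\<^esub> x) = r \<odot>\<^bsub>N\<^esub> h x"
  using assms by (auto simp: linear_maps_def hom_def)

lemma (in module) minus_one_smult:
  "x \<in> carrier M \<Longrightarrow> (\<ominus> \<one>) \<odot>\<^bsub>M\<^esub> x = \<ominus>\<^bsub>M\<^esub> x"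
  by (simp add: smult_l_minus)

lemma (in module) submodule_iff:
  "submodule H R M \<longleftrightarrow> H \<subseteq> carrier M \<and> \<zero>\<^bsub>M\<^esub> \<in> H \<and> (\<forall>x\<in>H. \<forall>y\<in>H. x \<oplus>\<^bsub>M\<^esub> y \<in> H) \<and>
     (\<forall>r\<in>carrier R. \<forall>x\<in>H. r \<odot>\<^bsub>M\<^esub> x \<in> H)"
proof
  assume H: "submodule H R M"
  note E = submoduleE[OF H]
  obtain x where "x \<in> H" using E(2) by blast
  then have "\<zero> \<odot>\<^bsub>M\<^esub> x \<in> H" "x \<in> carrier M" using E by auto
  then have "\<zero>\<^bsub>M\<^esub> \<in> H" by simp
  then show "H \<subseteq> carrier M \<and> \<zero>\<^bsub>M\<^esub> \<in> H \<and> (\<forall>x\<in>H. \<forall>y\<in>H. x \<oplus>\<^bsub>M\<^esub> y \<in> H) \<and>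
     (\<forall>r\<in>carrier R. \<forall>x\<in>H. r \<odot>\<^bsub>M\<^esub> x \<in> H)" using E by blast
next
  assume H: "H \<subseteq> carrier M \<and> \<zero>\<^bsub>M\<^esub> \<in> H \<and> (\<forall>x\<in>H. \<forall>y\<in>H. x \<oplus>\<^bsub>M\<^esub> y \<in> H) \<and>
     (\<forall>r\<in>carrier R. \<forall>x\<in>H. r \<odot>\<^bsub>M\<^esub> x \<in> H)"
  show "submodule H R M"
  proof (rule submoduleI)
    fix a assume "a \<in> H"
    then have "(\<ominus> \<one>) \<odot>\<^bsub>M\<^esub> a \<in> H" "a \<in> carrier M" using H by auto
    then show "\<ominus>\<^bsub>M\<^esub> a \<in> H" by (simp add: minus_one_smult)
  qed (use H in auto)
qed

text \<open>Supplies the upper bounds for the two Zorn arguments in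
  \<open>multiple_if_annihilator_le\<close>.\<close>

lemma (in module) submodule_Union_chain:
  assumes "\<C> \<noteq> {}" and "subset.chain \<A> \<C>" and "\<And>H. H \<in> \<A> \<Longrightarrow> submodule H R M"
  shows "submodule (\<Union>\<C>) R M"
proof -
  have s: "H \<subseteq> carrier M" "\<zero>\<^bsub>M\<^esub> \<in> H" "x \<in> H \<Longrightarrow> y \<in> H \<Longrightarrow> x \<oplus>\<^bsub>M\<^esub> y \<in> H"
    "r \<in> carrier R \<Longrightarrow> x \<in> H \<Longrightarrow> r \<odot>\<^bsub>M\<^esub> x \<in> H" if "H \<in> \<C>" for H x y r
    using assms that unfolding subset_chain_def submodule_iff by (meson subsetD)+
  have lin: "H \<subseteq> K \<or> K \<subseteq> H" if "H \<in> \<C>" "K \<in> \<C>" for H K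
    using assms(2) that by (auto simp: subset_chain_def)
  have "x \<oplus>\<^bsub>M\<^esub> y \<in> \<Union>\<C>" if "x \<in> \<Union>\<C>" "y \<in> \<Union>\<C>" for x y
  proof -
    obtain H K where "H \<in> \<C>" "K \<in> \<C>" "x \<in> H" "y \<in> K" using \<open>x \<in> \<Union>\<C>\<close> \<open>y \<in> \<Union>\<C>\<close> by blast
    then obtain L where "L \<in> \<C>" "x \<in> L" "y \<in> L" using lin by blast
    then show ?thesis using s(3) by blast
  qed
  moreover have "\<Union>\<C> \<subseteq> carrier M" using s(1) by blast
  moreover have "\<zero>\<^bsub>M\<^esub> \<in> \<Union>\<C>" using s(2) assms(1) by blast
  moreover have "r \<odot>\<^bsub>M\<^esub> x \<in> \<Union>\<C>" if "r \<in> carrier R" "x \<in> \<Union>\<C>" for r x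
    using that s(4) by (meson UnionE UnionI)
  ultimately show ?thesis
    unfolding submodule_iff by (intro conjI ballI)
qed

text \<open>The submodule \<open>N + Rx\<close>. Adjoining one cyclic module at a time serves both
  the induction over generators and the use of maximal submodules.\<close>

lemma (in module) submodule_add_cyclic:
  assumes N: "submodule N R M" and x: "x \<in> carrier M"
  defines "N' \<equiv> {n \<oplus>\<^bsub>M\<^esub> r \<odot>\<^bsub>M\<^esub> x | n r. n \<in> N \<and> r \<in> carrier R}"
  shows "submodule N' R M" and "N \<subseteq> N'" and "x \<in> N'"
proof -
  have s: "\<And>n. n \<in> N \<Longrightarrow> n \<in> carrier M" "\<zero>\<^bsub>M\<^esub> \<in> N" "\<And>x y. x \<in> N \<Longrightarrow> y \<in> N \<Longrightarrow> x \<oplus>\<^bsub>M\<^esub> y \<in> N"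
    "\<And>r x. r \<in> carrier R \<Longrightarrow> x \<in> N \<Longrightarrow> r \<odot>\<^bsub>M\<^esub> x \<in> N"
    using N unfolding submodule_iff by auto
  have I: "n \<oplus>\<^bsub>M\<^esub> r \<odot>\<^bsub>M\<^esub> x \<in> N'" if "n \<in> N" "r \<in> carrier R" for n r
    using that unfolding N'_def by blast
  show sub: "N \<subseteq> N'"
  proof
    fix n assume "n \<in> N"
    then show "n \<in> N'" using I[of n \<zero>] s(1) x by simp
  qed
  show "x \<in> N'" using I[of "\<zero>\<^bsub>M\<^esub>" \<one>] s x by simp
  have "a \<oplus>\<^bsub>M\<^esub> b \<in> N'" if ab: "a \<in> N'" "b \<in> N'" for a b
  proof -
    obtain n r n' r' where *: "n \<in> N" "r \<in> carrier R" "n' \<in> N" "r' \<in> carrier R"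
      "a = n \<oplus>\<^bsub>M\<^esub> r \<odot>\<^bsub>M\<^esub> x" "b = n' \<oplus>\<^bsub>M\<^esub> r' \<odot>\<^bsub>M\<^esub> x" using ab unfolding N'_def by blast
    have "a \<oplus>\<^bsub>M\<^esub> b = (n \<oplus>\<^bsub>M\<^esub> n') \<oplus>\<^bsub>M\<^esub> (r \<oplus> r') \<odot>\<^bsub>M\<^esub> x"
      using * x s(1) by (simp add: smult_l_distr M.a_ac)
    then show ?thesis using I[of "n \<oplus>\<^bsub>M\<^esub> n'" "r \<oplus> r'"] * s by simp
  qed
  moreover have "q \<odot>\<^bsub>M\<^esub> a \<in> N'" if q: "q \<in> carrier R" and "a \<in> N'" for q a
  proof -
    obtain n r where *: "n \<in> N" "r \<in> carrier R" "a = n \<oplus>\<^bsub>M\<^esub> r \<odot>\<^bsub>M\<^esub> x"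
      using \<open>a \<in> N'\<close> unfolding N'_def by blast
    have "q \<odot>\<^bsub>M\<^esub> a = q \<odot>\<^bsub>M\<^esub> n \<oplus>\<^bsub>M\<^esub> (q \<otimes> r) \<odot>\<^bsub>M\<^esub> x"
      using * x s(1) q by (simp add: smult_r_distr smult_assoc1)
    then show ?thesis using I[of "q \<odot>\<^bsub>M\<^esub> n" "q \<otimes> r"] * s q by simp
  qed
  ultimately show "submodule N' R M"
    using s x sub unfolding submodule_iff N'_def by auto
qed

lemma (in cring) ideal_if_closed:
  assumes sub: "I \<subseteq> carrier R" and zero: "\<zero> \<in> I"
    and add: "\<And>a b. \<lbrakk>a \<in> I; b \<in> I\<rbrakk> \<Longrightarrow> a \<oplus> b \<in> I"
    and mult: "\<And>r a. \<lbrakk>r \<in> carrier R; a \<in> I\<rbrakk> \<Longrightarrow> r \<otimes> a \<in> I"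
  shows "ideal I R"
proof (rule idealI)
  show "ring R" by (rule ring_axioms)
  have "\<ominus> a \<in> I" if "a \<in> I" for a
    using mult[of "\<ominus> \<one>" a] that sub by (simp add: l_minus subset_iff)
  then show "subgroup I (add_monoid R)"
    using assms by (intro add.subgroupI) auto
  show "x \<otimes> a \<in> I" "a \<otimes> x \<in> I" if "a \<in> I" "x \<in> carrier R" for a x
    using mult[OF that(2,1)] m_comm[of a x] that sub by auto
qed

lemma (in module) ideal_quotient:
  assumes "submodule N R M" and "x \<in> carrier M"
  shows "ideal {r \<in> carrier R. r \<odot>\<^bsub>M\<^esub> x \<in> N} R"
  using assms by (intro R.ideal_if_closed) (auto simp: submodule_iff smult_l_distr smult_assoc1)

lemma (in artinian_cring) minimal_ideal_exists:
  assumes ne: "\<I> \<noteq> {}" and id: "\<And>I. I \<in> \<I> \<Longrightarrow> ideal I R"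
  shows "\<exists>I\<in>\<I>. \<forall>J\<in>\<I>. J \<subseteq> I \<longrightarrow> J = I"
proof (rule ccontr)
  assume "\<not> ?thesis"
  then have "\<forall>I\<in>\<I>. \<exists>J\<in>\<I>. J \<subset> I" by blast
  then obtain f where f: "\<And>I. I \<in> \<I> \<Longrightarrow> f I \<in> \<I> \<and> f I \<subset> I" by metis
  obtain I0 where I0: "I0 \<in> \<I>" using ne by blast
  define S where "S n = (f ^^ n) I0" for n :: nat
  have S: "S n \<in> \<I>" for n unfolding S_def by (induction n) (use I0 f in auto)
  have SS: "S (Suc n) \<subset> S n" for n using f[OF S] by (simp add: S_def)
  obtain N where "\<forall>n\<ge>N. S n = S N"
    using descending_chain_condition[of S] S id SS by blast
  then show False using SS[of N] by (metis le_Suc_eq order_refl psubset_eq)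
qed

text \<open>The minimum condition for things that merely determine an ideal: scalars in
  \<open>simple_multiple\<close>, submodules in \<open>dcc_on_add_cyclic\<close>.\<close>

corollary (in artinian_cring) minimal_ideal_obtain:
  assumes "P a" and "\<And>a. P a \<Longrightarrow> ideal (J a) R"
  obtains b where "P b" and "\<And>c. \<lbrakk>P c; J c \<subseteq> J b\<rbrakk> \<Longrightarrow> J c = J b"
proof -
  have "\<exists>I\<in>J ` Collect P. \<forall>K\<in>J ` Collect P. K \<subseteq> I \<longrightarrow> K = I"
    by (rule minimal_ideal_exists) (use assms in auto)
  then show thesis using that by auto
qed

text \<open>A nonzero cyclic module over an artinian ring contains a simple submodule: the class of
  \<open>r x\<close> in \<open>M/N\<close> generates one, since each nonzero multiple of it
  generates it back. Elements of \<open>M\<close> are used in order to avoid quotient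
  modules.\<close>

lemma (in module) simple_multiple:
  assumes "artinian_cring R" and N: "submodule N R M" and x: "x \<in> carrier M" "x \<notin> N"
  obtains r where "r \<in> carrier R" and "r \<odot>\<^bsub>M\<^esub> x \<notin> N"
    and "\<And>s. \<lbrakk>s \<in> carrier R; s \<odot>\<^bsub>M\<^esub> (r \<odot>\<^bsub>M\<^esub> x) \<notin> N\<rbrakk> \<Longrightarrow>
      \<exists>q\<in>carrier R. \<exists>n\<in>N. r \<odot>\<^bsub>M\<^esub> x = n \<oplus>\<^bsub>M\<^esub> q \<odot>\<^bsub>M\<^esub> (s \<odot>\<^bsub>M\<^esub> (r \<odot>\<^bsub>M\<^esub> x))"
proof -
  interpret A: artinian_cring R by fact
  define Q where "Q r = {n \<oplus>\<^bsub>M\<^esub> s \<odot>\<^bsub>M\<^esub> (r \<odot>\<^bsub>M\<^esub> x) | n s. n \<in> N \<and> s \<in> carrier R}" for r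
  \<comment> \<open>The submodules \<open>(N + R r x)/N\<close> of \<open>M/N\<close> are pulled
    back along \<open>s \<mapsto> s x\<close> to ideals, where the chain condition applies.\<close>
  define J where "J r = {s \<in> carrier R. s \<odot>\<^bsub>M\<^esub> x \<in> Q r}" for r
  have Q: "submodule (Q r) R M" "r \<odot>\<^bsub>M\<^esub> x \<in> Q r" "N \<subseteq> Q r" if "r \<in> carrier R" for r
    using submodule_add_cyclic[OF N, of "r \<odot>\<^bsub>M\<^esub> x"] that x unfolding Q_def by auto
  obtain r where r: "r \<in> carrier R \<and> r \<odot>\<^bsub>M\<^esub> x \<notin> N"
    and min: "\<And>r'. r' \<in> carrier R \<and> r' \<odot>\<^bsub>M\<^esub> x \<notin> N \<Longrightarrow> J r' \<subseteq> J r \<Longrightarrow> J r' = J r"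
  proof -
    have "\<one> \<in> carrier R \<and> \<one> \<odot>\<^bsub>M\<^esub> x \<notin> N" using x by simp
    moreover have "ideal (J r) R" if "r \<in> carrier R \<and> r \<odot>\<^bsub>M\<^esub> x \<notin> N" for r
      unfolding J_def using ideal_quotient[OF Q(1) x(1)] that by simp
    ultimately show thesis
      using A.minimal_ideal_obtain[of "\<lambda>r. r \<in> carrier R \<and> r \<odot>\<^bsub>M\<^esub> x \<notin> N" \<one> J] that by blast
  qed
  have r': "r \<in> carrier R" using r ..
  have "\<exists>q\<in>carrier R. \<exists>n\<in>N. r \<odot>\<^bsub>M\<^esub> x = n \<oplus>\<^bsub>M\<^esub> q \<odot>\<^bsub>M\<^esub> (s \<odot>\<^bsub>M\<^esub> (r \<odot>\<^bsub>M\<^esub> x))"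
    if s: "s \<in> carrier R" "s \<odot>\<^bsub>M\<^esub> (r \<odot>\<^bsub>M\<^esub> x) \<notin> N" for s
  proof -
    have sr: "s \<odot>\<^bsub>M\<^esub> (r \<odot>\<^bsub>M\<^esub> x) = (s \<otimes> r) \<odot>\<^bsub>M\<^esub> x" using s r x by (simp add: smult_assoc1)
    have "Q (s \<otimes> r) \<subseteq> Q r"
    proof
      fix y assume "y \<in> Q (s \<otimes> r)"
      then obtain n q where "n \<in> N" "q \<in> carrier R" "y = n \<oplus>\<^bsub>M\<^esub> q \<odot>\<^bsub>M\<^esub> ((s \<otimes> r) \<odot>\<^bsub>M\<^esub> x)"
        unfolding Q_def by blast
      then have "y = n \<oplus>\<^bsub>M\<^esub> (q \<otimes> s) \<odot>\<^bsub>M\<^esub> (r \<odot>\<^bsub>M\<^esub> x)" "n \<in> N" "q \<otimes> s \<in> carrier R"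
        using s r x by (simp_all add: smult_assoc1)
      then show "y \<in> Q r" unfolding Q_def by blast
    qed
    then have "J (s \<otimes> r) = J r" using min[of "s \<otimes> r"] s r sr unfolding J_def by auto
    then have "r \<odot>\<^bsub>M\<^esub> x \<in> Q (s \<otimes> r)" using Q(2)[OF r'] r unfolding J_def by blast
    then show ?thesis unfolding Q_def sr by blast
  qed
  then show thesis using that r by blast
qed

text \<open>The minimum condition on submodules contained in \<open>N\<close>, relative to a fixed
  ambient \<open>M\<close>, so that \<open>N\<close> can grow generator by generator without a
  change of module structure.\<close>

definition dcc_on where
  "dcc_on R M N \<longleftrightarrow> (\<forall>\<N>. \<N> \<noteq> {} \<and> (\<forall>L\<in>\<N>. submodule L R M \<and> L \<subseteq> N) \<longrightarrow>
     (\<exists>L\<in>\<N>. \<forall>L'\<in>\<N>. L' \<subseteq> L \<longrightarrow> L' = L))"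

text \<open>\<open>N + Rx\<close> is an extension of a cyclic module by \<open>N\<close>, and a
  submodule \<open>L\<close> is controlled by its image in the quotient and by
  \<open>L \<inter> N\<close>. The image is minimized first, then the intersection among those with
  minimal image.\<close>

lemma (in module) dcc_on_add_cyclic:
  assumes "artinian_cring R" and N: "submodule N R M" and x: "x \<in> carrier M" and dcc: "dcc_on R M N"
  shows "dcc_on R M {n \<oplus>\<^bsub>M\<^esub> r \<odot>\<^bsub>M\<^esub> x | n r. n \<in> N \<and> r \<in> carrier R}"
  unfolding dcc_on_def
proof (intro allI impI)
  interpret A: artinian_cring R by fact
  fix \<N>
  assume as: "\<N> \<noteq> {} \<and> (\<forall>L\<in>\<N>. submodule L R M \<and> L \<subseteq> {n \<oplus>\<^bsub>M\<^esub> r \<odot>\<^bsub>M\<^esub> x | n r. n \<in> N \<and> r \<in> carrier R})"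
  \<comment> \<open>The image of \<open>L\<close> in \<open>(N + Rx)/N\<close>, pulled back along
    \<open>r \<mapsto> r x\<close> to an ideal.\<close>
  define J where "J L = {r \<in> carrier R. \<exists>n\<in>N. n \<oplus>\<^bsub>M\<^esub> r \<odot>\<^bsub>M\<^esub> x \<in> L}" for L
  have sub: "submodule L R M" if "L \<in> \<N>" for L using as that by blast
  have s: "\<And>n. n \<in> N \<Longrightarrow> n \<in> carrier M" "\<zero>\<^bsub>M\<^esub> \<in> N" "\<And>x y. x \<in> N \<Longrightarrow> y \<in> N \<Longrightarrow> x \<oplus>\<^bsub>M\<^esub> y \<in> N"
    "\<And>r x. r \<in> carrier R \<Longrightarrow> x \<in> N \<Longrightarrow> r \<odot>\<^bsub>M\<^esub> x \<in> N"
    using N unfolding submodule_iff by auto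
  have Jid: "ideal (J L) R" if L: "L \<in> \<N>" for L
  proof -
    have l: "\<And>n. n \<in> L \<Longrightarrow> n \<in> carrier M" "\<zero>\<^bsub>M\<^esub> \<in> L" "\<And>x y. x \<in> L \<Longrightarrow> y \<in> L \<Longrightarrow> x \<oplus>\<^bsub>M\<^esub> y \<in> L"
      "\<And>r x. r \<in> carrier R \<Longrightarrow> x \<in> L \<Longrightarrow> r \<odot>\<^bsub>M\<^esub> x \<in> L"
      using sub[OF L] unfolding submodule_iff by auto
    have JI: "r \<in> J L" if "r \<in> carrier R" "n \<in> N" "n \<oplus>\<^bsub>M\<^esub> r \<odot>\<^bsub>M\<^esub> x \<in> L" for r n
      using that unfolding J_def by blast
    have add: "a \<oplus> b \<in> J L" if ab: "a \<in> J L" "b \<in> J L" for a b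
    proof -
      obtain n m where nm: "n \<in> N" "m \<in> N" "n \<oplus>\<^bsub>M\<^esub> a \<odot>\<^bsub>M\<^esub> x \<in> L" "m \<oplus>\<^bsub>M\<^esub> b \<odot>\<^bsub>M\<^esub> x \<in> L"
        "a \<in> carrier R" "b \<in> carrier R" using ab unfolding J_def by blast
      have "(n \<oplus>\<^bsub>M\<^esub> m) \<oplus>\<^bsub>M\<^esub> (a \<oplus> b) \<odot>\<^bsub>M\<^esub> x = (n \<oplus>\<^bsub>M\<^esub> a \<odot>\<^bsub>M\<^esub> x) \<oplus>\<^bsub>M\<^esub> (m \<oplus>\<^bsub>M\<^esub> b \<odot>\<^bsub>M\<^esub> x)"
        using nm s(1) x by (simp add: smult_l_distr M.a_ac)
      then show ?thesis using JI[of "a \<oplus> b" "n \<oplus>\<^bsub>M\<^esub> m"] nm s l by simp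
    qed
    have sm: "q \<otimes> a \<in> J L" if q: "q \<in> carrier R" and "a \<in> J L" for q a
    proof -
      obtain n where n: "n \<in> N" "n \<oplus>\<^bsub>M\<^esub> a \<odot>\<^bsub>M\<^esub> x \<in> L" "a \<in> carrier R"
        using \<open>a \<in> J L\<close> unfolding J_def by blast
      have "q \<odot>\<^bsub>M\<^esub> n \<oplus>\<^bsub>M\<^esub> (q \<otimes> a) \<odot>\<^bsub>M\<^esub> x = q \<odot>\<^bsub>M\<^esub> (n \<oplus>\<^bsub>M\<^esub> a \<odot>\<^bsub>M\<^esub> x)"
        using n s(1) x q by (simp add: smult_r_distr smult_assoc1)
      then show ?thesis using JI[of "q \<otimes> a" "q \<odot>\<^bsub>M\<^esub> n"] n s l q by simp
    qed
    have JR: "J L \<subseteq> carrier R" unfolding J_def by blast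
    show ?thesis
      by (rule R.ideal_if_closed) (use JR add sm JI[of \<zero> "\<zero>\<^bsub>M\<^esub>"] s l x in auto)
  qed
  obtain L1 where "L1 \<in> \<N>" using as by blast
  then obtain L0 where L0: "L0 \<in> \<N>" and min0: "\<And>L. L \<in> \<N> \<Longrightarrow> J L \<subseteq> J L0 \<Longrightarrow> J L = J L0"
    using Jid A.minimal_ideal_obtain[of "\<lambda>L. L \<in> \<N>" L1 J] by blast
  define \<N>' where "\<N>' = (\<lambda>L. L \<inter> N) ` {L \<in> \<N>. J L = J L0}"
  have "\<N>' \<noteq> {}" using L0 unfolding \<N>'_def by blast
  moreover have "submodule K R M \<and> K \<subseteq> N" if K: "K \<in> \<N>'" for K
  proof -
    obtain L where "L \<in> \<N>" "K = L \<inter> N" using K unfolding \<N>'_def by blast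
    then show ?thesis using sub[of L] N unfolding submodule_iff by auto
  qed
  ultimately obtain K where K: "K \<in> \<N>'" and minK: "\<And>K'. K' \<in> \<N>' \<Longrightarrow> K' \<subseteq> K \<Longrightarrow> K' = K"
    using dcc unfolding dcc_on_def by (metis (no_types, lifting))
  obtain L where L: "L \<in> \<N>" "J L = J L0" "K = L \<inter> N" using K unfolding \<N>'_def by blast
  have "L' = L" if L': "L' \<in> \<N>" "L' \<subseteq> L" for L'
  proof -
    have "J L' \<subseteq> J L" using L' unfolding J_def by blast
    then have JJ: "J L' = J L" using min0[OF L'(1)] L by simp
    then have "L' \<inter> N \<in> \<N>'" using L' L unfolding \<N>'_def by auto
    then have LN: "L' \<inter> N = L \<inter> N" using minK L L' by blast
    have "L \<subseteq> L'"
    proof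
      fix y assume y: "y \<in> L"
      then obtain n r where nr: "n \<in> N" "r \<in> carrier R" "y = n \<oplus>\<^bsub>M\<^esub> r \<odot>\<^bsub>M\<^esub> x" using as L by blast
      then have "r \<in> J L'" using y unfolding JJ unfolding J_def by blast
      then obtain n' where n': "n' \<in> N" "n' \<oplus>\<^bsub>M\<^esub> r \<odot>\<^bsub>M\<^esub> x \<in> L'" unfolding J_def by blast
      \<comment> \<open>\<open>y\<close> and \<open>n' + r x\<close> have the same image in the
        quotient, so their difference lies in \<open>L \<inter> N\<close>, which equals
        \<open>L' \<inter> N\<close>.\<close>
      have yl: "y = (n \<oplus>\<^bsub>M\<^esub> \<ominus>\<^bsub>M\<^esub> n') \<oplus>\<^bsub>M\<^esub> (n' \<oplus>\<^bsub>M\<^esub> r \<odot>\<^bsub>M\<^esub> x)"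
        using nr n' s(1) x by (simp add: M.a_assoc M.r_neg1)
      have nn: "n \<oplus>\<^bsub>M\<^esub> \<ominus>\<^bsub>M\<^esub> n' = y \<oplus>\<^bsub>M\<^esub> \<ominus>\<^bsub>M\<^esub> (n' \<oplus>\<^bsub>M\<^esub> r \<odot>\<^bsub>M\<^esub> x)"
        using nr n' s(1) x by (simp add: M.minus_add M.a_ac M.r_neg1 M.r_neg2 M.r_neg)
      have "n \<oplus>\<^bsub>M\<^esub> \<ominus>\<^bsub>M\<^esub> n' \<in> N" using nr n' submoduleE[OF N] by blast
      moreover have "n \<oplus>\<^bsub>M\<^esub> \<ominus>\<^bsub>M\<^esub> n' \<in> L"
        unfolding nn using y n' L'(2) submoduleE[OF sub[OF L(1)]] by blast
      ultimately have "n \<oplus>\<^bsub>M\<^esub> \<ominus>\<^bsub>M\<^esub> n' \<in> L'" using LN by blast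
      then show "y \<in> L'" using n' submoduleE(5)[OF sub[OF L'(1)]] yl by metis
    qed
    then show ?thesis using L' by blast
  qed
  then show "\<exists>L\<in>\<N>. \<forall>L'\<in>\<N>. L' \<subseteq> L \<longrightarrow> L' = L" using L by blast
qed

text \<open>\<open>dcc_on_add_cyclic\<close> is iterated over the generators, starting from the zero
  submodule.\<close>

lemma fin_gen_module_dcc:
  assumes art: "artinian_cring R" and fg: "fin_gen_module R M"
  shows "dcc_on R M (carrier M)"
proof -
  interpret module R M using fg by (simp add: fin_gen_module_def)
  obtain B where B: "finite B" "B \<subseteq> carrier M" "\<Inter>{N. submodule N R M \<and> B \<subseteq> N} = carrier M"
    using fg unfolding fin_gen_module_def by blast
  have "\<exists>N. submodule N R M \<and> B \<subseteq> N \<and> dcc_on R M N"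
    using B(1,2)
  proof (induction B rule: finite_induct)
    case empty
    have "submodule {\<zero>\<^bsub>M\<^esub>} R M" by (auto simp: submodule_iff)
    moreover have "L = {\<zero>\<^bsub>M\<^esub>}" if "submodule L R M" "L \<subseteq> {\<zero>\<^bsub>M\<^esub>}" for L
      using that by (auto simp: submodule_iff)
    ultimately show ?case unfolding dcc_on_def by (metis all_not_in_conv empty_subsetI)
  next
    case (insert x B)
    then obtain N where N: "submodule N R M" "B \<subseteq> N" "dcc_on R M N" by blast
    have x: "x \<in> carrier M" using insert by blast
    show ?case
      using submodule_add_cyclic[OF N(1) x] dcc_on_add_cyclic[OF art N(1) x N(3)] N(2)
      by (intro exI conjI) auto
  qed
  then obtain N where N: "submodule N R M" "B \<subseteq> N" "dcc_on R M N" by blast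
  then have "N = carrier M" using B(3) unfolding submodule_iff by blast
  then show ?thesis using N by simp
qed

section \<open>Matlis duality\<close>

text \<open>\<open>\<beta>\<close> may have a kernel; since \<open>\<xi>\<close> kills it, the pairs
  \<open>(\<beta> b, \<xi> b)\<close> form the graph of a map on the image of
  \<open>\<beta>\<close>, which injectivity extends.\<close>

lemma injective_extend_along:
  assumes inj: "injective_module R E" and B: "module R B" and C: "module R C"
    and \<beta>: "\<beta> \<in> linear_maps R B C" and \<xi>: "\<xi> \<in> linear_maps R B E"
    and ker: "\<And>b. \<lbrakk>b \<in> carrier B; \<beta> b = \<zero>\<^bsub>C\<^esub>\<rbrakk> \<Longrightarrow> \<xi> b = \<zero>\<^bsub>E\<^esub>"
  shows "\<exists>\<zeta>\<in>linear_maps R C E. \<forall>b\<in>carrier B. \<zeta> (\<beta> b) = \<xi> b"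
proof -
  interpret B: module R B by (rule B)
  have E: "module R E" using inj by (simp add: injective_module_def)
  define G0 where "G0 = (\<lambda>b. (\<beta> b, \<xi> b)) ` carrier B"
  have G0I: "(\<beta> b, \<xi> b) \<in> G0" if "b \<in> carrier B" for b using that unfolding G0_def by blast
  have "\<exists>g\<in>linear_maps R C E. \<forall>(x, y)\<in>G0. g x = y"
  proof (rule injective_module_extend_from_graph[OF inj C])
    show "G0 \<subseteq> carrier C \<times> carrier E" using linear_mapsD[OF \<beta>] linear_mapsD[OF \<xi>] by (auto simp: G0_def)
    show "(\<zero>\<^bsub>C\<^esub>, \<zero>\<^bsub>E\<^esub>) \<in> G0"
      using G0I[OF B.M.zero_closed] linear_maps_zero[OF B C \<beta>] linear_maps_zero[OF B E \<xi>] by simp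
  next
    fix x y x' y' assume "(x, y) \<in> G0" "(x', y') \<in> G0"
    then obtain a b where "a \<in> carrier B" "b \<in> carrier B" "x = \<beta> a" "y = \<xi> a" "x' = \<beta> b" "y' = \<xi> b"
      unfolding G0_def by blast
    then show "(x \<oplus>\<^bsub>C\<^esub> x', y \<oplus>\<^bsub>E\<^esub> y') \<in> G0"
      using G0I[of "a \<oplus>\<^bsub>B\<^esub> b"] linear_mapsD[OF \<beta>] linear_mapsD[OF \<xi>] by simp
  next
    fix r x y assume "r \<in> carrier R" "(x, y) \<in> G0"
    then obtain a where "a \<in> carrier B" "x = \<beta> a" "y = \<xi> a" unfolding G0_def by blast
    then show "(r \<odot>\<^bsub>C\<^esub> x, r \<odot>\<^bsub>E\<^esub> y) \<in> G0"
      using G0I[of "r \<odot>\<^bsub>B\<^esub> a"] linear_mapsD[OF \<beta>] linear_mapsD[OF \<xi>] \<open>r \<in> carrier R\<close> by simp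
  next
    fix y assume "(\<zero>\<^bsub>C\<^esub>, y) \<in> G0"
    then show "y = \<zero>\<^bsub>E\<^esub>" using ker unfolding G0_def by auto
  qed
  then obtain g where g: "g \<in> linear_maps R C E" "\<forall>(x, y)\<in>G0. g x = y" ..
  have "g (\<beta> b) = \<xi> b" if "b \<in> carrier B" for b using bspec[OF g(2) G0I[OF that]] by simp
  then show ?thesis using g(1) by blast
qed

locale matlis_dual = artinian_cring R for R (structure) +
  fixes E :: "('a, 'e, 'l) module_scheme"
  assumes minimal_injective: "minimal_injective_cogenerator R E"
begin

lemma injective: "injective_module R E" and cogenerating: "cogenerator R E"
  and minimal: "\<lbrakk>submodule F R E; injective_module R (E\<lparr>carrier := F\<rparr>); cogenerator R (E\<lparr>carrier := F\<rparr>)\<rbrakk>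
    \<Longrightarrow> F = carrier E"
  using minimal_injective unfolding minimal_injective_cogenerator_def by auto

sublocale E: module R E
  using injective by (simp add: injective_module_def)

lemma linear_form_separating:
  assumes "module R M" and "x \<in> carrier M" and "x \<noteq> \<zero>\<^bsub>M\<^esub>"
  obtains f where "f \<in> linear_maps R M E" and "f x \<noteq> \<zero>\<^bsub>E\<^esub>"
  using injective_cogenerator_separates[OF injective cogenerating assms] by blast

text \<open>\<open>1 - q r\<close> annihilates \<open>y\<close>, hence also
  \<open>z\<close>.\<close>

lemma inverse_modulo_annihilator:
  assumes "q \<in> carrier R" "r \<in> carrier R" "y \<in> carrier E" "z \<in> carrier E" and y: "y = q \<odot>\<^bsub>E\<^esub> (r \<odot>\<^bsub>E\<^esub> y)"
    and ann: "\<And>s. \<lbrakk>s \<in> carrier R; s \<odot>\<^bsub>E\<^esub> y = \<zero>\<^bsub>E\<^esub>\<rbrakk> \<Longrightarrow> s \<odot>\<^bsub>E\<^esub> z = \<zero>\<^bsub>E\<^esub>"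
  shows "z = q \<odot>\<^bsub>E\<^esub> (r \<odot>\<^bsub>E\<^esub> z)"
proof -
  have *: "(\<one> \<oplus> \<ominus> (q \<otimes> r)) \<odot>\<^bsub>E\<^esub> x = x \<oplus>\<^bsub>E\<^esub> \<ominus>\<^bsub>E\<^esub> (q \<odot>\<^bsub>E\<^esub> (r \<odot>\<^bsub>E\<^esub> x))" if "x \<in> carrier E" for x
    using assms(1,2) that by (simp add: E.smult_l_distr E.smult_l_minus E.smult_assoc1)
  have "(\<one> \<oplus> \<ominus> (q \<otimes> r)) \<odot>\<^bsub>E\<^esub> y = \<zero>\<^bsub>E\<^esub>"
    unfolding *[OF assms(3)] y[symmetric] using assms(3) by (rule E.M.r_neg)
  then have "z \<oplus>\<^bsub>E\<^esub> \<ominus>\<^bsub>E\<^esub> (q \<odot>\<^bsub>E\<^esub> (r \<odot>\<^bsub>E\<^esub> z)) = \<zero>\<^bsub>E\<^esub>"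
    using ann *[OF assms(4)] assms(1,2) by simp
  then show ?thesis using assms(1,2,4) by (metis E.M.a_inv_closed E.M.minus_equality E.M.minus_minus E.smult_closed)
qed

text \<open>Minimality of \<open>E\<close> enters only here. If \<open>y\<close> generates a simple submodule and \<open>x \<notin> Ry\<close> is killed by
  the annihilator of \<open>y\<close>, take a submodule \<open>K\<close> maximal with \<open>y \<notin> K\<close>, and \<open>L\<close> maximal with
  \<open>K \<inter> L = 0\<close>. Then \<open>E = K \<oplus> L\<close>, and \<open>K\<close> is still an injective cogenerator.\<close>
lemma multiple_if_annihilator_le:
  assumes y: "y \<in> carrier E" "y \<noteq> \<zero>\<^bsub>E\<^esub>"
    and simple: "\<And>s. \<lbrakk>s \<in> carrier R; s \<odot>\<^bsub>E\<^esub> y \<noteq> \<zero>\<^bsub>E\<^esub>\<rbrakk> \<Longrightarrow> \<exists>q\<in>carrier R. y = q \<odot>\<^bsub>E\<^esub> (s \<odot>\<^bsub>E\<^esub> y)"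
    and x: "x \<in> carrier E"
    and ann: "\<And>r. \<lbrakk>r \<in> carrier R; r \<odot>\<^bsub>E\<^esub> y = \<zero>\<^bsub>E\<^esub>\<rbrakk> \<Longrightarrow> r \<odot>\<^bsub>E\<^esub> x = \<zero>\<^bsub>E\<^esub>"
  shows "\<exists>r\<in>carrier R. x = r \<odot>\<^bsub>E\<^esub> y"
proof (rule ccontr)
  assume xy: "\<not> ?thesis"
  \<comment> \<open>The annihilator of \<open>y\<close> is maximal because \<open>Ry\<close> is
    simple, so a nonzero \<open>z\<close> that it kills has no larger annihilator.\<close>
  have ann_eq: "r \<odot>\<^bsub>E\<^esub> y = \<zero>\<^bsub>E\<^esub>" if r: "r \<in> carrier R" "r \<odot>\<^bsub>E\<^esub> z = \<zero>\<^bsub>E\<^esub>" and z: "z \<in> carrier E" "z \<noteq> \<zero>\<^bsub>E\<^esub>"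
    and le: "\<And>r. \<lbrakk>r \<in> carrier R; r \<odot>\<^bsub>E\<^esub> y = \<zero>\<^bsub>E\<^esub>\<rbrakk> \<Longrightarrow> r \<odot>\<^bsub>E\<^esub> z = \<zero>\<^bsub>E\<^esub>" for r z
  proof (rule ccontr)
    assume "r \<odot>\<^bsub>E\<^esub> y \<noteq> \<zero>\<^bsub>E\<^esub>"
    then obtain q where q: "q \<in> carrier R" "y = q \<odot>\<^bsub>E\<^esub> (r \<odot>\<^bsub>E\<^esub> y)" using simple r by blast
    show False using inverse_modulo_annihilator[OF q(1) r(1) y(1) z(1) q(2) le] r z q(1) by simp
  qed
  have "\<exists>K\<in>{K. submodule K R E \<and> y \<notin> K}. \<forall>X\<in>{K. submodule K R E \<and> y \<notin> K}. K \<subseteq> X \<longrightarrow> X = K"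
  proof (rule subset_Zorn_nonempty)
    have "{\<zero>\<^bsub>E\<^esub>} \<in> {K. submodule K R E \<and> y \<notin> K}" using y by (auto simp: E.submodule_iff)
    then show "{K. submodule K R E \<and> y \<notin> K} \<noteq> {}" by blast
    fix \<C> assume C: "\<C> \<noteq> {}" "subset.chain {K. submodule K R E \<and> y \<notin> K} \<C>"
    have "submodule (\<Union>\<C>) R E" using E.submodule_Union_chain[OF C] by blast
    moreover have "y \<notin> \<Union>\<C>" using C(2) by (auto simp: subset_chain_def)
    ultimately show "\<Union>\<C> \<in> {K. submodule K R E \<and> y \<notin> K}" by blast
  qed
  then obtain K where K: "submodule K R E" "y \<notin> K"
    and maxK: "\<And>X. \<lbrakk>submodule X R E; y \<notin> X; K \<subseteq> X\<rbrakk> \<Longrightarrow> X = K" by auto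
  note K' = K(1)[unfolded E.submodule_iff]
  define \<L> where "\<L> = {L. submodule L R E \<and> L \<inter> K = {\<zero>\<^bsub>E\<^esub>}}"
  have "\<exists>L\<in>\<L>. \<forall>X\<in>\<L>. L \<subseteq> X \<longrightarrow> X = L"
  proof (rule subset_Zorn_nonempty)
    have "{\<zero>\<^bsub>E\<^esub>} \<in> \<L>" using K' by (auto simp: E.submodule_iff \<L>_def)
    then show "\<L> \<noteq> {}" by blast
    fix \<C> assume C: "\<C> \<noteq> {}" "subset.chain \<L> \<C>"
    have sub: "submodule (\<Union>\<C>) R E" using E.submodule_Union_chain[OF C] by (simp add: \<L>_def)
    have "\<And>L. L \<in> \<C> \<Longrightarrow> L \<inter> K = {\<zero>\<^bsub>E\<^esub>}" using C(2) by (auto simp: subset_chain_def \<L>_def)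
    then have "\<Union>\<C> \<inter> K = {\<zero>\<^bsub>E\<^esub>}" using C(1) by blast
    then show "\<Union>\<C> \<in> \<L>" using sub by (simp add: \<L>_def)
  qed
  then obtain L where L: "submodule L R E" "L \<inter> K = {\<zero>\<^bsub>E\<^esub>}"
    and maxL: "\<And>X. \<lbrakk>submodule X R E; X \<inter> K = {\<zero>\<^bsub>E\<^esub>}; L \<subseteq> X\<rbrakk> \<Longrightarrow> X = L"
    unfolding \<L>_def by auto
  note L' = L(1)[unfolded E.submodule_iff]
  have Kc: "k \<in> carrier E" if "k \<in> K" for k using K' that by blast
  have Lc: "l \<in> carrier E" if "l \<in> L" for l using L' that by blast
  \<comment> \<open>Graph of the projection of \<open>K + L\<close> onto \<open>K\<close> along
    \<open>L\<close>; its extension \<open>g\<close> to \<open>E\<close> will turn out to be a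
    retraction onto \<open>K\<close>.\<close>
  define G0 where "G0 = {(k \<oplus>\<^bsub>E\<^esub> l, k) | k l. k \<in> K \<and> l \<in> L}"
  have G0I: "(k \<oplus>\<^bsub>E\<^esub> l, k) \<in> G0" if "k \<in> K" "l \<in> L" for k l using that unfolding G0_def by blast
  have "\<exists>g\<in>linear_maps R E E. \<forall>(x, y)\<in>G0. g x = y"
  proof (rule injective_module_extend_from_graph[OF injective E.module_axioms])
    show "G0 \<subseteq> carrier E \<times> carrier E" using Kc Lc by (auto simp: G0_def)
    show "(\<zero>\<^bsub>E\<^esub>, \<zero>\<^bsub>E\<^esub>) \<in> G0" using G0I[of "\<zero>\<^bsub>E\<^esub>" "\<zero>\<^bsub>E\<^esub>"] K' L' by simp
  next
    fix x y x' y' assume "(x, y) \<in> G0" "(x', y') \<in> G0"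
    then obtain k l k' l' where *: "k \<in> K" "l \<in> L" "k' \<in> K" "l' \<in> L"
      "x = k \<oplus>\<^bsub>E\<^esub> l" "y = k" "x' = k' \<oplus>\<^bsub>E\<^esub> l'" "y' = k'" unfolding G0_def by blast
    then have "x \<oplus>\<^bsub>E\<^esub> x' = (k \<oplus>\<^bsub>E\<^esub> k') \<oplus>\<^bsub>E\<^esub> (l \<oplus>\<^bsub>E\<^esub> l')" using Kc Lc by (simp add: E.M.a_ac)
    then show "(x \<oplus>\<^bsub>E\<^esub> x', y \<oplus>\<^bsub>E\<^esub> y') \<in> G0" using G0I[of "k \<oplus>\<^bsub>E\<^esub> k'" "l \<oplus>\<^bsub>E\<^esub> l'"] * K' L' by simp
  next
    fix r x y assume r: "r \<in> carrier R" and "(x, y) \<in> G0"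
    then obtain k l where *: "k \<in> K" "l \<in> L" "x = k \<oplus>\<^bsub>E\<^esub> l" "y = k" unfolding G0_def by blast
    then have "r \<odot>\<^bsub>E\<^esub> x = r \<odot>\<^bsub>E\<^esub> k \<oplus>\<^bsub>E\<^esub> r \<odot>\<^bsub>E\<^esub> l" using Kc Lc r by (simp add: E.smult_r_distr)
    then show "(r \<odot>\<^bsub>E\<^esub> x, r \<odot>\<^bsub>E\<^esub> y) \<in> G0" using G0I[of "r \<odot>\<^bsub>E\<^esub> k" "r \<odot>\<^bsub>E\<^esub> l"] * K' L' r by simp
  next
    fix y' assume "(\<zero>\<^bsub>E\<^esub>, y') \<in> G0"
    then obtain l where *: "y' \<in> K" "l \<in> L" "y' \<oplus>\<^bsub>E\<^esub> l = \<zero>\<^bsub>E\<^esub>" unfolding G0_def by auto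
    then have "y' = \<ominus>\<^bsub>E\<^esub> l" using Kc Lc by (metis E.M.minus_equality)
    then have "y' \<in> L" using E.submoduleE(3)[OF L(1)] * by simp
    then show "y' = \<zero>\<^bsub>E\<^esub>" using L(2) * by blast
  qed
  then obtain g where g: "g \<in> linear_maps R E E" and gG0: "\<forall>(x, y)\<in>G0. g x = y" ..
  have gG: "g (k \<oplus>\<^bsub>E\<^esub> l) = k" if "k \<in> K" "l \<in> L" for k l
    using bspec[OF gG0 G0I[OF that]] by simp
  note g' = linear_mapsD[OF g] linear_maps_zero[OF E.module_axioms E.module_axioms g]
  have gK: "g k = k" if "k \<in> K" for k using gG[of k "\<zero>\<^bsub>E\<^esub>"] that K' L' Kc by simp
  have gL: "g l = \<zero>\<^bsub>E\<^esub>" if "l \<in> L" for l using gG[of "\<zero>\<^bsub>E\<^esub>" l] that K' L' Lc by simp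
  \<comment> \<open>The kernel of \<open>g\<close> contains \<open>L\<close> and meets
    \<open>K\<close> only in zero, because \<open>g\<close> fixes \<open>K\<close>. Maximality of
    \<open>L\<close> gives equality.\<close>
  have ker: "z \<in> L" if z: "z \<in> carrier E" "g z = \<zero>\<^bsub>E\<^esub>" for z
  proof -
    have "{z \<in> carrier E. g z = \<zero>\<^bsub>E\<^esub>} = L"
      by (rule maxL) (use g' gL gK Kc Lc K' in \<open>auto simp: E.submodule_iff\<close>)
    then show ?thesis using z by blast
  qed
  have "y \<notin> g ` carrier E"
  proof
    assume "y \<in> g ` carrier E"
    then obtain z where z: "z \<in> carrier E" "y = g z" by blast
    \<comment> \<open>The preimage of \<open>Ry\<close> under \<open>g\<close>. A nonzero element of
      \<open>H \<inter> K\<close> would be fixed by \<open>g\<close>, hence a multiple of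
      \<open>y\<close> that has \<open>y\<close> as a multiple, which \<open>K\<close> excludes. So
      \<open>H = L\<close>, and \<open>y = g z = 0\<close>.\<close>
    define H where "H = {a \<in> carrier E. \<exists>r\<in>carrier R. g a = r \<odot>\<^bsub>E\<^esub> y}"
    have "a \<oplus>\<^bsub>E\<^esub> b \<in> H" if ab: "a \<in> H" "b \<in> H" for a b
    proof -
      obtain r s where "r \<in> carrier R" "s \<in> carrier R" "g a = r \<odot>\<^bsub>E\<^esub> y" "g b = s \<odot>\<^bsub>E\<^esub> y" "a \<in> carrier E" "b \<in> carrier E"
        using ab unfolding H_def by blast
      then show ?thesis unfolding H_def using g' y by (auto simp: E.smult_l_distr intro!: bexI[of _ "r \<oplus> s"])
    qed
    moreover have "r \<odot>\<^bsub>E\<^esub> a \<in> H" if r: "r \<in> carrier R" and "a \<in> H" for r a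
    proof -
      obtain s where "s \<in> carrier R" "g a = s \<odot>\<^bsub>E\<^esub> y" "a \<in> carrier E"
        using \<open>a \<in> H\<close> unfolding H_def by blast
      then show ?thesis unfolding H_def using g' y r by (auto simp: E.smult_assoc1 intro!: bexI[of _ "r \<otimes> s"])
    qed
    moreover have "\<zero>\<^bsub>E\<^esub> \<in> H" unfolding H_def using g' y by (auto intro!: bexI[of _ \<zero>])
    ultimately have H: "submodule H R E" unfolding E.submodule_iff H_def by blast
    have "H \<inter> K = {\<zero>\<^bsub>E\<^esub>}"
    proof -
      have "a = \<zero>\<^bsub>E\<^esub>" if a: "a \<in> H" "a \<in> K" for a
      proof (rule ccontr)
        assume "a \<noteq> \<zero>\<^bsub>E\<^esub>"
        obtain r where r: "r \<in> carrier R" "a = r \<odot>\<^bsub>E\<^esub> y" using a gK unfolding H_def by auto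
        then obtain q where "q \<in> carrier R" "y = q \<odot>\<^bsub>E\<^esub> a" using simple \<open>a \<noteq> \<zero>\<^bsub>E\<^esub>\<close> by blast
        then show False using a K K' by blast
      qed
      then show ?thesis using \<open>\<zero>\<^bsub>E\<^esub> \<in> H\<close> K' by blast
    qed
    moreover have "L \<subseteq> H" unfolding H_def using gL Lc y by (auto intro!: bexI[of _ \<zero>])
    ultimately have "H = L" using maxL[OF H] by blast
    moreover have "z \<in> H" unfolding H_def using z y by (auto intro!: bexI[of _ \<one>])
    ultimately show False using gL z y by blast
  qed
  moreover have "submodule (g ` carrier E) R E"
    unfolding E.submodule_iff
  proof (intro conjI ballI)
    show "\<zero>\<^bsub>E\<^esub> \<in> g ` carrier E" using g'(4) by (metis E.M.zero_closed imageI)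
  next
    fix a b assume "a \<in> g ` carrier E" "b \<in> g ` carrier E"
    then obtain c d where "c \<in> carrier E" "d \<in> carrier E" "a = g c" "b = g d" by blast
    then show "a \<oplus>\<^bsub>E\<^esub> b \<in> g ` carrier E" using g'(2)[of c d] by (metis E.M.a_closed imageI)
  next
    fix r a assume "r \<in> carrier R" "a \<in> g ` carrier E"
    then obtain c where "r \<in> carrier R" "c \<in> carrier E" "a = g c" by blast
    then show "r \<odot>\<^bsub>E\<^esub> a \<in> g ` carrier E" using g'(3)[of r c] by (metis E.smult_closed imageI)
  qed (use g' in blast)
  moreover have "K \<subseteq> g ` carrier E" using gK Kc by force
  \<comment> \<open>The image contains \<open>K\<close> and misses \<open>y\<close>, so it is
    \<open>K\<close> by maximality. As a retract of \<open>E\<close>, the module \<open>K\<close> is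
    injective.\<close>
  ultimately have im: "g ` carrier E = K" using maxK by blast
  define EK where "EK = E\<lparr>carrier := K\<rparr>"
  have EK: "carrier EK = K" "zero EK = zero E" "add EK = add E" "smult EK = smult E" by (simp_all add: EK_def)
  have EKmod: "module R EK"
    unfolding EK_def by (rule submodule.submodule_is_module[OF K(1) E.module_axioms])
  have gEK: "g \<circ> h \<in> linear_maps R M EK" if "h \<in> linear_maps R M E" for h :: "'a \<Rightarrow> 'e" and M :: "('a, 'a) module"
    using linear_mapsD[OF that] g' im by (intro linear_mapsI) (auto simp: EK)
  have "injective_module R EK"
    unfolding injective_module_def
  proof (intro conjI allI impI)
    fix M N :: "('a, 'a) module" and i f
    assume as: "module R M \<and> module R N \<and> i \<in> linear_maps R M N \<and> inj_on i (carrier M) \<and> f \<in> linear_maps R M EK"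
    then have f: "f \<in> linear_maps R M EK" by blast
    have "f \<in> linear_maps R M E" using linear_mapsD[OF f] Kc by (intro linear_mapsI) (auto simp: EK)
    then obtain h where h: "h \<in> linear_maps R N E" "\<forall>x\<in>carrier M. h (i x) = f x"
      using injective as unfolding injective_module_def by blast
    have "(g \<circ> h) (i x) = f x" if "x \<in> carrier M" for x
      using h(2) gK linear_mapsD(1)[OF f that] that by (simp add: EK)
    then show "\<exists>g\<in>linear_maps R N EK. \<forall>x\<in>carrier M. g (i x) = f x" using gEK[OF h(1)] by blast
  qed (rule EKmod)
  moreover have "cogenerator R EK"
    unfolding cogenerator_def
  proof (intro conjI allI impI ballI)
    fix M :: "('a, 'a) module" and m
    assume M: "module R M" and m: "m \<in> carrier M" "m \<noteq> \<zero>\<^bsub>M\<^esub>"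
    interpret M: module R M by (rule M)
    obtain f where f: "f \<in> linear_maps R M E" "f m \<noteq> \<zero>\<^bsub>E\<^esub>" using linear_form_separating[OF M m] .
    have fm: "f m \<in> carrier E" using linear_mapsD(1)[OF f(1) m(1)] .
    have z0: "submodule {\<zero>\<^bsub>E\<^esub>} R E" by (auto simp: E.submodule_iff)
    obtain r where r: "r \<in> carrier R" "r \<odot>\<^bsub>E\<^esub> f m \<notin> {\<zero>\<^bsub>E\<^esub>}"
      and rs: "\<And>s. \<lbrakk>s \<in> carrier R; s \<odot>\<^bsub>E\<^esub> (r \<odot>\<^bsub>E\<^esub> f m) \<notin> {\<zero>\<^bsub>E\<^esub>}\<rbrakk> \<Longrightarrow>
        \<exists>q\<in>carrier R. \<exists>n\<in>{\<zero>\<^bsub>E\<^esub>}. r \<odot>\<^bsub>E\<^esub> f m = n \<oplus>\<^bsub>E\<^esub> q \<odot>\<^bsub>E\<^esub> (s \<odot>\<^bsub>E\<^esub> (r \<odot>\<^bsub>E\<^esub> f m))"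
      using E.simple_multiple[OF artinian_cring_axioms z0 fm] f(2) by auto
    \<comment> \<open>\<open>z\<close> spans a simple submodule of the image of \<open>f\<close>.
      Any \<open>h\<close> with \<open>g (h z) \<noteq> 0\<close> turns \<open>f\<close> into a form
      with values in \<open>K\<close> that does not vanish on \<open>m\<close>; the two cases below
      supply such an \<open>h\<close>.\<close>
    define z where "z = r \<odot>\<^bsub>E\<^esub> f m"
    have z: "z \<in> carrier E" "z \<noteq> \<zero>\<^bsub>E\<^esub>" using r fm by (auto simp: z_def)
    have zs: "\<exists>q\<in>carrier R. z = q \<odot>\<^bsub>E\<^esub> (s \<odot>\<^bsub>E\<^esub> z)" if "s \<in> carrier R" "s \<odot>\<^bsub>E\<^esub> z \<noteq> \<zero>\<^bsub>E\<^esub>" for s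
      using rs[of s] that z fm r unfolding z_def by auto
    have zf: "f (r \<odot>\<^bsub>M\<^esub> m) = z" using linear_mapsD(3)[OF f(1)] r m by (simp add: z_def)
    have nz: "\<exists>f\<in>linear_maps R M EK. f m \<noteq> \<zero>\<^bsub>EK\<^esub>" if h: "h \<in> linear_maps R E E" "g (h z) \<noteq> \<zero>\<^bsub>E\<^esub>" for h
    proof -
      have hf: "h \<circ> f \<in> linear_maps R M E"
        using linear_mapsD[OF h(1)] linear_mapsD[OF f(1)] by (intro linear_mapsI) auto
      have "g (h (f m)) \<noteq> \<zero>\<^bsub>E\<^esub>"
      proof
        assume "g (h (f m)) = \<zero>\<^bsub>E\<^esub>"
        moreover have "g (h z) = r \<odot>\<^bsub>E\<^esub> g (h (f m))"
          using linear_mapsD[OF h(1)] g' r fm by (simp add: z_def)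
        ultimately show False using h r by simp
      qed
      then show ?thesis using gEK[OF hf] by (intro bexI[of _ "g \<circ> (h \<circ> f)"]) (simp_all add: EK)
    qed
    show "\<exists>f\<in>linear_maps R M EK. f m \<noteq> \<zero>\<^bsub>EK\<^esub>"
    proof (cases "g z = \<zero>\<^bsub>E\<^esub>")
      case False
      then show ?thesis using nz[of id] by (simp add: linear_maps_def hom_def)
    next
      case True
      \<comment> \<open>Here \<open>g\<close> kills \<open>Rz\<close>. But \<open>Rz\<close> is
        isomorphic to \<open>Ry\<close>, and the extra element \<open>x\<close> forces a copy of
        this simple module into \<open>K\<close>, onto which \<open>Rz\<close> can be
        mapped.\<close>
      then have zL: "z \<in> L" using ker z by blast
      have zK: "z \<notin> K" using zL L(2) z by blast
      define Kz where "Kz = {k \<oplus>\<^bsub>E\<^esub> s \<odot>\<^bsub>E\<^esub> z | k s. k \<in> K \<and> s \<in> carrier R}"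
      have Kz: "submodule Kz R E" "K \<subseteq> Kz" "z \<in> Kz"
        using E.submodule_add_cyclic[OF K(1) z(1)] unfolding Kz_def by auto
      have "y \<in> Kz" using maxK[OF Kz(1) _ Kz(2)] Kz(3) zK by blast
      then obtain k s where ks: "k \<in> K" "s \<in> carrier R" "y = k \<oplus>\<^bsub>E\<^esub> s \<odot>\<^bsub>E\<^esub> z" unfolding Kz_def by blast
      have sz: "s \<odot>\<^bsub>E\<^esub> z \<noteq> \<zero>\<^bsub>E\<^esub>" using ks K(2) Kc by auto
      \<comment> \<open>If \<open>a y = 0\<close> but \<open>a z \<noteq> 0\<close>, then
        \<open>z = q a z\<close>, and multiplying \<open>y = k + s z\<close> by \<open>q a\<close>
        puts \<open>s z\<close> into \<open>K\<close>; since \<open>Rz\<close> is simple,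
        \<open>z\<close> would lie in \<open>K\<close>.\<close>
      have le: "a \<odot>\<^bsub>E\<^esub> z = \<zero>\<^bsub>E\<^esub>" if a: "a \<in> carrier R" "a \<odot>\<^bsub>E\<^esub> y = \<zero>\<^bsub>E\<^esub>" for a
      proof (rule ccontr)
        assume "a \<odot>\<^bsub>E\<^esub> z \<noteq> \<zero>\<^bsub>E\<^esub>"
        then obtain q where q: "q \<in> carrier R" "z = q \<odot>\<^bsub>E\<^esub> (a \<odot>\<^bsub>E\<^esub> z)" using zs a by blast
        have "\<zero>\<^bsub>E\<^esub> = (q \<otimes> a) \<odot>\<^bsub>E\<^esub> y" using q a y by (simp add: E.smult_assoc1)
        also have "\<dots> = (q \<otimes> a) \<odot>\<^bsub>E\<^esub> k \<oplus>\<^bsub>E\<^esub> (q \<otimes> a) \<odot>\<^bsub>E\<^esub> (s \<odot>\<^bsub>E\<^esub> z)"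
          using q(1) a ks Kc z by (simp add: E.smult_r_distr)
        also have "(q \<otimes> a) \<odot>\<^bsub>E\<^esub> (s \<odot>\<^bsub>E\<^esub> z) = s \<odot>\<^bsub>E\<^esub> (q \<odot>\<^bsub>E\<^esub> (a \<odot>\<^bsub>E\<^esub> z))"
          using q(1) a ks z by (metis E.smult_assoc1 m_closed m_comm)
        also have "\<dots> = s \<odot>\<^bsub>E\<^esub> z" using q(2) by simp
        finally have eq: "(q \<otimes> a) \<odot>\<^bsub>E\<^esub> k \<oplus>\<^bsub>E\<^esub> s \<odot>\<^bsub>E\<^esub> z = \<zero>\<^bsub>E\<^esub>" by simp
        have "(q \<otimes> a) \<odot>\<^bsub>E\<^esub> k \<in> K" using K' ks q a by simp
        moreover from this eq have "s \<odot>\<^bsub>E\<^esub> z = \<ominus>\<^bsub>E\<^esub> ((q \<otimes> a) \<odot>\<^bsub>E\<^esub> k)"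
          using Kc ks z by (metis E.M.a_comm E.M.minus_equality E.smult_closed)
        ultimately have "s \<odot>\<^bsub>E\<^esub> z \<in> K" using E.submoduleE(3)[OF K(1)] by simp
        moreover obtain q' where "q' \<in> carrier R" "z = q' \<odot>\<^bsub>E\<^esub> (s \<odot>\<^bsub>E\<^esub> z)" using zs ks sz by blast
        ultimately show False using zK K' by metis
      qed
      \<comment> \<open>If \<open>x\<close> is not in \<open>K\<close>, then
        \<open>y = k + s x\<close>, and \<open>k\<close> serves: it is killed by whatever kills
        \<open>y\<close>, and \<open>k = 0\<close> would make \<open>s\<close> invertible modulo the
        annihilator of \<open>y\<close>, hence \<open>x\<close> a multiple of
        \<open>y\<close>.\<close>
      have "\<exists>x'\<in>K. x' \<noteq> \<zero>\<^bsub>E\<^esub> \<and> (\<forall>a\<in>carrier R. a \<odot>\<^bsub>E\<^esub> y = \<zero>\<^bsub>E\<^esub> \<longrightarrow> a \<odot>\<^bsub>E\<^esub> x' = \<zero>\<^bsub>E\<^esub>)"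
      proof (cases "x \<in> K")
        case True
        have "x \<noteq> \<zero>\<^bsub>E\<^esub>" using xy y by (metis E.smult_l_null zero_closed)
        then show ?thesis using True ann by blast
      next
        case False
        define Kx where "Kx = {k \<oplus>\<^bsub>E\<^esub> s \<odot>\<^bsub>E\<^esub> x | k s. k \<in> K \<and> s \<in> carrier R}"
        have Kx: "submodule Kx R E" "K \<subseteq> Kx" "x \<in> Kx"
          using E.submodule_add_cyclic[OF K(1) x] unfolding Kx_def by auto
        have "y \<in> Kx" using maxK[OF Kx(1) _ Kx(2)] Kx(3) False by blast
        then obtain k s where ks: "k \<in> K" "s \<in> carrier R" "y = k \<oplus>\<^bsub>E\<^esub> s \<odot>\<^bsub>E\<^esub> x" unfolding Kx_def by blast
        have k: "k = y \<oplus>\<^bsub>E\<^esub> \<ominus>\<^bsub>E\<^esub> (s \<odot>\<^bsub>E\<^esub> x)" using ks Kc x by (simp add: E.M.a_assoc E.M.r_neg)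
        have "a \<odot>\<^bsub>E\<^esub> k = \<zero>\<^bsub>E\<^esub>" if a: "a \<in> carrier R" "a \<odot>\<^bsub>E\<^esub> y = \<zero>\<^bsub>E\<^esub>" for a
        proof -
          have "a \<odot>\<^bsub>E\<^esub> (s \<odot>\<^bsub>E\<^esub> x) = s \<odot>\<^bsub>E\<^esub> (a \<odot>\<^bsub>E\<^esub> x)" using a ks x by (metis E.smult_assoc1 m_comm)
          then show ?thesis unfolding k using a ks x y ann[OF a] by (simp add: E.smult_r_distr E.smult_r_minus)
        qed
        moreover have "k \<noteq> \<zero>\<^bsub>E\<^esub>"
        proof
          assume "k = \<zero>\<^bsub>E\<^esub>"
          then have ysx: "y = s \<odot>\<^bsub>E\<^esub> x" using ks x by simp
          then have "s \<odot>\<^bsub>E\<^esub> x \<noteq> \<zero>\<^bsub>E\<^esub>" using y by simp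
          then have sy: "s \<odot>\<^bsub>E\<^esub> y \<noteq> \<zero>\<^bsub>E\<^esub>" using ann ks by blast
          then obtain q where q: "q \<in> carrier R" "y = q \<odot>\<^bsub>E\<^esub> (s \<odot>\<^bsub>E\<^esub> y)" using simple ks by blast
          have "x = q \<odot>\<^bsub>E\<^esub> y" using inverse_modulo_annihilator[OF q(1) ks(2) y(1) x q(2) ann] unfolding ysx[symmetric] .
          then show False using xy q(1) by blast
        qed
        ultimately show ?thesis using ks(1) by blast
      qed
      then obtain x' where x': "x' \<in> K" "x' \<noteq> \<zero>\<^bsub>E\<^esub>"
        and ann': "\<And>a. \<lbrakk>a \<in> carrier R; a \<odot>\<^bsub>E\<^esub> y = \<zero>\<^bsub>E\<^esub>\<rbrakk> \<Longrightarrow> a \<odot>\<^bsub>E\<^esub> x' = \<zero>\<^bsub>E\<^esub>" by blast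
      have ann'': "a \<odot>\<^bsub>E\<^esub> x' = \<zero>\<^bsub>E\<^esub>" if "a \<in> carrier R" "a \<odot>\<^bsub>E\<^esub> z = \<zero>\<^bsub>E\<^esub>" for a
        using ann' ann_eq[OF that z le] that by blast
      have x'c: "x' \<in> carrier E" using x' Kc by blast
      \<comment> \<open>Graph of the map from \<open>Rz\<close> to \<open>Rx'\<close> sending
        \<open>z\<close> to \<open>x'\<close>, well defined because whatever kills \<open>z\<close>
        also kills \<open>y\<close> and hence \<open>x'\<close>.\<close>
      define G1 where "G1 = {(a \<odot>\<^bsub>E\<^esub> z, a \<odot>\<^bsub>E\<^esub> x') | a. a \<in> carrier R}"
      have G1I: "(a \<odot>\<^bsub>E\<^esub> z, a \<odot>\<^bsub>E\<^esub> x') \<in> G1" if "a \<in> carrier R" for a using that unfolding G1_def by blast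
      have "\<exists>h\<in>linear_maps R E E. \<forall>(x, y)\<in>G1. h x = y"
      proof (rule injective_module_extend_from_graph[OF injective E.module_axioms])
        show "G1 \<subseteq> carrier E \<times> carrier E" using z x'c by (auto simp: G1_def)
        show "(\<zero>\<^bsub>E\<^esub>, \<zero>\<^bsub>E\<^esub>) \<in> G1" using G1I[of \<zero>] z x'c by simp
      next
        fix u v u' v' assume "(u, v) \<in> G1" "(u', v') \<in> G1"
        then obtain a b where "a \<in> carrier R" "b \<in> carrier R" "u = a \<odot>\<^bsub>E\<^esub> z" "v = a \<odot>\<^bsub>E\<^esub> x'"
          "u' = b \<odot>\<^bsub>E\<^esub> z" "v' = b \<odot>\<^bsub>E\<^esub> x'" unfolding G1_def by blast
        then show "(u \<oplus>\<^bsub>E\<^esub> u', v \<oplus>\<^bsub>E\<^esub> v') \<in> G1" using G1I[of "a \<oplus> b"] z x'c by (simp add: E.smult_l_distr)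
      next
        fix q u v assume q: "q \<in> carrier R" and "(u, v) \<in> G1"
        then obtain a where "a \<in> carrier R" "u = a \<odot>\<^bsub>E\<^esub> z" "v = a \<odot>\<^bsub>E\<^esub> x'" unfolding G1_def by blast
        then show "(q \<odot>\<^bsub>E\<^esub> u, q \<odot>\<^bsub>E\<^esub> v) \<in> G1" using G1I[of "q \<otimes> a"] z x'c q by (simp add: E.smult_assoc1)
      qed (use ann'' in \<open>auto simp: G1_def\<close>)
      then obtain h where h: "h \<in> linear_maps R E E" "\<forall>(u, v)\<in>G1. h u = v" ..
      have "h z = x'" using bspec[OF h(2) G1I[OF one_closed]] z x'c by simp
      then show ?thesis using nz[OF h(1)] gK x' by simp
    qed
  qed (rule EKmod)
  ultimately have "K = carrier E" using minimal[OF K(1)] unfolding EK_def by blast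
  then show False using K(2) y by blast
qed

text \<open>The double annihilator argument: by well-founded induction on a submodule \<open>L\<close> of \<open>M\<close>, a linear form
  on \<open>N\<close> that vanishes on the orthogonal of \<open>L\<close> is given by an element of \<open>L\<close>.\<close>
lemma pairing_represents:
  fixes M :: "('a, 'm, 'i) module_scheme" and N :: "('a, 'n, 'j) module_scheme"
  assumes M: "module R M" and dcc: "dcc_on R M (carrier M)" and N: "module R N"
    and b1: "\<And>n. n \<in> carrier N \<Longrightarrow> (\<lambda>m. b m n) \<in> linear_maps R M E"
    and b2: "\<And>m. m \<in> carrier M \<Longrightarrow> b m \<in> linear_maps R N E"
    and nondeg: "\<And>n. \<lbrakk>n \<in> carrier N; \<And>m. m \<in> carrier M \<Longrightarrow> b m n = \<zero>\<^bsub>E\<^esub>\<rbrakk> \<Longrightarrow> n = \<zero>\<^bsub>N\<^esub>"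
    and \<Phi>: "\<Phi> \<in> linear_maps R N E"
  shows "\<exists>m\<in>carrier M. \<forall>n\<in>carrier N. \<Phi> n = b m n"
proof -
  interpret M: module R M by (rule M)
  interpret N: module R N by (rule N)
  have b1: "b m n \<in> carrier E" if "m \<in> carrier M" "n \<in> carrier N" for m n
    using linear_mapsD[OF b1] that by simp
  have b2: "b (m \<oplus>\<^bsub>M\<^esub> m') n = b m n \<oplus>\<^bsub>E\<^esub> b m' n" if "m \<in> carrier M" "m' \<in> carrier M" "n \<in> carrier N" for m m' n
    using linear_mapsD[OF assms(4)] that by simp
  have b3: "b m (n \<oplus>\<^bsub>N\<^esub> n') = b m n \<oplus>\<^bsub>E\<^esub> b m n'" if "m \<in> carrier M" "n \<in> carrier N" "n' \<in> carrier N" for m n n'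
    using linear_mapsD[OF assms(5)] that by simp
  have b4: "b \<zero>\<^bsub>M\<^esub> n = \<zero>\<^bsub>E\<^esub>" if "n \<in> carrier N" for n
    using linear_maps_zero[OF M E.module_axioms assms(4)] that by simp
  have b5: "b m \<zero>\<^bsub>N\<^esub> = \<zero>\<^bsub>E\<^esub>" if "m \<in> carrier M" for m
    using linear_maps_zero[OF N E.module_axioms assms(5)] that by simp
  note b = b1 b2 b3 b4 b5
  have bs: "b (r \<odot>\<^bsub>M\<^esub> m) n = r \<odot>\<^bsub>E\<^esub> b m n" "b m (r \<odot>\<^bsub>N\<^esub> n) = r \<odot>\<^bsub>E\<^esub> b m n"
    if "m \<in> carrier M" "r \<in> carrier R" "n \<in> carrier N" for m r n
    using linear_mapsD[OF assms(4)] linear_mapsD[OF assms(5)] that by simp_all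
  define P where "P L \<longleftrightarrow> (\<forall>\<Phi>\<in>linear_maps R N E.
    (\<forall>n\<in>carrier N. (\<forall>l\<in>L. b l n = \<zero>\<^bsub>E\<^esub>) \<longrightarrow> \<Phi> n = \<zero>\<^bsub>E\<^esub>) \<longrightarrow> (\<exists>m\<in>L. \<forall>n\<in>carrier N. \<Phi> n = b m n))" for L
  have "P (carrier M)"
  proof (rule ccontr)
    assume "\<not> P (carrier M)"
    define \<S> where "\<S> = {L. submodule L R M \<and> \<not> P L}"
    have "\<S> \<noteq> {} \<and> (\<forall>L\<in>\<S>. submodule L R M \<and> L \<subseteq> carrier M)"
      using \<open>\<not> P (carrier M)\<close> M.carrier_is_submodule unfolding \<S>_def by (auto simp: M.submodule_iff)
    then have "\<exists>L\<in>\<S>. \<forall>L'\<in>\<S>. L' \<subseteq> L \<longrightarrow> L' = L" using dcc unfolding dcc_on_def by (elim allE impE) assumption+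
    then obtain L where "L \<in> \<S>" and Lmin: "\<forall>L'\<in>\<S>. L' \<subseteq> L \<longrightarrow> L' = L" ..
    then have L: "submodule L R M" "\<not> P L" unfolding \<S>_def by blast+
    have min: "P L'" if "submodule L' R M" "L' \<subseteq> L" "L' \<noteq> L" for L'
      using Lmin that unfolding \<S>_def by blast
    note L' = L(1)[unfolded M.submodule_iff]
    have Lc: "l \<in> carrier M" if "l \<in> L" for l using L' that by blast
    have "\<exists>\<Psi>\<in>linear_maps R N E. (\<forall>n\<in>carrier N. (\<forall>l\<in>L. b l n = \<zero>\<^bsub>E\<^esub>) \<longrightarrow> \<Psi> n = \<zero>\<^bsub>E\<^esub>) \<and>
        \<not> (\<exists>m\<in>L. \<forall>n\<in>carrier N. \<Psi> n = b m n)"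
    proof (rule ccontr)
      assume "\<not> ?thesis"
      then have "P L" unfolding P_def by (intro ballI impI) (rule ccontr, erule notE, intro bexI conjI)
      then show False using L(2) by contradiction
    qed
    then obtain \<Psi> where \<Psi>: "\<Psi> \<in> linear_maps R N E"
      and \<Psi>1: "\<forall>n\<in>carrier N. (\<forall>l\<in>L. b l n = \<zero>\<^bsub>E\<^esub>) \<longrightarrow> \<Psi> n = \<zero>\<^bsub>E\<^esub>"
      and \<Psi>n: "\<not> (\<exists>m\<in>L. \<forall>n\<in>carrier N. \<Psi> n = b m n)"
      by (elim bexE conjE) (rule that)
    have \<Psi>0: "\<Psi> n = \<zero>\<^bsub>E\<^esub>" if "n \<in> carrier N" "\<forall>l\<in>L. b l n = \<zero>\<^bsub>E\<^esub>" for n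
      using \<Psi>1 that by blast
    note \<Psi>' = linear_mapsD[OF \<Psi>] linear_maps_zero[OF N E.module_axioms \<Psi>]
    define A where "A = {n \<in> carrier N. \<forall>l\<in>L. b l n = \<zero>\<^bsub>E\<^esub>}"
    have A: "submodule A R N" unfolding N.submodule_iff A_def using b bs Lc by auto
    obtain l0 n0 where l0: "l0 \<in> L" and n0: "n0 \<in> carrier N" "b l0 n0 \<noteq> \<zero>\<^bsub>E\<^esub>"
    proof (rule ccontr)
      assume "\<not> thesis"
      then have "\<forall>n\<in>carrier N. \<Psi> n = b \<zero>\<^bsub>M\<^esub> n" using that \<Psi>0 b4 by metis
      then show False using \<Psi>n L' by blast
    qed
    have n0A: "n0 \<notin> A" using n0 l0 unfolding A_def by blast
    obtain r where r: "r \<in> carrier R" "r \<odot>\<^bsub>N\<^esub> n0 \<notin> A"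
      and rs: "\<And>s. \<lbrakk>s \<in> carrier R; s \<odot>\<^bsub>N\<^esub> (r \<odot>\<^bsub>N\<^esub> n0) \<notin> A\<rbrakk> \<Longrightarrow>
        \<exists>q\<in>carrier R. \<exists>n\<in>A. r \<odot>\<^bsub>N\<^esub> n0 = n \<oplus>\<^bsub>N\<^esub> q \<odot>\<^bsub>N\<^esub> (s \<odot>\<^bsub>N\<^esub> (r \<odot>\<^bsub>N\<^esub> n0))"
      using N.simple_multiple[OF artinian_cring_axioms A n0(1) n0A] by blast
    \<comment> \<open>\<open>f\<close> spans a simple module modulo the orthogonal \<open>A\<close>
      of \<open>L\<close>. Consequently a scalar that does not kill all values \<open>b l f\<close>
      is inverted on all of them by a single \<open>q\<close>.\<close>
    define f where "f = r \<odot>\<^bsub>N\<^esub> n0"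
    have f: "f \<in> carrier N" "f \<notin> A" using r n0 by (auto simp: f_def)
    have fs: "\<exists>q\<in>carrier R. \<forall>l\<in>L. b l f = q \<odot>\<^bsub>E\<^esub> (s \<odot>\<^bsub>E\<^esub> b l f)"
      if s: "s \<in> carrier R" and sl: "l \<in> L" "s \<odot>\<^bsub>E\<^esub> b l f \<noteq> \<zero>\<^bsub>E\<^esub>" for s l
    proof -
      have "s \<odot>\<^bsub>N\<^esub> f \<notin> A" using sl s f bs Lc unfolding A_def by auto
      then obtain q n where q: "q \<in> carrier R" "n \<in> A" "f = n \<oplus>\<^bsub>N\<^esub> q \<odot>\<^bsub>N\<^esub> (s \<odot>\<^bsub>N\<^esub> f)"
        using rs[OF s] unfolding f_def by blast
      have "b l f = q \<odot>\<^bsub>E\<^esub> (s \<odot>\<^bsub>E\<^esub> b l f)" if l: "l \<in> L" for l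
      proof -
        have "b l f = b l (n \<oplus>\<^bsub>N\<^esub> q \<odot>\<^bsub>N\<^esub> (s \<odot>\<^bsub>N\<^esub> f))" using q(3) by simp
        also have "\<dots> = q \<odot>\<^bsub>E\<^esub> (s \<odot>\<^bsub>E\<^esub> b l f)"
          using l q(1,2) s f(1) Lc b bs unfolding A_def by simp
        finally show ?thesis .
      qed
      then show ?thesis using q(1) by blast
    qed
    obtain x where x: "x \<in> L" "b x f \<noteq> \<zero>\<^bsub>E\<^esub>" using f unfolding A_def by blast
    have xc: "x \<in> carrier M" using x Lc by blast
    have simple: "\<exists>q\<in>carrier R. b x f = q \<odot>\<^bsub>E\<^esub> (s \<odot>\<^bsub>E\<^esub> b x f)"
      if "s \<in> carrier R" "s \<odot>\<^bsub>E\<^esub> b x f \<noteq> \<zero>\<^bsub>E\<^esub>" for s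
      using fs[OF that(1) x(1) that(2)] x(1) by blast
    \<comment> \<open>\<open>b x f\<close> spans a simple submodule of \<open>E\<close>, so by
      minimality of \<open>E\<close> everything killed by its annihilator is a multiple of it: all
      values \<open>b l f\<close>, and below also \<open>\<Psi> f\<close> and certain
      \<open>b x n\<close>.\<close>
    note mult = multiple_if_annihilator_le[OF b1[OF xc f(1)] x(2) simple]
    have ann: "s \<odot>\<^bsub>E\<^esub> b l f = \<zero>\<^bsub>E\<^esub>" if s: "s \<in> carrier R" "s \<odot>\<^bsub>E\<^esub> b x f = \<zero>\<^bsub>E\<^esub>" and l: "l \<in> L" for s l
    proof (rule ccontr)
      assume "s \<odot>\<^bsub>E\<^esub> b l f \<noteq> \<zero>\<^bsub>E\<^esub>"
      then obtain q where "q \<in> carrier R" "b x f = q \<odot>\<^bsub>E\<^esub> (s \<odot>\<^bsub>E\<^esub> b x f)" using fs[OF s(1) l] x by blast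
      then show False using s x by simp
    qed
    \<comment> \<open>The orthogonal of \<open>f\<close> in \<open>L\<close>. It omits
      \<open>x\<close>, so the induction hypothesis applies to it, and \<open>mod\<close> will show
      \<open>L = L1 + Rx\<close>.\<close>
    define L1 where "L1 = {l \<in> L. b l f = \<zero>\<^bsub>E\<^esub>}"
    have L1: "submodule L1 R M" unfolding M.submodule_iff L1_def using L' b bs Lc f by auto
    have "L1 \<noteq> L" using x unfolding L1_def by blast
    then have P1: "P L1" using min[OF L1] unfolding L1_def by blast
    have mod: "\<exists>q\<in>carrier R. l \<oplus>\<^bsub>M\<^esub> q \<odot>\<^bsub>M\<^esub> x \<in> L1" if l: "l \<in> L" for l
    proof -
      obtain q where q: "q \<in> carrier R" "b l f = q \<odot>\<^bsub>E\<^esub> b x f"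
        using mult[of "b l f"] ann b(1) l Lc f by blast
      then have "b (l \<oplus>\<^bsub>M\<^esub> (\<ominus> q) \<odot>\<^bsub>M\<^esub> x) f = \<zero>\<^bsub>E\<^esub>"
        using l Lc xc f b bs by (simp add: E.smult_l_minus E.M.r_neg)
      then have "l \<oplus>\<^bsub>M\<^esub> (\<ominus> q) \<odot>\<^bsub>M\<^esub> x \<in> L1" unfolding L1_def using l L' x q by simp
      then show ?thesis using q(1) by blast
    qed
    have killed: "n \<in> A" if n: "n \<in> carrier N" "\<forall>l\<in>L1. b l n = \<zero>\<^bsub>E\<^esub>" "b x n = \<zero>\<^bsub>E\<^esub>" for n
    proof -
      have "b l n = \<zero>\<^bsub>E\<^esub>" if l: "l \<in> L" for l
      proof -
        obtain q where q: "q \<in> carrier R" "l \<oplus>\<^bsub>M\<^esub> q \<odot>\<^bsub>M\<^esub> x \<in> L1" using mod[OF l] by blast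
        then have "b (l \<oplus>\<^bsub>M\<^esub> q \<odot>\<^bsub>M\<^esub> x) n = \<zero>\<^bsub>E\<^esub>" using n by blast
        then show ?thesis using q(1) l Lc xc n b bs by simp
      qed
      then show ?thesis using n unfolding A_def by blast
    qed
    have \<Psi>A: "\<Psi> n = \<zero>\<^bsub>E\<^esub>" if "n \<in> A" for n using \<Psi>0 that unfolding A_def by blast
    have "\<exists>t\<in>carrier R. \<Psi> f = t \<odot>\<^bsub>E\<^esub> b x f"
    proof (rule mult)
      show "\<Psi> f \<in> carrier E" using \<Psi>' f by blast
      fix s assume s: "s \<in> carrier R" "s \<odot>\<^bsub>E\<^esub> b x f = \<zero>\<^bsub>E\<^esub>"
      then have "s \<odot>\<^bsub>N\<^esub> f \<in> A" using ann[OF s] bs Lc f unfolding A_def by auto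
      then show "s \<odot>\<^bsub>E\<^esub> \<Psi> f = \<zero>\<^bsub>E\<^esub>" using \<Psi>A \<Psi>' s f by metis
    qed
    then obtain t where t: "t \<in> carrier R" "\<Psi> f = t \<odot>\<^bsub>E\<^esub> b x f" by blast
    \<comment> \<open>Modulo \<open>A\<close>, an element orthogonal to \<open>L1\<close> is a
      multiple \<open>q f\<close>: the scalar \<open>q\<close> is read off from the value of
      \<open>b x\<close>, and the two forms agree on \<open>f\<close> by the choice of
      \<open>t\<close>.\<close>
    have on_L1: "\<Psi> n = t \<odot>\<^bsub>E\<^esub> b x n" if n: "n \<in> carrier N" "\<forall>l\<in>L1. b l n = \<zero>\<^bsub>E\<^esub>" for n
    proof -
      have "\<exists>q\<in>carrier R. b x n = q \<odot>\<^bsub>E\<^esub> b x f"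
      proof (rule mult)
        show "b x n \<in> carrier E" using b xc n by blast
        fix s assume s: "s \<in> carrier R" "s \<odot>\<^bsub>E\<^esub> b x f = \<zero>\<^bsub>E\<^esub>"
        then have "s \<odot>\<^bsub>M\<^esub> x \<in> L1" unfolding L1_def using x L' bs xc f by simp
        then show "s \<odot>\<^bsub>E\<^esub> b x n = \<zero>\<^bsub>E\<^esub>" using n bs xc s by metis
      qed
      then obtain q where q: "q \<in> carrier R" "b x n = q \<odot>\<^bsub>E\<^esub> b x f" by blast
      define n' where "n' = n \<oplus>\<^bsub>N\<^esub> (\<ominus> q) \<odot>\<^bsub>N\<^esub> f"
      have n': "n' \<in> carrier N" using n q f by (simp add: n'_def)
      have "n' \<in> A"
      proof (rule killed[OF n'])
        show "\<forall>l\<in>L1. b l n' = \<zero>\<^bsub>E\<^esub>"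
          using n q f b bs Lc unfolding n'_def L1_def by simp
        show "b x n' = \<zero>\<^bsub>E\<^esub>"
          using n q f b bs xc unfolding n'_def by (simp add: E.smult_l_minus E.M.r_neg)
      qed
      then have "\<Psi> n \<oplus>\<^bsub>E\<^esub> \<ominus>\<^bsub>E\<^esub> (q \<odot>\<^bsub>E\<^esub> \<Psi> f) = \<zero>\<^bsub>E\<^esub>"
      proof -
        assume "n' \<in> A"
        then have "\<Psi> n' = \<zero>\<^bsub>E\<^esub>" by (rule \<Psi>A)
        moreover have "\<Psi> n' = \<Psi> n \<oplus>\<^bsub>E\<^esub> (\<ominus> q) \<odot>\<^bsub>E\<^esub> \<Psi> f" using \<Psi>'(2,3) n(1) q(1) f(1) by (simp add: n'_def)
        ultimately show ?thesis using \<Psi>'(1) q(1) f(1) by (simp add: E.smult_l_minus)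
      qed
      then have "\<Psi> n = q \<odot>\<^bsub>E\<^esub> \<Psi> f"
        using \<Psi>' n q f by (metis E.M.a_inv_closed E.M.minus_equality E.M.minus_minus E.smult_closed)
      also have "\<dots> = t \<odot>\<^bsub>E\<^esub> b x n"
        using t q b(1) xc f by (simp add: E.smult_assoc1[symmetric] m_comm)
      finally show ?thesis .
    qed
    \<comment> \<open>The corrected form vanishes on the orthogonal of \<open>L1\<close>, so it is
      represented by some \<open>m\<close> in \<open>L1\<close>, and \<open>\<Psi>\<close> by
      \<open>m + t x\<close>.\<close>
    define \<Psi>' where "\<Psi>' n = \<Psi> n \<oplus>\<^bsub>E\<^esub> (\<ominus> t) \<odot>\<^bsub>E\<^esub> b x n" for n
    have "\<Psi>' \<in> linear_maps R N E"
    proof (rule linear_mapsI)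
      fix n n' assume nn: "n \<in> carrier N" "n' \<in> carrier N"
      then show "\<Psi>' (n \<oplus>\<^bsub>N\<^esub> n') = \<Psi>' n \<oplus>\<^bsub>E\<^esub> \<Psi>' n'"
        using linear_mapsD[OF \<Psi>] b xc t by (simp add: \<Psi>'_def E.smult_r_distr E.M.a_ac)
    next
      fix r n assume rn: "r \<in> carrier R" "n \<in> carrier N"
      have "(\<ominus> t) \<odot>\<^bsub>E\<^esub> (r \<odot>\<^bsub>E\<^esub> b x n) = r \<odot>\<^bsub>E\<^esub> ((\<ominus> t) \<odot>\<^bsub>E\<^esub> b x n)"
        using rn t b(1) xc by (simp add: E.smult_assoc1[symmetric] m_comm)
      then show "\<Psi>' (r \<odot>\<^bsub>N\<^esub> n) = r \<odot>\<^bsub>E\<^esub> \<Psi>' n"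
        using linear_mapsD[OF \<Psi>] b bs xc t rn by (simp add: \<Psi>'_def E.smult_r_distr)
    qed (use linear_mapsD[OF \<Psi>] b xc t in \<open>simp add: \<Psi>'_def\<close>)
    moreover have "\<forall>n\<in>carrier N. (\<forall>l\<in>L1. b l n = \<zero>\<^bsub>E\<^esub>) \<longrightarrow> \<Psi>' n = \<zero>\<^bsub>E\<^esub>"
      using on_L1 t b(1) xc unfolding \<Psi>'_def by (simp add: E.smult_l_minus E.M.r_neg)
    ultimately obtain m where m: "m \<in> L1" "\<And>n. n \<in> carrier N \<Longrightarrow> \<Psi>' n = b m n"
      using P1 unfolding P_def by blast
    have mL: "m \<in> L" "m \<in> carrier M" using m Lc unfolding L1_def by auto
    have "\<Psi> n = b (m \<oplus>\<^bsub>M\<^esub> t \<odot>\<^bsub>M\<^esub> x) n" if n: "n \<in> carrier N" for n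
    proof -
      have "b (m \<oplus>\<^bsub>M\<^esub> t \<odot>\<^bsub>M\<^esub> x) n = \<Psi>' n \<oplus>\<^bsub>E\<^esub> t \<odot>\<^bsub>E\<^esub> b x n" using m n mL t xc b bs by simp
      also have "\<dots> = \<Psi> n"
        using linear_mapsD[OF \<Psi>] n b(1) xc t
        by (simp add: \<Psi>'_def E.smult_l_minus E.M.a_assoc E.M.l_neg)
      finally show ?thesis by simp
    qed
    moreover have "m \<oplus>\<^bsub>M\<^esub> t \<odot>\<^bsub>M\<^esub> x \<in> L" using mL x L' t by blast
    ultimately show False using \<Psi>n by blast
  qed
  moreover have "\<Phi> n = \<zero>\<^bsub>E\<^esub>" if "n \<in> carrier N" "\<forall>l\<in>carrier M. b l n = \<zero>\<^bsub>E\<^esub>" for n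
    using nondeg[of n] that linear_maps_zero[OF N E.module_axioms \<Phi>] by simp
  ultimately show ?thesis
    unfolding P_def using \<Phi> by blast
qed

section \<open>Perfect pairings and representing elements\<close>

definition represent where
  "represent M N b \<xi> = (SOME m. m \<in> carrier M \<and> (\<forall>n\<in>carrier N. \<xi> n = b m n))"

lemma Hom_R_simps [simp]:
  "add (Hom_R R M E) = (\<lambda>f g. \<lambda>x\<in>carrier M. f x \<oplus>\<^bsub>E\<^esub> g x)"
  "smult (Hom_R R M E) = (\<lambda>r f. \<lambda>x\<in>carrier M. r \<odot>\<^bsub>E\<^esub> f x)"
  by (simp_all add: Hom_R_def)

lemma Hom_R_carrier: "carrier (Hom_R R M E) = linear_maps R M E \<inter> extensional (carrier M)"
  by (simp add: Hom_R_def)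

lemma restrict_Hom_R:
  assumes "module R M" and \<xi>: "\<xi> \<in> linear_maps R M E"
  shows "(\<lambda>x\<in>carrier M. \<xi> x) \<in> carrier (Hom_R R M E)"
proof -
  interpret M: module R M by fact
  show ?thesis unfolding Hom_R_carrier using linear_mapsD[OF \<xi>] by (auto intro!: linear_mapsI)
qed

text \<open>\<open>nondeg\<close> makes the map from \<open>m\<close> to the form \<open>b m\<close>
  injective and \<open>surj\<close> makes it onto; \<open>represent\<close> is its inverse.\<close>

lemma perfect_pairing:
  assumes M: "module R M" and N: "module R N"
    and b1: "\<And>n. n \<in> carrier N \<Longrightarrow> (\<lambda>m. b m n) \<in> linear_maps R M E"
    and b2: "\<And>m. m \<in> carrier M \<Longrightarrow> b m \<in> linear_maps R N E"
    and nondeg: "\<And>m. \<lbrakk>m \<in> carrier M; \<And>n. n \<in> carrier N \<Longrightarrow> b m n = \<zero>\<^bsub>E\<^esub>\<rbrakk> \<Longrightarrow> m = \<zero>\<^bsub>M\<^esub>"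
    and surj: "\<And>\<xi>. \<xi> \<in> linear_maps R N E \<Longrightarrow> \<exists>m\<in>carrier M. \<forall>n\<in>carrier N. \<xi> n = b m n"
  shows "\<xi> \<in> carrier (Hom_R R N E) \<Longrightarrow> represent M N b \<xi> \<in> carrier M"
    and "\<lbrakk>\<xi> \<in> carrier (Hom_R R N E); n \<in> carrier N\<rbrakk> \<Longrightarrow> \<xi> n = b (represent M N b \<xi>) n"
    and "\<lbrakk>\<xi> \<in> carrier (Hom_R R N E); m \<in> carrier M; \<And>n. n \<in> carrier N \<Longrightarrow> \<xi> n = b m n\<rbrakk> \<Longrightarrow> represent M N b \<xi> = m"
    and "represent M N b \<in> module_isos R (Hom_R R N E) M"
proof -
  interpret M: module R M by (rule M)
  interpret N: module R N by (rule N)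
  note B1 = linear_mapsD[OF b1] and B2 = linear_mapsD[OF b2]
  have ex: "\<exists>m. m \<in> carrier M \<and> (\<forall>n\<in>carrier N. \<xi> n = b m n)" if "\<xi> \<in> carrier (Hom_R R N E)" for \<xi>
    using surj[of \<xi>] that unfolding Hom_R_carrier by blast
  show rep1: "represent M N b \<xi> \<in> carrier M" if "\<xi> \<in> carrier (Hom_R R N E)" for \<xi>
    using someI_ex[OF ex[OF that]] unfolding represent_def by blast
  show rep2: "\<xi> n = b (represent M N b \<xi>) n" if "\<xi> \<in> carrier (Hom_R R N E)" "n \<in> carrier N" for \<xi> n
    using someI_ex[OF ex[OF that(1)]] that(2) unfolding represent_def by blast
  have inj: "m = m'" if m: "m \<in> carrier M" "m' \<in> carrier M" and eq: "\<And>n. n \<in> carrier N \<Longrightarrow> b m n = b m' n" for m m'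
  proof -
    have "b (m \<oplus>\<^bsub>M\<^esub> (\<ominus> \<one>) \<odot>\<^bsub>M\<^esub> m') n = \<zero>\<^bsub>E\<^esub>" if n: "n \<in> carrier N" for n
      using m B1[OF n] eq[OF n] by (simp add: E.smult_l_minus E.M.r_neg)
    then have "m \<oplus>\<^bsub>M\<^esub> \<ominus>\<^bsub>M\<^esub> m' = \<zero>\<^bsub>M\<^esub>" using nondeg[of "m \<oplus>\<^bsub>M\<^esub> (\<ominus> \<one>) \<odot>\<^bsub>M\<^esub> m'"] m by (simp add: M.smult_l_minus)
    then show ?thesis using m by (metis M.M.a_inv_closed M.M.minus_equality M.M.minus_minus)
  qed
  show rep3: "represent M N b \<xi> = m" if "\<xi> \<in> carrier (Hom_R R N E)" "m \<in> carrier M" "\<And>n. n \<in> carrier N \<Longrightarrow> \<xi> n = b m n" for \<xi> m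
    by (rule inj[OF rep1[OF that(1)] that(2)]) (use rep2[OF that(1)] that(3) in metis)
  have form: "(\<lambda>n\<in>carrier N. b m n) \<in> carrier (Hom_R R N E)" if "m \<in> carrier M" for m
    by (rule restrict_Hom_R[OF N b2[OF that]])
  have eqI: "\<xi> = (\<lambda>n\<in>carrier N. b (represent M N b \<xi>) n)" if "\<xi> \<in> carrier (Hom_R R N E)" for \<xi>
  proof (rule extensionalityI)
    show "\<xi> \<in> extensional (carrier N)" using that unfolding Hom_R_carrier by blast
    show "(\<lambda>n\<in>carrier N. b (represent M N b \<xi>) n) \<in> extensional (carrier N)" by simp
  qed (use rep2[OF that] in simp)
  have "bij_betw (represent M N b) (carrier (Hom_R R N E)) (carrier M)"
  proof (rule bij_betw_byWitness[of _ "\<lambda>m. \<lambda>n\<in>carrier N. b m n"])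
    show "\<forall>\<xi>\<in>carrier (Hom_R R N E). (\<lambda>n\<in>carrier N. b (represent M N b \<xi>) n) = \<xi>" using eqI by simp
    show "\<forall>m\<in>carrier M. represent M N b (\<lambda>n\<in>carrier N. b m n) = m" using rep3[OF form] by simp
  qed (use rep1 form in auto)
  moreover have "represent M N b \<in> linear_maps R (Hom_R R N E) M"
  proof (rule linear_mapsI)
    fix \<xi> \<xi>' assume x: "\<xi> \<in> carrier (Hom_R R N E)" "\<xi>' \<in> carrier (Hom_R R N E)"
    have m: "represent M N b \<xi> \<oplus>\<^bsub>M\<^esub> represent M N b \<xi>' \<in> carrier M" using rep1 x by simp
    have e: "\<xi> \<oplus>\<^bsub>Hom_R R N E\<^esub> \<xi>' = (\<lambda>n\<in>carrier N. b (represent M N b \<xi> \<oplus>\<^bsub>M\<^esub> represent M N b \<xi>') n)"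
      using x by (auto simp: B1 rep1 rep2[symmetric] intro!: restrict_ext)
    show "represent M N b (\<xi> \<oplus>\<^bsub>Hom_R R N E\<^esub> \<xi>') = represent M N b \<xi> \<oplus>\<^bsub>M\<^esub> represent M N b \<xi>'"
      unfolding e by (rule rep3[OF form[OF m] m]) simp
  next
    fix q \<xi> assume q: "q \<in> carrier R" and x: "\<xi> \<in> carrier (Hom_R R N E)"
    have m: "q \<odot>\<^bsub>M\<^esub> represent M N b \<xi> \<in> carrier M" using q rep1 x by simp
    have e: "q \<odot>\<^bsub>Hom_R R N E\<^esub> \<xi> = (\<lambda>n\<in>carrier N. b (q \<odot>\<^bsub>M\<^esub> represent M N b \<xi>) n)"
      using x q by (auto simp: B1 rep1 rep2[symmetric] intro!: restrict_ext)
    show "represent M N b (q \<odot>\<^bsub>Hom_R R N E\<^esub> \<xi>) = q \<odot>\<^bsub>M\<^esub> represent M N b \<xi>"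
      unfolding e by (rule rep3[OF form[OF m] m]) simp
  qed (rule rep1)
  ultimately show "represent M N b \<in> module_isos R (Hom_R R N E) M" unfolding module_isos_def by blast
qed

text \<open>A converse: the inverse \<open>\<psi>\<close> of \<open>m \<mapsto> b m\<close> is given
  and nondegeneracy is deduced. On the side of \<open>N\<close> this uses that \<open>E\<close>
  cogenerates: a nonzero \<open>n\<close> is detected by some form, and that form is some
  \<open>b m\<close>.\<close>

lemma represented_pairing:
  assumes M: "module R M" and N: "module R N"
    and b1: "\<And>n. n \<in> carrier N \<Longrightarrow> (\<lambda>m. b m n) \<in> linear_maps R M E"
    and b2: "\<And>m. m \<in> carrier M \<Longrightarrow> b m \<in> linear_maps R N E"
    and inj: "inj_on \<psi> (carrier (Hom_R R N E))" and into: "\<psi> ` carrier (Hom_R R N E) \<subseteq> carrier M"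
    and inv: "\<And>m. m \<in> carrier M \<Longrightarrow> \<psi> (\<lambda>n\<in>carrier N. b m n) = m"
  shows "\<lbrakk>\<xi> \<in> carrier (Hom_R R N E); n \<in> carrier N\<rbrakk> \<Longrightarrow> \<xi> n = b (\<psi> \<xi>) n"
    and "\<lbrakk>m \<in> carrier M; \<And>n. n \<in> carrier N \<Longrightarrow> b m n = \<zero>\<^bsub>E\<^esub>\<rbrakk> \<Longrightarrow> m = \<zero>\<^bsub>M\<^esub>"
    and "\<lbrakk>n \<in> carrier N; \<And>m. m \<in> carrier M \<Longrightarrow> b m n = \<zero>\<^bsub>E\<^esub>\<rbrakk> \<Longrightarrow> n = \<zero>\<^bsub>N\<^esub>"
proof -
  interpret M: module R M by (rule M)
  show rep: "\<xi> n = b (\<psi> \<xi>) n" if \<xi>: "\<xi> \<in> carrier (Hom_R R N E)" and n: "n \<in> carrier N" for \<xi> n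
  proof -
    have m: "\<psi> \<xi> \<in> carrier M" using into \<xi> by blast
    have "(\<lambda>n\<in>carrier N. b (\<psi> \<xi>) n) = \<xi>"
      by (rule inj_onD[OF inj inv[OF m] restrict_Hom_R[OF N b2[OF m]] \<xi>])
    then have "\<xi> n = (\<lambda>n\<in>carrier N. b (\<psi> \<xi>) n) n" by simp
    then show ?thesis using n by simp
  qed
  show "m = \<zero>\<^bsub>M\<^esub>" if m: "m \<in> carrier M" and z: "\<And>n. n \<in> carrier N \<Longrightarrow> b m n = \<zero>\<^bsub>E\<^esub>" for m
  proof -
    have "b m n = b \<zero>\<^bsub>M\<^esub> n" if "n \<in> carrier N" for n
      using z[OF that] linear_maps_zero[OF M E.module_axioms b1[OF that]] by simp
    then have "(\<lambda>n\<in>carrier N. b m n) = (\<lambda>n\<in>carrier N. b \<zero>\<^bsub>M\<^esub> n)" by (rule restrict_ext)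
    then have "\<psi> (\<lambda>n\<in>carrier N. b m n) = \<psi> (\<lambda>n\<in>carrier N. b \<zero>\<^bsub>M\<^esub> n)" by (rule arg_cong)
    then show ?thesis unfolding inv[OF m] inv[OF M.M.zero_closed] .
  qed
  show "n = \<zero>\<^bsub>N\<^esub>" if n: "n \<in> carrier N" and z: "\<And>m. m \<in> carrier M \<Longrightarrow> b m n = \<zero>\<^bsub>E\<^esub>"
  proof (rule ccontr)
    assume "n \<noteq> \<zero>\<^bsub>N\<^esub>"
    then obtain \<xi> where \<xi>: "\<xi> \<in> linear_maps R N E" "\<xi> n \<noteq> \<zero>\<^bsub>E\<^esub>" using linear_form_separating[OF N n] by blast
    note x = restrict_Hom_R[OF N \<xi>(1)]
    have "\<psi> (\<lambda>n\<in>carrier N. \<xi> n) \<in> carrier M" using into x by blast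
    then show False using rep[OF x n] z \<xi>(2) n by simp
  qed
qed

end

section \<open>Linear categories\<close>

context category
begin

text \<open>Typing becomes equational, so that simp discharges the source and target conditions of
  the rules below; \<open>Hom_iff\<close> is deleted where a membership has to stay intact for
  matching.\<close>

lemma Hom_iff [simp]: "f \<in> Hom C X Y \<longleftrightarrow> f \<in> Arr C \<and> Dom C f = X \<and> Cod C f = Y"
  by (simp add: Hom_def)

lemma comp_typing [simp]:
  assumes "f \<in> Arr C" and "g \<in> Arr C" and "Cod C f = Dom C g"
  shows "g \<bullet> f \<in> Arr C" and "Dom C (g \<bullet> f) = Dom C f" and "Cod C (g \<bullet> f) = Cod C g"
  using Comp_closed[of f "Dom C f" "Cod C f" g "Cod C g"] assms by simp_all

lemma comp_assoc [simp]:
  assumes "f \<in> Arr C" and "g \<in> Arr C" and "h \<in> Arr C" and "Cod C f = Dom C g" and "Cod C g = Dom C h"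
  shows "(h \<bullet> g) \<bullet> f = h \<bullet> (g \<bullet> f)"
  using Comp_assoc[of f "Dom C f" "Cod C f" g "Cod C g" h "Cod C h"] assms by simp

lemma Ident_typing [simp]:
  assumes "X \<in> Obj C"
  shows "Ident C X \<in> Arr C" and "Dom C (Ident C X) = X" and "Cod C (Ident C X) = X"
  using Ident_closed[OF assms] by simp_all

lemma comp_Ident [simp]: "f \<in> Arr C \<Longrightarrow> Dom C f = X \<Longrightarrow> f \<bullet> Ident C X = f"
  using Comp_Ident[of f "Dom C f" "Cod C f"] by simp

lemma Ident_comp [simp]: "f \<in> Arr C \<Longrightarrow> Cod C f = X \<Longrightarrow> Ident C X \<bullet> f = f"
  using Ident_Comp[of f "Dom C f" "Cod C f"] by simp

text \<open>Since \<open>comp_assoc\<close> brackets to the right, an equation for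
  \<open>g \<bullet> f\<close> no longer matches inside \<open>g \<bullet> (f \<bullet> y)\<close>;
  this is its reassociated form.\<close>

lemma comp_eq_comp:
  assumes "g \<bullet> f = k" and "f \<in> Arr C" and "g \<in> Arr C" and "Cod C f = Dom C g" and "y \<in> Arr C" and "Cod C y = Dom C f"
  shows "g \<bullet> (f \<bullet> y) = k \<bullet> y"
  using assms by (metis comp_assoc)

lemma Dom_Obj: "f \<in> Hom C X Y \<Longrightarrow> X \<in> Obj C" and Cod_Obj: "f \<in> Hom C X Y \<Longrightarrow> Y \<in> Obj C"
  using Dom_closed Cod_closed by auto

lemma iso_arrE:
  assumes "iso_arr C X Y f"
  obtains g where "f \<in> Hom C X Y" and "g \<in> Hom C Y X" and "g \<bullet> f = Ident C X" and "f \<bullet> g = Ident C Y"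
    and "iso_arr C Y X g"
  using assms unfolding iso_arr_def by blast

lemma iso_arrI:
  assumes "f \<in> Hom C X Y" and "g \<in> Hom C Y X" and "g \<bullet> f = Ident C X" and "f \<bullet> g = Ident C Y"
  shows "iso_arr C X Y f"
  using assms unfolding iso_arr_def by blast

lemma iso_arr_Ident: "X \<in> Obj C \<Longrightarrow> iso_arr C X X (Ident C X)"
  by (rule iso_arrI[of _ _ _ "Ident C X"]) auto

end

lemma hom_module_simps [simp]:
  "carrier (hom_module C X Y) = Hom C X Y" "mult (hom_module C X Y) = Comp C" "one (hom_module C X Y) = Ident C X"
  "zero (hom_module C X Y) = ZeroArr C X Y" "add (hom_module C X Y) = AddArr C" "smult (hom_module C X Y) = SmultArr C"
  by (simp_all add: hom_module_def)

context linear_category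
begin

abbreviation comp_arrow (infixl \<open>\<cdot>\<close> 70) where "g \<cdot> f \<equiv> Comp C g f"
abbreviation add_arrow (infixl \<open>\<boxplus>\<close> 65) where "f \<boxplus> g \<equiv> AddArr C f g"
text \<open>Unlike the inverse in a Hom module, a scalar multiple does not mention source and
  target, and its compatibility with composition and shift is plain linearity.\<close>

definition neg where "neg f = SmultArr C (\<ominus>\<^bsub>R\<^esub> \<one>\<^bsub>R\<^esub>) f"

lemma zero_typing [simp]:
  assumes "X \<in> Obj C" and "Y \<in> Obj C"
  shows "ZeroArr C X Y \<in> Arr C" and "Dom C (ZeroArr C X Y) = X" and "Cod C (ZeroArr C X Y) = Y"
proof -
  interpret H: module R "hom_module C X Y" by (rule hom_is_module[OF assms])
  show "ZeroArr C X Y \<in> Arr C" "Dom C (ZeroArr C X Y) = X" "Cod C (ZeroArr C X Y) = Y"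
    using H.M.zero_closed by simp_all
qed

lemma smult_typing [simp]:
  assumes "r \<in> carrier R" and "f \<in> Arr C"
  shows "SmultArr C r f \<in> Arr C" and "Dom C (SmultArr C r f) = Dom C f" and "Cod C (SmultArr C r f) = Cod C f"
proof -
  interpret H: module R "hom_module C (Dom C f) (Cod C f)" using assms Dom_closed Cod_closed by (intro hom_is_module)
  show "SmultArr C r f \<in> Arr C" "Dom C (SmultArr C r f) = Dom C f" "Cod C (SmultArr C r f) = Cod C f"
    using H.smult_closed[of r f] assms by simp_all
qed

lemma add_typing [simp]:
  assumes "f \<in> Arr C" and "g \<in> Arr C" and "Dom C f = Dom C g" and "Cod C f = Cod C g"
  shows "f \<boxplus> g \<in> Arr C" and "Dom C (f \<boxplus> g) = Dom C g" and "Cod C (f \<boxplus> g) = Cod C g"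
proof -
  interpret H: module R "hom_module C (Dom C f) (Cod C f)" using assms Dom_closed Cod_closed by (intro hom_is_module)
  show "f \<boxplus> g \<in> Arr C" "Dom C (f \<boxplus> g) = Dom C g" "Cod C (f \<boxplus> g) = Cod C g"
    using H.M.a_closed[of f g] assms by simp_all
qed

lemma neg_typing [simp]:
  assumes "f \<in> Arr C"
  shows "neg f \<in> Arr C" and "Dom C (neg f) = Dom C f" and "Cod C (neg f) = Cod C f"
  using assms by (simp_all add: neg_def)

lemma a_inv_hom_module:
  assumes "f \<in> Hom C X Y"
  shows "\<ominus>\<^bsub>hom_module C X Y\<^esub> f = neg f"
proof -
  interpret H: module R "hom_module C X Y" using assms Dom_closed Cod_closed by (intro hom_is_module) auto
  show ?thesis using H.minus_one_smult[of f] assms by (simp add: neg_def)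
qed

lemma add_zero [simp]:
  assumes "f \<in> Arr C" and "Dom C f = X" and "Cod C f = Y"
  shows "f \<boxplus> ZeroArr C X Y = f" and "ZeroArr C X Y \<boxplus> f = f" and "f \<boxplus> neg f = ZeroArr C X Y"
    and "neg f \<boxplus> f = ZeroArr C X Y" and "neg (neg f) = f"
proof -
  interpret H: module R "hom_module C X Y" using assms Dom_closed Cod_closed by (intro hom_is_module) auto
  show "f \<boxplus> ZeroArr C X Y = f" "ZeroArr C X Y \<boxplus> f = f" "f \<boxplus> neg f = ZeroArr C X Y"
    "neg f \<boxplus> f = ZeroArr C X Y"  "neg (neg f) = f"
    using H.M.r_zero[of f] H.M.l_zero[of f] H.M.r_neg[of f] H.M.l_neg[of f] H.M.minus_minus[of f] assms
    by (simp_all add: a_inv_hom_module)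
qed

lemma neg_zero [simp]:
  assumes "X \<in> Obj C" and "Y \<in> Obj C"
  shows "neg (ZeroArr C X Y) = ZeroArr C X Y"
proof -
  have "ZeroArr C X Y \<boxplus> neg (ZeroArr C X Y) = ZeroArr C X Y" using assms by simp
  then show ?thesis using assms by (metis add_zero(2) neg_typing zero_typing)
qed

lemma smult_zero_arrow [simp]:
  assumes "r \<in> carrier R" "X \<in> Obj C" and "Y \<in> Obj C"
  shows "SmultArr C r (ZeroArr C X Y) = ZeroArr C X Y"
proof -
  interpret H: module R "hom_module C X Y" using assms by (intro hom_is_module)
  show ?thesis using H.smult_r_null[of r] assms by simp
qed

lemma add_assoc_arrow:
  assumes "f \<in> Arr C" "g \<in> Arr C" "h \<in> Arr C" "Dom C f = Dom C g" "Cod C f = Cod C g" "Dom C g = Dom C h" "Cod C g = Cod C h"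
  shows "(f \<boxplus> g) \<boxplus> h = f \<boxplus> (g \<boxplus> h)"
proof -
  interpret H: module R "hom_module C (Dom C f) (Cod C f)" using assms Dom_closed Cod_closed by (intro hom_is_module) auto
  show ?thesis using H.M.a_assoc[of f g h] assms by simp
qed

lemma add_comm_arrow:
  assumes "f \<in> Arr C" "g \<in> Arr C" "Dom C f = Dom C g" "Cod C f = Cod C g"
  shows "f \<boxplus> g = g \<boxplus> f"
proof -
  interpret H: module R "hom_module C (Dom C f) (Cod C f)" using assms Dom_closed Cod_closed by (intro hom_is_module) auto
  show ?thesis using H.M.a_comm[of f g] assms by simp
qed

lemma add_left_comm_arrow:
  assumes "f \<in> Arr C" "g \<in> Arr C" "h \<in> Arr C" "Dom C f = Dom C g" "Cod C f = Cod C g" "Dom C g = Dom C h" "Cod C g = Cod C h"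
  shows "f \<boxplus> (g \<boxplus> h) = g \<boxplus> (f \<boxplus> h)"
  using assms add_assoc_arrow[of f g h] add_assoc_arrow[of g f h] add_comm_arrow[of f g] by simp

lemmas add_ac_arrow = add_assoc_arrow add_comm_arrow add_left_comm_arrow

lemma eq_if_diff_zero:
  assumes "f \<in> Hom C X Y" "g \<in> Hom C X Y" and "f \<boxplus> neg g = ZeroArr C X Y"
  shows "f = g"
proof -
  have "f = f \<boxplus> (neg g \<boxplus> g)" using assms(1,2) by simp
  also have "\<dots> = (f \<boxplus> neg g) \<boxplus> g" using assms(1,2) by (subst add_assoc_arrow) auto
  also have "\<dots> = g" using assms by simp
  finally show ?thesis .
qed

lemma comp_add [simp]:
  assumes "f \<in> Arr C" "g \<in> Arr C" "h \<in> Arr C" "Cod C f = Dom C h" "Dom C f = Dom C g" "Cod C f = Cod C g"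
  shows "h \<cdot> (f \<boxplus> g) = h \<cdot> f \<boxplus> h \<cdot> g"
  using Comp_add_right[of f "Dom C f" "Cod C f" g h "Cod C h"] assms by simp

lemma add_comp [simp]:
  assumes "f \<in> Arr C" "g \<in> Arr C" "h \<in> Arr C" "Cod C h = Dom C f" "Dom C f = Dom C g" "Cod C f = Cod C g"
  shows "(f \<boxplus> g) \<cdot> h = f \<cdot> h \<boxplus> g \<cdot> h"
  using Comp_add_left[of h "Dom C h" "Cod C h" f "Cod C f" g] assms by simp

lemma comp_smult [simp]:
  assumes "r \<in> carrier R" "f \<in> Arr C" "h \<in> Arr C" "Cod C f = Dom C h"
  shows "h \<cdot> SmultArr C r f = SmultArr C r (h \<cdot> f)" and "SmultArr C r h \<cdot> f = SmultArr C r (h \<cdot> f)"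
  using Comp_smult_right[of r f "Dom C f" "Cod C f" h "Cod C h"]
    Comp_smult_left[of r f "Dom C f" "Cod C f" h "Cod C h"] assms by simp_all

lemma comp_neg [simp]:
  assumes "f \<in> Arr C" "h \<in> Arr C" "Cod C f = Dom C h"
  shows "h \<cdot> neg f = neg (h \<cdot> f)" and "neg h \<cdot> f = neg (h \<cdot> f)"
  using assms by (simp_all add: neg_def)

lemma zero_smult:
  assumes "f \<in> Arr C"
  shows "SmultArr C \<zero>\<^bsub>R\<^esub> f = ZeroArr C (Dom C f) (Cod C f)"
proof -
  interpret H: module R "hom_module C (Dom C f) (Cod C f)" using assms Dom_closed Cod_closed by (intro hom_is_module) auto
  show ?thesis using H.smult_l_null[of f] assms by simp
qed

lemma comp_zero [simp]:
  assumes "f \<in> Arr C" and "X \<in> Obj C"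
  shows "Cod C f = Y \<Longrightarrow> ZeroArr C Y X \<cdot> f = ZeroArr C (Dom C f) X"
    and "Dom C f = Y \<Longrightarrow> f \<cdot> ZeroArr C X Y = ZeroArr C X (Cod C f)"
proof -
  have o: "Dom C f \<in> Obj C" "Cod C f \<in> Obj C" using assms Dom_closed Cod_closed by auto
  have "SmultArr C \<zero>\<^bsub>R\<^esub> (ZeroArr C (Cod C f) X) \<cdot> f = SmultArr C \<zero>\<^bsub>R\<^esub> (ZeroArr C (Cod C f) X \<cdot> f)"
    using assms o by (intro comp_smult) auto
  then show "Cod C f = Y \<Longrightarrow> ZeroArr C Y X \<cdot> f = ZeroArr C (Dom C f) X" using assms o by (auto simp: zero_smult)
  have "f \<cdot> SmultArr C \<zero>\<^bsub>R\<^esub> (ZeroArr C X (Dom C f)) = SmultArr C \<zero>\<^bsub>R\<^esub> (f \<cdot> ZeroArr C X (Dom C f))"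
    using assms o by (intro comp_smult) auto
  then show "Dom C f = Y \<Longrightarrow> f \<cdot> ZeroArr C X Y = ZeroArr C X (Cod C f)" using assms o by (auto simp: zero_smult)
qed

text \<open>An arrow into or out of \<open>X\<close> is its own composite with the identity of
  \<open>X\<close>, hence zero as soon as that identity is.\<close>

lemma zero_object_iff: "zero_object C X \<longleftrightarrow> X \<in> Obj C \<and> Ident C X = ZeroArr C X X"
proof
  assume X: "zero_object C X"
  then have "X \<in> Obj C" "\<exists>!f. f \<in> Hom C X X" unfolding zero_object_def by auto
  moreover from this have "Ident C X \<in> Hom C X X" "ZeroArr C X X \<in> Hom C X X" by simp_all
  ultimately show "X \<in> Obj C \<and> Ident C X = ZeroArr C X X" by blast
next
  assume X: "X \<in> Obj C \<and> Ident C X = ZeroArr C X X"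
  have "f = ZeroArr C X Y" if "f \<in> Hom C X Y" "Y \<in> Obj C" for f Y
  proof -
    have "f = f \<cdot> Ident C X" using that by simp
    also have "\<dots> = ZeroArr C X Y" using that X by simp
    finally show ?thesis .
  qed
  moreover have "f = ZeroArr C Y X" if "f \<in> Hom C Y X" "Y \<in> Obj C" for f Y
  proof -
    have "f = Ident C X \<cdot> f" using that by simp
    also have "\<dots> = ZeroArr C Y X" using that X by simp
    finally show ?thesis .
  qed
  moreover have "ZeroArr C X Y \<in> Hom C X Y" "ZeroArr C Y X \<in> Hom C Y X" if "Y \<in> Obj C" for Y
    using X that by simp_all
  ultimately have "(\<exists>!f. f \<in> Hom C X Y) \<and> (\<exists>!f. f \<in> Hom C Y X)" if "Y \<in> Obj C" for Y
    by (intro conjI ex1I) (use that in \<open>assumption | blast\<close>)+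
  then show "zero_object C X" unfolding zero_object_def using X by blast
qed

lemma zero_object_arrow:
  assumes "zero_object C N" and "Y \<in> Obj C"
  shows "f \<in> Hom C N Y \<Longrightarrow> f = ZeroArr C N Y" and "f \<in> Hom C Y N \<Longrightarrow> f = ZeroArr C Y N"
proof -
  have N: "N \<in> Obj C" and u: "\<exists>!f. f \<in> Hom C N Y" "\<exists>!f. f \<in> Hom C Y N"
    using assms unfolding zero_object_def by auto
  have "ZeroArr C N Y \<in> Hom C N Y" "ZeroArr C Y N \<in> Hom C Y N" using N assms by auto
  then show "f \<in> Hom C N Y \<Longrightarrow> f = ZeroArr C N Y" "f \<in> Hom C Y N \<Longrightarrow> f = ZeroArr C Y N"
    using u by blast+
qed

lemma direct_sum_pair_iff:
  "direct_sum C [A, B] X \<longleftrightarrow> A \<in> Obj C \<and> B \<in> Obj C \<and> X \<in> Obj C \<and>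
     (\<exists>i j p q. i \<in> Hom C A X \<and> j \<in> Hom C B X \<and> p \<in> Hom C X A \<and> q \<in> Hom C X B \<and>
        p \<cdot> i = Ident C A \<and> q \<cdot> j = Ident C B \<and> p \<cdot> j = ZeroArr C B A \<and> q \<cdot> i = ZeroArr C A B \<and>
        i \<cdot> p \<boxplus> j \<cdot> q = Ident C X)" (is "?L \<longleftrightarrow> ?R")
proof -
  have two: "(\<forall>i<Suc (Suc 0). P i) \<longleftrightarrow> P 0 \<and> P (Suc 0)" for P by (auto simp: less_Suc_eq)
  have sum: "finsum (hom_module C X X) f {..<Suc (Suc 0)} = f 0 \<boxplus> f (Suc 0)"
    if "f 0 \<in> Hom C X X" "f (Suc 0) \<in> Hom C X X" "X \<in> Obj C" for f
  proof -
    interpret H: module R "hom_module C X X" using that(3) by (intro hom_is_module)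
    have "f 0 \<boxplus> f (Suc 0) = f (Suc 0) \<boxplus> f 0" using that by (intro add_comm_arrow) auto
    then show ?thesis
      using that by (simp add: lessThan_Suc H.M.finsum_insert Pi_def)
  qed
  show ?thesis
  proof
    assume ?L
    then obtain \<iota> \<pi> where ob: "A \<in> Obj C" "B \<in> Obj C" "X \<in> Obj C"
      and t: "\<iota> 0 \<in> Hom C A X" "\<pi> 0 \<in> Hom C X A" "\<iota> (Suc 0) \<in> Hom C B X" "\<pi> (Suc 0) \<in> Hom C X B"
      and e: "\<pi> 0 \<cdot> \<iota> 0 = Ident C A" "\<pi> (Suc 0) \<cdot> \<iota> 0 = ZeroArr C A B" "\<pi> 0 \<cdot> \<iota> (Suc 0) = ZeroArr C B A"
        "\<pi> (Suc 0) \<cdot> \<iota> (Suc 0) = Ident C B"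
      and s: "finsum (hom_module C X X) (\<lambda>i. \<iota> i \<cdot> \<pi> i) {..<Suc (Suc 0)} = Ident C X"
      unfolding direct_sum_def by (auto simp: two simp del: Hom_iff)
    have "\<iota> 0 \<cdot> \<pi> 0 \<boxplus> \<iota> (Suc 0) \<cdot> \<pi> (Suc 0) = Ident C X"
      using s sum[of "\<lambda>i. \<iota> i \<cdot> \<pi> i"] t ob by simp
    then show ?R using ob t e by blast
  next
    assume ?R
    then obtain i j p q where ob: "A \<in> Obj C" "B \<in> Obj C" "X \<in> Obj C"
      and t: "i \<in> Hom C A X" "j \<in> Hom C B X" "p \<in> Hom C X A" "q \<in> Hom C X B"
      and e: "p \<cdot> i = Ident C A" "q \<cdot> j = Ident C B" "p \<cdot> j = ZeroArr C B A" "q \<cdot> i = ZeroArr C A B"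
      and s: "i \<cdot> p \<boxplus> j \<cdot> q = Ident C X" by blast
    define \<iota> where "\<iota> k = (if k = 0 then i else j)" for k :: nat
    define \<pi> where "\<pi> k = (if k = 0 then p else q)" for k :: nat
    have "finsum (hom_module C X X) (\<lambda>i. \<iota> i \<cdot> \<pi> i) {..<Suc (Suc 0)} = Ident C X"
      using sum[of "\<lambda>i. \<iota> i \<cdot> \<pi> i"] t ob s by (simp add: \<iota>_def \<pi>_def)
    then show ?L
      unfolding direct_sum_def using ob t e
      by (intro conjI exI[of _ \<iota>] exI[of _ \<pi>]) (auto simp: two \<iota>_def \<pi>_def)
  qed
qed

text \<open>\<open>B\<close> is the image of \<open>e\<close>; the two equations force
  \<open>e\<close> to be idempotent.\<close>

definition split_idempotent where
  "split_idempotent Z e B \<longleftrightarrow> B \<in> Obj C \<and> (\<exists>i\<in>Hom C B Z. \<exists>p\<in>Hom C Z B. p \<cdot> i = Ident C B \<and> i \<cdot> p = e)"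

text \<open>The nonunits of the ring are the endomorphisms that are not invertible arrows. They form
  an ideal, and it cannot contain both \<open>f\<close> and \<open>1 - f\<close>, whose sum is the
  identity.\<close>

lemma local_ring_iso:
  assumes A: "A \<in> Obj C" and loc: "local_ring (hom_module C A A)"
  shows "\<lbrakk>f \<in> Hom C A A; g \<in> Hom C A A; \<not> iso_arr C A A f\<rbrakk> \<Longrightarrow> \<not> iso_arr C A A (f \<cdot> g)"
    and "\<lbrakk>f \<in> Hom C A A; \<not> iso_arr C A A f\<rbrakk> \<Longrightarrow> iso_arr C A A (Ident C A \<boxplus> neg f)"
proof -
  let ?H = "hom_module C A A"
  have un: "f \<in> carrier ?H - Units ?H \<longleftrightarrow> f \<in> Hom C A A \<and> \<not> iso_arr C A A f" for f
    unfolding Units_def iso_arr_def by (auto simp del: Hom_iff)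
  interpret I: ideal "carrier ?H - Units ?H" ?H using loc unfolding local_ring_def by blast
  show "\<lbrakk>f \<in> Hom C A A; g \<in> Hom C A A; \<not> iso_arr C A A f\<rbrakk> \<Longrightarrow> \<not> iso_arr C A A (f \<cdot> g)" for f g
    using I.I_r_closed[of f g] unfolding un by (simp del: Hom_iff)
  show "iso_arr C A A (Ident C A \<boxplus> neg f)" if f: "f \<in> Hom C A A" "\<not> iso_arr C A A f" for f
  proof (rule ccontr)
    assume "\<not> ?thesis"
    then have "f \<boxplus> (Ident C A \<boxplus> neg f) \<in> carrier ?H - Units ?H"
      using additive_subgroup.a_closed[OF I.additive_subgroup_axioms, unfolded un, of f "Ident C A \<boxplus> neg f"] f A
      unfolding un by simp
    moreover have "f \<boxplus> (Ident C A \<boxplus> neg f) = Ident C A \<boxplus> (f \<boxplus> neg f)"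
      using f A by (intro add_left_comm_arrow) auto
    ultimately show False using f A iso_arr_Ident[OF A] unfolding un by simp
  qed
qed

end

section \<open>Functors and triangles\<close>

lemma is_functorD:
  assumes "is_functor C D F"
  shows "X \<in> Obj C \<Longrightarrow> fob F X \<in> Obj D"
    and "\<lbrakk>f \<in> Hom C X Y; X \<in> Obj C; Y \<in> Obj C\<rbrakk> \<Longrightarrow> far F f \<in> Hom D (fob F X) (fob F Y)"
    and "X \<in> Obj C \<Longrightarrow> far F (Ident C X) = Ident D (fob F X)"
    and "\<lbrakk>f \<in> Hom C X Y; g \<in> Hom C Y Z; X \<in> Obj C; Y \<in> Obj C; Z \<in> Obj C\<rbrakk> \<Longrightarrow>
      far F (g \<bullet>\<^bsub>C\<^esub> f) = far F g \<bullet>\<^bsub>D\<^esub> far F f"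
  using assms unfolding is_functor_def by blast+

lemma is_functor_comp:
  assumes F: "is_functor C D F" and G: "is_functor D B G"
  shows "is_functor C B (comp_func G F)"
proof -
  note F' = is_functorD[OF F] and G' = is_functorD[OF G]
  show ?thesis
    unfolding is_functor_def comp_func_def
    by (intro conjI ballI)
      (simp_all add: F'(1,3) G'(1,3) G'(2)[OF F'(2)] F'(4) G'(4)[OF F'(2) F'(2)])
qed

section \<open>Equivalences as fully faithful, essentially surjective functors\<close>

lemma equivalence_faithful:
  assumes "category C" and "category D" and F: "is_functor C D F" and G: "is_functor D C G"
    and \<alpha>: "nat_iso C C id_func (comp_func G F) \<alpha>"
    and f: "f \<in> Hom C X Y" "f' \<in> Hom C X Y" and eq: "far F f = far F f'"
  shows "f = f'"
proof -
  interpret C: category C by fact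
  note XY = C.Dom_Obj[OF f(1)] C.Cod_Obj[OF f(1)]
  have nat: "\<alpha> Y \<bullet>\<^bsub>C\<^esub> f = far G (far F f) \<bullet>\<^bsub>C\<^esub> \<alpha> X" if "f \<in> Hom C X Y" for f
    using \<alpha> that XY unfolding nat_iso_def id_func_def comp_func_def by (simp del: C.Hom_iff)
  have "iso_arr C Y (fob G (fob F Y)) (\<alpha> Y)"
    using \<alpha> XY unfolding nat_iso_def id_func_def comp_func_def by simp
  then obtain \<beta> where \<beta>: "\<alpha> Y \<in> Hom C Y (fob G (fob F Y))" "\<beta> \<in> Hom C (fob G (fob F Y)) Y" "\<beta> \<bullet>\<^bsub>C\<^esub> \<alpha> Y = Ident C Y"
    by (rule C.iso_arrE)
  have "f = \<beta> \<bullet>\<^bsub>C\<^esub> (\<alpha> Y \<bullet>\<^bsub>C\<^esub> f)" using C.comp_eq_comp[OF \<beta>(3)] \<beta> f XY by simp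
  also have "\<dots> = \<beta> \<bullet>\<^bsub>C\<^esub> (\<alpha> Y \<bullet>\<^bsub>C\<^esub> f')" using nat[OF f(1)] nat[OF f(2)] eq by simp
  also have "\<dots> = f'" using C.comp_eq_comp[OF \<beta>(3)] \<beta> f XY by simp
  finally show ?thesis .
qed

text \<open>For fullness, \<open>h\<close> is lifted to \<open>G h\<close> conjugated by
  \<open>\<alpha>\<close>. That \<open>F\<close> sends this lift to \<open>h\<close> is tested after
  applying \<open>G\<close>, which is faithful because of \<open>\<beta>\<close>.\<close>

lemma equivalence_fully_faithful:
  assumes C: "category C" and D: "category D" and eq: "is_equivalence C D F"
  shows "\<lbrakk>f \<in> Hom C X Y; f' \<in> Hom C X Y; far F f = far F f'\<rbrakk> \<Longrightarrow> f = f'"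
    and "\<lbrakk>h \<in> Hom D (fob F X) (fob F Y); X \<in> Obj C; Y \<in> Obj C\<rbrakk> \<Longrightarrow> \<exists>f\<in>Hom C X Y. far F f = h"
    and "Y' \<in> Obj D \<Longrightarrow> \<exists>X\<in>Obj C. \<exists>f. iso_arr D (fob F X) Y' f"
proof -
  interpret C: category C by fact
  interpret D: category D by fact
  obtain G \<alpha> \<beta> where F: "is_functor C D F" and G: "is_functor D C G"
    and \<alpha>: "nat_iso C C id_func (comp_func G F) \<alpha>" and \<beta>: "nat_iso D D (comp_func F G) id_func \<beta>"
    using eq unfolding is_equivalence_def by blast
  show faithful: "f = f'" if "f \<in> Hom C X Y" "f' \<in> Hom C X Y" "far F f = far F f'" for f f' X Y
    by (rule equivalence_faithful[OF C D F G \<alpha> that])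
  show "\<exists>X\<in>Obj C. \<exists>f. iso_arr D (fob F X) Y' f" if "Y' \<in> Obj D"
    using \<beta> is_functorD(1)[OF G that] that unfolding nat_iso_def id_func_def comp_func_def by auto
  have G_faithful: "g = g'" if g: "g \<in> Hom D X Y" "g' \<in> Hom D X Y" "far G g = far G g'" for g g' X Y
  proof -
    note XY = D.Dom_Obj[OF g(1)] D.Cod_Obj[OF g(1)]
    have nat: "\<beta> Y \<bullet>\<^bsub>D\<^esub> far F (far G g) = g \<bullet>\<^bsub>D\<^esub> \<beta> X" if "g \<in> Hom D X Y" for g
      using \<beta> that XY unfolding nat_iso_def id_func_def comp_func_def by (simp del: D.Hom_iff)
    have "iso_arr D (fob F (fob G X)) X (\<beta> X)"
      using \<beta> XY unfolding nat_iso_def id_func_def comp_func_def by simp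
    then obtain \<gamma> where \<gamma>: "\<beta> X \<in> Hom D (fob F (fob G X)) X" "\<gamma> \<in> Hom D X (fob F (fob G X))" "\<beta> X \<bullet>\<^bsub>D\<^esub> \<gamma> = Ident D X"
      by (rule D.iso_arrE)
    have "g = g \<bullet>\<^bsub>D\<^esub> \<beta> X \<bullet>\<^bsub>D\<^esub> \<gamma>" using \<gamma> g XY by simp
    also have "\<dots> = g' \<bullet>\<^bsub>D\<^esub> \<beta> X \<bullet>\<^bsub>D\<^esub> \<gamma>" using nat[OF g(1)] nat[OF g(2)] g(3) by simp
    also have "\<dots> = g'" using \<gamma> g XY by simp
    finally show ?thesis .
  qed
  show "\<exists>f\<in>Hom C X Y. far F f = h" if h: "h \<in> Hom D (fob F X) (fob F Y)" and XY: "X \<in> Obj C" "Y \<in> Obj C"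
  proof -
    have "iso_arr C Y (fob G (fob F Y)) (\<alpha> Y)" "iso_arr C X (fob G (fob F X)) (\<alpha> X)"
      using \<alpha> XY unfolding nat_iso_def id_func_def comp_func_def by simp_all
    then obtain y x where y: "\<alpha> Y \<in> Hom C Y (fob G (fob F Y))" "y \<in> Hom C (fob G (fob F Y)) Y" "\<alpha> Y \<bullet>\<^bsub>C\<^esub> y = Ident C (fob G (fob F Y))"
      and x: "\<alpha> X \<in> Hom C X (fob G (fob F X))" "x \<in> Hom C (fob G (fob F X)) X" "\<alpha> X \<bullet>\<^bsub>C\<^esub> x = Ident C (fob G (fob F X))"
      unfolding iso_arr_def by blast
    have FXY: "fob F X \<in> Obj D" "fob F Y \<in> Obj D" using is_functorD(1)[OF F] XY by auto
    have Gh: "far G h \<in> Hom C (fob G (fob F X)) (fob G (fob F Y))" using is_functorD(2)[OF G h FXY] .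
    define f where "f = y \<bullet>\<^bsub>C\<^esub> (far G h \<bullet>\<^bsub>C\<^esub> \<alpha> X)"
    have f: "f \<in> Hom C X Y" using x y Gh by (simp add: f_def)
    have GFf: "far G (far F f) \<in> Hom C (fob G (fob F X)) (fob G (fob F Y))"
      using is_functorD(2)[OF G is_functorD(2)[OF F f XY] FXY] .
    have ob: "fob G (fob F X) \<in> Obj C" using C.Cod_Obj[OF x(1)] .
    have "far G (far F f) = far G (far F f) \<bullet>\<^bsub>C\<^esub> (\<alpha> X \<bullet>\<^bsub>C\<^esub> x)" using x(3) GFf by simp
    also have "\<dots> = (far G (far F f) \<bullet>\<^bsub>C\<^esub> \<alpha> X) \<bullet>\<^bsub>C\<^esub> x" using x GFf by simp
    also have "far G (far F f) \<bullet>\<^bsub>C\<^esub> \<alpha> X = \<alpha> Y \<bullet>\<^bsub>C\<^esub> f"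
      using \<alpha> f XY unfolding nat_iso_def id_func_def comp_func_def by (simp del: C.Hom_iff)
    also have "\<dots> = far G h \<bullet>\<^bsub>C\<^esub> \<alpha> X"
      unfolding f_def using C.comp_eq_comp[OF y(3)] y x Gh by simp
    also have "\<dots> \<bullet>\<^bsub>C\<^esub> x = far G h" using x Gh by simp
    finally have "far G (far F f) = far G h" .
    then have "far F f = h" using G_faithful[OF is_functorD(2)[OF F f XY] h] by blast
    then show ?thesis using f by blast
  qed
qed

text \<open>Objects, isomorphisms and preimages of arrows are chosen. \<open>m g\<close> is
  \<open>g\<close> conjugated by the chosen isomorphisms and \<open>G g\<close> is its preimage; the
  laws of \<open>G\<close> and the claims on \<open>\<alpha>\<close> are checked after applying the
  faithful \<open>F\<close>.\<close>

lemma equivalence_if_fully_faithful: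
  assumes C: "category C" and D: "category D" and F: "is_functor C D F"
    and faithful: "\<And>X Y f f'. \<lbrakk>f \<in> Hom C X Y; f' \<in> Hom C X Y; far F f = far F f'\<rbrakk> \<Longrightarrow> f = f'"
    and full: "\<And>X Y h. \<lbrakk>h \<in> Hom D (fob F X) (fob F Y); X \<in> Obj C; Y \<in> Obj C\<rbrakk> \<Longrightarrow> \<exists>f\<in>Hom C X Y. far F f = h"
    and surj: "\<And>Y. Y \<in> Obj D \<Longrightarrow> \<exists>X\<in>Obj C. \<exists>f. iso_arr D (fob F X) Y f"
  shows "is_equivalence C D F"
proof -
  interpret C: category C by fact
  interpret D: category D by fact
  have "\<exists>X \<beta> \<gamma>. X \<in> Obj C \<and> \<beta> \<in> Hom D (fob F X) Y \<and> \<gamma> \<in> Hom D Y (fob F X) \<and>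
      \<gamma> \<bullet>\<^bsub>D\<^esub> \<beta> = Ident D (fob F X) \<and> \<beta> \<bullet>\<^bsub>D\<^esub> \<gamma> = Ident D Y" if "Y \<in> Obj D" for Y
    using surj[OF that] unfolding iso_arr_def by blast
  then obtain G0 \<beta> \<gamma> where G0: "\<And>Y. Y \<in> Obj D \<Longrightarrow> G0 Y \<in> Obj C"
    and \<beta>: "\<And>Y. Y \<in> Obj D \<Longrightarrow> \<beta> Y \<in> Hom D (fob F (G0 Y)) Y"
    and \<gamma>: "\<And>Y. Y \<in> Obj D \<Longrightarrow> \<gamma> Y \<in> Hom D Y (fob F (G0 Y))"
    and \<gamma>\<beta>: "\<And>Y. Y \<in> Obj D \<Longrightarrow> \<gamma> Y \<bullet>\<^bsub>D\<^esub> \<beta> Y = Ident D (fob F (G0 Y))"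
    and \<beta>\<gamma>: "\<And>Y. Y \<in> Obj D \<Longrightarrow> \<beta> Y \<bullet>\<^bsub>D\<^esub> \<gamma> Y = Ident D Y"
    by metis
  define P where "P X Y h = (SOME f. f \<in> Hom C X Y \<and> far F f = h)" for X Y h
  have P: "P X Y h \<in> Hom C X Y" "far F (P X Y h) = h"
    if "h \<in> Hom D (fob F X) (fob F Y)" "X \<in> Obj C" "Y \<in> Obj C" for X Y h
    using someI_ex[of "\<lambda>f. f \<in> Hom C X Y \<and> far F f = h"] full[OF that] unfolding P_def by blast+
  note F' = is_functorD[OF F]
  define m where "m g = \<gamma> (Cod D g) \<bullet>\<^bsub>D\<^esub> (g \<bullet>\<^bsub>D\<^esub> \<beta> (Dom D g))" for g
  define G where "G = \<lparr>fob = G0, far = (\<lambda>g. P (G0 (Dom D g)) (G0 (Cod D g)) (m g))\<rparr>"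
  have Gob: "fob G Y = G0 Y" for Y by (simp add: G_def)
  have m: "m g \<in> Hom D (fob F (G0 X)) (fob F (G0 Y))" if "g \<in> Hom D X Y" for g X Y
    using that \<gamma>[of Y] \<beta>[of X] D.Dom_Obj[OF that] D.Cod_Obj[OF that] by (simp add: m_def)
  have Gar: "far G g \<in> Hom C (G0 X) (G0 Y)" "far F (far G g) = m g" if "g \<in> Hom D X Y" for g X Y
    using P[OF m[OF that]] G0 D.Dom_Obj[OF that] D.Cod_Obj[OF that] that unfolding G_def by auto
  have Gfun: "is_functor D C G"
    unfolding is_functor_def
  proof (intro conjI ballI)
    fix X assume X: "X \<in> Obj D"
    show "fob G X \<in> Obj C" using G0 X by (simp add: Gob)
    have I: "Ident D X \<in> Hom D X X" using X by simp
    have "far F (far G (Ident D X)) = far F (Ident C (G0 X))"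
      using Gar(2)[OF I] \<beta>[OF X] \<gamma>\<beta>[OF X] X F'(3)[OF G0[OF X]] by (simp add: m_def)
    then show "far G (Ident D X) = Ident C (fob G X)"
      using faithful[OF Gar(1)[OF I], of "Ident C (G0 X)"] G0[OF X] by (simp add: Gob)
  next
    fix X Y f assume "X \<in> Obj D" "Y \<in> Obj D" "f \<in> Hom D X Y"
    then show "far G f \<in> Hom C (fob G X) (fob G Y)" using Gar by (simp add: Gob)
  next
    fix X Y Z f g assume ob: "X \<in> Obj D" "Y \<in> Obj D" "Z \<in> Obj D" and fg: "f \<in> Hom D X Y" "g \<in> Hom D Y Z"
    have gf: "g \<bullet>\<^bsub>D\<^esub> f \<in> Hom D X Z" using fg by simp
    have GG: "far G g \<bullet>\<^bsub>C\<^esub> far G f \<in> Hom C (G0 X) (G0 Z)" using Gar(1)[OF fg(1)] Gar(1)[OF fg(2)] by simp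
    have "far F (far G g \<bullet>\<^bsub>C\<^esub> far G f) = m g \<bullet>\<^bsub>D\<^esub> m f"
      using F'(4)[OF Gar(1)[OF fg(1)] Gar(1)[OF fg(2)]] Gar(2)[OF fg(1)] Gar(2)[OF fg(2)] G0 ob by simp
    also have "\<dots> = m (g \<bullet>\<^bsub>D\<^esub> f)"
      using \<beta>[OF ob(1)] \<beta>[OF ob(2)] \<gamma>[OF ob(2)] \<gamma>[OF ob(3)] fg ob D.comp_eq_comp[OF \<beta>\<gamma>[OF ob(2)], of "f \<bullet>\<^bsub>D\<^esub> \<beta> X"]
      by (simp add: m_def)
    finally have "far F (far G (g \<bullet>\<^bsub>D\<^esub> f)) = far F (far G g \<bullet>\<^bsub>C\<^esub> far G f)" using Gar(2)[OF gf] by simp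
    then show "far G (g \<bullet>\<^bsub>D\<^esub> f) = far G g \<bullet>\<^bsub>C\<^esub> far G f" using faithful[OF Gar(1)[OF gf] GG] by blast
  qed
  have compF: "is_functor C C (comp_func G F)" "is_functor D D (comp_func F G)"
    "is_functor C C id_func" "is_functor D D id_func"
    using is_functor_comp[OF F Gfun] is_functor_comp[OF Gfun F]
    by (simp_all add: is_functor_def id_func_def del: C.Hom_iff D.Hom_iff)
  have \<beta>iso: "nat_iso D D (comp_func F G) id_func \<beta>"
    unfolding nat_iso_def
  proof (intro conjI ballI compF)
    fix X assume X: "X \<in> Obj D"
    show "iso_arr D (fob (comp_func F G) X) (fob id_func X) (\<beta> X)"
      using \<beta>[OF X] \<gamma>[OF X] \<gamma>\<beta>[OF X] \<beta>\<gamma>[OF X] unfolding iso_arr_def by (auto simp: comp_func_def id_func_def Gob)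
  next
    fix X Y f assume ob: "X \<in> Obj D" "Y \<in> Obj D" and f: "f \<in> Hom D X Y"
    show "\<beta> Y \<bullet>\<^bsub>D\<^esub> far (comp_func F G) f = far id_func f \<bullet>\<^bsub>D\<^esub> \<beta> X"
      using Gar(2)[OF f] D.comp_eq_comp[OF \<beta>\<gamma>[OF ob(2)], of "f \<bullet>\<^bsub>D\<^esub> \<beta> X"] \<beta>[OF ob(1)] \<beta>[OF ob(2)] \<gamma>[OF ob(2)] f
      by (simp add: comp_func_def id_func_def m_def)
  qed
  define \<alpha> where "\<alpha> X = P X (G0 (fob F X)) (\<gamma> (fob F X))" for X
  have \<alpha>: "\<alpha> X \<in> Hom C X (G0 (fob F X))" "far F (\<alpha> X) = \<gamma> (fob F X)" if X: "X \<in> Obj C" for X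
    using P[OF \<gamma>[OF F'(1)[OF X]] X G0[OF F'(1)[OF X]]] unfolding \<alpha>_def .
  have \<alpha>iso: "nat_iso C C id_func (comp_func G F) \<alpha>"
    unfolding nat_iso_def
  proof (intro conjI ballI compF)
    fix X assume X: "X \<in> Obj C"
    note FX = F'(1)[OF X] and GFX = G0[OF F'(1)[OF X]]
    define \<alpha>' where "\<alpha>' = P (G0 (fob F X)) X (\<beta> (fob F X))"
    have \<alpha>': "\<alpha>' \<in> Hom C (G0 (fob F X)) X" "far F \<alpha>' = \<beta> (fob F X)"
      using P[OF \<beta>[OF FX] GFX X] unfolding \<alpha>'_def .
    have "far F (\<alpha>' \<bullet>\<^bsub>C\<^esub> \<alpha> X) = far F (Ident C X)"
      using F'(4)[OF \<alpha>(1)[OF X] \<alpha>'(1) X GFX X] F'(3)[OF X] \<alpha>(2)[OF X] \<alpha>'(2) \<beta>\<gamma>[OF FX] by simp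
    then have 1: "\<alpha>' \<bullet>\<^bsub>C\<^esub> \<alpha> X = Ident C X" using faithful[of "\<alpha>' \<bullet>\<^bsub>C\<^esub> \<alpha> X" X X "Ident C X"] \<alpha>(1)[OF X] \<alpha>'(1) X by simp
    have "far F (\<alpha> X \<bullet>\<^bsub>C\<^esub> \<alpha>') = far F (Ident C (G0 (fob F X)))"
      using F'(4)[OF \<alpha>'(1) \<alpha>(1)[OF X] GFX X GFX] F'(3)[OF GFX] \<alpha>(2)[OF X] \<alpha>'(2) \<gamma>\<beta>[OF FX] by simp
    then have "\<alpha> X \<bullet>\<^bsub>C\<^esub> \<alpha>' = Ident C (G0 (fob F X))"
      using faithful[of "\<alpha> X \<bullet>\<^bsub>C\<^esub> \<alpha>'" "G0 (fob F X)" "G0 (fob F X)" "Ident C (G0 (fob F X))"] \<alpha>(1)[OF X] \<alpha>'(1) GFX by simp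
    then show "iso_arr C (fob id_func X) (fob (comp_func G F) X) (\<alpha> X)"
      using 1 \<alpha>(1)[OF X] \<alpha>'(1) by (auto simp: comp_func_def id_func_def Gob intro!: C.iso_arrI[of _ _ _ \<alpha>'])
  next
    fix X Y f assume ob: "X \<in> Obj C" "Y \<in> Obj C" and f: "f \<in> Hom C X Y"
    note FX = F'(1)[OF ob(1)] and GFX = G0[OF F'(1)[OF ob(1)]] and FY = F'(1)[OF ob(2)] and GFY = G0[OF F'(1)[OF ob(2)]]
    note Ff = F'(2)[OF f ob]
    have t: "\<alpha> Y \<bullet>\<^bsub>C\<^esub> f \<in> Hom C X (G0 (fob F Y))" "far G (far F f) \<bullet>\<^bsub>C\<^esub> \<alpha> X \<in> Hom C X (G0 (fob F Y))"
      using \<alpha>(1)[OF ob(1)] \<alpha>(1)[OF ob(2)] f Gar(1)[OF Ff] by simp_all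
    have "far F (far G (far F f) \<bullet>\<^bsub>C\<^esub> \<alpha> X) = m (far F f) \<bullet>\<^bsub>D\<^esub> \<gamma> (fob F X)"
      using F'(4)[OF \<alpha>(1)[OF ob(1)] Gar(1)[OF Ff] ob(1) GFX GFY] Gar(2)[OF Ff] \<alpha>(2)[OF ob(1)] by simp
    also have "\<dots> = \<gamma> (fob F Y) \<bullet>\<^bsub>D\<^esub> far F f"
      using Ff \<gamma>[OF FX] \<gamma>[OF FY] \<beta>[OF FX] \<beta>\<gamma>[OF FX] by (simp add: m_def)
    also have "\<dots> = far F (\<alpha> Y \<bullet>\<^bsub>C\<^esub> f)"
      using F'(4)[OF f \<alpha>(1)[OF ob(2)] ob GFY] \<alpha>(2)[OF ob(2)] by simp
    finally show "\<alpha> Y \<bullet>\<^bsub>C\<^esub> far id_func f = far (comp_func G F) f \<bullet>\<^bsub>C\<^esub> \<alpha> X"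
      using faithful[OF t] by (simp add: comp_func_def id_func_def)
  qed
  show ?thesis unfolding is_equivalence_def using F Gfun \<alpha>iso \<beta>iso by blast
qed

lemma (in category) full_subcat_Hom:
  "\<lbrakk>X \<in> A; Y \<in> A\<rbrakk> \<Longrightarrow> Hom (full_subcat C A) X Y = Hom C X Y"
  by (auto simp: Hom_def full_subcat_def)

lemma full_subcat_simps [simp]:
  "Obj (full_subcat C A) = A" "Ident (full_subcat C A) = Ident C" "Comp (full_subcat C A) = Comp C"
  "Dom (full_subcat C A) = Dom C" "Cod (full_subcat C A) = Cod C"
  "Arr (full_subcat C A) = {f \<in> Arr C. Dom C f \<in> A \<and> Cod C f \<in> A}"
  by (simp_all add: full_subcat_def)

section \<open>First consequences of the triangle axioms\<close>

context linear_triangulated_category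
begin

abbreviation compose_T (infixl \<open>\<cdot>\<close> 70) where "g \<cdot> f \<equiv> Comp T g f"
abbreviation add_T (infixl \<open>\<boxplus>\<close> 65) where "f \<boxplus> g \<equiv> AddArr T f g"
abbreviation sh where "sh \<equiv> fob (Shift T)"
abbreviation shf where "shf \<equiv> far (Shift T)"

lemma Shift_functor: "is_functor T T (Shift T)"
  using Shift_linear unfolding linear_functor_def by blast

lemma shift_typing [simp]:
  "X \<in> Obj T \<Longrightarrow> sh X \<in> Obj T" "f \<in> Arr T \<Longrightarrow> shf f \<in> Arr T" "f \<in> Arr T \<Longrightarrow> Dom T (shf f) = sh (Dom T f)"
  "f \<in> Arr T \<Longrightarrow> Cod T (shf f) = sh (Cod T f)"
  using is_functorD(1)[OF Shift_functor] is_functorD(2)[OF Shift_functor, of f "Dom T f" "Cod T f"]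
    Dom_closed[of f] Cod_closed[of f] by simp_all

lemma shift_Ident [simp]: "X \<in> Obj T \<Longrightarrow> shf (Ident T X) = Ident T (sh X)"
  by (rule is_functorD(3)[OF Shift_functor])

lemma shift_comp [simp]:
  "\<lbrakk>f \<in> Arr T; g \<in> Arr T; Cod T f = Dom T g\<rbrakk> \<Longrightarrow> shf (g \<cdot> f) = shf g \<cdot> shf f"
  using is_functorD(4)[OF Shift_functor, of f "Dom T f" "Cod T f" g "Cod T g"] Dom_closed Cod_closed by simp

lemma shift_linear [simp]:
  "\<lbrakk>f \<in> Arr T; g \<in> Arr T; Dom T f = Dom T g; Cod T f = Cod T g\<rbrakk> \<Longrightarrow> shf (f \<boxplus> g) = shf f \<boxplus> shf g"
  "\<lbrakk>r \<in> carrier R; f \<in> Arr T\<rbrakk> \<Longrightarrow> shf (SmultArr T r f) = SmultArr T r (shf f)"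
proof -
  have "shf \<in> linear_maps R (hom_module T (Dom T f) (Cod T f)) (hom_module T (sh (Dom T f)) (sh (Cod T f)))"
    if "f \<in> Arr T" for f
    using Shift_linear that Dom_closed Cod_closed unfolding linear_functor_def by blast
  note s = linear_mapsD[OF this]
  show "\<lbrakk>f \<in> Arr T; g \<in> Arr T; Dom T f = Dom T g; Cod T f = Cod T g\<rbrakk> \<Longrightarrow> shf (f \<boxplus> g) = shf f \<boxplus> shf g"
    "\<lbrakk>r \<in> carrier R; f \<in> Arr T\<rbrakk> \<Longrightarrow> shf (SmultArr T r f) = SmultArr T r (shf f)"
    using s(2)[of f f g] s(3)[of f r f] by simp_all
qed

lemma shift_neg [simp]: "f \<in> Arr T \<Longrightarrow> shf (neg f) = neg (shf f)"
  by (simp add: neg_def)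

lemma shift_zero [simp]: "\<lbrakk>X \<in> Obj T; Y \<in> Obj T\<rbrakk> \<Longrightarrow> shf (ZeroArr T X Y) = ZeroArr T (sh X) (sh Y)"
  using shift_linear(2)[of "\<zero>\<^bsub>R\<^esub>" "ZeroArr T X Y"] by (simp add: zero_smult)

lemma shift_faithful: "\<lbrakk>f \<in> Hom T X Y; g \<in> Hom T X Y; shf f = shf g\<rbrakk> \<Longrightarrow> f = g"
  and shift_full: "\<lbrakk>h \<in> Hom T (sh X) (sh Y); X \<in> Obj T; Y \<in> Obj T\<rbrakk> \<Longrightarrow> \<exists>f\<in>Hom T X Y. shf f = h"
  and shift_surj: "Y' \<in> Obj T \<Longrightarrow> \<exists>X\<in>Obj T. \<exists>f. iso_arr T (sh X) Y' f"
  using equivalence_fully_faithful[OF category_axioms category_axioms Shift_equivalence] by blast+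

lemma zero_object_exists: "\<exists>N. zero_object T N"
proof -
  obtain N where N: "direct_sum T [] N" using direct_sums_exist[of "[]"] by auto
  then have ob: "N \<in> Obj T" unfolding direct_sum_def by blast
  interpret H: module R "hom_module T N N" using ob by (intro hom_is_module)
  have "Ident T N = ZeroArr T N N" using N unfolding direct_sum_def by simp
  then show ?thesis using ob zero_object_iff by blast
qed

lemma zero_object_shift: "zero_object T N \<Longrightarrow> zero_object T (sh N)"
  using shift_Ident[of N] by (simp add: zero_object_iff)

lemma dist_triangleD:
  assumes "dist_triangle T X Y Z u v w"
  shows "X \<in> Obj T" "Y \<in> Obj T" "Z \<in> Obj T" "u \<in> Hom T X Y" "v \<in> Hom T Y Z" "w \<in> Hom T Z (sh X)"
  using assms unfolding dist_triangle_def triangle_def by blast+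

lemma rotate:
  assumes "dist_triangle T X Y Z u v w"
  shows "dist_triangle T Y Z (sh X) v w (neg (shf u))"
proof -
  have "triangle T X Y Z u v w" using assms unfolding dist_triangle_def by blast
  then show ?thesis
    using TR2[of X Y Z u v w] assms a_inv_hom_module[of "shf u" "sh X" "sh Y"] dist_triangleD(4)[OF assms] by simp
qed

lemma unrotate:
  assumes "X \<in> Obj T" "u \<in> Hom T X Y" and "dist_triangle T Y Z (sh X) v w (neg (shf u))"
  shows "dist_triangle T X Y Z u v w"
proof -
  have "triangle T X Y Z u v w" using assms dist_triangleD[OF assms(3)] unfolding triangle_def by blast
  then show ?thesis
    using TR2[of X Y Z u v w] assms a_inv_hom_module[of "shf u" "sh X" "sh Y"] by simp
qed

text \<open>TR3 maps the triangle \<open>X \<rightarrow> X \<rightarrow> 0\<close> to the given one,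
  so \<open>v u\<close> factors through a zero object.\<close>

lemma triangle_comp_zero:
  assumes t: "dist_triangle T X Y Z u v w"
  shows "v \<cdot> u = ZeroArr T X Z"
proof -
  note t' = dist_triangleD[OF t]
  obtain N where N: "zero_object T N" using zero_object_exists by blast
  then have No: "N \<in> Obj T" by (simp add: zero_object_iff)
  obtain h where h: "h \<in> Hom T N Z" "h \<cdot> ZeroArr T X N = v \<cdot> u"
    using TR3[OF TR1_ident[OF t'(1) N] t, of "Ident T X" u] t' by auto
  then show ?thesis using t' No by simp
qed

text \<open>TR3, applied to a square from the given triangle to
  \<open>0 \<rightarrow> P \<rightarrow> P\<close>.\<close>

lemma weak_cokernel:
  assumes t: "dist_triangle T X Y Z u v w" and f: "f \<in> Hom T Y P" "f \<cdot> u = ZeroArr T X P"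
  shows "\<exists>f'\<in>Hom T Z P. f = f' \<cdot> v"
proof -
  note t' = dist_triangleD[OF t] and P = Cod_Obj[OF f(1)]
  obtain N where N: "zero_object T N" using zero_object_exists by blast
  then have No: "N \<in> Obj T" by (simp add: zero_object_iff)
  \<comment> \<open>The target triangle arises by rotating back the one on the identity of
    \<open>P\<close>; for this the third object must literally be a shift, hence the zero object
    \<open>sh N\<close>.\<close>
  have "neg (shf (ZeroArr T N P)) = ZeroArr T (sh N) (sh P)" using No P by simp
  then have tP: "dist_triangle T N P P (ZeroArr T N P) (Ident T P) (ZeroArr T P (sh N))"
    using unrotate[of N "ZeroArr T N P" P P "Ident T P" "ZeroArr T P (sh N)"]
      TR1_ident[OF P zero_object_shift[OF N]] No P by simp
  have "f \<cdot> u = ZeroArr T N P \<cdot> ZeroArr T X N" using f t' No P by simp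
  moreover have "ZeroArr T X N \<in> Hom T X N" using t' No by simp
  ultimately obtain h where h: "h \<in> Hom T Z P" "h \<cdot> v = Ident T P \<cdot> f"
    using TR3[OF t tP _ f(1)] by blast
  then show ?thesis using f by (intro bexI[of _ h]) simp_all
qed

text \<open>TR3 produces only third arrows, so it is applied to rotated triangles, starting from
  \<open>P \<rightarrow> 0 \<rightarrow> P[1]\<close>; the resulting arrow
  \<open>P[1] \<rightarrow> X[1]\<close> is shifted back by fullness.\<close>

lemma weak_kernel:
  assumes t: "dist_triangle T X Y Z u v w" and g: "g \<in> Hom T P Y" "v \<cdot> g = ZeroArr T P Z"
  shows "\<exists>g'\<in>Hom T P X. g = u \<cdot> g'"
proof -
  note t' = dist_triangleD[OF t] and P = Dom_Obj[OF g(1)]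
  obtain N where N: "zero_object T N" using zero_object_exists by blast
  then have No: "N \<in> Obj T" by (simp add: zero_object_iff)
  have tP: "dist_triangle T P N (sh P) (ZeroArr T P N) (ZeroArr T N (sh P)) (neg (Ident T (sh P)))"
    using rotate[OF TR1_ident[OF P N]] P by simp
  obtain h where h: "h \<in> Hom T (sh P) (sh X)" "shf g \<cdot> neg (Ident T (sh P)) = neg (shf u) \<cdot> h"
    using TR3[OF tP rotate[OF t], of g "ZeroArr T N Z"] g t' No P by auto
  obtain g' where g': "g' \<in> Hom T P X" "shf g' = h" using shift_full[OF h(1) P t'(1)] by blast
  have "neg (shf g) = neg (shf (u \<cdot> g'))" using h g' t' g P by simp
  then have "neg (neg (shf g)) = neg (neg (shf (u \<cdot> g')))" by simp
  then have "shf g = shf (u \<cdot> g')" using g g' h t' by simp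
  then have "g = u \<cdot> g'" using shift_faithful[of g P Y "u \<cdot> g'"] g g' t' by simp
  then show ?thesis using g' by blast
qed

lemma weak_cokernel2:
  assumes t: "dist_triangle T X Y Z u v w" and f: "f \<in> Hom T Z P" "f \<cdot> v = ZeroArr T Y P"
  shows "\<exists>f'\<in>Hom T (sh X) P. f = f' \<cdot> w"
  using weak_cokernel[OF rotate[OF t] f] .

lemma weak_kernel2:
  assumes t: "dist_triangle T X Y Z u v w" and g: "g \<in> Hom T P Z" "w \<cdot> g = ZeroArr T P (sh X)"
  shows "\<exists>g'\<in>Hom T P Y. g = v \<cdot> g'"
  using weak_kernel[OF rotate[OF t] g] .

lemma triangle_comp_zero2: "dist_triangle T X Y Z u v w \<Longrightarrow> w \<cdot> v = ZeroArr T Y (sh X)"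
  using triangle_comp_zero rotate by blast

lemma neg_eq_zero:
  assumes "f \<in> Hom T X Y" and "neg f = ZeroArr T X Y"
  shows "f = ZeroArr T X Y"
proof -
  have "neg (neg f) = ZeroArr T X Y" using assms Dom_Obj[OF assms(1)] Cod_Obj[OF assms(1)] by simp
  then show ?thesis using assms(1) by simp
qed

lemma triangle_comp_zero3:
  assumes t: "dist_triangle T X Y Z u v w"
  shows "shf u \<cdot> w = ZeroArr T Z (sh Y)"
  using triangle_comp_zero2[OF rotate[OF t]] dist_triangleD[OF t] neg_eq_zero[of "shf u \<cdot> w" Z "sh Y"] by simp

lemma weak_kernel3:
  assumes t: "dist_triangle T X Y Z u v w" and g: "g \<in> Hom T P (sh X)" "shf u \<cdot> g = ZeroArr T P (sh Y)"
  shows "\<exists>g'\<in>Hom T P Z. g = w \<cdot> g'"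
  using weak_kernel2[OF rotate[OF t] g(1)] g dist_triangleD[OF t] Dom_Obj[OF g(1)] by simp

text \<open>The cone of \<open>f\<close> can be shifted back only up to isomorphism: it is replaced
  by an isomorphic \<open>V[1]\<close>, and \<open>p\<close> receives the sign that rotation
  introduces.\<close>

lemma cocone:
  assumes f: "f \<in> Hom T X Y"
  shows "\<exists>V p w. dist_triangle T V X Y p f w"
proof -
  note XY = Dom_Obj[OF f] Cod_Obj[OF f]
  obtain Z v w where t: "dist_triangle T X Y Z f v w" using TR1_cone[OF XY f] by blast
  note t' = dist_triangleD[OF t]
  obtain V i where V: "V \<in> Obj T" "iso_arr T (sh V) Z i" using shift_surj[OF t'(3)] by blast
  obtain j where i: "i \<in> Hom T (sh V) Z" "j \<in> Hom T Z (sh V)" "i \<cdot> j = Ident T Z" and j: "iso_arr T Z (sh V) j"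
    using V(2) by (rule iso_arrE)
  obtain p where p: "p \<in> Hom T V X" "shf p = neg (w \<cdot> i)" using shift_full[of "neg (w \<cdot> i)" V X] V XY t' i by auto
  have "dist_triangle T X Y (sh V) f (j \<cdot> v) (neg (shf p))"
  proof (rule TR1_iso[OF t _ iso_arr_Ident[OF XY(1)] iso_arr_Ident[OF XY(2)] j])
    show "triangle T X Y (sh V) f (j \<cdot> v) (neg (shf p))"
      unfolding triangle_def using XY V i t' p by simp
    show "shf (Ident T X) \<cdot> w = neg (shf p) \<cdot> j" using XY p t' i by simp
  qed (use XY f i t' in simp_all)
  then show ?thesis using unrotate[OF V(1) p(1)] by blast
qed

end

section \<open>Splitting idempotents\<close>

locale hom_finite_triangulated = linear_triangulated_category R T + matlis_dual R E
  for R :: "('r, 'k) ring_scheme" and T :: "('o, 'm, 'r, 'z) tcat_scheme" and E :: "('r, 'e, 'l) module_scheme" +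
  assumes hom_finite: "Hom_finite R T" and krull_schmidt: "Krull_Schmidt T"
begin

lemma hom_dcc: "\<lbrakk>X \<in> Obj T; Y \<in> Obj T\<rbrakk> \<Longrightarrow> dcc_on R (hom_module T X Y) (carrier (hom_module T X Y))"
  using hom_finite fin_gen_module_dcc[OF artinian_cring_axioms] unfolding Hom_finite_def by blast

text \<open>The descending chain condition on \<open>(X, Y)\<close>, applied to the submodules \<open>w \<circ> End(X)\<close>.\<close>
lemma minimal_comp_image:
  assumes "W w0" and W: "\<And>w. W w \<Longrightarrow> w \<in> Hom T X Y"
  obtains w where "W w" "\<And>h. \<lbrakk>h \<in> Hom T X X; W (w \<cdot> h)\<rbrakk> \<Longrightarrow> \<exists>k\<in>Hom T X X. w = (w \<cdot> h) \<cdot> k"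
proof -
  have X: "X \<in> Obj T" and Y: "Y \<in> Obj T" using Dom_Obj Cod_Obj W[OF assms(1)] by blast+
  interpret H: module R "hom_module T X Y" using X Y by (intro hom_is_module)
  define I where "I w = (\<lambda>h. w \<cdot> h) ` Hom T X X" for w
  have sub: "submodule (I w) R (hom_module T X Y)" if w: "w \<in> Hom T X Y" for w
    unfolding H.submodule_iff
  proof (intro conjI ballI)
    show "I w \<subseteq> carrier (hom_module T X Y)" using w by (auto simp: I_def)
    show "\<zero>\<^bsub>hom_module T X Y\<^esub> \<in> I w"
      unfolding I_def using w X by (intro image_eqI[of _ _ "ZeroArr T X X"]) simp_all
    fix x y assume "x \<in> I w" "y \<in> I w"
    then obtain a b where "a \<in> Hom T X X" "b \<in> Hom T X X" "x = w \<cdot> a" "y = w \<cdot> b" unfolding I_def by blast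
    then show "x \<oplus>\<^bsub>hom_module T X Y\<^esub> y \<in> I w"
      unfolding I_def using w by (intro image_eqI[of _ _ "a \<boxplus> b"]) simp_all
  next
    fix r x assume "r \<in> carrier R" "x \<in> I w"
    then obtain a where "r \<in> carrier R" "a \<in> Hom T X X" "x = w \<cdot> a" unfolding I_def by blast
    then show "r \<odot>\<^bsub>hom_module T X Y\<^esub> x \<in> I w"
      unfolding I_def using w by (intro image_eqI[of _ _ "SmultArr T r a"]) simp_all
  qed
  then have "I ` Collect W \<noteq> {} \<and>
      (\<forall>L\<in>I ` Collect W. submodule L R (hom_module T X Y) \<and> L \<subseteq> carrier (hom_module T X Y))"
    using assms unfolding H.submodule_iff by (auto simp del: Hom_iff)
  then have "\<exists>L\<in>I ` Collect W. \<forall>L'\<in>I ` Collect W. L' \<subseteq> L \<longrightarrow> L' = L"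
    using hom_dcc[OF X Y] unfolding dcc_on_def by (elim allE impE) assumption+
  then obtain w where w: "W w" and min: "\<And>w'. \<lbrakk>W w'; I w' \<subseteq> I w\<rbrakk> \<Longrightarrow> I w' = I w" by auto
  note wt = W[OF w]
  have "\<exists>k\<in>Hom T X X. w = (w \<cdot> h) \<cdot> k" if h: "h \<in> Hom T X X" "W (w \<cdot> h)" for h
  proof -
    have "I (w \<cdot> h) \<subseteq> I w"
    proof
      fix x assume "x \<in> I (w \<cdot> h)"
      then obtain k where "k \<in> Hom T X X" "x = (w \<cdot> h) \<cdot> k" unfolding I_def by blast
      then show "x \<in> I w" unfolding I_def using wt h by (intro image_eqI[of _ _ "h \<cdot> k"]) simp_all
    qed
    then have "I (w \<cdot> h) = I w" using min h by blast
    moreover have "w \<in> I w" unfolding I_def using wt X by (intro image_eqI[of _ _ "Ident T X"]) simp_all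
    ultimately show ?thesis unfolding I_def by blast
  qed
  then show thesis using that w by blast
qed

lemma split_idempotent_zero:
  assumes "Z \<in> Obj T"
  shows "\<exists>B. split_idempotent Z (ZeroArr T Z Z) B"
proof -
  obtain N where N: "zero_object T N" using zero_object_exists by blast
  then have "N \<in> Obj T" "Ident T N = ZeroArr T N N" by (simp_all add: zero_object_iff)
  then show ?thesis using assms unfolding split_idempotent_def
    by (intro exI[of _ N] conjI bexI[of _ "ZeroArr T N Z"] bexI[of _ "ZeroArr T Z N"]) simp_all
qed

text \<open>Decompose \<open>Z\<close> into objects \<open>A\<^sub>k\<close> with local endomorphism rings and components \<open>\<iota>\<^sub>k, \<pi>\<^sub>k\<close>. If no
  endomorphism \<open>\<pi>\<^sub>k e h e \<iota>\<^sub>k\<close> is invertible, each \<open>e \<iota>\<^sub>k \<pi>\<^sub>k e\<close> lies in the radical of \<open>e End(Z) e\<close>, and so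
  does their sum \<open>e\<close>.\<close>
lemma idempotent_has_summand:
  assumes e: "e \<in> Hom T Z Z" "e \<cdot> e = e" "e \<noteq> ZeroArr T Z Z"
  shows "\<exists>A\<in>Obj T. \<exists>a\<in>Hom T A Z. \<exists>b\<in>Hom T Z A. b \<cdot> a = Ident T A \<and> e \<cdot> a = a \<and> b \<cdot> e = b \<and> \<not> zero_object T A"
proof -
  have Z: "Z \<in> Obj T" using Dom_Obj[OF e(1)] .
  interpret H: module R "hom_module T Z Z" using Z by (intro hom_is_module)
  obtain As where sum: "direct_sum T As Z"
    and loc: "\<And>A. A \<in> set As \<Longrightarrow> indecomposable T A \<and> local_ring (hom_module T A A)"
    using krull_schmidt Z unfolding Krull_Schmidt_def by blast
  obtain \<iota> \<pi> where
    ip: "\<And>k. k < length As \<Longrightarrow> \<iota> k \<in> Hom T (As ! k) Z \<and> \<pi> k \<in> Hom T Z (As ! k)"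
    and fs: "finsum (hom_module T Z Z) (\<lambda>i. \<iota> i \<cdot> \<pi> i) {..<length As} = Ident T Z"
    and obs: "set As \<subseteq> Obj T"
    using sum unfolding direct_sum_def by (auto simp del: Hom_iff)
  define s where "s n = finsum (hom_module T Z Z) (\<lambda>i. \<iota> i \<cdot> \<pi> i) {..<n}" for n :: nat
  have s0: "s 0 = ZeroArr T Z Z" by (simp add: s_def)
  have sS: "s (Suc n) = \<iota> n \<cdot> \<pi> n \<boxplus> s n" and st: "s n \<in> Hom T Z Z" if "n < length As" for n
  proof -
    have p: "(\<lambda>i. \<iota> i \<cdot> \<pi> i) \<in> {..<n} \<rightarrow> carrier (hom_module T Z Z)"
      using ip that by auto
    show "s (Suc n) = \<iota> n \<cdot> \<pi> n \<boxplus> s n"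
      using p ip[OF that] by (simp add: s_def lessThan_Suc H.M.finsum_insert)
    show "s n \<in> Hom T Z Z" using H.M.finsum_closed[OF p] by (simp add: s_def)
  qed
  have "\<exists>k h. k < length As \<and> h \<in> Hom T Z Z \<and> iso_arr T (As ! k) (As ! k) (\<pi> k \<cdot> (e \<cdot> (h \<cdot> (e \<cdot> \<iota> k))))"
  proof (rule ccontr)
    assume neg: "\<not> ?thesis"
    \<comment> \<open>Summands are removed one by one from the decomposition of the identity while
      \<open>e s e\<close> keeps a left inverse \<open>v\<close> with \<open>e v = v\<close>. At the
      empty sum this forces \<open>e = 0\<close>.\<close>
    have inv: "\<exists>v\<in>Hom T Z Z. e \<cdot> v = v \<and> v \<cdot> (e \<cdot> (s (length As - j) \<cdot> e)) = e" if "j \<le> length As" for j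
      using that
    proof (induction j)
      case 0
      have "s (length As) = Ident T Z" using fs by (simp add: s_def)
      then show ?case using e Z by (intro bexI[of _ e]) simp_all
    next
      case (Suc j)
      then obtain v where v: "v \<in> Hom T Z Z" "e \<cdot> v = v" "v \<cdot> (e \<cdot> (s (length As - j) \<cdot> e)) = e" by auto
      define k where "k = length As - Suc j"
      have k: "k < length As" "length As - j = Suc k" using Suc.prems by (auto simp: k_def)
      note ik = ip[OF k(1)] and sk = st[OF k(1)]
      have A: "As ! k \<in> Obj T" "local_ring (hom_module T (As ! k) (As ! k))"
        using obs loc nth_mem[OF k(1)] by auto
      \<comment> \<open>Removing the summand of index \<open>k\<close> changes \<open>e\<close> into
        \<open>e - \<alpha> \<beta>\<close>. As \<open>\<beta> \<alpha>\<close> is a nonunit of a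
        local ring, \<open>1 - \<beta> \<alpha>\<close> has an inverse \<open>u\<close>, and
        \<open>e + \<alpha> u \<beta>\<close> inverts \<open>e - \<alpha> \<beta>\<close> from the
        left.\<close>
      define \<alpha> where "\<alpha> = v \<cdot> (e \<cdot> \<iota> k)"
      define \<beta> where "\<beta> = \<pi> k \<cdot> e"
      have t: "\<alpha> \<in> Hom T (As ! k) Z" "\<beta> \<in> Hom T Z (As ! k)" using ik v e by (simp_all add: \<alpha>_def \<beta>_def)
      have "\<not> iso_arr T (As ! k) (As ! k) (\<beta> \<cdot> \<alpha>)"
        using neg k(1) v(1) e(1) ik unfolding \<alpha>_def \<beta>_def by auto
      then have "iso_arr T (As ! k) (As ! k) (Ident T (As ! k) \<boxplus> neg (\<beta> \<cdot> \<alpha>))"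
        using local_ring_iso(2)[OF A] t by simp
      then obtain u where u: "u \<in> Hom T (As ! k) (As ! k)" "u \<cdot> (Ident T (As ! k) \<boxplus> neg (\<beta> \<cdot> \<alpha>)) = Ident T (As ! k)"
        by (rule iso_arrE)
      have u': "u \<boxplus> neg (u \<cdot> (\<beta> \<cdot> \<alpha>)) = Ident T (As ! k)" using u t A by simp
      have e\<alpha>: "e \<cdot> \<alpha> = \<alpha>" and \<beta>e: "\<beta> \<cdot> e = \<beta>"
        using v e ik comp_eq_comp[OF v(2), of "e \<cdot> \<iota> k"] by (simp_all add: \<alpha>_def \<beta>_def)
      define y where "y = v \<cdot> (e \<cdot> (s k \<cdot> e))"
      have y: "y \<in> Hom T Z Z" using v e sk by (simp add: y_def)
      have "e = v \<cdot> (e \<cdot> ((\<iota> k \<cdot> \<pi> k \<boxplus> s k) \<cdot> e))" using v(3) k(2) sS[OF k(1)] by simp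
      also have "\<dots> = \<alpha> \<cdot> \<beta> \<boxplus> y" using v e sk ik by (simp add: \<alpha>_def \<beta>_def y_def)
      finally have "e \<boxplus> neg (\<alpha> \<cdot> \<beta>) = (\<alpha> \<cdot> \<beta> \<boxplus> y) \<boxplus> neg (\<alpha> \<cdot> \<beta>)" by simp
      also have "\<dots> = y \<boxplus> (\<alpha> \<cdot> \<beta> \<boxplus> neg (\<alpha> \<cdot> \<beta>))"
        using y t by (simp only: add_ac_arrow comp_typing neg_typing add_typing Hom_iff)
      also have "\<dots> = y" using y t by simp
      finally have ye: "y = e \<boxplus> neg (\<alpha> \<cdot> \<beta>)" by simp
      define v' where "v' = (e \<boxplus> \<alpha> \<cdot> (u \<cdot> \<beta>)) \<cdot> v"
      have "\<alpha> \<cdot> (u \<cdot> \<beta>) \<cdot> y = \<alpha> \<cdot> ((u \<boxplus> neg (u \<cdot> (\<beta> \<cdot> \<alpha>))) \<cdot> \<beta>)"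
        unfolding ye using t u(1) e \<beta>e by simp
      also have "\<dots> = \<alpha> \<cdot> \<beta>" using u' t A by simp
      finally have 1: "\<alpha> \<cdot> (u \<cdot> \<beta>) \<cdot> y = \<alpha> \<cdot> \<beta>" .
      have 2: "e \<cdot> y = e \<boxplus> neg (\<alpha> \<cdot> \<beta>)" unfolding ye using e t comp_eq_comp[OF e\<alpha>, of \<beta>] by simp
      have "v' \<cdot> (e \<cdot> (s k \<cdot> e)) = (e \<boxplus> \<alpha> \<cdot> (u \<cdot> \<beta>)) \<cdot> y"
        unfolding v'_def y_def using e t u(1) v sk comp_eq_comp[OF v(2), of "e \<cdot> (s k \<cdot> e)"] by simp
      also have "\<dots> = e \<cdot> y \<boxplus> \<alpha> \<cdot> (u \<cdot> \<beta>) \<cdot> y" using e t u(1) y by simp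
      also have "\<dots> = (e \<boxplus> neg (\<alpha> \<cdot> \<beta>)) \<boxplus> \<alpha> \<cdot> \<beta>" unfolding 1 2 ..
      also have "\<dots> = e" using e t by (simp add: add_assoc_arrow)
      finally have "v' \<cdot> (e \<cdot> (s k \<cdot> e)) = e" .
      moreover have "v' \<in> Hom T Z Z" using e t u(1) v by (simp add: v'_def)
      moreover have "e \<cdot> v' = v'"
        using e t u(1) v comp_eq_comp[OF e\<alpha>, of "u \<cdot> (\<beta> \<cdot> v)"] by (simp add: v'_def)
      ultimately show ?case unfolding k_def by blast
    qed
    obtain v where "v \<in> Hom T Z Z" "v \<cdot> (e \<cdot> (s 0 \<cdot> e)) = e" using inv[of "length As"] by auto
    then show False using e Z by (simp add: s0)
  qed
  then obtain k h where k: "k < length As" and h: "h \<in> Hom T Z Z"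
    and iso: "iso_arr T (As ! k) (As ! k) (\<pi> k \<cdot> (e \<cdot> (h \<cdot> (e \<cdot> \<iota> k))))" by blast
  obtain r where r: "r \<in> Hom T (As ! k) (As ! k)" "r \<cdot> (\<pi> k \<cdot> (e \<cdot> (h \<cdot> (e \<cdot> \<iota> k)))) = Ident T (As ! k)"
    using iso by (rule iso_arrE)
  note ik = ip[OF k]
  have A: "As ! k \<in> Obj T" "\<not> zero_object T (As ! k)"
    using obs loc nth_mem[OF k] unfolding indecomposable_def by auto
  show ?thesis
  proof (intro bexI conjI)
    show "(r \<cdot> (\<pi> k \<cdot> (e \<cdot> (h \<cdot> e)))) \<cdot> (e \<cdot> \<iota> k) = Ident T (As ! k)"
      using r ik e h comp_eq_comp[OF e(2), of "\<iota> k"] by simp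
    show "e \<cdot> (e \<cdot> \<iota> k) = e \<cdot> \<iota> k" using ik e comp_eq_comp[OF e(2), of "\<iota> k"] by simp
    show "(r \<cdot> (\<pi> k \<cdot> (e \<cdot> (h \<cdot> e)))) \<cdot> e = r \<cdot> (\<pi> k \<cdot> (e \<cdot> (h \<cdot> e)))" using r ik e h by simp
  qed (use A r ik e h in simp_all)
qed

text \<open>Among the idempotents that do not split, one with \<open>e End(Z)\<close> minimal is
  taken. A summand \<open>A\<close> of its would-be image is removed; the remaining idempotent
  \<open>e - a b\<close> splits by minimality through some \<open>B\<close>, and then
  \<open>e\<close> splits through the direct sum of \<open>A\<close> and \<open>B\<close>.\<close>

lemma idempotent_splits:
  assumes e0: "e0 \<in> Hom T Z Z" "e0 \<cdot> e0 = e0"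
  shows "\<exists>B. split_idempotent Z e0 B"
proof (rule ccontr)
  assume ns0: "\<not> ?thesis"
  have Z: "Z \<in> Obj T" using Dom_Obj[OF e0(1)] .
  define bad where "bad e \<longleftrightarrow> e \<in> Hom T Z Z \<and> e \<cdot> e = e \<and> \<not> (\<exists>B. split_idempotent Z e B)" for e
  obtain e where "bad e" and min: "\<And>h. \<lbrakk>h \<in> Hom T Z Z; bad (e \<cdot> h)\<rbrakk> \<Longrightarrow> \<exists>k\<in>Hom T Z Z. e = (e \<cdot> h) \<cdot> k"
    using minimal_comp_image[of bad e0] ns0 e0 unfolding bad_def by metis
  then have e: "e \<in> Hom T Z Z" "e \<cdot> e = e" and ns: "\<not> (\<exists>B. split_idempotent Z e B)" unfolding bad_def by blast+
  have "e \<noteq> ZeroArr T Z Z" using ns split_idempotent_zero[OF Z] by blast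
  then obtain A a b where A: "A \<in> Obj T" "\<not> zero_object T A"
    and a: "a \<in> Hom T A Z" and b: "b \<in> Hom T Z A" and ba: "b \<cdot> a = Ident T A" and ea: "e \<cdot> a = a" and be: "b \<cdot> e = b"
    using idempotent_has_summand[OF e] by blast
  define e' where "e' = e \<boxplus> neg (a \<cdot> b)"
  have e': "e' \<in> Hom T Z Z" using e a b by (simp add: e'_def)
  have be': "b \<cdot> e' = ZeroArr T Z A" and e'a: "e' \<cdot> a = ZeroArr T A Z"
    and ee': "e \<cdot> e' = e'" and e'e: "e' \<cdot> e = e'"
    using e a b A be ba ea comp_eq_comp[OF ba, of b] comp_eq_comp[OF ea, of b] by (simp_all add: e'_def)
  have e'e': "e' \<cdot> e' = e'"
  proof -
    have "(e \<boxplus> neg (a \<cdot> b)) \<cdot> x = e \<cdot> x \<boxplus> neg (a \<cdot> (b \<cdot> x))" if "x \<in> Hom T Z Z" for x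
      using that e a b by simp
    then have "e' \<cdot> e' = e \<cdot> e' \<boxplus> neg (a \<cdot> (b \<cdot> e'))" using e' unfolding e'_def .
    then show ?thesis using be' ee' a e' A Z by simp
  qed
  \<comment> \<open>Otherwise minimality gives \<open>e = e' h\<close>, hence
    \<open>e' e = e\<close>; but \<open>b e' = 0\<close>, while \<open>b e = b\<close> is
    nonzero.\<close>
  have "\<not> bad e'"
  proof
    assume "bad e'"
    then obtain h where h: "h \<in> Hom T Z Z" "e = e' \<cdot> h" using min[OF e'] ee' by auto
    have "e' \<cdot> (e' \<cdot> h) = e' \<cdot> h" using comp_eq_comp[OF e'e', of h] e' h(1) by simp
    then have "e' \<cdot> e = e" unfolding h(2)[symmetric] .
    then have "b \<cdot> e = ZeroArr T Z A" using e'e be' by simp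
    then have "Ident T A = ZeroArr T A A" using be ba a A by simp
    then show False using A by (simp add: zero_object_iff)
  qed
  then obtain B where B: "split_idempotent Z e' B" using e' e'e' unfolding bad_def by blast
  then obtain i p where Bo: "B \<in> Obj T" and i: "i \<in> Hom T B Z" and p: "p \<in> Hom T Z B"
    and pi: "p \<cdot> i = Ident T B" and ip: "i \<cdot> p = e'" unfolding split_idempotent_def by blast
  have e'i: "e' \<cdot> i = i" and pe': "p \<cdot> e' = p"
    using ip[symmetric] pi i p comp_eq_comp[OF pi, of p] Bo by simp_all
  have bi: "b \<cdot> i = ZeroArr T B A" using comp_eq_comp[OF be', of i] e'i b i e' A by simp
  have pa: "p \<cdot> a = ZeroArr T A B" using comp_eq_comp[OF pe', of a] e'a p a e' A Bo Z by simp
  obtain X where "direct_sum T [A, B] X" using direct_sums_exist[of "[A, B]"] A Bo by auto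
  then obtain i1 i2 p1 p2 where X: "X \<in> Obj T" and t: "i1 \<in> Hom T A X" "i2 \<in> Hom T B X" "p1 \<in> Hom T X A" "p2 \<in> Hom T X B"
    and eqs: "p1 \<cdot> i1 = Ident T A" "p2 \<cdot> i2 = Ident T B" "p1 \<cdot> i2 = ZeroArr T B A" "p2 \<cdot> i1 = ZeroArr T A B"
      "i1 \<cdot> p1 \<boxplus> i2 \<cdot> p2 = Ident T X"
    unfolding direct_sum_pair_iff by blast
  note c = comp_eq_comp[OF eqs(1), of b] comp_eq_comp[OF eqs(2), of p] comp_eq_comp[OF eqs(3), of p]
    comp_eq_comp[OF eqs(4), of b] comp_eq_comp[OF ba, of p1] comp_eq_comp[OF bi, of p2]
    comp_eq_comp[OF pa, of p1] comp_eq_comp[OF pi, of p2]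
  have "(i1 \<cdot> b \<boxplus> i2 \<cdot> p) \<cdot> (a \<cdot> p1 \<boxplus> i \<cdot> p2) = Ident T X"
    using t a b i p A Bo X Z c eqs(5) by simp
  moreover have "(a \<cdot> p1 \<boxplus> i \<cdot> p2) \<cdot> (i1 \<cdot> b \<boxplus> i2 \<cdot> p) = e"
  proof -
    have "(a \<cdot> p1 \<boxplus> i \<cdot> p2) \<cdot> (i1 \<cdot> b \<boxplus> i2 \<cdot> p) = a \<cdot> b \<boxplus> e'"
      using t a b i p A Bo X Z c ip e' by simp
    also have "\<dots> = e \<boxplus> (a \<cdot> b \<boxplus> neg (a \<cdot> b))"
      unfolding e'_def using e a b by (intro add_left_comm_arrow) simp_all
    also have "\<dots> = e" using e a b by simp
    finally show ?thesis .
  qed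
  ultimately have "split_idempotent Z e X"
    unfolding split_idempotent_def using X t a b i p
    by (intro conjI bexI[of _ "a \<cdot> p1 \<boxplus> i \<cdot> p2"] bexI[of _ "i1 \<cdot> b \<boxplus> i2 \<cdot> p"]) simp_all
  then show False using ns by blast
qed

text \<open>A split monomorphism has a complement, namely the image of the idempotent
  \<open>1 - i p\<close>.\<close>

lemma summand_of_complement:
  assumes X: "X \<in> Obj T" and A: "A \<in> Obj T" and i: "i \<in> Hom T A X" and p: "p \<in> Hom T X A" and pi: "p \<cdot> i = Ident T A"
  obtains B j q where "B \<in> Obj T" "j \<in> Hom T B X" "q \<in> Hom T X B" "q \<cdot> j = Ident T B"
    "j \<cdot> q = Ident T X \<boxplus> neg (i \<cdot> p)" "direct_sum T [A, B] X"
proof -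
  define e where "e = Ident T X \<boxplus> neg (i \<cdot> p)"
  have e: "e \<in> Hom T X X" using X i p by (simp add: e_def)
  have pe: "p \<cdot> e = ZeroArr T X A" and ei: "e \<cdot> i = ZeroArr T A X"
    using X A i p pi comp_eq_comp[OF pi, of p] by (simp_all add: e_def)
  have "e \<cdot> e = Ident T X \<cdot> e \<boxplus> neg (i \<cdot> (p \<cdot> e))" using X i p by (simp add: e_def)
  then have "e \<cdot> e = e" using e pe i X A by simp
  then obtain B j q where B: "B \<in> Obj T" and j: "j \<in> Hom T B X" and q: "q \<in> Hom T X B"
    and qj: "q \<cdot> j = Ident T B" and jq: "j \<cdot> q = e"
    using idempotent_splits[OF e] unfolding split_idempotent_def by blast
  have ej: "e \<cdot> j = j" and qe: "q \<cdot> e = q" using jq[symmetric] qj j q comp_eq_comp[OF qj, of q] B by simp_all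
  have "p \<cdot> j = ZeroArr T B A" using comp_eq_comp[OF pe, of j] ej p j e A by simp
  moreover have "q \<cdot> i = ZeroArr T A B" using comp_eq_comp[OF qe, of i] ei q i e A B X by simp
  moreover have "i \<cdot> p \<boxplus> j \<cdot> q = Ident T X"
  proof -
    have "i \<cdot> p \<boxplus> j \<cdot> q = Ident T X \<boxplus> (i \<cdot> p \<boxplus> neg (i \<cdot> p))"
      unfolding jq e_def using X i p by (intro add_left_comm_arrow) simp_all
    then show ?thesis using X i p by simp
  qed
  ultimately have "direct_sum T [A, B] X"
    unfolding direct_sum_pair_iff using X A B i j p q pi qj by blast
  then show thesis using that B j q qj jq unfolding e_def by blast
qed

text \<open>Locality is given only for the summands in some decomposition. The first summand
  \<open>A\<close> of \<open>X\<close> has a complement, which must vanish, so \<open>X\<close> is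
  isomorphic to \<open>A\<close> and both properties are transported along \<open>i\<close> and
  \<open>p\<close>.\<close>

lemma indecomposable_iso:
  assumes X: "indecomposable T X"
  shows "\<lbrakk>f \<in> Hom T X X; g \<in> Hom T X X; \<not> iso_arr T X X f\<rbrakk> \<Longrightarrow> \<not> iso_arr T X X (f \<cdot> g)"
    and "\<lbrakk>f \<in> Hom T X X; \<not> iso_arr T X X f\<rbrakk> \<Longrightarrow> iso_arr T X X (Ident T X \<boxplus> neg f)"
proof -
  have Xo: "X \<in> Obj T" and Xn: "\<not> zero_object T X" using X unfolding indecomposable_def by auto
  obtain As where sum: "direct_sum T As X"
    and loc: "\<And>A. A \<in> set As \<Longrightarrow> indecomposable T A \<and> local_ring (hom_module T A A)"
    using krull_schmidt Xo unfolding Krull_Schmidt_def by blast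
  have ne: "0 < length As"
  proof (rule ccontr)
    assume "\<not> 0 < length As"
    interpret H: module R "hom_module T X X" using Xo by (intro hom_is_module)
    have "Ident T X = ZeroArr T X X" using sum \<open>\<not> 0 < length As\<close> unfolding direct_sum_def by simp
    then show False using Xn Xo zero_object_iff by blast
  qed
  define A where "A = As ! 0"
  have A: "indecomposable T A" "local_ring (hom_module T A A)" using loc ne unfolding A_def by simp_all
  then have Ao: "A \<in> Obj T" "\<not> zero_object T A" unfolding indecomposable_def by auto
  obtain i p where i: "i \<in> Hom T A X" and p: "p \<in> Hom T X A" and pi: "p \<cdot> i = Ident T A"
  proof -
    obtain \<iota> \<pi> where ip: "\<And>k. k < length As \<Longrightarrow> \<iota> k \<in> Hom T (As ! k) X \<and> \<pi> k \<in> Hom T X (As ! k)"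
      and e: "\<forall>i<length As. \<forall>j<length As.
         \<pi> j \<cdot> \<iota> i = (if i = j then Ident T (As ! i) else ZeroArr T (As ! i) (As ! j))"
      using sum unfolding direct_sum_def by (auto simp del: Hom_iff)
    have "\<pi> 0 \<cdot> \<iota> 0 = Ident T A" using e ne unfolding A_def by simp
    then show thesis using ip[OF ne] that unfolding A_def by blast
  qed
  obtain B j q where B: "B \<in> Obj T" "j \<in> Hom T B X" "q \<in> Hom T X B" "j \<cdot> q = Ident T X \<boxplus> neg (i \<cdot> p)"
    and "direct_sum T [A, B] X"
    using summand_of_complement[OF Xo Ao(1) i p pi] .
  then have "zero_object T B" using X Ao unfolding indecomposable_def by blast
  then have "j = ZeroArr T B X" using zero_object_arrow(1) B Xo by blast
  then have "Ident T X \<boxplus> neg (i \<cdot> p) = ZeroArr T X X" using B Xo by simp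
  then have ip: "i \<cdot> p = Ident T X" using eq_if_diff_zero[of "Ident T X" X X "i \<cdot> p"] Xo i p by simp
  have ipc: "i \<cdot> (p \<cdot> f) = f" if "f \<in> Arr T" "Cod T f = X" for f using comp_eq_comp[OF ip, of f] that i p by simp
  have pic: "p \<cdot> (i \<cdot> f) = f" if "f \<in> Arr T" "Cod T f = A" for f using comp_eq_comp[OF pi, of f] that i p by simp
  have iso: "iso_arr T X X f \<longleftrightarrow> iso_arr T A A (p \<cdot> (f \<cdot> i))" if f: "f \<in> Hom T X X" for f
  proof
    assume "iso_arr T X X f"
    then obtain g where g: "g \<in> Hom T X X" "g \<cdot> f = Ident T X" "f \<cdot> g = Ident T X" by (rule iso_arrE)
    show "iso_arr T A A (p \<cdot> (f \<cdot> i))"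
      by (rule iso_arrI[of _ _ _ "p \<cdot> (g \<cdot> i)"])
        (use f g i p Ao Xo pi comp_eq_comp[OF g(2), of i] comp_eq_comp[OF g(3), of i] in \<open>simp_all add: ipc\<close>)
  next
    assume "iso_arr T A A (p \<cdot> (f \<cdot> i))"
    then obtain g where g: "g \<in> Hom T A A" "g \<cdot> (p \<cdot> (f \<cdot> i)) = Ident T A" "(p \<cdot> (f \<cdot> i)) \<cdot> g = Ident T A"
      by (rule iso_arrE)
    have 1: "g \<cdot> (p \<cdot> f) = p"
    proof -
      have "(g \<cdot> (p \<cdot> (f \<cdot> i))) \<cdot> p = p" using g p Ao by simp
      then show ?thesis using g(1) f i p ip Xo by simp
    qed
    have 2: "f \<cdot> (i \<cdot> g) = i"
    proof -
      have "i \<cdot> ((p \<cdot> (f \<cdot> i)) \<cdot> g) = i" using g i Ao by simp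
      then show ?thesis using g(1) f i p Xo by (simp add: ipc)
    qed
    show "iso_arr T X X f"
      by (rule iso_arrI[of _ _ _ "i \<cdot> (g \<cdot> p)"])
        (use f g(1) i p Ao Xo ip 1 comp_eq_comp[OF 2, of p] in simp_all)
  qed
  note loc = local_ring_iso[OF Ao(1) A(2)]
  show "\<not> iso_arr T X X (f \<cdot> g)" if f: "f \<in> Hom T X X" "g \<in> Hom T X X" "\<not> iso_arr T X X f" for f g
    using loc(1)[of "p \<cdot> (f \<cdot> i)" "p \<cdot> (g \<cdot> i)"] iso[of f] iso[of "f \<cdot> g"] f i p by (simp add: ipc)
  show "iso_arr T X X (Ident T X \<boxplus> neg f)" if f: "f \<in> Hom T X X" "\<not> iso_arr T X X f" for f
    using loc(2)[of "p \<cdot> (f \<cdot> i)"] iso[of f] iso[of "Ident T X \<boxplus> neg f"] f i p Xo pi by simp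
qed

text \<open>Splitting of idempotents turns indecomposability into a condition on the endomorphisms
  of \<open>X\<close> alone, which passes through the shift and through Serre pairings.\<close>

lemma indecomposable_iff:
  assumes X: "X \<in> Obj T"
  shows "indecomposable T X \<longleftrightarrow> Ident T X \<noteq> ZeroArr T X X \<and>
    (\<forall>e\<in>Hom T X X. e \<cdot> e = e \<longrightarrow> e = ZeroArr T X X \<or> e = Ident T X)" (is "?L \<longleftrightarrow> ?R")
proof
  assume L: ?L
  have "e = ZeroArr T X X \<or> e = Ident T X" if e: "e \<in> Hom T X X" "e \<cdot> e = e" for e
  proof -
    obtain A i p where A: "A \<in> Obj T" and i: "i \<in> Hom T A X" and p: "p \<in> Hom T X A"
      and pi: "p \<cdot> i = Ident T A" and ip: "i \<cdot> p = e"
      using idempotent_splits[OF e] unfolding split_idempotent_def by blast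
    obtain B j q where B: "B \<in> Obj T" "j \<in> Hom T B X" "q \<in> Hom T X B" "j \<cdot> q = Ident T X \<boxplus> neg (i \<cdot> p)"
      and "direct_sum T [A, B] X"
      using summand_of_complement[OF X A i p pi] .
    then have "zero_object T A \<or> zero_object T B" using L unfolding indecomposable_def by blast
    then show ?thesis
    proof
      assume "zero_object T A"
      then have "i = ZeroArr T A X" using zero_object_arrow(1) i X by blast
      then show ?thesis using ip p X by auto
    next
      assume "zero_object T B"
      then have "j = ZeroArr T B X" using zero_object_arrow(1) B X by blast
      then have "Ident T X \<boxplus> neg e = ZeroArr T X X" using B X ip by simp
      then show ?thesis using eq_if_diff_zero[of "Ident T X" X X e] X e by simp
    qed
  qed
  then show ?R using L X unfolding indecomposable_def zero_object_iff by blast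
next
  assume R: ?R
  have "zero_object T A \<or> zero_object T B" if "direct_sum T [A, B] X" for A B
  proof -
    obtain i j p q where ob: "A \<in> Obj T" "B \<in> Obj T" and t: "i \<in> Hom T A X" "j \<in> Hom T B X" "p \<in> Hom T X A" "q \<in> Hom T X B"
      and e: "p \<cdot> i = Ident T A" "q \<cdot> j = Ident T B" "p \<cdot> j = ZeroArr T B A" "q \<cdot> i = ZeroArr T A B"
      using \<open>direct_sum T [A, B] X\<close> unfolding direct_sum_pair_iff by blast
    have "(i \<cdot> p) \<cdot> (i \<cdot> p) = i \<cdot> p" using t ob e comp_eq_comp[OF e(1), of p] by simp
    then have "i \<cdot> p = ZeroArr T X X \<or> i \<cdot> p = Ident T X" using R t by simp
    then show ?thesis
    proof
      assume "i \<cdot> p = ZeroArr T X X"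
      then have "p \<cdot> ((i \<cdot> p) \<cdot> i) = ZeroArr T A A" using t X ob by simp
      moreover have "p \<cdot> ((i \<cdot> p) \<cdot> i) = Ident T A" using t ob e by simp
      ultimately show ?thesis using ob by (simp add: zero_object_iff)
    next
      assume ip: "i \<cdot> p = Ident T X"
      have "j = (i \<cdot> p) \<cdot> j" unfolding ip using t X by simp
      also have "\<dots> = ZeroArr T B X" using t e ob by simp
      finally have "Ident T B = ZeroArr T B B" using e(2) t ob X by simp
      then show ?thesis using ob by (simp add: zero_object_iff)
    qed
  qed
  then show ?L unfolding indecomposable_def zero_object_iff using R X by blast
qed

end

section \<open>Serre pairings\<close>

context hom_finite_triangulated
begin

abbreviation zero_E ("\<zero>\<^sub>E") where "\<zero>\<^sub>E \<equiv> \<zero>\<^bsub>E\<^esub>"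
abbreviation forms where "forms X Y \<equiv> linear_maps R (hom_module T X Y) E"

lemma form_simps:
  assumes t: "t \<in> forms X Z"
  shows "\<lbrakk>f \<in> Arr T; Dom T f = X; Cod T f = Z\<rbrakk> \<Longrightarrow> t f \<in> carrier E"
    and "\<lbrakk>f \<in> Arr T; Dom T f = X; Cod T f = Z; g \<in> Arr T; Dom T g = X; Cod T g = Z\<rbrakk> \<Longrightarrow> t (f \<boxplus> g) = t f \<oplus>\<^bsub>E\<^esub> t g"
    and "\<lbrakk>r \<in> carrier R; f \<in> Arr T; Dom T f = X; Cod T f = Z\<rbrakk> \<Longrightarrow> t (SmultArr T r f) = r \<odot>\<^bsub>E\<^esub> t f"
    and "\<lbrakk>f \<in> Arr T; Dom T f = X; Cod T f = Z\<rbrakk> \<Longrightarrow> t (neg f) = \<ominus>\<^bsub>E\<^esub> t f"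
    and "\<lbrakk>X \<in> Obj T; Z \<in> Obj T\<rbrakk> \<Longrightarrow> t (ZeroArr T X Z) = \<zero>\<^sub>E"
proof -
  note l = linear_mapsD[OF t]
  show 1: "t f \<in> carrier E" "t (neg f) = \<ominus>\<^bsub>E\<^esub> t f" if "f \<in> Arr T" "Dom T f = X" "Cod T f = Z" for f
    using l(1)[of f] l(3)[of "\<ominus>\<^bsub>R\<^esub> \<one>\<^bsub>R\<^esub>" f] that by (simp_all add: neg_def E.smult_l_minus)
  show "\<lbrakk>f \<in> Arr T; Dom T f = X; Cod T f = Z; g \<in> Arr T; Dom T g = X; Cod T g = Z\<rbrakk> \<Longrightarrow> t (f \<boxplus> g) = t f \<oplus>\<^bsub>E\<^esub> t g"
    "\<lbrakk>r \<in> carrier R; f \<in> Arr T; Dom T f = X; Cod T f = Z\<rbrakk> \<Longrightarrow> t (SmultArr T r f) = r \<odot>\<^bsub>E\<^esub> t f"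
    using l(2)[of f g] l(3)[of r f] by simp_all
  show "t (ZeroArr T X Z) = \<zero>\<^sub>E" if XZ: "X \<in> Obj T" "Z \<in> Obj T"
    using linear_maps_zero[OF hom_is_module[OF XZ] E.module_axioms t] by simp
qed

lemma precomp_form:
  assumes t: "t \<in> forms X Z" and f: "f \<in> Hom T X Y"
  shows "(\<lambda>g. t (g \<cdot> f)) \<in> forms Y Z"
  using f by (intro linear_mapsI) (simp_all add: form_simps[OF t])

lemma postcomp_form:
  assumes t: "t \<in> forms X Z" and g: "g \<in> Hom T Y Z"
  shows "(\<lambda>f. t (g \<cdot> f)) \<in> forms X Y"
  using g by (intro linear_mapsI) (simp_all add: form_simps[OF t])

lemma extend_form:
  assumes XY: "X \<in> Obj T" "Y \<in> Obj T" "X' \<in> Obj T" "Y' \<in> Obj T"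
    and \<beta>: "\<beta> \<in> linear_maps R (hom_module T X Y) (hom_module T X' Y')" and \<xi>: "\<xi> \<in> forms X Y"
    and ker: "\<And>f. \<lbrakk>f \<in> Hom T X Y; \<beta> f = ZeroArr T X' Y'\<rbrakk> \<Longrightarrow> \<xi> f = \<zero>\<^sub>E"
  obtains \<zeta> where "\<zeta> \<in> forms X' Y'" "\<And>f. f \<in> Hom T X Y \<Longrightarrow> \<zeta> (\<beta> f) = \<xi> f"
proof -
  have "\<exists>\<zeta>\<in>forms X' Y'. \<forall>f\<in>carrier (hom_module T X Y). \<zeta> (\<beta> f) = \<xi> f"
    by (rule injective_extend_along[OF injective hom_is_module[OF XY(1,2)] hom_is_module[OF XY(3,4)] \<beta> \<xi>])
      (use ker in simp)
  then obtain \<zeta> where \<zeta>: "\<zeta> \<in> forms X' Y'" and e: "\<forall>f\<in>Hom T X Y. \<zeta> (\<beta> f) = \<xi> f"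
    unfolding hom_module_simps ..
  show thesis by (rule that[OF \<zeta>]) (use e in blast)
qed

text \<open>\<open>t\<close> is modelled on the form that corresponds to the identity of
  \<open>Z = S(X)\<close>. Only nondegeneracy is demanded; perfectness is recovered through
  \<open>pairing_represents\<close>.\<close>

definition serre where
  "serre X Z t \<longleftrightarrow> X \<in> Obj T \<and> Z \<in> Obj T \<and> t \<in> forms X Z \<and>
     (\<forall>Y. (\<forall>f\<in>Hom T X Y. (\<forall>g\<in>Hom T Y Z. t (g \<cdot> f) = \<zero>\<^sub>E) \<longrightarrow> f = ZeroArr T X Y) \<and>
          (\<forall>g\<in>Hom T Y Z. (\<forall>f\<in>Hom T X Y. t (g \<cdot> f) = \<zero>\<^sub>E) \<longrightarrow> g = ZeroArr T Y Z))"

lemma serreI: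
  assumes "X \<in> Obj T" "Z \<in> Obj T" "t \<in> forms X Z"
    and "\<And>Y f. \<lbrakk>Y \<in> Obj T; f \<in> Hom T X Y; \<And>g. g \<in> Hom T Y Z \<Longrightarrow> t (g \<cdot> f) = \<zero>\<^sub>E\<rbrakk> \<Longrightarrow> f = ZeroArr T X Y"
    and "\<And>Y g. \<lbrakk>Y \<in> Obj T; g \<in> Hom T Y Z; \<And>f. f \<in> Hom T X Y \<Longrightarrow> t (g \<cdot> f) = \<zero>\<^sub>E\<rbrakk> \<Longrightarrow> g = ZeroArr T Y Z"
  shows "serre X Z t"
  unfolding serre_def
proof (intro conjI allI ballI impI assms(1-3))
  fix Y f assume "f \<in> Hom T X Y" "\<forall>g\<in>Hom T Y Z. t (g \<cdot> f) = \<zero>\<^sub>E"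
  then show "f = ZeroArr T X Y" using assms(4)[OF Cod_Obj] by blast
next
  fix Y g assume "g \<in> Hom T Y Z" "\<forall>f\<in>Hom T X Y. t (g \<cdot> f) = \<zero>\<^sub>E"
  then show "g = ZeroArr T Y Z" using assms(5)[OF Dom_Obj] by blast
qed

lemma serreD:
  assumes "serre X Z t"
  shows "X \<in> Obj T" "Z \<in> Obj T" "t \<in> forms X Z"
    and "\<lbrakk>f \<in> Hom T X Y; \<And>g. g \<in> Hom T Y Z \<Longrightarrow> t (g \<cdot> f) = \<zero>\<^sub>E\<rbrakk> \<Longrightarrow> f = ZeroArr T X Y"
    and "\<lbrakk>g \<in> Hom T Y Z; \<And>f. f \<in> Hom T X Y \<Longrightarrow> t (g \<cdot> f) = \<zero>\<^sub>E\<rbrakk> \<Longrightarrow> g = ZeroArr T Y Z"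
  using assms unfolding serre_def by blast+

lemma serre_eq_left:
  assumes s: "serre X Z t" and f: "f \<in> Hom T X Y" "f' \<in> Hom T X Y"
    and eq: "\<And>g. g \<in> Hom T Y Z \<Longrightarrow> t (g \<cdot> f) = t (g \<cdot> f')"
  shows "f = f'"
proof (rule eq_if_diff_zero[OF f], rule serreD(4)[OF s])
  show "f \<boxplus> neg f' \<in> Hom T X Y" using f by simp
  fix g assume g: "g \<in> Hom T Y Z"
  then show "t (g \<cdot> (f \<boxplus> neg f')) = \<zero>\<^sub>E"
    using f eq[OF g] by (simp add: form_simps[OF serreD(3)[OF s]] E.M.r_neg)
qed

lemma serre_eq_right:
  assumes s: "serre X Z t" and g: "g \<in> Hom T Y Z" "g' \<in> Hom T Y Z"
    and eq: "\<And>f. f \<in> Hom T X Y \<Longrightarrow> t (g \<cdot> f) = t (g' \<cdot> f)"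
  shows "g = g'"
proof (rule eq_if_diff_zero[OF g], rule serreD(5)[OF s])
  show "g \<boxplus> neg g' \<in> Hom T Y Z" using g by simp
  fix f assume f: "f \<in> Hom T X Y"
  then show "t ((g \<boxplus> neg g') \<cdot> f) = \<zero>\<^sub>E"
    using g eq[OF f] by (simp add: form_simps[OF serreD(3)[OF s]] E.M.r_neg)
qed

text \<open>Injectivity on one side yields surjectivity on the other: nondegeneracy in
  \<open>f\<close> makes every form on \<open>(X, Y)\<close> come from an arrow
  \<open>Y \<rightarrow> Z\<close>.\<close>

lemma serre_represents_right:
  assumes s: "serre X Z t" and Y: "Y \<in> Obj T" and \<xi>: "\<xi> \<in> forms X Y"
  obtains g where "g \<in> Hom T Y Z" "\<And>f. f \<in> Hom T X Y \<Longrightarrow> \<xi> f = t (g \<cdot> f)"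
proof -
  note d = serreD[OF s]
  have "\<exists>g\<in>carrier (hom_module T Y Z). \<forall>f\<in>carrier (hom_module T X Y). \<xi> f = t (g \<cdot> f)"
  proof (rule pairing_represents[OF hom_is_module[OF Y d(2)] hom_dcc[OF Y d(2)] hom_is_module[OF d(1) Y] _ _ _ \<xi>])
    show "f = \<zero>\<^bsub>hom_module T X Y\<^esub>" if "f \<in> carrier (hom_module T X Y)"
      "\<And>g. g \<in> carrier (hom_module T Y Z) \<Longrightarrow> t (g \<cdot> f) = \<zero>\<^sub>E" for f
      using d(4)[of f Y] that by simp
  qed (use precomp_form[OF d(3)] postcomp_form[OF d(3)] in \<open>simp_all del: Hom_iff\<close>)
  then obtain g where g: "g \<in> Hom T Y Z" and e: "\<forall>f\<in>Hom T X Y. \<xi> f = t (g \<cdot> f)" unfolding hom_module_simps ..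
  show thesis by (rule that[OF g]) (use e in blast)
qed

lemma serre_represents_left:
  assumes s: "serre X Z t" and Y: "Y \<in> Obj T" and \<xi>: "\<xi> \<in> forms Y Z"
  obtains f where "f \<in> Hom T X Y" "\<And>g. g \<in> Hom T Y Z \<Longrightarrow> \<xi> g = t (g \<cdot> f)"
proof -
  note d = serreD[OF s]
  have "\<exists>f\<in>carrier (hom_module T X Y). \<forall>g\<in>carrier (hom_module T Y Z). \<xi> g = t (g \<cdot> f)"
  proof (rule pairing_represents[OF hom_is_module[OF d(1) Y] hom_dcc[OF d(1) Y] hom_is_module[OF Y d(2)] _ _ _ \<xi>])
    show "g = \<zero>\<^bsub>hom_module T Y Z\<^esub>" if "g \<in> carrier (hom_module T Y Z)"
      "\<And>f. f \<in> carrier (hom_module T X Y) \<Longrightarrow> t (g \<cdot> f) = \<zero>\<^sub>E" for g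
      using d(5)[of g Y] that by simp
  qed (use precomp_form[OF d(3)] postcomp_form[OF d(3)] in \<open>simp_all del: Hom_iff\<close>)
  then obtain f where f: "f \<in> Hom T X Y" and e: "\<forall>g\<in>Hom T Y Z. \<xi> g = t (g \<cdot> f)" unfolding hom_module_simps ..
  show thesis by (rule that[OF f]) (use e in blast)
qed

text \<open>\<open>a = S(u)\<close> for \<open>u : X \<rightarrow> X'\<close>, relative to Serre pairings \<open>t\<close> of \<open>X, Z\<close> and \<open>t'\<close> of \<open>X', Z'\<close>.\<close>
definition dual_arrow where
  "dual_arrow X' Z t Z' t' u a \<longleftrightarrow> a \<in> Hom T Z Z' \<and> (\<forall>h\<in>Hom T X' Z. t' (a \<cdot> h) = t (h \<cdot> u))"

lemma dual_arrowD:
  assumes "dual_arrow X' Z t Z' t' u a"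
  shows "a \<in> Hom T Z Z'" and "h \<in> Hom T X' Z \<Longrightarrow> t' (a \<cdot> h) = t (h \<cdot> u)"
  using assms unfolding dual_arrow_def by blast+

text \<open>\<open>a\<close> represents the form \<open>h \<mapsto> t (h u)\<close> on
  \<open>(X', Z)\<close>.\<close>

lemma dual_arrow_exists:
  assumes s: "serre X Z t" and s': "serre X' Z' t'" and u: "u \<in> Hom T X X'"
  obtains a where "dual_arrow X' Z t Z' t' u a"
proof -
  obtain a where a: "a \<in> Hom T Z Z'" "\<And>h. h \<in> Hom T X' Z \<Longrightarrow> t (h \<cdot> u) = t' (a \<cdot> h)"
    using serre_represents_right[OF s' serreD(2)[OF s] precomp_form[OF serreD(3)[OF s] u]] by blast
  show thesis by (rule that[of a]) (use a in \<open>simp add: dual_arrow_def del: Hom_iff\<close>)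
qed

text \<open>Representation on the other side; it is the source of the fullness of \<open>S\<close>
  and of the closure of \<open>Tl\<close> under cones.\<close>

lemma predual_arrow_exists:
  assumes s: "serre X Z t" and s': "serre X' Z' t'" and a: "a \<in> Hom T Z Z'"
  obtains u where "u \<in> Hom T X X'" "dual_arrow X' Z t Z' t' u a"
proof -
  obtain u where "u \<in> Hom T X X'" "\<And>h. h \<in> Hom T X' Z \<Longrightarrow> t' (a \<cdot> h) = t (h \<cdot> u)"
    using serre_represents_left[OF s serreD(1)[OF s'] postcomp_form[OF serreD(3)[OF s'] a]] by blast
  then show thesis using that a unfolding dual_arrow_def by simp
qed

lemma dual_arrow_unique:
  assumes "serre X' Z' t'" and "dual_arrow X' Z t Z' t' u a" "dual_arrow X' Z t Z' t' u a'"
  shows "a = a'"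
  using assms(2,3) unfolding dual_arrow_def by (intro serre_eq_right[OF assms(1)]) auto

lemma predual_arrow_unique:
  assumes "serre X Z t" and "u \<in> Hom T X X'" "u' \<in> Hom T X X'"
    and "dual_arrow X' Z t Z' t' u a" "dual_arrow X' Z t Z' t' u' a"
  shows "u = u'"
proof (rule serre_eq_left[OF assms(1-3)])
  fix h assume "h \<in> Hom T X' Z"
  then show "t (h \<cdot> u) = t (h \<cdot> u')" using assms(4,5) unfolding dual_arrow_def by metis
qed

lemma dual_arrow_comp:
  assumes s: "serre X Z t" and u: "u \<in> Hom T X X'" "u' \<in> Hom T X' X''"
    and a: "dual_arrow X' Z t Z' t' u a" and a': "dual_arrow X'' Z' t' Z'' t'' u' a'"
  shows "dual_arrow X'' Z t Z'' t'' (u' \<cdot> u) (a' \<cdot> a)"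
  unfolding dual_arrow_def
proof (intro conjI ballI)
  show "a' \<cdot> a \<in> Hom T Z Z''" using a a' unfolding dual_arrow_def by simp
  fix h assume h: "h \<in> Hom T X'' Z"
  have "t'' ((a' \<cdot> a) \<cdot> h) = t'' (a' \<cdot> (a \<cdot> h))" using a a' h unfolding dual_arrow_def by simp
  also have "\<dots> = t' ((a \<cdot> h) \<cdot> u')" using dual_arrowD(2)[OF a', of "a \<cdot> h"] dual_arrowD(1)[OF a] h by simp
  also have "\<dots> = t' (a \<cdot> (h \<cdot> u'))" using dual_arrowD(1)[OF a] h u by simp
  also have "\<dots> = t ((h \<cdot> u') \<cdot> u)" using dual_arrowD(2)[OF a, of "h \<cdot> u'"] h u by simp
  also have "\<dots> = t (h \<cdot> (u' \<cdot> u))" using h u by simp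
  finally show "t'' ((a' \<cdot> a) \<cdot> h) = t (h \<cdot> (u' \<cdot> u))" .
qed

lemma dual_arrow_Ident: "serre X Z t \<Longrightarrow> dual_arrow X Z t Z t (Ident T X) (Ident T Z)"
  using serreD(1,2)[of X Z t] unfolding dual_arrow_def by simp

text \<open>The identity of \<open>X\<close>, seen between two Serre pairings of \<open>X\<close>, compares the two dual objects.\<close>
lemma dual_arrow_Ident_iso:
  assumes s: "serre X Z t" and s': "serre X Z' t'" and a: "dual_arrow X Z t Z' t' (Ident T X) a"
  shows "iso_arr T Z Z' a"
proof -
  have I: "Ident T X \<in> Hom T X X" and X: "X \<in> Obj T" using serreD(1)[OF s] by simp_all
  obtain b where b: "dual_arrow X Z' t' Z t (Ident T X) b" using dual_arrow_exists[OF s' s I] .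
  have "b \<cdot> a = Ident T Z"
    using dual_arrow_unique[OF s dual_arrow_comp[OF s I I a b]] dual_arrow_Ident[OF s] X by simp
  moreover have "a \<cdot> b = Ident T Z'"
    using dual_arrow_unique[OF s' dual_arrow_comp[OF s' I I b a]] dual_arrow_Ident[OF s'] X by simp
  ultimately show ?thesis
    using dual_arrowD(1)[OF a] dual_arrowD(1)[OF b] by (intro iso_arrI)
qed

section \<open>Serre pairings under isomorphisms, summands, shifts and cones\<close>

lemma serre_iso:
  assumes s: "serre X Z t" and x: "iso_arr T X X' x" and z: "iso_arr T Z Z' z"
  shows "\<exists>t'. serre X' Z' t'"
proof -
  obtain x' where x': "x \<in> Hom T X X'" "x' \<in> Hom T X' X" "x' \<cdot> x = Ident T X" "x \<cdot> x' = Ident T X'"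
    using x by (rule iso_arrE)
  obtain z' where z': "z \<in> Hom T Z Z'" "z' \<in> Hom T Z' Z" "z' \<cdot> z = Ident T Z" "z \<cdot> z' = Ident T Z'"
    using z by (rule iso_arrE)
  note d = serreD[OF s]
  have X': "X' \<in> Obj T" and Z': "Z' \<in> Obj T" using Cod_Obj x'(1) z'(1) by blast+
  define t' where "t' h = t (z' \<cdot> (h \<cdot> x))" for h
  have "serre X' Z' t'"
  proof (rule serreI[OF X' Z'])
    show "t' \<in> forms X' Z'"
      by (intro linear_mapsI) (use x' z' in \<open>simp_all add: t'_def form_simps[OF d(3)]\<close>)
  next
    fix Y f assume Y: "Y \<in> Obj T" and f: "f \<in> Hom T X' Y" and n: "\<And>g. g \<in> Hom T Y Z' \<Longrightarrow> t' (g \<cdot> f) = \<zero>\<^sub>E"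
    have "f \<cdot> x = ZeroArr T X Y"
    proof (rule d(4))
      fix g assume g: "g \<in> Hom T Y Z"
      have "t' ((z \<cdot> g) \<cdot> f) = \<zero>\<^sub>E" using n[of "z \<cdot> g"] g z' by simp
      then show "t (g \<cdot> (f \<cdot> x)) = \<zero>\<^sub>E"
        using comp_eq_comp[OF z'(3), of "g \<cdot> (f \<cdot> x)"] g f x' z' by (simp add: t'_def)
    qed (use f x' in simp)
    then have "(f \<cdot> x) \<cdot> x' = ZeroArr T X' Y" using x' Y by simp
    then show "f = ZeroArr T X' Y" using f x' X' by simp
  next
    fix Y g assume Y: "Y \<in> Obj T" and g: "g \<in> Hom T Y Z'" and n: "\<And>f. f \<in> Hom T X' Y \<Longrightarrow> t' (g \<cdot> f) = \<zero>\<^sub>E"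
    have "z' \<cdot> g = ZeroArr T Y Z"
    proof (rule d(5))
      fix f assume f: "f \<in> Hom T X Y"
      have "t' (g \<cdot> (f \<cdot> x')) = \<zero>\<^sub>E" using n[of "f \<cdot> x'"] f x' by simp
      then show "t ((z' \<cdot> g) \<cdot> f) = \<zero>\<^sub>E" using g f x' z' by (simp add: t'_def)
    qed (use g z' in simp)
    then have "z \<cdot> (z' \<cdot> g) = ZeroArr T Y Z'" using z' Y by simp
    then show "g = ZeroArr T Y Z'" using comp_eq_comp[OF z'(4), of g] g z' Z' by simp
  qed
  then show ?thesis by blast
qed

lemma serre_zero:
  assumes "zero_object T N"
  shows "\<exists>t. serre N N t"
proof -
  have N: "N \<in> Obj T" using assms by (simp add: zero_object_iff)
  have "serre N N (\<lambda>_. \<zero>\<^sub>E)"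
    by (rule serreI) (use N zero_object_arrow[OF assms] in \<open>auto intro!: linear_mapsI simp del: Hom_iff\<close>)
  then show ?thesis by blast
qed

text \<open>Here \<open>e' = S(e)\<close>, and the form is restricted to the summands. A test arrow
  \<open>g\<close> into \<open>Z\<close> may be replaced by \<open>e' g\<close>, because
  \<open>e'\<close> moves across \<open>t\<close> to \<open>e\<close>, which \<open>p\<close>
  absorbs; the other side is symmetric.\<close>

lemma serre_split:
  assumes s: "serre X Z t" and e: "e \<in> Hom T X X" and d: "dual_arrow X Z t Z t e e'"
    and B: "split_idempotent X e B" and C: "split_idempotent Z e' C"
  shows "\<exists>t'. serre B C t'"
proof -
  note se = serreD[OF s]
  obtain i p where Bo: "B \<in> Obj T" and i: "i \<in> Hom T B X" and p: "p \<in> Hom T X B"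
    and pi: "p \<cdot> i = Ident T B" and ip: "i \<cdot> p = e" using B unfolding split_idempotent_def by blast
  obtain j q where Co: "C \<in> Obj T" and j: "j \<in> Hom T C Z" and q: "q \<in> Hom T Z C"
    and qj: "q \<cdot> j = Ident T C" and jq: "j \<cdot> q = e'" using C unfolding split_idempotent_def by blast
  have e': "e' \<in> Hom T Z Z" and te: "\<And>h. h \<in> Hom T X Z \<Longrightarrow> t (e' \<cdot> h) = t (h \<cdot> e)"
    using dual_arrowD[OF d] by blast+
  have ep: "p \<cdot> e = p" "e' \<cdot> j = j"
    using ip[symmetric] jq[symmetric] pi qj i p j q comp_eq_comp[OF pi, of p] comp_eq_comp[OF qj, of q] Bo Co by simp_all
  define t' where "t' h = t (j \<cdot> (h \<cdot> p))" for h
  have "serre B C t'"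
  proof (rule serreI[OF Bo Co])
    show "t' \<in> forms B C"
      by (intro linear_mapsI) (use j p in \<open>simp_all add: t'_def form_simps[OF se(3)]\<close>)
  next
    fix Y f assume Y: "Y \<in> Obj T" and f: "f \<in> Hom T B Y" and n: "\<And>g. g \<in> Hom T Y C \<Longrightarrow> t' (g \<cdot> f) = \<zero>\<^sub>E"
    have "f \<cdot> p = ZeroArr T X Y"
    proof (rule se(4))
      fix g assume g: "g \<in> Hom T Y Z"
      have "t (g \<cdot> (f \<cdot> p)) = t ((g \<cdot> (f \<cdot> p)) \<cdot> e)" using g f p e ep by simp
      also have "\<dots> = t (e' \<cdot> (g \<cdot> (f \<cdot> p)))" using te[of "g \<cdot> (f \<cdot> p)"] g f p by simp
      also have "\<dots> = t' ((q \<cdot> g) \<cdot> f)" unfolding t'_def using g f p j q jq[symmetric] by simp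
      also have "\<dots> = \<zero>\<^sub>E" using n[of "q \<cdot> g"] g q by simp
      finally show "t (g \<cdot> (f \<cdot> p)) = \<zero>\<^sub>E" .
    qed (use f p in simp)
    then have "(f \<cdot> p) \<cdot> i = ZeroArr T B Y" using i Y by simp
    then show "f = ZeroArr T B Y" using f i p pi by simp
  next
    fix Y g assume Y: "Y \<in> Obj T" and g: "g \<in> Hom T Y C" and n: "\<And>f. f \<in> Hom T B Y \<Longrightarrow> t' (g \<cdot> f) = \<zero>\<^sub>E"
    have "j \<cdot> g = ZeroArr T Y Z"
    proof (rule se(5))
      fix f assume f: "f \<in> Hom T X Y"
      have "t ((j \<cdot> g) \<cdot> f) = t (e' \<cdot> (j \<cdot> (g \<cdot> f)))" using comp_eq_comp[OF ep(2), of "g \<cdot> f"] g f j e' by simp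
      also have "\<dots> = t ((j \<cdot> (g \<cdot> f)) \<cdot> e)" using te[of "j \<cdot> (g \<cdot> f)"] g f j by simp
      also have "\<dots> = t' (g \<cdot> (f \<cdot> i))" unfolding t'_def using g f p j i ip[symmetric] by simp
      also have "\<dots> = \<zero>\<^sub>E" using n[of "f \<cdot> i"] f i by simp
      finally show "t ((j \<cdot> g) \<cdot> f) = \<zero>\<^sub>E" .
    qed (use g j in simp)
    then have "q \<cdot> (j \<cdot> g) = ZeroArr T Y C" using q Y by simp
    then show "g = ZeroArr T Y C" using comp_eq_comp[OF qj, of g] g j q by simp
  qed
  then show ?thesis by blast
qed

text \<open>The shift is full, faithful and essentially surjective, so test objects and arrows may
  be taken shifted; the sign does not affect the vanishing of values.\<close>

lemma serre_shift_iff: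
  assumes X: "X \<in> Obj T" and Z: "Z \<in> Obj T" and t: "t \<in> forms X Z" and t': "t' \<in> forms (sh X) (sh Z)"
    and tt: "\<And>h. h \<in> Hom T X Z \<Longrightarrow> t' (shf h) = \<ominus>\<^bsub>E\<^esub> t h"
  shows "serre X Z t \<longleftrightarrow> serre (sh X) (sh Z) t'"
proof -
  have tz: "t' (shf h) = \<zero>\<^sub>E \<longleftrightarrow> t h = \<zero>\<^sub>E" if h: "h \<in> Hom T X Z" for h
    using tt[OF h] form_simps(1)[OF t, of h] h E.M.minus_minus[of "t h"] E.M.minus_equality[of "\<zero>\<^sub>E" "\<zero>\<^sub>E"] by auto
  show ?thesis
  proof
    assume s: "serre X Z t"
    show "serre (sh X) (sh Z) t'"
    proof (rule serreI[OF _ _ t'])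
      fix Y f assume Y: "Y \<in> Obj T" and f: "f \<in> Hom T (sh X) Y" and n: "\<And>g. g \<in> Hom T Y (sh Z) \<Longrightarrow> t' (g \<cdot> f) = \<zero>\<^sub>E"
      obtain V y where V: "V \<in> Obj T" "iso_arr T (sh V) Y y" using shift_surj[OF Y] by blast
      obtain y' where y: "y \<in> Hom T (sh V) Y" "y' \<in> Hom T Y (sh V)" "y \<cdot> y' = Ident T Y" using V(2) by (rule iso_arrE)
      obtain k where k: "k \<in> Hom T X V" "shf k = y' \<cdot> f" using shift_full[of "y' \<cdot> f" X V] X V f y by auto
      have "k = ZeroArr T X V"
      proof (rule serreD(4)[OF s k(1)])
        fix g assume g: "g \<in> Hom T V Z"
        have "t' (shf (g \<cdot> k)) = \<zero>\<^sub>E" using n[of "shf g \<cdot> y'"] g k y f by simp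
        then show "t (g \<cdot> k) = \<zero>\<^sub>E" using tz[of "g \<cdot> k"] g k by simp
      qed
      then have "y \<cdot> (y' \<cdot> f) = ZeroArr T (sh X) Y" using k(2)[symmetric] X V y by simp
      then show "f = ZeroArr T (sh X) Y" using comp_eq_comp[OF y(3), of f] y f by simp
    next
      fix Y g assume Y: "Y \<in> Obj T" and g: "g \<in> Hom T Y (sh Z)" and n: "\<And>f. f \<in> Hom T (sh X) Y \<Longrightarrow> t' (g \<cdot> f) = \<zero>\<^sub>E"
      obtain V y where V: "V \<in> Obj T" "iso_arr T (sh V) Y y" using shift_surj[OF Y] by blast
      obtain y' where y: "y \<in> Hom T (sh V) Y" "y' \<in> Hom T Y (sh V)" "y \<cdot> y' = Ident T Y" using V(2) by (rule iso_arrE)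
      obtain k where k: "k \<in> Hom T V Z" "shf k = g \<cdot> y" using shift_full[of "g \<cdot> y" V Z] Z V g y by auto
      have "k = ZeroArr T V Z"
      proof (rule serreD(5)[OF s k(1)])
        fix f assume f: "f \<in> Hom T X V"
        have "t' (shf (k \<cdot> f)) = \<zero>\<^sub>E" using n[of "y \<cdot> shf f"] g k y f by simp
        then show "t (k \<cdot> f) = \<zero>\<^sub>E" using tz[of "k \<cdot> f"] f k by simp
      qed
      then have "(g \<cdot> y) \<cdot> y' = ZeroArr T Y (sh Z)" using k(2)[symmetric] Z V y by simp
      then show "g = ZeroArr T Y (sh Z)" using y g by simp
    qed (use X Z in simp_all)
  next
    assume s: "serre (sh X) (sh Z) t'"
    show "serre X Z t"
    proof (rule serreI[OF X Z t])
      fix Y f assume Y: "Y \<in> Obj T" and f: "f \<in> Hom T X Y" and n: "\<And>g. g \<in> Hom T Y Z \<Longrightarrow> t (g \<cdot> f) = \<zero>\<^sub>E"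
      have "shf f = ZeroArr T (sh X) (sh Y)"
      proof (rule serreD(4)[OF s])
        fix g assume "g \<in> Hom T (sh Y) (sh Z)"
        then obtain g' where g: "g' \<in> Hom T Y Z" "shf g' = g" using shift_full Y Z by blast
        then have "t' (shf (g' \<cdot> f)) = \<zero>\<^sub>E" using tz[of "g' \<cdot> f"] n f by simp
        then show "t' (g \<cdot> shf f) = \<zero>\<^sub>E" using g f by simp
      qed (use f in simp)
      then show "f = ZeroArr T X Y" using shift_faithful[OF f, of "ZeroArr T X Y"] X Y by simp
    next
      fix Y g assume Y: "Y \<in> Obj T" and g: "g \<in> Hom T Y Z" and n: "\<And>f. f \<in> Hom T X Y \<Longrightarrow> t (g \<cdot> f) = \<zero>\<^sub>E"
      have "shf g = ZeroArr T (sh Y) (sh Z)"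
      proof (rule serreD(5)[OF s])
        fix f assume "f \<in> Hom T (sh X) (sh Y)"
        then obtain f' where f: "f' \<in> Hom T X Y" "shf f' = f" using shift_full X Y by blast
        then have "t' (shf (g \<cdot> f')) = \<zero>\<^sub>E" using tz[of "g \<cdot> f'"] n g by simp
        then show "t' (shf g \<cdot> f) = \<zero>\<^sub>E" using f g by simp
      qed (use g in simp)
      then show "g = ZeroArr T Y Z" using shift_faithful[OF g, of "ZeroArr T Y Z"] Y Z by simp
    qed
  qed
qed

text \<open>The sign makes up for the sign of \<open>u[1]\<close> in the rotated triangle, see \<open>serre_cone\<close>.\<close>
definition shift_form where
  "shift_form X Z t h = \<ominus>\<^bsub>E\<^esub> t (SOME h'. h' \<in> Hom T X Z \<and> shf h' = h)"

lemma shift_form: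
  assumes X: "X \<in> Obj T" and Z: "Z \<in> Obj T" and t: "t \<in> forms X Z"
  shows "\<And>h. h \<in> Hom T X Z \<Longrightarrow> shift_form X Z t (shf h) = \<ominus>\<^bsub>E\<^esub> t h"
    and "shift_form X Z t \<in> forms (sh X) (sh Z)"
proof -
  show 1: "shift_form X Z t (shf h) = \<ominus>\<^bsub>E\<^esub> t h" if h: "h \<in> Hom T X Z" for h
  proof -
    have "(SOME h'. h' \<in> Hom T X Z \<and> shf h' = shf h) = h"
      by (rule some_equality) (use h shift_faithful in blast)+
    then show ?thesis unfolding shift_form_def by simp
  qed
  show "shift_form X Z t \<in> forms (sh X) (sh Z)"
  proof (rule linear_mapsI)
    fix x assume "x \<in> carrier (hom_module T (sh X) (sh Z))"
    then obtain h where h: "h \<in> Hom T X Z" "x = shf h" using shift_full[of x X Z] X Z unfolding hom_module_simps by blast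
    then show "shift_form X Z t x \<in> carrier E" using 1[OF h(1)] form_simps[OF t] by simp
    fix y assume "y \<in> carrier (hom_module T (sh X) (sh Z))"
    then obtain k where k: "k \<in> Hom T X Z" "y = shf k" using shift_full[of y X Z] X Z unfolding hom_module_simps by blast
    have "shf (h \<boxplus> k) = x \<boxplus> y" using h k by simp
    then show "shift_form X Z t (x \<oplus>\<^bsub>hom_module T (sh X) (sh Z)\<^esub> y) = shift_form X Z t x \<oplus>\<^bsub>E\<^esub> shift_form X Z t y"
      using 1[of "h \<boxplus> k"] 1[OF h(1)] 1[OF k(1)] h k form_simps[OF t]
      by (simp add: E.M.minus_add)
  next
    fix r x assume r: "r \<in> carrier R" and "x \<in> carrier (hom_module T (sh X) (sh Z))"
    then obtain h where h: "h \<in> Hom T X Z" "x = shf h" using shift_full[of x X Z] X Z unfolding hom_module_simps by blast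
    have "shf (SmultArr T r h) = SmultArr T r x" using h r by simp
    then show "shift_form X Z t (r \<odot>\<^bsub>hom_module T (sh X) (sh Z)\<^esub> x) = r \<odot>\<^bsub>E\<^esub> shift_form X Z t x"
      using 1[of "SmultArr T r h"] 1[OF h(1)] h r form_simps[OF t] by (simp add: E.smult_r_minus)
  qed
qed

lemma serre_shift:
  assumes s: "serre X Z t"
  shows "serre (sh X) (sh Z) (shift_form X Z t)"
  using serre_shift_iff[OF serreD(1-3)[OF s] shift_form(2)[OF serreD(1-3)[OF s]] shift_form(1)[OF serreD(1-3)[OF s]]] s
  by blast

lemma serre_unshift:
  assumes X: "X \<in> Obj T" and Z: "Z \<in> Obj T" and s: "serre (sh X) (sh Z) t'"
  shows "\<exists>t. serre X Z t"
proof -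
  define t where "t h = \<ominus>\<^bsub>E\<^esub> t' (shf h)" for h
  note f = form_simps[OF serreD(3)[OF s]]
  have t: "t \<in> forms X Z"
    by (intro linear_mapsI) (simp_all add: t_def f E.M.minus_add E.smult_r_minus)
  have "t' (shf h) = \<ominus>\<^bsub>E\<^esub> t h" if "h \<in> Hom T X Z" for h
    using that f(1)[of "shf h"] by (simp add: t_def)
  then show ?thesis using serre_shift_iff[OF X Z t serreD(3)[OF s]] s by blast
qed

text \<open>The sign occurs in both shifted forms and cancels, so \<open>S(u)[1]\<close> is dual to
  \<open>u[1]\<close>.\<close>

lemma dual_arrow_shift:
  assumes s: "serre X Z t" and s': "serre X' Z' t'" and u: "u \<in> Hom T X X'" and a: "dual_arrow X' Z t Z' t' u a"
  shows "dual_arrow (sh X') (sh Z) (shift_form X Z t) (sh Z') (shift_form X' Z' t') (shf u) (shf a)"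
  unfolding dual_arrow_def
proof (intro conjI ballI)
  note a' = dual_arrowD[OF a]
  show "shf a \<in> Hom T (sh Z) (sh Z')" using a'(1) by simp
  fix h assume "h \<in> Hom T (sh X') (sh Z)"
  then obtain k where k: "k \<in> Hom T X' Z" "h = shf k" using shift_full[of h X' Z] serreD[OF s] serreD[OF s'] by blast
  have "shift_form X' Z' t' (shf (a \<cdot> k)) = shift_form X Z t (shf (k \<cdot> u))"
    using shift_form(1)[OF serreD(1-3)[OF s], of "k \<cdot> u"] shift_form(1)[OF serreD(1-3)[OF s'], of "a \<cdot> k"] a'(2)[OF k(1)] a'(1) u k(1)
    by simp
  then show "shift_form X' Z' t' (shf a \<cdot> h) = shift_form X Z t (h \<cdot> shf u)" using k a'(1) u by simp
qed

text \<open>The form on \<open>(Z, C)\<close> is prescribed on \<open>b \<circ> (Z, Y') + (X[1], C) \<circ> w\<close> by the compatibility with the two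
  given pairings; the axiom TR3 makes this well defined, and injectivity of \<open>E\<close> extends it.\<close>
lemma serre_cone:
  assumes sX: "serre X X' t" and sY: "serre Y Y' s"
    and tri: "dist_triangle T X Y Z u v w" and tri': "dist_triangle T X' Y' C a b c"
    and a: "dual_arrow Y X' t Y' s u a"
  obtains r where "serre Z C r" "dual_arrow Z Y' s C r v b" "dual_arrow (sh X) C r (sh X') (shift_form X X' t) w c"
proof -
  note d = dist_triangleD[OF tri] and d' = dist_triangleD[OF tri']
  define t1 where "t1 = shift_form X X' t"
  define s1 where "s1 = shift_form Y Y' s"
  have sX1: "serre (sh X) (sh X') t1" unfolding t1_def by (rule serre_shift[OF sX])
  have sY1: "serre (sh Y) (sh Y') s1" unfolding s1_def by (rule serre_shift[OF sY])
  have t1: "t1 (shf h) = \<ominus>\<^bsub>E\<^esub> t h" if "h \<in> Hom T X X'" for h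
    unfolding t1_def using shift_form(1)[OF serreD(1-3)[OF sX] that] .
  have a1: "dual_arrow (sh Y) (sh X') t1 (sh Y') s1 (shf u) (shf a)"
    unfolding t1_def s1_def by (rule dual_arrow_shift[OF sX sY d(4) a])
  note fs = form_simps[OF serreD(3)[OF sY]] and ft = form_simps[OF serreD(3)[OF sX1]]
  \<comment> \<open>The prescription \<open>r (b h) = s (h v)\<close> makes \<open>b\<close> dual to
    \<open>v\<close>, and \<open>r (k w) = t1 (c k)\<close> makes \<open>c\<close> dual to
    \<open>w\<close>.\<close>
  define G0 where "G0 = {(b \<cdot> h \<boxplus> k \<cdot> w, s (h \<cdot> v) \<oplus>\<^bsub>E\<^esub> t1 (c \<cdot> k)) | h k. h \<in> Hom T Z Y' \<and> k \<in> Hom T (sh X) C}"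
  have G0I: "(b \<cdot> h \<boxplus> k \<cdot> w, s (h \<cdot> v) \<oplus>\<^bsub>E\<^esub> t1 (c \<cdot> k)) \<in> G0" if "h \<in> Hom T Z Y'" "k \<in> Hom T (sh X) C" for h k
    using that unfolding G0_def by blast
  have "\<exists>r\<in>forms Z C. \<forall>(x, y)\<in>G0. r x = y"
  proof (rule injective_module_extend_from_graph[OF injective hom_is_module[OF d(3) d'(3)]])
    show "G0 \<subseteq> carrier (hom_module T Z C) \<times> carrier E"
      using d d' by (auto simp: G0_def fs ft)
    show "(\<zero>\<^bsub>hom_module T Z C\<^esub>, \<zero>\<^sub>E) \<in> G0"
      using G0I[of "ZeroArr T Z Y'" "ZeroArr T (sh X) C"] d d' by (simp add: fs ft)
  next
    fix x y x' y' assume "(x, y) \<in> G0" "(x', y') \<in> G0"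
    then obtain h k h' k' where hk: "h \<in> Hom T Z Y'" "k \<in> Hom T (sh X) C" "h' \<in> Hom T Z Y'" "k' \<in> Hom T (sh X) C"
      and eq: "x = b \<cdot> h \<boxplus> k \<cdot> w" "y = s (h \<cdot> v) \<oplus>\<^bsub>E\<^esub> t1 (c \<cdot> k)" "x' = b \<cdot> h' \<boxplus> k' \<cdot> w" "y' = s (h' \<cdot> v) \<oplus>\<^bsub>E\<^esub> t1 (c \<cdot> k')"
      unfolding G0_def by blast
    have "b \<cdot> (h \<boxplus> h') \<boxplus> (k \<boxplus> k') \<cdot> w = (b \<cdot> h \<boxplus> b \<cdot> h') \<boxplus> (k \<cdot> w \<boxplus> k' \<cdot> w)" using hk d d' by simp
    also have "\<dots> = x \<boxplus> x'"
      unfolding eq using hk d d' by (simp only: add_ac_arrow comp_typing neg_typing add_typing Hom_iff)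
    finally have 1: "b \<cdot> (h \<boxplus> h') \<boxplus> (k \<boxplus> k') \<cdot> w = x \<boxplus> x'" .
    have "s ((h \<boxplus> h') \<cdot> v) \<oplus>\<^bsub>E\<^esub> t1 (c \<cdot> (k \<boxplus> k')) = y \<oplus>\<^bsub>E\<^esub> y'"
      unfolding eq using hk d d' by (simp add: fs ft E.M.a_ac)
    then show "(x \<oplus>\<^bsub>hom_module T Z C\<^esub> x', y \<oplus>\<^bsub>E\<^esub> y') \<in> G0"
      using G0I[of "h \<boxplus> h'" "k \<boxplus> k'"] hk 1 by simp
  next
    fix q x y assume q: "q \<in> carrier R" and "(x, y) \<in> G0"
    then obtain h k where hk: "h \<in> Hom T Z Y'" "k \<in> Hom T (sh X) C"
      and eq: "x = b \<cdot> h \<boxplus> k \<cdot> w" "y = s (h \<cdot> v) \<oplus>\<^bsub>E\<^esub> t1 (c \<cdot> k)" unfolding G0_def by blast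
    interpret H: module R "hom_module T Z C" by (rule hom_is_module[OF d(3) d'(3)])
    have "SmultArr T q (b \<cdot> h \<boxplus> k \<cdot> w) = SmultArr T q (b \<cdot> h) \<boxplus> SmultArr T q (k \<cdot> w)"
      using H.smult_r_distr[of q "b \<cdot> h" "k \<cdot> w"] q hk d d' by simp
    then have 1: "b \<cdot> SmultArr T q h \<boxplus> SmultArr T q k \<cdot> w = SmultArr T q x" using q hk d d' eq by simp
    have "s (SmultArr T q h \<cdot> v) \<oplus>\<^bsub>E\<^esub> t1 (c \<cdot> SmultArr T q k) = q \<odot>\<^bsub>E\<^esub> y"
      unfolding eq using q hk d d' by (simp add: fs ft E.smult_r_distr)
    then show "(q \<odot>\<^bsub>hom_module T Z C\<^esub> x, q \<odot>\<^bsub>E\<^esub> y) \<in> G0"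
      using G0I[of "SmultArr T q h" "SmultArr T q k"] q hk 1 by simp
  next
    fix y assume "(\<zero>\<^bsub>hom_module T Z C\<^esub>, y) \<in> G0"
    then obtain h k where hk: "h \<in> Hom T Z Y'" "k \<in> Hom T (sh X) C"
      and eq: "b \<cdot> h \<boxplus> k \<cdot> w = ZeroArr T Z C" "y = s (h \<cdot> v) \<oplus>\<^bsub>E\<^esub> t1 (c \<cdot> k)" unfolding G0_def by auto
    \<comment> \<open>The relation is a commutative square between rotated triangles. The third
      arrow \<open>m[1]\<close> given by TR3 satisfies \<open>h v = a m\<close> and
      \<open>c k = (m u)[1]\<close>, so the two contributions to \<open>y\<close> are
      \<open>t (m u)\<close> and its negative.\<close>
    have "b \<cdot> h = neg k \<cdot> w"
      using eq_if_diff_zero[of "b \<cdot> h" Z C "neg k \<cdot> w"] eq(1) hk d d' by simp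
    then have "neg k \<cdot> w = b \<cdot> h" by simp
    moreover have "neg k \<in> Hom T (sh X) C" using hk by simp
    ultimately obtain l where l: "l \<in> Hom T (sh Y) (sh X')" "l \<cdot> neg (shf u) = c \<cdot> neg k"
      "shf h \<cdot> neg (shf v) = neg (shf a) \<cdot> l"
      using TR3[OF rotate[OF rotate[OF tri]] rotate[OF tri'] hk(1)] by blast
    obtain m where m: "m \<in> Hom T Y X'" "shf m = l" using shift_full[OF l(1) d(2) d'(1)] by blast
    have 1: "c \<cdot> k = shf (m \<cdot> u)"
    proof -
      have "neg (neg (l \<cdot> shf u)) = neg (neg (c \<cdot> k))" using l(1,2) hk d d' by simp
      moreover have "neg (neg (l \<cdot> shf u)) = l \<cdot> shf u" "neg (neg (c \<cdot> k)) = c \<cdot> k" using l(1) hk d d' by simp_all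
      ultimately show ?thesis using m d by simp
    qed
    have "shf (h \<cdot> v) = shf (a \<cdot> m)"
    proof -
      have "neg (neg (shf h \<cdot> shf v)) = neg (neg (shf a \<cdot> l))" using l(1,3) hk d d' by simp
      moreover have "neg (neg (shf h \<cdot> shf v)) = shf h \<cdot> shf v" "neg (neg (shf a \<cdot> l)) = shf a \<cdot> l"
        using l(1) hk d d' by simp_all
      ultimately show ?thesis using m d d' hk by simp
    qed
    then have 2: "h \<cdot> v = a \<cdot> m" using shift_faithful[of "h \<cdot> v" Y Y' "a \<cdot> m"] hk d d' m(1) by simp
    have "s (h \<cdot> v) = t (m \<cdot> u)" unfolding 2 using dual_arrowD(2)[OF a m(1)] .
    moreover have "t1 (c \<cdot> k) = \<ominus>\<^bsub>E\<^esub> t (m \<cdot> u)" unfolding 1 using t1[of "m \<cdot> u"] m(1) d by simp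
    moreover have "t (m \<cdot> u) \<in> carrier E" using form_simps(1)[OF serreD(3)[OF sX]] m(1) d by simp
    ultimately show "y = \<zero>\<^sub>E" unfolding eq(2) by (simp add: E.M.r_neg)
  qed
  then obtain r where r: "r \<in> forms Z C" and rG: "\<forall>(x, y)\<in>G0. r x = y" ..
  note fr = form_simps[OF r]
  have rv: "r (b \<cdot> h) = s (h \<cdot> v)" if h: "h \<in> Hom T Z Y'" for h
    using bspec[OF rG G0I[OF h, of "ZeroArr T (sh X) C"]] h d d' by (simp add: fs ft)
  have rw: "r (k \<cdot> w) = t1 (c \<cdot> k)" if k: "k \<in> Hom T (sh X) C" for k
    using bspec[OF rG G0I[of "ZeroArr T Z Y'", OF _ k]] k d d' by (simp add: fs ft)
  have v: "dual_arrow Z Y' s C r v b" unfolding dual_arrow_def using rv d' by (simp del: Hom_iff)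
  have w: "dual_arrow (sh X) C r (sh X') t1 w c" unfolding dual_arrow_def using rw d' by (simp del: Hom_iff)
  have "serre Z C r"
  proof (rule serreI[OF d(3) d'(3) r])
    fix P k assume P: "P \<in> Obj T" and k: "k \<in> Hom T P C" and n: "\<And>f. f \<in> Hom T Z P \<Longrightarrow> r (k \<cdot> f) = \<zero>\<^sub>E"
    \<comment> \<open>A chase as in the five lemma: \<open>c k\<close> pairs trivially, so
      \<open>k = b g\<close>; the form \<open>s (g -)\<close> factors through composition with
      \<open>u\<close>, which gives \<open>g = a m\<close>, and \<open>b a = 0\<close>.\<close>
    have "c \<cdot> k = ZeroArr T P (sh X')"
    proof (rule serreD(5)[OF sX1])
      fix f assume f: "f \<in> Hom T (sh X) P"
      have "r ((k \<cdot> f) \<cdot> w) = \<zero>\<^sub>E" using n[of "f \<cdot> w"] f k d by simp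
      then show "t1 ((c \<cdot> k) \<cdot> f) = \<zero>\<^sub>E" using rw[of "k \<cdot> f"] f k d' by simp
    qed (use k d' in simp)
    then obtain g where g: "g \<in> Hom T P Y'" "k = b \<cdot> g" using weak_kernel2[OF tri' k] by blast
    have n': "s (g \<cdot> (f \<cdot> v)) = \<zero>\<^sub>E" if f: "f \<in> Hom T Z P" for f
      using n[OF f] rv[of "g \<cdot> f"] f g d d' by simp
    have \<beta>: "(\<lambda>f. f \<cdot> u) \<in> linear_maps R (hom_module T Y P) (hom_module T X P)"
      by (rule linear_mapsI) (use d in simp_all)
    have ker: "s (g \<cdot> f) = \<zero>\<^sub>E" if f: "f \<in> Hom T Y P" "f \<cdot> u = ZeroArr T X P" for f
    proof -
      obtain f' where "f' \<in> Hom T Z P" "f = f' \<cdot> v" using weak_cokernel[OF tri f] by blast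
      then show ?thesis using n' by simp
    qed
    obtain \<zeta> where \<zeta>: "\<zeta> \<in> forms X P" "\<And>f. f \<in> Hom T Y P \<Longrightarrow> \<zeta> (f \<cdot> u) = s (g \<cdot> f)"
      using extend_form[OF d(2) P d(1) P \<beta> postcomp_form[OF serreD(3)[OF sY] g(1)] ker] by blast
    obtain m where m: "m \<in> Hom T P X'" "\<And>f. f \<in> Hom T X P \<Longrightarrow> \<zeta> f = t (m \<cdot> f)"
      using serre_represents_right[OF sX P \<zeta>(1)] by blast
    have "g = a \<cdot> m"
    proof (rule serre_eq_right[OF sY g(1)])
      show "a \<cdot> m \<in> Hom T P Y'" using m(1) d' by simp
      fix f assume f: "f \<in> Hom T Y P"
      have "s (g \<cdot> f) = t (m \<cdot> (f \<cdot> u))" using \<zeta>(2)[OF f] m(2)[of "f \<cdot> u"] f d by simp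
      also have "\<dots> = s (a \<cdot> (m \<cdot> f))" using dual_arrowD(2)[OF a, of "m \<cdot> f"] f m(1) d by simp
      finally show "s (g \<cdot> f) = s ((a \<cdot> m) \<cdot> f)" using f m(1) d' by simp
    qed
    then show "k = ZeroArr T P C"
      using g(2) comp_eq_comp[OF triangle_comp_zero[OF tri'], of m] m(1) d' by simp
  next
    fix P f assume P: "P \<in> Obj T" and f: "f \<in> Hom T Z P" and n: "\<And>k. k \<in> Hom T P C \<Longrightarrow> r (k \<cdot> f) = \<zero>\<^sub>E"
    \<comment> \<open>The mirror image: \<open>f = f' w\<close>, the form \<open>t1 (- f')\<close>
      factors through composition with \<open>a[1]\<close>, hence \<open>f' = m u[1]\<close>, and
      \<open>u[1] w = 0\<close>.\<close>
    have "f \<cdot> v = ZeroArr T Y P"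
    proof (rule serreD(4)[OF sY])
      fix g assume g: "g \<in> Hom T P Y'"
      show "s (g \<cdot> (f \<cdot> v)) = \<zero>\<^sub>E" using n[of "b \<cdot> g"] rv[of "g \<cdot> f"] g f d d' by simp
    qed (use f d in simp)
    then obtain f' where f': "f' \<in> Hom T (sh X) P" "f = f' \<cdot> w" using weak_cokernel2[OF tri f] by blast
    have n': "t1 ((c \<cdot> k) \<cdot> f') = \<zero>\<^sub>E" if k: "k \<in> Hom T P C" for k
      using n[OF k] rw[of "k \<cdot> f'"] k f' d d' by simp
    have \<beta>: "(\<lambda>h. shf a \<cdot> h) \<in> linear_maps R (hom_module T P (sh X')) (hom_module T P (sh Y'))"
      by (rule linear_mapsI) (use d' in simp_all)
    have ker: "t1 (h \<cdot> f') = \<zero>\<^sub>E" if h: "h \<in> Hom T P (sh X')" "shf a \<cdot> h = ZeroArr T P (sh Y')" for h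
    proof -
      obtain k where "k \<in> Hom T P C" "h = c \<cdot> k" using weak_kernel3[OF tri' h] by blast
      then show ?thesis using n' by simp
    qed
    obtain \<zeta> where \<zeta>: "\<zeta> \<in> forms P (sh Y')" "\<And>h. h \<in> Hom T P (sh X') \<Longrightarrow> \<zeta> (shf a \<cdot> h) = t1 (h \<cdot> f')"
      using extend_form[OF P shift_typing(1)[OF d'(1)] P shift_typing(1)[OF d'(2)] \<beta>
        precomp_form[OF serreD(3)[OF sX1] f'(1)] ker] by blast
    obtain m where m: "m \<in> Hom T (sh Y) P" "\<And>g. g \<in> Hom T P (sh Y') \<Longrightarrow> \<zeta> g = s1 (g \<cdot> m)"
      using serre_represents_left[OF sY1 P \<zeta>(1)] by blast
    have "f' = m \<cdot> shf u"
    proof (rule serre_eq_left[OF sX1 f'(1)])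
      show "m \<cdot> shf u \<in> Hom T (sh X) P" using m(1) d by simp
      fix h assume h: "h \<in> Hom T P (sh X')"
      have "t1 (h \<cdot> f') = s1 (shf a \<cdot> (h \<cdot> m))" using \<zeta>(2)[OF h] m(2)[of "shf a \<cdot> h"] m(1) h d' by simp
      also have "\<dots> = t1 ((h \<cdot> m) \<cdot> shf u)" using dual_arrowD(2)[OF a1, of "h \<cdot> m"] h m(1) by simp
      finally show "t1 (h \<cdot> f') = t1 (h \<cdot> (m \<cdot> shf u))" using h m(1) d by simp
    qed
    then show "f = ZeroArr T Z P"
      using f'(2) triangle_comp_zero3[OF tri] m(1) d by simp
  qed
  then show thesis using that v w unfolding t1_def by blast
qed


section \<open>Representability\<close>

lemma hom_functor_simps [simp]:
  "mob (Hom_from C X) Y = hom_module C X Y" "mar (Hom_from C X) f = (\<lambda>g. f \<bullet>\<^bsub>C\<^esub> g)"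
  "mob (Hom_to C X) Y = hom_module C Y X" "mar (Hom_to C X) f = (\<lambda>g. g \<bullet>\<^bsub>C\<^esub> f)"
  "mob (dual_of_cov R E C F) Y = Hom_R R (mob F Y) E"
  "mar (dual_of_cov R E C F) f \<xi> = compose (carrier (mob F (Dom C f))) \<xi> (mar F f)"
  "mob (dual_of_contra R E C F) Y = Hom_R R (mob F Y) E"
  "mar (dual_of_contra R E C F) f \<xi> = compose (carrier (mob F (Cod C f))) \<xi> (mar F f)"
  by (simp_all add: Hom_from_def Hom_to_def dual_of_cov_def dual_of_contra_def)

abbreviation dual where "dual X Y \<equiv> carrier (Hom_R R (hom_module T X Y) E)"

lemma dual_form: "\<xi> \<in> dual X Y \<Longrightarrow> \<xi> \<in> forms X Y"
  by (simp add: Hom_R_carrier)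

lemma restrict_dual:
  "\<lbrakk>\<xi> \<in> forms X Y; X \<in> Obj T; Y \<in> Obj T\<rbrakk> \<Longrightarrow> (\<lambda>f\<in>Hom T X Y. \<xi> f) \<in> dual X Y"
  using restrict_Hom_R[OF hom_is_module, of X Y \<xi>] by (simp del: Hom_iff)

text \<open>Yoneda: \<open>t\<close> is the form that \<open>\<psi>\<close> sends to the identity of
  \<open>Z\<close>. Naturality then shows that \<open>\<psi>\<close> sends the form
  \<open>t (g -)\<close> to \<open>g\<close>, so \<open>represented_pairing\<close> applies.\<close>

lemma nat_iso_contra_serre:
  assumes X: "X \<in> Obj T" and Z: "Z \<in> Obj T"
    and \<psi>: "nat_iso_contra R T (dual_of_cov R E T (Hom_from T X)) (Hom_to T Z) \<psi>"
  obtains t where "serre X Z t"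
    "\<And>Y \<xi> f. \<lbrakk>Y \<in> Obj T; \<xi> \<in> dual X Y; f \<in> Hom T X Y\<rbrakk> \<Longrightarrow> \<xi> f = t (\<psi> Y \<xi> \<cdot> f)"
    "\<And>Y g. g \<in> Hom T Y Z \<Longrightarrow> \<psi> Y (\<lambda>f\<in>Hom T X Y. t (g \<cdot> f)) = g"
proof -
  have bij: "bij_betw (\<psi> Y) (dual X Y) (Hom T Y Z)" if "Y \<in> Obj T" for Y
    using \<psi> that unfolding nat_iso_contra_def module_isos_def by (auto simp del: Hom_iff)
  have nat: "\<psi> Y (\<lambda>h\<in>Hom T X Y. \<xi> (f \<cdot> h)) = \<psi> Y' \<xi> \<cdot> f"
    if "f \<in> Hom T Y Y'" "\<xi> \<in> dual X Y'" for Y Y' f \<xi>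
    using \<psi> that Dom_Obj[OF that(1)] Cod_Obj[OF that(1)] unfolding nat_iso_contra_def by (simp add: compose_def)
  obtain t where t: "t \<in> dual X Z" "\<psi> Z t = Ident T Z"
    using bij[OF Z] Z unfolding bij_betw_def by (metis Ident_closed imageE)
  note tf = dual_form[OF t(1)]
  have inv: "\<psi> Y (\<lambda>f\<in>Hom T X Y. t (g \<cdot> f)) = g" if g: "g \<in> Hom T Y Z" for Y g
    using nat[OF g t(1)] t(2) g by simp
  have into: "\<psi> Y ` dual X Y \<subseteq> carrier (hom_module T Y Z)" "inj_on (\<psi> Y) (dual X Y)" if "Y \<in> Obj T" for Y
    using bij[OF that] unfolding bij_betw_def by (simp_all del: Hom_iff)
  note p = represented_pairing[OF hom_is_module[OF _ Z] hom_is_module[OF X] precomp_form[OF tf] postcomp_form[OF tf] into(2,1),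
      unfolded hom_module_simps, OF _ _ _ _ _ _ inv]
  have "serre X Z t"
    by (rule serreI[OF X Z tf]) (use p(2,3) in blast)+
  then show thesis using that p(1) inv by blast
qed

lemma nat_iso_cov_serre:
  assumes X: "X \<in> Obj T" and Z: "Z \<in> Obj T"
    and \<psi>: "nat_iso_cov R T (dual_of_contra R E T (Hom_to T X)) (Hom_from T Z) \<psi>"
  shows "\<exists>t. serre Z X t"
proof -
  have bij: "bij_betw (\<psi> Y) (dual Y X) (Hom T Z Y)" if "Y \<in> Obj T" for Y
    using \<psi> that unfolding nat_iso_cov_def module_isos_def by (auto simp del: Hom_iff)
  have nat: "\<psi> Y' (\<lambda>h\<in>Hom T Y' X. \<xi> (h \<cdot> f)) = f \<cdot> \<psi> Y \<xi>"
    if "f \<in> Hom T Y Y'" "\<xi> \<in> dual Y X" for Y Y' f \<xi>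
    using \<psi> that Dom_Obj[OF that(1)] Cod_Obj[OF that(1)] unfolding nat_iso_cov_def by (simp add: compose_def)
  obtain t where t: "t \<in> dual Z X" "\<psi> Z t = Ident T Z"
    using bij[OF Z] Z unfolding bij_betw_def by (metis Ident_closed imageE)
  note tf = dual_form[OF t(1)]
  have inv: "\<psi> Y (\<lambda>h\<in>Hom T Y X. t (h \<cdot> f)) = f" if f: "f \<in> Hom T Z Y" for Y f
    using nat[OF f t(1)] t(2) f by simp
  have into: "\<psi> Y ` dual Y X \<subseteq> carrier (hom_module T Z Y)" "inj_on (\<psi> Y) (dual Y X)" if "Y \<in> Obj T" for Y
    using bij[OF that] unfolding bij_betw_def by (simp_all del: Hom_iff)
  note p = represented_pairing[OF hom_is_module[OF Z] hom_is_module[OF _ X] postcomp_form[OF tf] precomp_form[OF tf] into(2,1),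
      unfolded hom_module_simps, OF _ _ _ _ _ _ inv]
  have "serre Z X t"
    by (rule serreI[OF Z X tf]) (use p(2,3) in blast)+
  then show ?thesis by blast
qed

definition represent_right where
  "represent_right X Z t Y = represent (hom_module T Y Z) (hom_module T X Y) (\<lambda>g f. t (g \<cdot> f))"

definition represent_left where
  "represent_left X Z t Y = represent (hom_module T X Y) (hom_module T Y Z) (\<lambda>f g. t (g \<cdot> f))"

lemma represent_right:
  assumes s: "serre X Z t" and Y: "Y \<in> Obj T"
  shows "represent_right X Z t Y \<in> module_isos R (Hom_R R (hom_module T X Y) E) (hom_module T Y Z)"
    and "\<xi> \<in> dual X Y \<Longrightarrow> represent_right X Z t Y \<xi> \<in> Hom T Y Z"
    and "\<lbrakk>\<xi> \<in> dual X Y; f \<in> Hom T X Y\<rbrakk> \<Longrightarrow> \<xi> f = t (represent_right X Z t Y \<xi> \<cdot> f)"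
    and "\<lbrakk>\<xi> \<in> dual X Y; g \<in> Hom T Y Z; \<And>f. f \<in> Hom T X Y \<Longrightarrow> \<xi> f = t (g \<cdot> f)\<rbrakk> \<Longrightarrow> represent_right X Z t Y \<xi> = g"
proof -
  note d = serreD[OF s]
  have surj: "\<exists>g\<in>Hom T Y Z. \<forall>f\<in>Hom T X Y. \<xi> f = t (g \<cdot> f)" if "\<xi> \<in> forms X Y" for \<xi>
    using serre_represents_right[OF s Y that] by metis
  note p = perfect_pairing[OF hom_is_module[OF Y d(2)] hom_is_module[OF d(1) Y] precomp_form[OF d(3)] postcomp_form[OF d(3)],
      folded represent_right_def, unfolded hom_module_simps, OF _ _ d(5) surj]
  show "represent_right X Z t Y \<in> module_isos R (Hom_R R (hom_module T X Y) E) (hom_module T Y Z)"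
    "\<xi> \<in> dual X Y \<Longrightarrow> represent_right X Z t Y \<xi> \<in> Hom T Y Z"
    "\<lbrakk>\<xi> \<in> dual X Y; f \<in> Hom T X Y\<rbrakk> \<Longrightarrow> \<xi> f = t (represent_right X Z t Y \<xi> \<cdot> f)"
    "\<lbrakk>\<xi> \<in> dual X Y; g \<in> Hom T Y Z; \<And>f. f \<in> Hom T X Y \<Longrightarrow> \<xi> f = t (g \<cdot> f)\<rbrakk> \<Longrightarrow> represent_right X Z t Y \<xi> = g"
    using p by blast+
qed

lemma represent_left:
  assumes s: "serre X Z t" and Y: "Y \<in> Obj T"
  shows "represent_left X Z t Y \<in> module_isos R (Hom_R R (hom_module T Y Z) E) (hom_module T X Y)"
    and "\<xi> \<in> dual Y Z \<Longrightarrow> represent_left X Z t Y \<xi> \<in> Hom T X Y"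
    and "\<lbrakk>\<xi> \<in> dual Y Z; g \<in> Hom T Y Z\<rbrakk> \<Longrightarrow> \<xi> g = t (g \<cdot> represent_left X Z t Y \<xi>)"
    and "\<lbrakk>\<xi> \<in> dual Y Z; f \<in> Hom T X Y; \<And>g. g \<in> Hom T Y Z \<Longrightarrow> \<xi> g = t (g \<cdot> f)\<rbrakk> \<Longrightarrow> represent_left X Z t Y \<xi> = f"
proof -
  note d = serreD[OF s]
  have surj: "\<exists>f\<in>Hom T X Y. \<forall>g\<in>Hom T Y Z. \<xi> g = t (g \<cdot> f)" if "\<xi> \<in> forms Y Z" for \<xi>
    using serre_represents_left[OF s Y that] by metis
  note p = perfect_pairing[OF hom_is_module[OF d(1) Y] hom_is_module[OF Y d(2)] postcomp_form[OF d(3)] precomp_form[OF d(3)],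
      folded represent_left_def, unfolded hom_module_simps, OF _ _ d(4) surj]
  show "represent_left X Z t Y \<in> module_isos R (Hom_R R (hom_module T Y Z) E) (hom_module T X Y)"
    "\<xi> \<in> dual Y Z \<Longrightarrow> represent_left X Z t Y \<xi> \<in> Hom T X Y"
    "\<lbrakk>\<xi> \<in> dual Y Z; g \<in> Hom T Y Z\<rbrakk> \<Longrightarrow> \<xi> g = t (g \<cdot> represent_left X Z t Y \<xi>)"
    "\<lbrakk>\<xi> \<in> dual Y Z; f \<in> Hom T X Y; \<And>g. g \<in> Hom T Y Z \<Longrightarrow> \<xi> g = t (g \<cdot> f)\<rbrakk> \<Longrightarrow> represent_left X Z t Y \<xi> = f"
    using p by blast+
qed

lemma serre_nat_iso_contra:
  assumes s: "serre X Z t"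
  shows "nat_iso_contra R T (dual_of_cov R E T (Hom_from T X)) (Hom_to T Z) (represent_right X Z t)"
  unfolding nat_iso_contra_def
proof (intro conjI ballI)
  fix Y Y' f \<xi> assume ob: "Y \<in> Obj T" "Y' \<in> Obj T" and f: "f \<in> Hom T Y Y'"
    and "\<xi> \<in> carrier (mob (dual_of_cov R E T (Hom_from T X)) Y')"
  then have \<xi>: "\<xi> \<in> dual X Y'" by simp
  have x: "(\<lambda>h\<in>Hom T X Y. \<xi> (f \<cdot> h)) \<in> dual X Y"
    by (rule restrict_dual[OF postcomp_form[OF dual_form[OF \<xi>] f] serreD(1)[OF s] ob(1)])
  note r = represent_right[OF s ob(2)]
  have "represent_right X Z t Y (\<lambda>h\<in>Hom T X Y. \<xi> (f \<cdot> h)) = represent_right X Z t Y' \<xi> \<cdot> f"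
    by (rule represent_right(4)[OF s ob(1) x]) (use r(2)[OF \<xi>] r(3)[OF \<xi>] f in simp_all)
  then show "represent_right X Z t Y (mar (dual_of_cov R E T (Hom_from T X)) f \<xi>) =
      mar (Hom_to T Z) f (represent_right X Z t Y' \<xi>)"
    using f by (simp add: compose_def)
qed (use represent_right(1)[OF s] in simp)

lemma serre_nat_iso_cov:
  assumes s: "serre X Z t"
  shows "nat_iso_cov R T (dual_of_contra R E T (Hom_to T Z)) (Hom_from T X) (represent_left X Z t)"
  unfolding nat_iso_cov_def
proof (intro conjI ballI)
  fix Y Y' f \<xi> assume ob: "Y \<in> Obj T" "Y' \<in> Obj T" and f: "f \<in> Hom T Y Y'"
    and "\<xi> \<in> carrier (mob (dual_of_contra R E T (Hom_to T Z)) Y)"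
  then have \<xi>: "\<xi> \<in> dual Y Z" by simp
  have x: "(\<lambda>h\<in>Hom T Y' Z. \<xi> (h \<cdot> f)) \<in> dual Y' Z"
    by (rule restrict_dual[OF precomp_form[OF dual_form[OF \<xi>] f] ob(2) serreD(2)[OF s]])
  note r = represent_left[OF s ob(1)]
  have "represent_left X Z t Y' (\<lambda>h\<in>Hom T Y' Z. \<xi> (h \<cdot> f)) = f \<cdot> represent_left X Z t Y \<xi>"
    by (rule represent_left(4)[OF s ob(2) x]) (use r(2)[OF \<xi>] r(3)[OF \<xi>] f in simp_all)
  then show "represent_left X Z t Y' (mar (dual_of_contra R E T (Hom_to T Z)) f \<xi>) =
      mar (Hom_from T X) f (represent_left X Z t Y \<xi>)"
    using f by (simp add: compose_def)
qed (use represent_left(1)[OF s] in simp)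

text \<open>Together with \<open>left_objs_iff\<close> this exhibits the two subcategories as the
  projections of one relation, so that each argument for \<open>Tr\<close> has a mirror image for
  \<open>Tl\<close>.\<close>

lemma right_objs_iff: "X \<in> right_objs R E T \<longleftrightarrow> (\<exists>Z t. serre X Z t)"
proof
  assume "X \<in> right_objs R E T"
  then obtain Z \<psi> where "X \<in> Obj T" "Z \<in> Obj T"
    "nat_iso_contra R T (dual_of_cov R E T (Hom_from T X)) (Hom_to T Z) \<psi>"
    unfolding right_objs_def by blast
  from nat_iso_contra_serre[OF this] show "\<exists>Z t. serre X Z t" by metis
next
  assume "\<exists>Z t. serre X Z t"
  then show "X \<in> right_objs R E T"
    unfolding right_objs_def using serre_nat_iso_contra serreD(1,2) by blast
qed

lemma left_objs_iff: "Z \<in> left_objs R E T \<longleftrightarrow> (\<exists>X t. serre X Z t)"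
proof
  assume "Z \<in> left_objs R E T"
  then obtain X \<psi> where "Z \<in> Obj T" "X \<in> Obj T"
    "nat_iso_cov R T (dual_of_contra R E T (Hom_to T Z)) (Hom_from T X) \<psi>"
    unfolding left_objs_def by blast
  then show "\<exists>X t. serre X Z t" using nat_iso_cov_serre by blast
next
  assume "\<exists>X t. serre X Z t"
  then show "Z \<in> left_objs R E T"
    unfolding left_objs_def using serre_nat_iso_cov serreD(1,2) by blast
qed

end

section \<open>Thickness\<close>

context hom_finite_triangulated
begin

abbreviation Tr where "Tr \<equiv> right_objs R E T"
abbreviation Tl where "Tl \<equiv> left_objs R E T"

text \<open>Rotation reduces the two-out-of-three property to cones, since membership is insensitive
  to the shift; direct summands are images of idempotents.\<close>

lemma thick_subcatI:
  assumes sub: "A \<subseteq> Obj T" and zero: "\<exists>N\<in>A. zero_object T N"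
    and iso: "\<And>X Y f. \<lbrakk>X \<in> A; iso_arr T X Y f\<rbrakk> \<Longrightarrow> Y \<in> A"
    and shift: "\<And>X. X \<in> Obj T \<Longrightarrow> X \<in> A \<longleftrightarrow> sh X \<in> A"
    and cone: "\<And>X Y Z u v w. \<lbrakk>dist_triangle T X Y Z u v w; X \<in> A; Y \<in> A\<rbrakk> \<Longrightarrow> Z \<in> A"
    and split: "\<And>X e B. \<lbrakk>X \<in> A; e \<in> Hom T X X; e \<cdot> e = e; split_idempotent X e B\<rbrakk> \<Longrightarrow> B \<in> A"
  shows "thick_subcat T A"
proof -
  have tri: "(X \<in> A \<and> Y \<in> A \<longrightarrow> Z \<in> A) \<and> (Y \<in> A \<and> Z \<in> A \<longrightarrow> X \<in> A) \<and> (X \<in> A \<and> Z \<in> A \<longrightarrow> Y \<in> A)"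
    if t: "dist_triangle T X Y Z u v w" for X Y Z u v w
    using cone[OF t] cone[OF rotate[OF t]] cone[OF rotate[OF rotate[OF t]]] dist_triangleD(1,2)[OF t] shift by blast
  have sum: "B \<in> A \<and> B' \<in> A" if X: "X \<in> A" and "direct_sum T [B, B'] X" for X B B'
  proof -
    obtain i j p q where ob: "B \<in> Obj T" "B' \<in> Obj T" and t: "i \<in> Hom T B X" "j \<in> Hom T B' X" "p \<in> Hom T X B" "q \<in> Hom T X B'"
      and e: "p \<cdot> i = Ident T B" "q \<cdot> j = Ident T B'"
      using \<open>direct_sum T [B, B'] X\<close> unfolding direct_sum_pair_iff by blast
    have "split_idempotent X (i \<cdot> p) B" "split_idempotent X (j \<cdot> q) B'"
      unfolding split_idempotent_def using ob t e by blast+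
    moreover have "(i \<cdot> p) \<cdot> (i \<cdot> p) = i \<cdot> p" "(j \<cdot> q) \<cdot> (j \<cdot> q) = j \<cdot> q"
      using t ob comp_eq_comp[OF e(1), of p] comp_eq_comp[OF e(2), of q] by simp_all
    ultimately show ?thesis using split[OF X, of "i \<cdot> p" B] split[OF X, of "j \<cdot> q" B'] t by simp
  qed
  show ?thesis
    unfolding thick_subcat_def triangulated_subcat_def
  proof (intro conjI)
    show "\<forall>X\<in>A. \<forall>Y\<in>Obj T. (\<exists>f. iso_arr T X Y f) \<longrightarrow> Y \<in> A" using iso by blast
    show "\<forall>X\<in>Obj T. X \<in> A \<longleftrightarrow> sh X \<in> A" using shift by blast
    show "\<forall>X Y Z u v w. dist_triangle T X Y Z u v w \<longrightarrow>
        (X \<in> A \<and> Y \<in> A \<longrightarrow> Z \<in> A) \<and> (Y \<in> A \<and> Z \<in> A \<longrightarrow> X \<in> A) \<and> (X \<in> A \<and> Z \<in> A \<longrightarrow> Y \<in> A)"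
      by (intro allI impI tri)
    show "\<forall>X B B'. X \<in> A \<and> direct_sum T [B, B'] X \<longrightarrow> B \<in> A \<and> B' \<in> A" using sum by blast
  qed (use sub zero in auto)
qed

lemma right_objsE:
  assumes "X \<in> Tr"
  obtains Z t where "serre X Z t"
  using assms right_objs_iff by blast

lemma left_objsE:
  assumes "Z \<in> Tl"
  obtains X t where "serre X Z t"
  using assms left_objs_iff by blast

lemma right_objsI: "serre X Z t \<Longrightarrow> X \<in> Tr"
  and left_objsI: "serre X Z t \<Longrightarrow> Z \<in> Tl"
  using right_objs_iff left_objs_iff by blast+

lemma shift_preimage:
  assumes "Y \<in> Obj T"
  obtains V y where "V \<in> Obj T" "iso_arr T Y (sh V) y"
  using shift_surj[OF assms] by (meson iso_arrE)

lemma thick_right: "thick_subcat T Tr"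
proof (rule thick_subcatI)
  show "Tr \<subseteq> Obj T" using right_objsE serreD(1) by blast
  show "\<exists>N\<in>Tr. zero_object T N" using zero_object_exists serre_zero right_objsI by blast
next
  fix X Y f assume "X \<in> Tr" and f: "iso_arr T X Y f"
  then obtain Z t where s: "serre X Z t" using right_objsE by blast
  show "Y \<in> Tr" using serre_iso[OF s f iso_arr_Ident[OF serreD(2)[OF s]]] right_objsI by blast
next
  fix X assume X: "X \<in> Obj T"
  show "X \<in> Tr \<longleftrightarrow> sh X \<in> Tr"
  proof
    assume "X \<in> Tr"
    then obtain Z t where "serre X Z t" using right_objsE by blast
    then show "sh X \<in> Tr" by (rule right_objsI[OF serre_shift])
  next
    assume "sh X \<in> Tr"
    then obtain W t where s: "serre (sh X) W t" using right_objsE by blast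
    \<comment> \<open>The partner \<open>W\<close> of \<open>X[1]\<close> is only isomorphic to a
      shift, and \<open>serre_unshift\<close> needs shifts on both sides.\<close>
    obtain V y where V: "V \<in> Obj T" "iso_arr T W (sh V) y" using shift_preimage serreD(2)[OF s] by blast
    obtain t' where "serre (sh X) (sh V) t'" using serre_iso[OF s iso_arr_Ident[OF serreD(1)[OF s]] V(2)] by blast
    then show "X \<in> Tr" using serre_unshift[OF X V(1)] right_objsI by blast
  qed
next
  fix X Y Z u v w assume tri: "dist_triangle T X Y Z u v w" and "X \<in> Tr" "Y \<in> Tr"
  then obtain X' t Y' s where sX: "serre X X' t" and sY: "serre Y Y' s" using right_objsE by metis
  obtain a where a: "dual_arrow Y X' t Y' s u a" using dual_arrow_exists[OF sX sY dist_triangleD(4)[OF tri]] .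
  obtain C b c where "dist_triangle T X' Y' C a b c"
    using TR1_cone[OF serreD(2)[OF sX] serreD(2)[OF sY] dual_arrowD(1)[OF a]] by blast
  then show "Z \<in> Tr" using serre_cone[OF sX sY tri _ a] right_objsI by metis
next
  fix X e B assume "X \<in> Tr" and e: "e \<in> Hom T X X" "e \<cdot> e = e" and B: "split_idempotent X e B"
  then obtain Z t where s: "serre X Z t" using right_objsE by blast
  obtain e' where d: "dual_arrow X Z t Z t e e'" using dual_arrow_exists[OF s s e(1)] .
  \<comment> \<open>\<open>e'\<close> and \<open>e' e'\<close> are both dual to
    \<open>e e = e\<close>, so \<open>e'\<close> is idempotent and splits.\<close>
  have "dual_arrow X Z t Z t e (e' \<cdot> e')" using dual_arrow_comp[OF s e(1,1) d d] unfolding e(2) .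
  then have "e' \<cdot> e' = e'" using dual_arrow_unique[OF s _ d] by blast
  then obtain C where "split_idempotent Z e' C" using idempotent_splits[OF dual_arrowD(1)[OF d]] by blast
  then show "B \<in> Tr" using serre_split[OF s e(1) d B] right_objsI by blast
qed

lemma thick_left: "thick_subcat T Tl"
proof (rule thick_subcatI)
  show "Tl \<subseteq> Obj T" using left_objsE serreD(2) by blast
  show "\<exists>N\<in>Tl. zero_object T N" using zero_object_exists serre_zero left_objsI by blast
next
  fix Z Y f assume "Z \<in> Tl" and f: "iso_arr T Z Y f"
  then obtain X t where s: "serre X Z t" using left_objsE by blast
  show "Y \<in> Tl" using serre_iso[OF s iso_arr_Ident[OF serreD(1)[OF s]] f] left_objsI by blast
next
  fix Z assume Z: "Z \<in> Obj T"
  show "Z \<in> Tl \<longleftrightarrow> sh Z \<in> Tl"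
  proof
    assume "Z \<in> Tl"
    then obtain X t where "serre X Z t" using left_objsE by blast
    then show "sh Z \<in> Tl" by (rule left_objsI[OF serre_shift])
  next
    assume "sh Z \<in> Tl"
    then obtain W t where s: "serre W (sh Z) t" using left_objsE by blast
    obtain V y where V: "V \<in> Obj T" "iso_arr T W (sh V) y" using shift_preimage serreD(1)[OF s] by blast
    obtain t' where "serre (sh V) (sh Z) t'" using serre_iso[OF s V(2) iso_arr_Ident[OF serreD(2)[OF s]]] by blast
    then show "Z \<in> Tl" using serre_unshift[OF V(1) Z] left_objsI by blast
  qed
next
  fix X' Y' C a b c assume tri': "dist_triangle T X' Y' C a b c" and "X' \<in> Tl" "Y' \<in> Tl"
  then obtain X t Y s where sX: "serre X X' t" and sY: "serre Y Y' s" using left_objsE by metis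
  \<comment> \<open>In contrast to the case of \<open>Tr\<close>, the arrow \<open>a\<close> is
    given and \<open>u\<close> with \<open>S(u) = a\<close> is recovered from it.\<close>
  obtain u where u: "u \<in> Hom T X Y" and a: "dual_arrow Y X' t Y' s u a"
    using predual_arrow_exists[OF sX sY dist_triangleD(4)[OF tri']] .
  obtain Z v w where "dist_triangle T X Y Z u v w"
    using TR1_cone[OF serreD(1)[OF sX] serreD(1)[OF sY] u] by blast
  then show "C \<in> Tl" using serre_cone[OF sX sY _ tri' a] left_objsI by metis
next
  fix Z e' C assume "Z \<in> Tl" and e': "e' \<in> Hom T Z Z" "e' \<cdot> e' = e'" and C: "split_idempotent Z e' C"
  then obtain X t where s: "serre X Z t" using left_objsE by blast
  obtain e where e: "e \<in> Hom T X X" and d: "dual_arrow X Z t Z t e e'" using predual_arrow_exists[OF s s e'(1)] .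
  have "e \<cdot> e = e"
    by (rule predual_arrow_unique[OF s _ e _ d]) (use dual_arrow_comp[OF s e e d d] e' e in simp_all)
  then obtain B where "split_idempotent X e B" using idempotent_splits[OF e] by blast
  then show "C \<in> Tl" using serre_split[OF s e d _ C] left_objsI by blast
qed

lemma right_objs_Obj: "Tr \<subseteq> Obj T"
  and right_objs_shift: "X \<in> Tr \<Longrightarrow> sh X \<in> Tr"
  using thick_right unfolding thick_subcat_def triangulated_subcat_def by blast+

lemma left_objs_Obj: "Tl \<subseteq> Obj T"
  and left_objs_shift: "X \<in> Tl \<Longrightarrow> sh X \<in> Tl"
  and left_objs_unshift: "\<lbrakk>X \<in> Obj T; sh X \<in> Tl\<rbrakk> \<Longrightarrow> X \<in> Tl"
  using thick_left unfolding thick_subcat_def triangulated_subcat_def by blast+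


section \<open>The generalized Serre functor\<close>

text \<open>A partner and a form are chosen for each object and arrows are sent to their dual
  arrows, whose uniqueness yields the functor laws. The natural isomorphism is
  \<open>represent_right\<close>.\<close>

lemma generalized_serre_functor_exists: "\<exists>S. generalized_serre_functor R E T S"
proof -
  have "\<forall>X\<in>Tr. \<exists>Z t. serre X Z t" using right_objs_iff by blast
  then obtain Z t where s: "\<And>X. X \<in> Tr \<Longrightarrow> serre X (Z X) (t X)" by metis
  define A where "A u = (SOME a. dual_arrow (Cod T u) (Z (Dom T u)) (t (Dom T u)) (Z (Cod T u)) (t (Cod T u)) u a)" for u
  have A: "dual_arrow X' (Z X) (t X) (Z X') (t X') u (A u)" if X: "X \<in> Tr" "X' \<in> Tr" and u: "u \<in> Hom T X X'" for X X' u
  proof -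
    obtain a where "dual_arrow X' (Z X) (t X) (Z X') (t X') u a" using dual_arrow_exists[OF s[OF X(1)] s[OF X(2)] u] .
    then show ?thesis unfolding A_def using u by (auto intro: someI)
  qed
  define S where "S = \<lparr>fob = Z, far = A\<rparr>"
  have S: "fob S = Z" "far S = A" by (simp_all add: S_def)
  have "is_functor (full_subcat T Tr) (full_subcat T Tl) S"
    unfolding is_functor_def S full_subcat_simps
  proof (intro conjI ballI)
    show "Z X \<in> Tl" if "X \<in> Tr" for X using s[OF that] left_objsI by blast
    fix X Y u assume "X \<in> Tr" "Y \<in> Tr" "u \<in> Hom (full_subcat T Tr) X Y"
    then show "A u \<in> Hom (full_subcat T Tl) (Z X) (Z Y)"
      using dual_arrowD(1)[OF A[of X Y u]] left_objsI[OF s] by (simp add: full_subcat_Hom del: Hom_iff)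
  next
    fix X assume X: "X \<in> Tr"
    have I: "Ident T X \<in> Hom T X X" using X right_objs_Obj by auto
    show "A (Ident T X) = Ident T (Z X)"
      using dual_arrow_unique[OF s[OF X] A[OF X X I] dual_arrow_Ident[OF s[OF X]]] .
  next
    fix X X' X'' u u' assume X: "X \<in> Tr" "X' \<in> Tr" "X'' \<in> Tr"
      and "u \<in> Hom (full_subcat T Tr) X X'" "u' \<in> Hom (full_subcat T Tr) X' X''"
    then have u: "u \<in> Hom T X X'" "u' \<in> Hom T X' X''" by (simp_all add: full_subcat_Hom del: Hom_iff)
    then have uu: "u' \<cdot> u \<in> Hom T X X''" by simp
    show "A (u' \<cdot> u) = A u' \<cdot> A u"
      using dual_arrow_unique[OF s[OF X(3)] A[OF X(1,3) uu] dual_arrow_comp[OF s[OF X(1)] u A[OF X(1,2) u(1)] A[OF X(2,3) u(2)]]] .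
  qed
  moreover have "nat_iso_contra R T (dual_of_cov R E T (Hom_from T X)) (Hom_to T (fob S X)) (represent_right X (Z X) (t X))"
    if "X \<in> Tr" for X
    using serre_nat_iso_contra[OF s[OF that]] by (simp add: S)
  moreover have "nat_iso_cov R (full_subcat T Tr) (dual_of_contra R E T (Hom_to T Y)) (precomp_func (Hom_from T Y) S)
      (\<lambda>X. represent_right X (Z X) (t X) Y)" if Y: "Y \<in> Obj T" for Y
    unfolding nat_iso_cov_def full_subcat_simps
  proof (intro conjI ballI)
    fix X assume "X \<in> Tr"
    then have "represent_right X (Z X) (t X) Y \<in> module_isos R (Hom_R R (hom_module T X Y) E) (hom_module T Y (Z X))"
      using serre_nat_iso_contra[OF s] Y unfolding nat_iso_contra_def by simp
    then show "represent_right X (Z X) (t X) Y \<in> module_isos R (mob (dual_of_contra R E T (Hom_to T Y)) X) (mob (precomp_func (Hom_from T Y) S) X)"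
      by (simp add: precomp_func_def S)
  next
    fix X X' u \<xi> assume X: "X \<in> Tr" "X' \<in> Tr" and "u \<in> Hom (full_subcat T Tr) X X'"
      and "\<xi> \<in> carrier (mob (dual_of_contra R E T (Hom_to T Y)) X)"
    then have u: "u \<in> Hom T X X'" and \<xi>: "\<xi> \<in> dual X Y" by (simp_all add: full_subcat_Hom del: Hom_iff)
    let ?g = "represent_right X (Z X) (t X) Y \<xi>"
    note r = represent_right(2,3)[OF s[OF X(1)] Y \<xi>] and a = dual_arrowD[OF A[OF X u]]
    have "represent_right X' (Z X') (t X') Y (\<lambda>h\<in>Hom T X' Y. \<xi> (h \<cdot> u)) = A u \<cdot> ?g"
    proof (rule represent_right(4)[OF s[OF X(2)] Y restrict_dual[OF precomp_form[OF dual_form[OF \<xi>] u] serreD(1)[OF s[OF X(2)]] Y]])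
      show "A u \<cdot> ?g \<in> Hom T Y (Z X')" using r(1) a(1) by simp
      fix h assume h: "h \<in> Hom T X' Y"
      have "\<xi> (h \<cdot> u) = t X ((?g \<cdot> h) \<cdot> u)" using r(2)[of "h \<cdot> u"] r(1) h u by simp
      also have "\<dots> = t X' (A u \<cdot> (?g \<cdot> h))" using a(2)[of "?g \<cdot> h"] r(1) h by simp
      finally show "(\<lambda>h\<in>Hom T X' Y. \<xi> (h \<cdot> u)) h = t X' ((A u \<cdot> ?g) \<cdot> h)" using h r(1) a(1) by simp
    qed
    then show "represent_right X' (Z X') (t X') Y (mar (dual_of_contra R E T (Hom_to T Y)) u \<xi>) =
        mar (precomp_func (Hom_from T Y) S) u ?g"
      using u by (simp add: precomp_func_def S compose_def)
  qed
  ultimately have "generalized_serre_functor R E T S"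
    unfolding generalized_serre_functor_def by (intro conjI exI[of _ "\<lambda>X. represent_right X (Z X) (t X)"]) blast+
  then show ?thesis by blast
qed

text \<open>For an arbitrary functor with the defining property, naturality in \<open>Y\<close>
  produces the forms and naturality in \<open>X\<close> identifies \<open>S(u)\<close> as the dual
  arrow of \<open>u\<close>.\<close>

lemma generalized_serre_functor_pairings:
  assumes "generalized_serre_functor R E T S"
  obtains t where "\<And>X. X \<in> Tr \<Longrightarrow> serre X (fob S X) (t X)"
    "\<And>X X' u. \<lbrakk>X \<in> Tr; X' \<in> Tr; u \<in> Hom T X X'\<rbrakk> \<Longrightarrow> dual_arrow X' (fob S X) (t X) (fob S X') (t X') u (far S u)"
proof -
  obtain \<phi> where F: "is_functor (full_subcat T Tr) (full_subcat T Tl) S"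
    and \<phi>1: "\<And>X. X \<in> Tr \<Longrightarrow> nat_iso_contra R T (dual_of_cov R E T (Hom_from T X)) (Hom_to T (fob S X)) (\<phi> X)"
    and \<phi>2: "\<And>Y. Y \<in> Obj T \<Longrightarrow> nat_iso_cov R (full_subcat T Tr) (dual_of_contra R E T (Hom_to T Y)) (precomp_func (Hom_from T Y) S) (\<lambda>X. \<phi> X Y)"
    using assms unfolding generalized_serre_functor_def by blast
  note F' = is_functorD[OF F, unfolded full_subcat_simps]
  have SX: "fob S X \<in> Obj T" if "X \<in> Tr" for X using F'(1)[OF that] left_objs_Obj by blast
  have "\<exists>t. serre X (fob S X) t \<and> (\<forall>Y \<xi> f. Y \<in> Obj T \<longrightarrow> \<xi> \<in> dual X Y \<longrightarrow> f \<in> Hom T X Y \<longrightarrow> \<xi> f = t (\<phi> X Y \<xi> \<cdot> f)) \<and>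
      (\<forall>Y g. g \<in> Hom T Y (fob S X) \<longrightarrow> \<phi> X Y (\<lambda>f\<in>Hom T X Y. t (g \<cdot> f)) = g)" if X: "X \<in> Tr" for X
  proof -
    have Xo: "X \<in> Obj T" using X right_objs_Obj by blast
    show ?thesis by (rule nat_iso_contra_serre[OF Xo SX[OF X] \<phi>1[OF X]]) blast
  qed
  then have "\<forall>X\<in>Tr. \<exists>t. serre X (fob S X) t \<and> (\<forall>Y \<xi> f. Y \<in> Obj T \<longrightarrow> \<xi> \<in> dual X Y \<longrightarrow> f \<in> Hom T X Y \<longrightarrow> \<xi> f = t (\<phi> X Y \<xi> \<cdot> f)) \<and>
      (\<forall>Y g. g \<in> Hom T Y (fob S X) \<longrightarrow> \<phi> X Y (\<lambda>f\<in>Hom T X Y. t (g \<cdot> f)) = g)" by blast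
  from bchoice[OF this] obtain t where
    tt: "\<forall>X\<in>Tr. serre X (fob S X) (t X) \<and> (\<forall>Y \<xi> f. Y \<in> Obj T \<longrightarrow> \<xi> \<in> dual X Y \<longrightarrow> f \<in> Hom T X Y \<longrightarrow> \<xi> f = t X (\<phi> X Y \<xi> \<cdot> f)) \<and>
      (\<forall>Y g. g \<in> Hom T Y (fob S X) \<longrightarrow> \<phi> X Y (\<lambda>f\<in>Hom T X Y. t X (g \<cdot> f)) = g)" ..
  have s: "serre X (fob S X) (t X)" if "X \<in> Tr" for X using tt that by blast
  have t1: "\<xi> f = t X (\<phi> X Y \<xi> \<cdot> f)" if "X \<in> Tr" "Y \<in> Obj T" "\<xi> \<in> dual X Y" "f \<in> Hom T X Y" for X Y \<xi> f
    using tt that by blast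
  have t2: "\<phi> X Y (\<lambda>f\<in>Hom T X Y. t X (g \<cdot> f)) = g" if "X \<in> Tr" "g \<in> Hom T Y (fob S X)" for X Y g
    using tt that by blast
  have "dual_arrow X' (fob S X) (t X) (fob S X') (t X') u (far S u)"
    if X: "X \<in> Tr" "X' \<in> Tr" and u: "u \<in> Hom T X X'" for X X' u
    unfolding dual_arrow_def
  proof (intro conjI ballI)
    note So = SX[OF X(1)]
    show Su: "far S u \<in> Hom T (fob S X) (fob S X')"
      using F'(2)[of u X X'] F'(1) X u by (simp add: full_subcat_Hom del: Hom_iff)
    fix h assume h: "h \<in> Hom T X' (fob S X)"
    \<comment> \<open>\<open>\<xi>\<close> is the form \<open>t X\<close>, written as in the
      inversion formula \<open>t2\<close>, so that \<open>\<phi>\<close> sends it to the identity.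
      Naturality along \<open>u\<close>, applied to \<open>\<xi>\<close>, then shows that the form
      \<open>\<zeta>\<close> is sent to \<open>S(u)\<close>.\<close>
    define \<xi> where "\<xi> = (\<lambda>f\<in>Hom T X (fob S X). t X (Ident T (fob S X) \<cdot> f))"
    have I: "Ident T (fob S X) \<in> Hom T (fob S X) (fob S X)" using So by simp
    have \<xi>: "\<xi> \<in> dual X (fob S X)" unfolding \<xi>_def
      by (rule restrict_dual[OF postcomp_form[OF serreD(3)[OF s[OF X(1)]] I] serreD(1)[OF s[OF X(1)]] So])
    have \<phi>\<xi>: "\<phi> X (fob S X) \<xi> = Ident T (fob S X)" unfolding \<xi>_def by (rule t2[OF X(1) I])
    define \<zeta> where "\<zeta> = (\<lambda>h\<in>Hom T X' (fob S X). \<xi> (h \<cdot> u))"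
    have \<zeta>: "\<zeta> \<in> dual X' (fob S X)" unfolding \<zeta>_def
      by (rule restrict_dual[OF precomp_form[OF dual_form[OF \<xi>] u] serreD(1)[OF s[OF X(2)]] So])
    have "\<phi> X' (fob S X) \<zeta> = far S u \<cdot> \<phi> X (fob S X) \<xi>"
      using \<phi>2[OF So] X u \<xi> unfolding nat_iso_cov_def full_subcat_simps \<zeta>_def
      by (simp add: full_subcat_Hom precomp_func_def compose_def)
    then have "\<phi> X' (fob S X) \<zeta> = far S u" using \<phi>\<xi> Su by simp
    then have "t X' (far S u \<cdot> h) = \<zeta> h" using t1[OF X(2) So \<zeta> h] by simp
    also have "\<dots> = t X (h \<cdot> u)" using h u So by (simp add: \<zeta>_def \<xi>_def)
    finally show "t X' (far S u \<cdot> h) = t X (h \<cdot> u)" .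
  qed
  then show thesis using that[of t] s by blast
qed

end

section \<open>Restricted triangulated categories and the triangle equivalence\<close>

lemma restrict_tcat_simps [simp]:
  "Obj (restrict_tcat C A) = A" "Ident (restrict_tcat C A) = Ident C" "Comp (restrict_tcat C A) = Comp C"
  "Dom (restrict_tcat C A) = Dom C" "Cod (restrict_tcat C A) = Cod C" "Shift (restrict_tcat C A) = Shift C"
  "Arr (restrict_tcat C A) = {f \<in> Arr C. Dom C f \<in> A \<and> Cod C f \<in> A}"
  by (simp_all add: restrict_tcat_def full_subcat_def)

context hom_finite_triangulated
begin

lemma restrict_tcat_Hom: "\<lbrakk>X \<in> A; Y \<in> A\<rbrakk> \<Longrightarrow> Hom (restrict_tcat T A) X Y = Hom T X Y"
  by (auto simp: Hom_def)

lemma restrict_tcat_HomD: "f \<in> Hom (restrict_tcat T A) X Y \<Longrightarrow> f \<in> Hom T X Y \<and> X \<in> A \<and> Y \<in> A"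
  by (auto simp: Hom_def)

lemma restrict_tcat_category:
  assumes "A \<subseteq> Obj T"
  shows "category (restrict_tcat T A)"
  by unfold_locales (use assms in \<open>auto simp: Hom_def[of "restrict_tcat T A"]\<close>)

lemma restrict_tcat_iso:
  "\<lbrakk>X \<in> A; Y \<in> A\<rbrakk> \<Longrightarrow> iso_arr (restrict_tcat T A) X Y f \<longleftrightarrow> iso_arr T X Y f"
  unfolding iso_arr_def by (simp add: restrict_tcat_Hom del: Hom_iff)

text \<open>\<open>sh X\<close> has to lie in \<open>A\<close> because it is the target of the third
  arrow, which must belong to the restricted category.\<close>

lemma dist_triangle_restrict_tcat:
  "dist_triangle (restrict_tcat T A) X Y Z u v w \<longleftrightarrow>
     X \<in> A \<and> Y \<in> A \<and> Z \<in> A \<and> sh X \<in> A \<and> dist_triangle T X Y Z u v w" if "A \<subseteq> Obj T"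
  using that unfolding dist_triangle_def triangle_def
  by (auto simp: restrict_tcat_def full_subcat_def Hom_def)

text \<open>\<open>X[1]\<close> carries two Serre pairings, its own and the shifted one of
  \<open>X\<close>; \<open>\<eta> X\<close> compares them. Likewise the third object of a triangle
  carries its own pairing and the one built by \<open>serre_cone\<close> on a cone of
  \<open>S(u)\<close>; comparing these identifies the image triangle with a distinguished
  one.\<close>

lemma triangle_equivalence_serre:
  assumes S: "generalized_serre_functor R E T S"
  shows "\<exists>\<eta>. triangle_equivalence (restrict_tcat T Tr) (restrict_tcat T Tl) S \<eta>"
proof -
  let ?A = "restrict_tcat T Tr" and ?B = "restrict_tcat T Tl"
  obtain t where s: "\<And>X. X \<in> Tr \<Longrightarrow> serre X (fob S X) (t X)"
    and d: "\<And>X X' u. \<lbrakk>X \<in> Tr; X' \<in> Tr; u \<in> Hom T X X'\<rbrakk> \<Longrightarrow> dual_arrow X' (fob S X) (t X) (fob S X') (t X') u (far S u)"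
    using generalized_serre_functor_pairings[OF S] by blast
  have F: "is_functor (full_subcat T Tr) (full_subcat T Tl) S"
    using S unfolding generalized_serre_functor_def by blast
  note F' = is_functorD[OF F, unfolded full_subcat_simps]
  have FS: "is_functor ?A ?B S"
  proof -
    have "Hom ?A = Hom (full_subcat T Tr)" "Hom ?B = Hom (full_subcat T Tl)"
      by (intro ext, simp add: Hom_def)+
    then show ?thesis using F unfolding is_functor_def by (simp del: Hom_iff)
  qed
  have Sob: "fob S X \<in> Tl" if "X \<in> Tr" for X using F'(1)[OF that] .
  have Sobj: "fob S X \<in> Obj T" if "X \<in> Tr" for X using Sob[OF that] left_objs_Obj by blast
  have Tro: "X \<in> Obj T" if "X \<in> Tr" for X using that right_objs_Obj by blast
  note Sar = dual_arrowD(1)[OF d]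
  have shift_fun: "is_functor (restrict_tcat T A) (restrict_tcat T A) (Shift T)"
    if "A \<subseteq> Obj T" "\<And>X. X \<in> A \<Longrightarrow> sh X \<in> A" for A
    unfolding is_functor_def
  proof (intro conjI ballI)
    fix X Y f assume "X \<in> Obj (restrict_tcat T A)" "Y \<in> Obj (restrict_tcat T A)" "f \<in> Hom (restrict_tcat T A) X Y"
    then show "shf f \<in> Hom (restrict_tcat T A) (sh X) (sh Y)" using that(2) by (simp add: restrict_tcat_Hom)
  next
    fix X Y Z f g assume "X \<in> Obj (restrict_tcat T A)" "Y \<in> Obj (restrict_tcat T A)" "Z \<in> Obj (restrict_tcat T A)"
      "f \<in> Hom (restrict_tcat T A) X Y" "g \<in> Hom (restrict_tcat T A) Y Z"
    then show "shf (g \<bullet>\<^bsub>restrict_tcat T A\<^esub> f) = shf g \<bullet>\<^bsub>restrict_tcat T A\<^esub> shf f" by (simp add: restrict_tcat_Hom)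
  qed (use that in auto)
  have eq: "is_equivalence ?A ?B S"
  proof (rule equivalence_if_fully_faithful[OF restrict_tcat_category[OF right_objs_Obj] restrict_tcat_category[OF left_objs_Obj] FS])
    fix X Y f f' assume "f \<in> Hom ?A X Y" "f' \<in> Hom ?A X Y" and e: "far S f = far S f'"
    then have f: "f \<in> Hom T X Y" "f' \<in> Hom T X Y" and X: "X \<in> Tr" "Y \<in> Tr" using restrict_tcat_HomD by blast+
    show "f = f'" using predual_arrow_unique[OF s[OF X(1)] f d[OF X f(1)]] d[OF X f(2)] e by simp
  next
    fix X Y h assume h: "h \<in> Hom ?B (fob S X) (fob S Y)" and "X \<in> Obj ?A" "Y \<in> Obj ?A"
    then have X: "X \<in> Tr" "Y \<in> Tr" by simp_all
    obtain u where u: "u \<in> Hom T X Y" and du: "dual_arrow Y (fob S X) (t X) (fob S Y) (t Y) u h"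
      using predual_arrow_exists[OF s[OF X(1)] s[OF X(2)]] restrict_tcat_HomD[OF h] by blast
    have "far S u = h" using dual_arrow_unique[OF s[OF X(2)] d[OF X u] du] .
    then show "\<exists>f\<in>Hom ?A X Y. far S f = h" using u X by (auto simp: restrict_tcat_Hom simp del: Hom_iff)
  next
    fix Z assume "Z \<in> Obj ?B"
    then have Z: "Z \<in> Tl" by simp
    obtain X r where r: "serre X Z r" using left_objsE[OF Z] .
    have X: "X \<in> Tr" using right_objsI[OF r] .
    \<comment> \<open>\<open>S(X)\<close> and \<open>Z\<close> are both partners of
      \<open>X\<close>, hence isomorphic.\<close>
    obtain a where a: "dual_arrow X (fob S X) (t X) Z r (Ident T X) a"
      using dual_arrow_exists[OF s[OF X] r] Tro[OF X] by (metis Ident_closed)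
    have "iso_arr ?B (fob S X) Z a" using dual_arrow_Ident_iso[OF s[OF X] r a] restrict_tcat_iso Sob[OF X] Z by blast
    then show "\<exists>X\<in>Obj ?A. \<exists>f. iso_arr ?B (fob S X) Z f" using X by auto
  qed
  define sf where "sf X = shift_form X (fob S X) (t X)" for X
  have ssf: "serre (sh X) (sh (fob S X)) (sf X)" if "X \<in> Tr" for X
    unfolding sf_def by (rule serre_shift[OF s[OF that]])
  define \<eta> where "\<eta> X = (SOME a. dual_arrow (sh X) (fob S (sh X)) (t (sh X)) (sh (fob S X)) (sf X) (Ident T (sh X)) a)" for X
  have \<eta>: "dual_arrow (sh X) (fob S (sh X)) (t (sh X)) (sh (fob S X)) (sf X) (Ident T (sh X)) (\<eta> X)" if X: "X \<in> Tr" for X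
  proof -
    obtain a where "dual_arrow (sh X) (fob S (sh X)) (t (sh X)) (sh (fob S X)) (sf X) (Ident T (sh X)) a"
      using dual_arrow_exists[OF s[OF right_objs_shift[OF X]] ssf[OF X]] Tro[OF right_objs_shift[OF X]]
      by (metis Ident_closed)
    then show ?thesis unfolding \<eta>_def by (rule someI)
  qed
  have \<eta>_iso: "iso_arr T (fob S (sh X)) (sh (fob S X)) (\<eta> X)" if X: "X \<in> Tr" for X
    using dual_arrow_Ident_iso[OF s[OF right_objs_shift[OF X]] ssf[OF X] \<eta>[OF X]] .
  have "nat_iso ?A ?B (comp_func S (Shift ?A)) (comp_func (Shift ?B) S) \<eta>"
    unfolding nat_iso_def
  proof (intro conjI ballI)
    show "is_functor ?A ?B (comp_func S (Shift ?A))" "is_functor ?A ?B (comp_func (Shift ?B) S)"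
      using is_functor_comp[OF shift_fun[OF right_objs_Obj right_objs_shift] FS]
        is_functor_comp[OF FS shift_fun[OF left_objs_Obj left_objs_shift]] by simp_all
    fix X assume "X \<in> Obj ?A"
    then have X: "X \<in> Tr" by simp
    then show "iso_arr ?B (fob (comp_func S (Shift ?A)) X) (fob (comp_func (Shift ?B) S) X) (\<eta> X)"
      using restrict_tcat_iso[OF Sob[OF right_objs_shift] left_objs_shift[OF Sob]] \<eta>_iso by (simp add: comp_func_def)
  next
    fix X Y f assume "X \<in> Obj ?A" "Y \<in> Obj ?A" "f \<in> Hom ?A X Y"
    then have X: "X \<in> Tr" "Y \<in> Tr" and f: "f \<in> Hom T X Y" using restrict_tcat_HomD by simp_all
    note sX = right_objs_shift[OF X(1)] right_objs_shift[OF X(2)]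
    have f1: "shf f \<in> Hom T (sh X) (sh Y)" using f by simp
    have I: "Ident T (sh X) \<in> Hom T (sh X) (sh X)" "Ident T (sh Y) \<in> Hom T (sh Y) (sh Y)" using Tro X by simp_all
    have d1: "dual_arrow (sh Y) (sh (fob S X)) (sf X) (sh (fob S Y)) (sf Y) (shf f) (shf (far S f))"
      unfolding sf_def by (rule dual_arrow_shift[OF s[OF X(1)] s[OF X(2)] f d[OF X f]])
    have "\<eta> Y \<cdot> far S (shf f) = shf (far S f) \<cdot> \<eta> X"
      using dual_arrow_unique[OF ssf[OF X(2)]] dual_arrow_comp[OF s[OF sX(1)] f1 I(2) d[OF sX f1] \<eta>[OF X(2)]]
        dual_arrow_comp[OF s[OF sX(1)] I(1) f1 \<eta>[OF X(1)] d1] f1 by simp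
    then show "\<eta> Y \<bullet>\<^bsub>?B\<^esub> far (comp_func S (Shift ?A)) f = far (comp_func (Shift ?B) S) f \<bullet>\<^bsub>?B\<^esub> \<eta> X"
      by (simp add: comp_func_def)
  qed
  moreover have "dist_triangle ?B (fob S X) (fob S Y) (fob S Z) (far S u) (far S v) (\<eta> X \<bullet>\<^bsub>?B\<^esub> far S w)"
    if "dist_triangle ?A X Y Z u v w" for X Y Z u v w
  proof -
    have X: "X \<in> Tr" "Y \<in> Tr" "Z \<in> Tr" "sh X \<in> Tr" and tri: "dist_triangle T X Y Z u v w"
      using that dist_triangle_restrict_tcat[OF right_objs_Obj] by blast+
    note td = dist_triangleD[OF tri]
    note du = d[OF X(1,2) td(4)] and dv = d[OF X(2,3) td(5)] and dw = d[OF X(3,4) td(6)]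
    obtain C b c where tri': "dist_triangle T (fob S X) (fob S Y) C (far S u) b c"
      using TR1_cone[OF Sobj[OF X(1)] Sobj[OF X(2)] dual_arrowD(1)[OF du]] by blast
    note td' = dist_triangleD[OF tri']
    obtain r where r: "serre Z C r" and b: "dual_arrow Z (fob S Y) (t Y) C r v b"
      and c: "dual_arrow (sh X) C r (sh (fob S X)) (sf X) w c"
      using serre_cone[OF s[OF X(1)] s[OF X(2)] tri tri' du] unfolding sf_def by blast
    have I: "Ident T Z \<in> Hom T Z Z" "Ident T (sh X) \<in> Hom T (sh X) (sh X)" using td by simp_all
    \<comment> \<open>\<open>\<sigma>\<close> compares the partners \<open>S(Z)\<close> and
      \<open>C\<close> of \<open>Z\<close>. Uniqueness of the dual arrows of \<open>v\<close> and
      \<open>w\<close> will give \<open>b = \<sigma> S(v)\<close> and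
      \<open>c \<sigma> = \<eta> S(w)\<close>.\<close>
    obtain \<sigma> where \<sigma>: "dual_arrow Z (fob S Z) (t Z) C r (Ident T Z) \<sigma>" using dual_arrow_exists[OF s[OF X(3)] r I(1)] .
    obtain \<tau> where \<sigma>\<tau>: "\<sigma> \<in> Hom T (fob S Z) C" "\<tau> \<in> Hom T C (fob S Z)" "\<tau> \<cdot> \<sigma> = Ident T (fob S Z)" "\<sigma> \<cdot> \<tau> = Ident T C"
      and \<tau>: "iso_arr T C (fob S Z) \<tau>"
      using dual_arrow_Ident_iso[OF s[OF X(3)] r \<sigma>] by (rule iso_arrE)
    have "dual_arrow Z (fob S Y) (t Y) C r v (\<sigma> \<cdot> far S v)"
      using dual_arrow_comp[OF s[OF X(2)] td(5) I(1) dv \<sigma>] td by simp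
    then have b\<sigma>: "b = \<sigma> \<cdot> far S v" using dual_arrow_unique[OF r b] by blast
    have "dual_arrow (sh X) (fob S Z) (t Z) (sh (fob S X)) (sf X) w (c \<cdot> \<sigma>)"
      using dual_arrow_comp[OF s[OF X(3)] I(1) td(6) \<sigma> c] td by simp
    moreover have "dual_arrow (sh X) (fob S Z) (t Z) (sh (fob S X)) (sf X) w (\<eta> X \<cdot> far S w)"
      using dual_arrow_comp[OF s[OF X(3)] td(6) I(2) dw \<eta>[OF X(1)]] td by simp
    ultimately have c\<sigma>: "c \<cdot> \<sigma> = \<eta> X \<cdot> far S w" using dual_arrow_unique[OF ssf[OF X(1)]] by blast
    note ar = dual_arrowD(1)[OF du] dual_arrowD(1)[OF dv] dual_arrowD(1)[OF dw] dual_arrowD(1)[OF \<eta>[OF X(1)]]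
    have "dist_triangle T (fob S X) (fob S Y) (fob S Z) (far S u) (far S v) (\<eta> X \<cdot> far S w)"
    proof (rule TR1_iso[OF tri' _ iso_arr_Ident[OF td'(1)] iso_arr_Ident[OF td'(2)] \<tau>])
      show "triangle T (fob S X) (fob S Y) (fob S Z) (far S u) (far S v) (\<eta> X \<cdot> far S w)"
        unfolding triangle_def using Sobj X ar by simp
      show "\<tau> \<cdot> b = far S v \<cdot> Ident T (fob S Y)"
        unfolding b\<sigma> using comp_eq_comp[OF \<sigma>\<tau>(3), of "far S v"] \<sigma>\<tau> ar by simp
      show "shf (Ident T (fob S X)) \<cdot> c = \<eta> X \<cdot> far S w \<cdot> \<tau>"
        unfolding c\<sigma>[symmetric] using \<sigma>\<tau> td' by simp
    qed (use ar td' in simp)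
    then show ?thesis
      using dist_triangle_restrict_tcat[OF left_objs_Obj] Sob X left_objs_shift by simp
  qed
  ultimately have "triangle_equivalence ?A ?B S \<eta>"
    unfolding triangle_equivalence_def triangle_functor_def using FS eq by blast
  then show ?thesis by blast
qed


section \<open>Auslander-Reiten triangles\<close>

text \<open>Passing to dual arrows is a multiplicative bijection between the endomorphisms of
  \<open>X\<close> and of \<open>Z\<close> that preserves zero and identity, so the idempotent
  criterion transfers.\<close>

lemma serre_indecomposable_iff:
  assumes s: "serre X Z t"
  shows "indecomposable T X \<longleftrightarrow> indecomposable T Z"
proof -
  note d = serreD[OF s]
  have zero: "dual_arrow X Z t Z t (ZeroArr T X X) (ZeroArr T Z Z)"
    unfolding dual_arrow_def using d(1,2) by (simp add: form_simps[OF d(3)])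
  note ident = dual_arrow_Ident[OF s]
  have nz: "Ident T X = ZeroArr T X X \<longleftrightarrow> Ident T Z = ZeroArr T Z Z"
  proof
    assume "Ident T X = ZeroArr T X X"
    then show "Ident T Z = ZeroArr T Z Z" using dual_arrow_unique[OF s ident] zero by simp
  next
    assume "Ident T Z = ZeroArr T Z Z"
    then show "Ident T X = ZeroArr T X X"
      using predual_arrow_unique[OF s _ _ ident] zero d(1) by simp
  qed
  have "(\<forall>e\<in>Hom T X X. e \<cdot> e = e \<longrightarrow> e = ZeroArr T X X \<or> e = Ident T X) \<longleftrightarrow>
      (\<forall>e\<in>Hom T Z Z. e \<cdot> e = e \<longrightarrow> e = ZeroArr T Z Z \<or> e = Ident T Z)" (is "?L \<longleftrightarrow> ?R")
  proof
    assume L: ?L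
    show ?R
    proof (intro ballI impI)
      fix e' assume e': "e' \<in> Hom T Z Z" "e' \<cdot> e' = e'"
      obtain e where e: "e \<in> Hom T X X" and de: "dual_arrow X Z t Z t e e'" using predual_arrow_exists[OF s s e'(1)] .
      have "e \<cdot> e = e"
        by (rule predual_arrow_unique[OF s _ e _ de]) (use dual_arrow_comp[OF s e e de de] e' e in simp_all)
      then have "e = ZeroArr T X X \<or> e = Ident T X" using L e by blast
      then show "e' = ZeroArr T Z Z \<or> e' = Ident T Z"
        using dual_arrow_unique[OF s de] zero ident by blast
    qed
  next
    assume R: ?R
    show ?L
    proof (intro ballI impI)
      fix e assume e: "e \<in> Hom T X X" "e \<cdot> e = e"
      obtain e' where de: "dual_arrow X Z t Z t e e'" using dual_arrow_exists[OF s s e(1)] .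
      have "dual_arrow X Z t Z t e (e' \<cdot> e')" using dual_arrow_comp[OF s e(1,1) de de] unfolding e(2) .
      then have "e' \<cdot> e' = e'" using dual_arrow_unique[OF s _ de] by blast
      then have "e' = ZeroArr T Z Z \<or> e' = Ident T Z" using R dual_arrowD(1)[OF de] by blast
      then show "e = ZeroArr T X X \<or> e = Ident T X"
        using predual_arrow_unique[OF s e(1) _ de] zero ident d(1) by auto
    qed
  qed
  then show ?thesis using nz by (simp only: indecomposable_iff[OF d(1)] indecomposable_iff[OF d(2)])
qed

lemma indecomposable_shift:
  assumes V: "V \<in> Obj T"
  shows "indecomposable T V \<longleftrightarrow> indecomposable T (sh V)"
proof -
  have i: "shf e = ZeroArr T (sh V) (sh V) \<longleftrightarrow> e = ZeroArr T V V" "shf e = Ident T (sh V) \<longleftrightarrow> e = Ident T V"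
    if "e \<in> Hom T V V" for e
    using shift_faithful[OF that, of "ZeroArr T V V"] shift_faithful[OF that, of "Ident T V"] V by auto
  have id: "shf e \<cdot> shf e = shf e \<longleftrightarrow> e \<cdot> e = e" if "e \<in> Hom T V V" for e
  proof -
    have "shf (e \<cdot> e) = shf e \<cdot> shf e" and t: "e \<cdot> e \<in> Hom T V V" using that by simp_all
    then show ?thesis using shift_faithful[OF t that] by metis
  qed
  have all: "(\<forall>e\<in>Hom T (sh V) (sh V). P e) \<longleftrightarrow> (\<forall>e\<in>Hom T V V. P (shf e))" for P
  proof
    assume "\<forall>e\<in>Hom T (sh V) (sh V). P e"
    then show "\<forall>e\<in>Hom T V V. P (shf e)" by simp
  next
    assume "\<forall>e\<in>Hom T V V. P (shf e)"
    then show "\<forall>e\<in>Hom T (sh V) (sh V). P e" using shift_full[OF _ V V] by blast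
  qed
  show ?thesis
    unfolding indecomposable_iff[OF V] indecomposable_iff[OF shift_typing(1)[OF V]] all
    using i id i(1)[of "Ident T V"] V by (simp del: Hom_iff) (simp)
qed

text \<open>Take a nonzero \<open>w\<close> in \<open>(X, V[1])\<close> with \<open>w \<circ> End(X)\<close> minimal; it is annihilated by the radical of the local
  ring \<open>End(X)\<close>. Testing against the Serre pairing shows \<open>w \<circ> \<gamma> = 0\<close> for every non-retraction \<open>\<gamma>\<close>.\<close>
lemma AR_triangle_exists:
  assumes s: "serre X (sh V) t" and V: "V \<in> Obj T" and ind: "indecomposable T X"
  shows "\<exists>Y u v w. AR_triangle T V Y X u v w"
proof -
  note d = serreD[OF s]
  note loc = indecomposable_iso[OF ind]
  define ok where "ok w \<longleftrightarrow> w \<in> Hom T X (sh V) \<and> w \<noteq> ZeroArr T X (sh V)" for w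
  have "\<exists>w. ok w"
  proof (rule ccontr)
    assume n: "\<not> ?thesis"
    \<comment> \<open>If \<open>(X, V[1])\<close> were zero, nondegeneracy would annihilate the
      identity of \<open>X\<close>.\<close>
    have "Ident T X = ZeroArr T X X"
    proof (rule d(4))
      fix g assume g: "g \<in> Hom T X (sh V)"
      then have "g = ZeroArr T X (sh V)" using n unfolding ok_def by blast
      then show "t (g \<cdot> Ident T X) = \<zero>\<^sub>E" using d(1,2) by (simp add: form_simps[OF d(3)])
    qed (use d(1) in simp)
    then show False using ind d(1) indecomposable_iff by blast
  qed
  then obtain w where "ok w" and min: "\<And>h. \<lbrakk>h \<in> Hom T X X; ok (w \<cdot> h)\<rbrakk> \<Longrightarrow> \<exists>k\<in>Hom T X X. w = (w \<cdot> h) \<cdot> k"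
    using minimal_comp_image[of ok] unfolding ok_def by metis
  then have w: "w \<in> Hom T X (sh V)" and w0: "w \<noteq> ZeroArr T X (sh V)" unfolding ok_def by blast+
  have rad: "w \<cdot> j = ZeroArr T X (sh V)" if j: "j \<in> Hom T X X" "\<not> iso_arr T X X j" for j
  proof (rule ccontr)
    assume "w \<cdot> j \<noteq> ZeroArr T X (sh V)"
    then have "ok (w \<cdot> j)" unfolding ok_def using w j by simp
    then obtain h where h: "h \<in> Hom T X X" and wjh: "w = (w \<cdot> j) \<cdot> h" using min[OF j(1)] by blast
    \<comment> \<open>Nakayama's argument: \<open>w = w j h\<close> with \<open>1 - j h\<close>
      invertible forces \<open>w = 0\<close>.\<close>
    have "iso_arr T X X (Ident T X \<boxplus> neg (j \<cdot> h))" using loc(1)[OF j(1) h j(2)] loc(2)[of "j \<cdot> h"] j h by simp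
    then obtain k where k: "k \<in> Hom T X X" "(Ident T X \<boxplus> neg (j \<cdot> h)) \<cdot> k = Ident T X" by (rule iso_arrE)
    have "w \<cdot> (Ident T X \<boxplus> neg (j \<cdot> h)) = w \<boxplus> neg ((w \<cdot> j) \<cdot> h)" using w j h d(1) by simp
    also have "\<dots> = ZeroArr T X (sh V)" using wjh[symmetric] w by simp
    finally have z: "w \<cdot> (Ident T X \<boxplus> neg (j \<cdot> h)) = ZeroArr T X (sh V)" .
    have "w = w \<cdot> ((Ident T X \<boxplus> neg (j \<cdot> h)) \<cdot> k)" unfolding k(2) using w by simp
    also have "\<dots> = (w \<cdot> (Ident T X \<boxplus> neg (j \<cdot> h))) \<cdot> k" by (rule comp_assoc[symmetric]) (use w j h k(1) d(1) in simp_all)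
    also have "\<dots> = ZeroArr T X (sh V)" unfolding z using k(1) d(2) by simp
    finally show False using w0 by blast
  qed
  obtain Y v q where tri: "dist_triangle T Y X (sh V) v w q" using cocone[OF w] by blast
  note td = dist_triangleD[OF tri]
  \<comment> \<open>The third object is literally \<open>V[1]\<close>, so rotating back with
    \<open>u[1] = - q\<close> makes \<open>V\<close> the first term.\<close>
  obtain u where u: "u \<in> Hom T V Y" "shf u = neg q" using shift_full[of "neg q" V Y] td V by auto
  have "dist_triangle T V Y X u v w" using unrotate[OF V u(1), of X v w] tri u(2) td by simp
  moreover have "w \<cdot> \<gamma> = ZeroArr T P (sh V)" if \<gamma>: "\<gamma> \<in> Hom T P X" "\<not> retraction T P X \<gamma>" for P \<gamma>
  proof (rule d(5))
    show "w \<cdot> \<gamma> \<in> Hom T P (sh V)" using w \<gamma> by simp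
    fix f assume f: "f \<in> Hom T X P"
    \<comment> \<open>An inverse of \<open>\<gamma> f\<close> would make \<open>\<gamma>\<close> a
      retraction; so \<open>\<gamma> f\<close> is a nonunit, which \<open>w\<close> kills.\<close>
    have "\<not> iso_arr T X X (\<gamma> \<cdot> f)"
    proof
      assume "iso_arr T X X (\<gamma> \<cdot> f)"
      then obtain k where "k \<in> Hom T X X" "(\<gamma> \<cdot> f) \<cdot> k = Ident T X" by (rule iso_arrE)
      then have "\<gamma> \<cdot> (f \<cdot> k) = Ident T X" "f \<cdot> k \<in> Hom T X P" using \<gamma> f by simp_all
      then show False using \<gamma> unfolding retraction_def by blast
    qed
    then show "t ((w \<cdot> \<gamma>) \<cdot> f) = \<zero>\<^sub>E" using rad[of "\<gamma> \<cdot> f"] w \<gamma> f d(1,2) by (simp add: form_simps[OF d(3)])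
  qed
  moreover have "indecomposable T V" using ind serre_indecomposable_iff[OF s] indecomposable_shift[OF V] by blast
  ultimately show ?thesis unfolding AR_triangle_def using ind w0 by blast
qed

text \<open>A form that does not vanish on \<open>w\<close> is nondegenerate: every nonzero \<open>f : X \<rightarrow> P\<close> is a right factor of \<open>w\<close>,
  because the cocone of \<open>f\<close> is not a retraction, and every nonzero \<open>g : P \<rightarrow> W[1]\<close> is a left factor of \<open>w\<close>.\<close>
lemma AR_triangle_serre:
  assumes AR: "AR_triangle T W Y X u v w"
  shows "\<exists>t. serre X (sh W) t"
proof -
  have tri: "dist_triangle T W Y X u v w" and iW: "indecomposable T W" and w0: "w \<noteq> ZeroArr T X (sh W)"
    and ar: "\<And>P \<gamma>. \<lbrakk>P \<in> Obj T; \<gamma> \<in> Hom T P X; \<not> retraction T P X \<gamma>\<rbrakk> \<Longrightarrow> w \<cdot> \<gamma> = ZeroArr T P (sh W)"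
    using AR unfolding AR_triangle_def by blast+
  note td = dist_triangleD[OF tri]
  have X: "X \<in> Obj T" and W1: "sh W \<in> Obj T" and w: "w \<in> Hom T X (sh W)" using td by simp_all
  have "indecomposable T (sh W)" using iW indecomposable_shift[OF td(1)] by blast
  note loc = indecomposable_iso(2)[OF this]
  obtain t where t: "t \<in> forms X (sh W)" "t w \<noteq> \<zero>\<^sub>E"
    using linear_form_separating[OF hom_is_module[OF X W1], of w] w w0 by auto
  have right: "\<exists>g\<in>Hom T P (sh W). g \<cdot> f = w" if f: "f \<in> Hom T X P" and f0: "f \<noteq> ZeroArr T X P" for P f
  proof -
    have P: "P \<in> Obj T" using Cod_Obj[OF f] .
    obtain Q p q where trf: "dist_triangle T Q X P p f q" using cocone[OF f] by blast
    note tf = dist_triangleD[OF trf]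
    have "\<not> retraction T Q X p"
    proof
      assume "retraction T Q X p"
      then obtain r where r: "r \<in> Hom T X Q" "p \<cdot> r = Ident T X" unfolding retraction_def by blast
      have "f = f \<cdot> (p \<cdot> r)" using r(2) f by simp
      also have "\<dots> = ZeroArr T X P" using comp_eq_comp[OF triangle_comp_zero[OF trf], of r] r(1) tf P by simp
      finally show False using f0 by blast
    qed
    then have "w \<cdot> p = ZeroArr T Q (sh W)" using ar tf by blast
    then obtain g where "g \<in> Hom T P (sh W)" "w = g \<cdot> f" using weak_cokernel[OF trf w] by blast
    then show ?thesis by blast
  qed
  have left: "\<exists>f\<in>Hom T X P. g \<cdot> f = w" if g: "g \<in> Hom T P (sh W)" and g0: "g \<noteq> ZeroArr T P (sh W)" for P g
  proof -
    have P: "P \<in> Obj T" using Dom_Obj[OF g] .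
    obtain Q \<gamma> q where trg: "dist_triangle T P (sh W) Q g \<gamma> q" using TR1_cone[OF P W1 g] by blast
    note tg = dist_triangleD[OF trg]
    \<comment> \<open>Otherwise \<open>right\<close> gives \<open>k \<gamma> w = w\<close>. Since
      \<open>W[1]\<close> is indecomposable, either \<open>k \<gamma>\<close> is invertible, and
      \<open>\<gamma> g = 0\<close> forces \<open>g = 0\<close>, or \<open>1 - k \<gamma>\<close> is
      invertible, and as it kills \<open>w\<close>, it forces \<open>w = 0\<close>.\<close>
    have "\<gamma> \<cdot> w = ZeroArr T X Q"
    proof (rule ccontr)
      assume "\<gamma> \<cdot> w \<noteq> ZeroArr T X Q"
      then obtain k where k: "k \<in> Hom T Q (sh W)" "k \<cdot> (\<gamma> \<cdot> w) = w" using right[of "\<gamma> \<cdot> w" Q] w tg by auto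
      have kg: "k \<cdot> \<gamma> \<in> Hom T (sh W) (sh W)" using k(1) tg by simp
      show False
      proof (cases "iso_arr T (sh W) (sh W) (k \<cdot> \<gamma>)")
        case True
        then obtain r where r: "r \<in> Hom T (sh W) (sh W)" "r \<cdot> (k \<cdot> \<gamma>) = Ident T (sh W)" by (rule iso_arrE)
        have "g = (r \<cdot> (k \<cdot> \<gamma>)) \<cdot> g" unfolding r(2) using g by simp
        also have "\<dots> = r \<cdot> (k \<cdot> (\<gamma> \<cdot> g))" using r(1) k(1) tg by simp
        also have "\<dots> = ZeroArr T P (sh W)" using triangle_comp_zero[OF trg] r(1) k(1) P by simp
        finally show False using g0 by blast
      next
        case False
        then have "iso_arr T (sh W) (sh W) (Ident T (sh W) \<boxplus> neg (k \<cdot> \<gamma>))" using loc kg by blast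
        then obtain r where r: "r \<in> Hom T (sh W) (sh W)" "r \<cdot> (Ident T (sh W) \<boxplus> neg (k \<cdot> \<gamma>)) = Ident T (sh W)" by (rule iso_arrE)
        have z: "(Ident T (sh W) \<boxplus> neg (k \<cdot> \<gamma>)) \<cdot> w = ZeroArr T X (sh W)" using k w tg W1 by simp
        have "w = (r \<cdot> (Ident T (sh W) \<boxplus> neg (k \<cdot> \<gamma>))) \<cdot> w" unfolding r(2) using w by simp
        also have "\<dots> = r \<cdot> ((Ident T (sh W) \<boxplus> neg (k \<cdot> \<gamma>)) \<cdot> w)" by (rule comp_assoc) (use r(1) k(1) w tg W1 in simp_all)
        also have "\<dots> = ZeroArr T X (sh W)" unfolding z using r(1) X by simp
        finally show False using w0 by blast
      qed
    qed
    then obtain f where "f \<in> Hom T X P" "w = g \<cdot> f" using weak_kernel[OF trg w] by blast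
    then show ?thesis by blast
  qed
  have "serre X (sh W) t"
  proof (rule serreI[OF X W1 t(1)])
    fix P f assume f: "f \<in> Hom T X P" and n: "\<And>g. g \<in> Hom T P (sh W) \<Longrightarrow> t (g \<cdot> f) = \<zero>\<^sub>E"
    show "f = ZeroArr T X P" using right[OF f] n t(2) by metis
  next
    fix P g assume g: "g \<in> Hom T P (sh W)" and n: "\<And>f. f \<in> Hom T X P \<Longrightarrow> t (g \<cdot> f) = \<zero>\<^sub>E"
    show "g = ZeroArr T P (sh W)" using left[OF g] n t(2) by metis
  qed
  then show ?thesis by blast
qed

text \<open>The Serre partner of the third term of the triangle is the shift of the first term,
  hence the passage between \<open>X\<close> and \<open>X[1]\<close>.\<close>

lemma left_objs_iff_AR_triangle:
  assumes ind: "indecomposable T X"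
  shows "X \<in> Tl \<longleftrightarrow> (\<exists>Y Z u v w. AR_triangle T X Y Z u v w)"
proof
  have X: "X \<in> Obj T" using ind unfolding indecomposable_def by blast
  assume "X \<in> Tl"
  then obtain P t where s: "serre P (sh X) t" using left_objs_shift left_objsE by metis
  then have "indecomposable T P" using serre_indecomposable_iff indecomposable_shift[OF X] ind by blast
  then show "\<exists>Y Z u v w. AR_triangle T X Y Z u v w" using AR_triangle_exists[OF s X] by blast
next
  have X: "X \<in> Obj T" using ind unfolding indecomposable_def by blast
  assume "\<exists>Y Z u v w. AR_triangle T X Y Z u v w"
  then show "X \<in> Tl" using AR_triangle_serre left_objsI left_objs_unshift[OF X] by blast
qed

lemma right_objs_iff_AR_triangle:
  assumes ind: "indecomposable T X"
  shows "X \<in> Tr \<longleftrightarrow> (\<exists>W Y u v w. AR_triangle T W Y X u v w)"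
proof
  assume "X \<in> Tr"
  then obtain Z t where s: "serre X Z t" using right_objsE by blast
  obtain V y where V: "V \<in> Obj T" "iso_arr T Z (sh V) y" using shift_preimage serreD(2)[OF s] by blast
  obtain t' where "serre X (sh V) t'" using serre_iso[OF s iso_arr_Ident[OF serreD(1)[OF s]] V(2)] by blast
  then show "\<exists>W Y u v w. AR_triangle T W Y X u v w" using AR_triangle_exists V(1) ind by blast
next
  assume "\<exists>W Y u v w. AR_triangle T W Y X u v w"
  then show "X \<in> Tr" using AR_triangle_serre right_objsI by blast
qed

end

text \<open>The functor is determined only up to isomorphism, so part (1) concerns each of its
  versions; the separate existence conjunct keeps this from being vacuous.\<close>

theorem mainTheorem1:
  fixes R :: "('r, 'k) ring_scheme"
    and E :: "('r, 'e) module"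
    and T :: "('o, 'm, 'r) tcat"
  assumes "artinian_cring R"
    and "minimal_injective_cogenerator R E"
    and "linear_triangulated_category R T"
    and "Hom_finite R T"
    and "Krull_Schmidt T"
  defines "Tr \<equiv> right_objs R E T"
    and "Tl \<equiv> left_objs R E T"
  shows "thick_subcat T Tr \<and> thick_subcat T Tl \<and>
    (\<exists>S. generalized_serre_functor R E T S) \<and>
    (\<forall>S. generalized_serre_functor R E T S \<longrightarrow>
       (\<exists>\<eta>. triangle_equivalence (restrict_tcat T Tr) (restrict_tcat T Tl) S \<eta>)) \<and>
    (\<forall>X. indecomposable T X \<longrightarrow>
       (X \<in> Tl \<longleftrightarrow> (\<exists>Y Z u v w. AR_triangle T X Y Z u v w)) \<and>
       (X \<in> Tr \<longleftrightarrow> (\<exists>W Y u v w. AR_triangle T W Y X u v w)))"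
proof -
  interpret linear_triangulated_category R T by fact
  interpret matlis_dual R E using assms(1,2) by (intro matlis_dual.intro matlis_dual_axioms.intro)
  interpret hom_finite_triangulated R T E using assms(4,5) by unfold_locales
  show ?thesis
    unfolding Tr_def Tl_def
    using thick_right thick_left generalized_serre_functor_exists triangle_equivalence_serre
      left_objs_iff_AR_triangle right_objs_iff_AR_triangle by blast
qed

end
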